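(* Let $M$ be an $n$-manifold, let $\rho:N\to M$ be a principal $S^1$-bundle or principal $\mathbb{R}^{\ast}$-bundle, and let $\mathbb{E}$ be the fundamental vertical vector field generated by the principal action. Let $\nabla$ be a torsion-free affine connection on $M$ and let $\beta$ be a principal connection on $\rho:N\to M$. Let $\widehat\nabla$ be the cone connection on $N$ generated by $(\nabla,\beta)$. Suppose the symmetrized projective Schouten tensor of $\nabla$, $g_{ij}=P_{(ij)}$, is nondegenerate, and let $\rho^{\ast}(\omega)_{IJ}=d\beta_{IJ}$ be the curvature of $\beta$. For $t\neq-1$ and $s\in\mathbb{R}$ define on $N$ the metric $$G_{IJ}=\widehat\nabla_{(I}\beta_{J)}+(2+t)\beta_I\beta_J=(1+t)\beta_I\beta_J-\rho^{\ast}(P)_{(IJ)}$$ and the connection $\widehat D^{s}=\widehat\nabla+\Omega_{IJ}{}^{K}$, where $$\Omega_{IJ}{}^{K}=(1+t)\beta_{(I}d\beta_{J)Q}G^{QK}-t\beta_I\beta_J\mathbb{E}^K+(s-1)\left(2\beta_{(I}\delta_{J)}{}^{K}-G_{IJ}\mathbb{E}^K\right)+2st\,\beta_{(I}\delta_{J)}{}^{K}.$$ (1) If $\nabla_{[i}g_{j]k}=0$ and $\nabla_i|\det g|=0$, so that $(\nabla,g)$ is a special statistical structure, and there is $\alpha\in\mathbb{R}\setminus\{0\}$ such that $\omega_{ip}\omega_{qj}g^{pq}=\alpha g_{ij}$, then $\widehat D^{s}_{[I}G_{J]K}=-2s(t+1)\beta_{[I}G_{J]K}$ and, if $\alpha>-\frac{4(n-1)}{(n+2)(t+1)}$,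 for $$s=\pm\sqrt{\tfrac{1}{1+t}+\tfrac{(n+2)\alpha}{4(n-1)}},$$ $(\widehat D^{s},G_{IJ})$ is a half naive Einstein AH structure. (2) If $(\nabla,g)$ is an Einstein special statistical structure with scalar curvature $-n(n-1)$, and there is $\alpha\in\mathbb{R}\setminus\{0\}$ such that $\omega_{ip}\omega_{qj}g^{pq}=\alpha g_{ij}$, then $(\widehat D^{s},G_{IJ})$ generates a naive Einstein AH structure for which $\widehat D^{s}$ is the aligned representative. If $t=0$, then $(\widehat D^{s},G_{IJ})$ is moreover an Einstein AH structure for which the scalar curvature associated with $G_{IJ}$ is $-\frac{n(n+1)\alpha}{4}$. If $g$ has definite signature, the hypotheses in (1) and (2) imply $\alpha<0$ and $n$ is even.
   Context: All manifolds are smooth and connected; $n\ge 2$. Abstract indices are used: $[\,]$ and $(\,)$ denote complete antisymmetrization and symmetrization (with factor $1/k!$); lowercase indices are on $M$, uppercase on $N$; metrics may have any signature and $g^{ij},G^{IJ}$ denote inverses. For a torsion-free affine connection $\nabla$: $2\nabla_{[i}\nabla_{j]}X^k=R_{ijp}{}^kX^p$, Ricci tensor $R_{ij}=R_{pij}{}^p$, projective Schouten tensor $P_{ij}=\frac1{1-n}R_{(ij)}-\frac1{n+1}R_{[ij]}$ (on an $n$-manifold). A connection $\nabla+\Pi_{ij}{}^k$ acts by $X\mapsto\nabla_iX^k+\Pi_{ij}{}^kX^j$. For a one-form, $d\beta_{ij}=2\nabla_{[i}\beta_{j]}$. Principal connections: the Lie algebra of $S^1$ or $\mathbb{R}^\ast$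 is identified with $\mathbb{R}$ ($\mathbb{E}$ generates the action of $e^{\mathsf{i}t}$, resp. $e^{t}$); a principal connection is a one-form $\beta$ on $N$ invariant under the principal action with $\beta(\mathbb{E})=1$; its curvature is the two-form $\omega$ on $M$ with $\rho^\ast(\omega)=d\beta$. Cone connection of $(\nabla,\beta)$: the torsion-free connection $\widehat\nabla$ on $N$ given by $\widehat\nabla_{\hat X}\hat Y=\widehat{\nabla_XY}+\rho^\ast(Q(X,Y))\mathbb{E}$, $\widehat\nabla_{\hat X}\mathbb{E}=\hat X=\widehat\nabla_{\mathbb{E}}\hat X$, $\widehat\nabla_{\mathbb{E}}\mathbb{E}=\mathbb{E}$, where $\hat X$ is the $\beta$-horizontal lift of a vector field $X$ on $M$ and $Q_{ij}=P_{(ij)}-\frac12\omega_{ij}$. Statistical structures: a statistical structure is a pair $(\nabla,g)$ of a torsion-free affine connection and a pseudo-Riemannian metric with $\nabla_{[i}g_{j]k}=0$; it is special if $\nabla|\det g|=0$ (equivalently $g^{pq}\nabla_ig_{pq}=0$). AH structures: on an $m$-manifold, an AH structure is a pair $(\nabla,[g])$ of a torsion-free affine connection and a conformal class of pseudo-Riemannian metrics such that for each $g\in[g]$ there is a one-form $\chi_i$ with $\nabla_{[i}g_{j]k}=\chi_{[i}g_{j]k}$ and $\nabla$ is aligned with respect to $[g]$: $g^{pq}\nabla_ig_{pq}=m\,g^{pq}\nabla_pg_{qi}$. Saying that a pair $(\nabla,g)$ with $g$ a metric is an AH structure means that $(\nabla,[g])$ is one. If $(\nabla,g)$ merely satisfies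 $\nabla_{[i}g_{j]k}=\gamma_{[i}g_{j]k}$ for some one-form $\gamma$, then there is a unique connection of the form $\nabla+2\sigma_{(i}\delta_{j)}{}^k$ aligned with respect to $[g]$; it is the aligned representative of the AH structure it forms with $[g]$, which is the AH structure generated by $(\nabla,g)$. The cubic form of $(\nabla,[g])$ for $g$ is $\mathcal L_{ijk}=\nabla_ig_{jk}-\chi_ig_{jk}$; the conjugate AH structure is $(\nabla+g^{kp}\mathcal L_{ijp},[g])$. The scalar curvature associated with $g\in[g]$ is $\mathit{s}=g^{pq}R_{pq}$ (not to be confused with the real parameter $s$). The AH structure is half naive Einstein if $R_{(ij)}=\frac{\mathit{s}}{m}g_{ij}$; naive Einstein if both it and its conjugate are half naive Einstein; Einstein if it is naive Einstein and for every $g\in[g]$, $d\mathit{s}_i+\mathit{s}\chi_i+\frac m2g^{pq}\nabla_pd\chi_{qi}=0$. A special statistical structure $(\nabla,g)$ is (naive) Einstein if the AH structure $(\nabla,[g])$ it generates (for which the one-form $\chi$ of $g$ vanishes) is, and its scalar curvature is that associated with $g$.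
   Formalization: Part (2) leaves s arbitrary, which is false (hyperbolic plane, ω the area form, t=0, s=1); it is proved for every real s with s²=1/(1+t)+(n+2)α/(4(n−1)), the only values for which the naive Einstein condition can hold. *)

theory Defs
  imports "HOL-Analysis.Analysis"
begin

section \<open>Smooth manifolds\<close>

text \<open>
  \<^term>\<open>Ck_on k S f\<close> is only ever used for open \<open>S\<close>.
\<close>

primrec Ck_on :: "nat \<Rightarrow> 'a::euclidean_space set \<Rightarrow> ('a \<Rightarrow> 'b::real_normed_vector) \<Rightarrow> bool" where
  "Ck_on 0 S f \<longleftrightarrow> continuous_on S f"
| "Ck_on (Suc k) S f \<longleftrightarrow>
     (\<forall>x\<in>S. f differentiable (at x)) \<and>
     (\<forall>v\<in>Basis. Ck_on k S (\<lambda>x. frechet_derivative f (at x) v))"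

definition smooth_on :: "'a::euclidean_space set \<Rightarrow> ('a \<Rightarrow> 'b::real_normed_vector) \<Rightarrow> bool" where
  "smooth_on S f \<longleftrightarrow> (\<forall>k. Ck_on k S f)"

text \<open>
  A chart is a pair of its domain and its coordinate map. A manifold is presented by an atlas; its
  underlying set is the union of the chart domains, with the subspace topology. The atlas is not
  required to be maximal: it stands for the smooth structure which it generates.
\<close>

type_synonym ('m, 'e) chart = "'m set \<times> ('m \<Rightarrow> 'e)"

abbreviation dom_chart :: "('m, 'e) chart \<Rightarrow> 'm set" where "dom_chart c \<equiv> fst c"
abbreviation coords :: "('m, 'e) chart \<Rightarrow> 'm \<Rightarrow> 'e" where "coords c \<equiv> snd c"

definition inv_chart :: "('m, 'e) chart \<Rightarrow> 'e \<Rightarrow> 'm" where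
  "inv_chart c = inv_into (dom_chart c) (coords c)"

definition carrier :: "('m, 'e) chart set \<Rightarrow> 'm set" where
  "carrier A = (\<Union>c\<in>A. dom_chart c)"

definition open_in :: "('m::topological_space, 'e) chart set \<Rightarrow> 'm set \<Rightarrow> bool" where
  "open_in A U \<longleftrightarrow> openin (top_of_set (carrier A)) U"

definition smooth_atlas :: "('m::topological_space, 'e::euclidean_space) chart set \<Rightarrow> bool" where
  "smooth_atlas A \<longleftrightarrow>
     (\<forall>c\<in>A. open_in A (dom_chart c) \<and> open (coords c ` dom_chart c) \<and>
        homeomorphism (dom_chart c) (coords c ` dom_chart c) (coords c) (inv_chart c)) \<and>
     (\<forall>c\<in>A. \<forall>d\<in>A.
        smooth_on (coords c ` (dom_chart c \<inter> dom_chart d)) (coords d \<circ> inv_chart c))"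

definition smooth_manifold ::
    "('m::{t2_space,second_countable_topology}, 'e::euclidean_space) chart set \<Rightarrow> bool" where
  "smooth_manifold A \<longleftrightarrow> smooth_atlas A \<and> carrier A \<noteq> {} \<and> connected (carrier A)"

definition smooth_map ::
    "('m::topological_space, 'e::euclidean_space) chart set \<Rightarrow>
     ('p::topological_space, 'f::euclidean_space) chart set \<Rightarrow> ('m \<Rightarrow> 'p) \<Rightarrow> bool" where
  "smooth_map A B f \<longleftrightarrow>
     continuous_on (carrier A) f \<and> f ` carrier A \<subseteq> carrier B \<and>
     (\<forall>c\<in>A. \<forall>d\<in>B.
        smooth_on (coords c ` (dom_chart c \<inter> f -` dom_chart d)) (coords d \<circ> f \<circ> inv_chart c))"

definition diffeomorphism ::
    "('m::topological_space, 'e::euclidean_space) chart set \<Rightarrow>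
     ('p::topological_space, 'f::euclidean_space) chart set \<Rightarrow> ('m \<Rightarrow> 'p) \<Rightarrow> bool" where
  "diffeomorphism A B f \<longleftrightarrow>
     bij_betw f (carrier A) (carrier B) \<and> smooth_map A B f \<and>
     smooth_map B A (inv_into (carrier A) f)"

definition smooth_function ::
    "('m::topological_space, 'e::euclidean_space) chart set \<Rightarrow> 'm set \<Rightarrow> ('m \<Rightarrow> real) \<Rightarrow> bool" where
  "smooth_function A U f \<longleftrightarrow>
     (\<forall>c\<in>A. smooth_on (coords c ` (dom_chart c \<inter> U)) (f \<circ> inv_chart c))"

definition restrict_atlas :: "('m, 'e) chart set \<Rightarrow> 'm set \<Rightarrow> ('m, 'e) chart set" where
  "restrict_atlas A U = (\<lambda>c. (dom_chart c \<inter> U, coords c)) ` A"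

definition prod_atlas ::
    "('m, 'e) chart set \<Rightarrow> ('p, 'f) chart set \<Rightarrow> ('m \<times> 'p, 'e \<times> 'f) chart set" where
  "prod_atlas A B =
     (\<lambda>(c, d). (dom_chart c \<times> dom_chart d, map_prod (coords c) (coords d))) ` (A \<times> B)"


section \<open>Principal bundles\<close>

text \<open>
  Both structure groups are regarded as subgroups of the multiplicative group of complex numbers,
  the nonzero reals being embedded in the standard way. The identification of the Lie algebra
  with the reals is encoded by the one-parameter subgroup \<open>group_exp\<close>.
\<close>

datatype structure_group = Circle | Nonzero_Reals

fun group_carrier :: "structure_group \<Rightarrow> complex set" where
  "group_carrier Circle = sphere 0 1"
| "group_carrier Nonzero_Reals = complex_of_real ` {r. r \<noteq> 0}"

fun group_exp :: "structure_group \<Rightarrow> real \<Rightarrow> complex" where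
  "group_exp Circle t = exp (\<i> * complex_of_real t)"
| "group_exp Nonzero_Reals t = complex_of_real (exp t)"

text \<open>Exponential coordinates centred at each group element.\<close>

definition group_atlas :: "structure_group \<Rightarrow> (complex, real) chart set" where
  "group_atlas K =
     (\<lambda>z. ((\<lambda>t. group_exp K t * z) ` {-1<..<1},
           inv_into {-1<..<1} (\<lambda>t. group_exp K t * z))) ` group_carrier K"

text \<open>
  The groups are abelian, so left and right actions agree. Freeness of the action and transitivity
  on the fibres follow from the equivariant local trivializations.
\<close>

definition principal_bundle ::
    "structure_group \<Rightarrow>
     ('m::topological_space, 'e::euclidean_space) chart set \<Rightarrow>
     ('p::topological_space, 'f::euclidean_space) chart set \<Rightarrow>
     ('p \<Rightarrow> 'm) \<Rightarrow> (complex \<Rightarrow> 'p \<Rightarrow> 'p) \<Rightarrow> bool" where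
  "principal_bundle K AM AN \<rho> act \<longleftrightarrow>
     smooth_map AN AM \<rho> \<and> \<rho> ` carrier AN = carrier AM \<and>
     smooth_map (prod_atlas (group_atlas K) AN) AN (\<lambda>(z, q). act z q) \<and>
     (\<forall>q\<in>carrier AN. act 1 q = q) \<and>
     (\<forall>z\<in>group_carrier K. \<forall>w\<in>group_carrier K. \<forall>q\<in>carrier AN.
        act (z * w) q = act z (act w q)) \<and>
     (\<forall>z\<in>group_carrier K. \<forall>q\<in>carrier AN. \<rho> (act z q) = \<rho> q) \<and>
     (\<forall>x\<in>carrier AM. \<exists>U \<tau>. open_in AM U \<and> x \<in> U \<and>
        diffeomorphism
          (restrict_atlas AN (carrier AN \<inter> \<rho> -` U))
          (prod_atlas (restrict_atlas AM U) (group_atlas K))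
          (\<lambda>q. (\<rho> q, \<tau> q)) \<and>
        (\<forall>z\<in>group_carrier K. \<forall>q\<in>carrier AN \<inter> \<rho> -` U. \<tau> (act z q) = z * \<tau> q))"


section \<open>Tensor fields and connections\<close>

text \<open>
  Tensor fields and connections on a manifold whose charts take values in \<^typ>\<open>real^'i\<close> are
  families of component functions, one for each chart of the atlas, related by the usual
  transformation laws. Only the components for charts in the atlas and at points of the domain of
  the chart are meaningful. The derivative \<open>pd c f i p\<close> is the \<open>i\<close>-th partial
  derivative of \<open>f\<close> at \<open>p\<close> in the coordinates of \<open>c\<close>.
\<close>

type_synonym ('m, 'i) tensor1 = "('m, real^'i) chart \<Rightarrow> 'm \<Rightarrow> 'i \<Rightarrow> real"
type_synonym ('m, 'i) tensor2 = "('m, real^'i) chart \<Rightarrow> 'm \<Rightarrow> 'i \<Rightarrow> 'i \<Rightarrow> real"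
type_synonym ('m, 'i) tensor3 = "('m, real^'i) chart \<Rightarrow> 'm \<Rightarrow> 'i \<Rightarrow> 'i \<Rightarrow> 'i \<Rightarrow> real"

definition pd :: "('m, real^'i::finite) chart \<Rightarrow> ('m \<Rightarrow> real) \<Rightarrow> 'i \<Rightarrow> 'm \<Rightarrow> real" where
  "pd c f i p = frechet_derivative (f \<circ> inv_chart c) (at (coords c p)) (axis i 1)"

definition sym2 :: "('i \<Rightarrow> 'i \<Rightarrow> real) \<Rightarrow> 'i \<Rightarrow> 'i \<Rightarrow> real" where
  "sym2 T i j = (T i j + T j i) / 2"

definition alt2 :: "('i \<Rightarrow> 'i \<Rightarrow> real) \<Rightarrow> 'i \<Rightarrow> 'i \<Rightarrow> real" where
  "alt2 T i j = (T i j - T j i) / 2"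

definition kron :: "'i \<Rightarrow> 'i \<Rightarrow> real" where
  "kron i j = (if i = j then 1 else 0)"

definition vector_field_on ::
    "('m::topological_space, real^'i::finite) chart set \<Rightarrow> 'm set \<Rightarrow> ('m, 'i) tensor1 \<Rightarrow> bool" where
  "vector_field_on A U X \<longleftrightarrow>
     open_in A U \<and>
     (\<forall>c\<in>A. \<forall>i. smooth_on (coords c ` (dom_chart c \<inter> U)) ((\<lambda>p. X c p i) \<circ> inv_chart c)) \<and>
     (\<forall>c\<in>A. \<forall>d\<in>A. \<forall>p\<in>dom_chart c \<inter> dom_chart d \<inter> U. \<forall>j.
        X d p j = (\<Sum>i\<in>UNIV. X c p i * pd c (\<lambda>q. coords d q $ j) i p))"

definition one_form ::
    "('m::topological_space, real^'i::finite) chart set \<Rightarrow> ('m, 'i) tensor1 \<Rightarrow> bool" where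
  "one_form A \<beta> \<longleftrightarrow>
     (\<forall>c\<in>A. \<forall>i. smooth_on (coords c ` dom_chart c) ((\<lambda>p. \<beta> c p i) \<circ> inv_chart c)) \<and>
     (\<forall>c\<in>A. \<forall>d\<in>A. \<forall>p\<in>dom_chart c \<inter> dom_chart d. \<forall>i.
        \<beta> c p i = (\<Sum>j\<in>UNIV. pd c (\<lambda>q. coords d q $ j) i p * \<beta> d p j))"

definition covariant2 ::
    "('m::topological_space, real^'i::finite) chart set \<Rightarrow> ('m, 'i) tensor2 \<Rightarrow> bool" where
  "covariant2 A T \<longleftrightarrow>
     (\<forall>c\<in>A. \<forall>i j. smooth_on (coords c ` dom_chart c) ((\<lambda>p. T c p i j) \<circ> inv_chart c)) \<and>
     (\<forall>c\<in>A. \<forall>d\<in>A. \<forall>p\<in>dom_chart c \<inter> dom_chart d. \<forall>i j.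
        T c p i j = (\<Sum>k\<in>UNIV. \<Sum>l\<in>UNIV.
          pd c (\<lambda>q. coords d q $ k) i p * pd c (\<lambda>q. coords d q $ l) j p * T d p k l))"

definition two_form ::
    "('m::topological_space, real^'i::finite) chart set \<Rightarrow> ('m, 'i) tensor2 \<Rightarrow> bool" where
  "two_form A \<omega> \<longleftrightarrow>
     covariant2 A \<omega> \<and> (\<forall>c\<in>A. \<forall>p\<in>dom_chart c. \<forall>i j. \<omega> c p i j = - \<omega> c p j i)"

text \<open>
  An affine connection is given by its Christoffel symbols, with the index convention
  \<open>\<nabla>\<^sub>i X\<^sup>k = \<partial>\<^sub>i X\<^sup>k + \<Gamma>\<^sub>i\<^sub>j\<^sup>k X\<^sup>j\<close>, where \<open>\<Gamma>\<^sub>i\<^sub>j\<^sup>k\<close> is \<open>\<Gamma> c p i j k\<close>.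
\<close>

definition affine_connection ::
    "('m::topological_space, real^'i::finite) chart set \<Rightarrow> ('m, 'i) tensor3 \<Rightarrow> bool" where
  "affine_connection A \<Gamma> \<longleftrightarrow>
     (\<forall>c\<in>A. \<forall>i j k. smooth_on (coords c ` dom_chart c) ((\<lambda>p. \<Gamma> c p i j k) \<circ> inv_chart c)) \<and>
     (\<forall>c\<in>A. \<forall>d\<in>A. \<forall>p\<in>dom_chart c \<inter> dom_chart d. \<forall>i j m.
        (\<Sum>k\<in>UNIV. \<Gamma> c p i j k * pd c (\<lambda>q. coords d q $ m) k p) =
        pd c (pd c (\<lambda>q. coords d q $ m) j) i p +
        (\<Sum>a\<in>UNIV. \<Sum>b\<in>UNIV.
           \<Gamma> d p a b m * pd c (\<lambda>q. coords d q $ a) i p * pd c (\<lambda>q. coords d q $ b) j p))"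

definition torsion_free_connection ::
    "('m::topological_space, real^'i::finite) chart set \<Rightarrow> ('m, 'i) tensor3 \<Rightarrow> bool" where
  "torsion_free_connection A \<Gamma> \<longleftrightarrow>
     affine_connection A \<Gamma> \<and> (\<forall>c\<in>A. \<forall>p\<in>dom_chart c. \<forall>i j k. \<Gamma> c p i j k = \<Gamma> c p j i k)"

text \<open>\<open>X\<^sup>i \<nabla>\<^sub>i Y\<^sup>k\<close>\<close>

definition cov_along ::
    "('m, 'i::finite) tensor3 \<Rightarrow> ('m, 'i) tensor1 \<Rightarrow> ('m, 'i) tensor1 \<Rightarrow> ('m, 'i) tensor1" where
  "cov_along \<Gamma> X Y c p k =
     (\<Sum>i\<in>UNIV. X c p i * (pd c (\<lambda>q. Y c q k) i p + (\<Sum>j\<in>UNIV. \<Gamma> c p i j k * Y c p j)))"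

text \<open>\<open>\<nabla>\<^sub>i \<beta>\<^sub>j\<close>\<close>

definition cov1 :: "('m, 'i::finite) tensor3 \<Rightarrow> ('m, 'i) tensor1 \<Rightarrow> ('m, 'i) tensor2" where
  "cov1 \<Gamma> \<beta> c p i j = pd c (\<lambda>q. \<beta> c q j) i p - (\<Sum>k\<in>UNIV. \<Gamma> c p i j k * \<beta> c p k)"

text \<open>\<open>\<nabla>\<^sub>i T\<^sub>j\<^sub>k\<close>\<close>

definition cov2 :: "('m, 'i::finite) tensor3 \<Rightarrow> ('m, 'i) tensor2 \<Rightarrow> ('m, 'i) tensor3" where
  "cov2 \<Gamma> T c p i j k =
     pd c (\<lambda>q. T c q j k) i p
     - (\<Sum>l\<in>UNIV. \<Gamma> c p i j l * T c p l k) - (\<Sum>l\<in>UNIV. \<Gamma> c p i k l * T c p j l)"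

text \<open>\<open>d\<beta>\<^sub>i\<^sub>j = \<partial>\<^sub>i \<beta>\<^sub>j - \<partial>\<^sub>j \<beta>\<^sub>i = 2 \<nabla>\<^sub>[\<^sub>i \<beta>\<^sub>j\<^sub>]\<close> for any torsion-free connection.\<close>

definition ext_deriv :: "('m, 'i::finite) tensor1 \<Rightarrow> ('m, 'i) tensor2" where
  "ext_deriv \<beta> c p i j = pd c (\<lambda>q. \<beta> c q j) i p - pd c (\<lambda>q. \<beta> c q i) j p"

text \<open>
  \<open>curvature \<Gamma> c p i j l k\<close> is the tensor \<open>R\<^sub>i\<^sub>j\<^sub>l\<^sup>k\<close> of a torsion-free connection determined
  by \<open>\<nabla>\<^sub>i \<nabla>\<^sub>j X\<^sup>k - \<nabla>\<^sub>j \<nabla>\<^sub>i X\<^sup>k = R\<^sub>i\<^sub>j\<^sub>l\<^sup>k X\<^sup>l\<close>, written out in coordinates.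
\<close>

definition curvature :: "('m, 'i::finite) tensor3 \<Rightarrow>
    ('m, real^'i) chart \<Rightarrow> 'm \<Rightarrow> 'i \<Rightarrow> 'i \<Rightarrow> 'i \<Rightarrow> 'i \<Rightarrow> real" where
  "curvature \<Gamma> c p i j l k =
     pd c (\<lambda>q. \<Gamma> c q j l k) i p - pd c (\<lambda>q. \<Gamma> c q i l k) j p
     + (\<Sum>a\<in>UNIV. \<Gamma> c p i a k * \<Gamma> c p j l a) - (\<Sum>a\<in>UNIV. \<Gamma> c p j a k * \<Gamma> c p i l a)"

definition ricci :: "('m, 'i::finite) tensor3 \<Rightarrow> ('m, 'i) tensor2" where
  "ricci \<Gamma> c p i j = (\<Sum>k\<in>UNIV. curvature \<Gamma> c p k i j k)"

text \<open>The projective Schouten tensor.\<close>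

definition schouten :: "('m, 'i::finite) tensor3 \<Rightarrow> ('m, 'i) tensor2" where
  "schouten \<Gamma> c p i j =
     1 / (1 - real CARD('i)) * sym2 (ricci \<Gamma> c p) i j
     - 1 / (real CARD('i) + 1) * alt2 (ricci \<Gamma> c p) i j"


section \<open>Metrics, statistical structures and AH structures\<close>

definition gram :: "('m, 'i::finite) tensor2 \<Rightarrow> ('m, real^'i) chart \<Rightarrow> 'm \<Rightarrow> real^'i^'i" where
  "gram g c p = (\<chi> i j. g c p i j)"

definition nondegenerate ::
    "('m::topological_space, real^'i::finite) chart set \<Rightarrow> ('m, 'i) tensor2 \<Rightarrow> bool" where
  "nondegenerate A g \<longleftrightarrow> (\<forall>c\<in>A. \<forall>p\<in>dom_chart c. invertible (gram g c p))"

definition pseudo_metric ::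
    "('m::topological_space, real^'i::finite) chart set \<Rightarrow> ('m, 'i) tensor2 \<Rightarrow> bool" where
  "pseudo_metric A g \<longleftrightarrow>
     covariant2 A g \<and> (\<forall>c\<in>A. \<forall>p\<in>dom_chart c. \<forall>i j. g c p i j = g c p j i) \<and> nondegenerate A g"

definition definite_signature ::
    "('m::topological_space, real^'i::finite) chart set \<Rightarrow> ('m, 'i) tensor2 \<Rightarrow> bool" where
  "definite_signature A g \<longleftrightarrow>
     (\<forall>c\<in>A. \<forall>p\<in>dom_chart c. \<forall>v. v \<noteq> 0 \<longrightarrow> v \<bullet> (gram g c p *v v) > 0) \<or>
     (\<forall>c\<in>A. \<forall>p\<in>dom_chart c. \<forall>v. v \<noteq> 0 \<longrightarrow> v \<bullet> (gram g c p *v v) < 0)"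

text \<open>\<open>g\<^sup>i\<^sup>j\<close>\<close>

definition ginv :: "('m, 'i::finite) tensor2 \<Rightarrow> ('m, 'i) tensor2" where
  "ginv g c p i j = matrix_inv (gram g c p) $ i $ j"

definition scal :: "('m, 'i::finite) tensor3 \<Rightarrow> ('m, 'i) tensor2 \<Rightarrow>
    ('m, real^'i) chart \<Rightarrow> 'm \<Rightarrow> real" where
  "scal \<Gamma> g c p = (\<Sum>i\<in>UNIV. \<Sum>j\<in>UNIV. ginv g c p i j * ricci \<Gamma> c p i j)"

definition statistical ::
    "('m::topological_space, real^'i::finite) chart set \<Rightarrow>
     ('m, 'i) tensor3 \<Rightarrow> ('m, 'i) tensor2 \<Rightarrow> bool" where
  "statistical A \<Gamma> g \<longleftrightarrow>
     torsion_free_connection A \<Gamma> \<and> pseudo_metric A g \<and>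
     (\<forall>c\<in>A. \<forall>p\<in>dom_chart c. \<forall>i j k. alt2 (\<lambda>i j. cov2 \<Gamma> g c p i j k) i j = 0)"

text \<open>
  \<open>|det g|\<close> is a section of the square of the line bundle of densities, so that
  \<open>\<nabla>\<^sub>i |det g| = \<partial>\<^sub>i |det g| - 2 \<Gamma>\<^sub>i\<^sub>k\<^sup>k |det g|\<close>.
\<close>

definition cov_det :: "('m, 'i::finite) tensor3 \<Rightarrow> ('m, 'i) tensor2 \<Rightarrow> ('m, 'i) tensor1" where
  "cov_det \<Gamma> g c p i =
     pd c (\<lambda>q. \<bar>det (gram g c q)\<bar>) i p - 2 * (\<Sum>k\<in>UNIV. \<Gamma> c p i k k) * \<bar>det (gram g c p)\<bar>"

definition special_statistical ::
    "('m::topological_space, real^'i::finite) chart set \<Rightarrow>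
     ('m, 'i) tensor3 \<Rightarrow> ('m, 'i) tensor2 \<Rightarrow> bool" where
  "special_statistical A \<Gamma> g \<longleftrightarrow>
     statistical A \<Gamma> g \<and> (\<forall>c\<in>A. \<forall>p\<in>dom_chart c. \<forall>i. cov_det \<Gamma> g c p i = 0)"

text \<open>Below, a metric \<open>g\<close> stands for its conformal class whenever AH structures are concerned.\<close>

definition conformal_class ::
    "('m::topological_space, real^'i::finite) chart set \<Rightarrow> ('m, 'i) tensor2 \<Rightarrow>
     ('m, 'i) tensor2 set" where
  "conformal_class A g = {h. \<exists>f. smooth_function A (carrier A) f \<and> (\<forall>p\<in>carrier A. f p > 0) \<and>
     (\<forall>c\<in>A. \<forall>p\<in>dom_chart c. \<forall>i j. h c p i j = f p * g c p i j)}"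

text \<open>\<open>\<eta>\<close> is a one-form with \<open>\<nabla>\<^sub>[\<^sub>i g\<^sub>j\<^sub>]\<^sub>k = \<eta>\<^sub>[\<^sub>i g\<^sub>j\<^sub>]\<^sub>k\<close>.\<close>

definition AH_form ::
    "('m::topological_space, real^'i::finite) chart set \<Rightarrow>
     ('m, 'i) tensor3 \<Rightarrow> ('m, 'i) tensor2 \<Rightarrow> ('m, 'i) tensor1 \<Rightarrow> bool" where
  "AH_form A \<Gamma> g \<eta> \<longleftrightarrow>
     one_form A \<eta> \<and>
     (\<forall>c\<in>A. \<forall>p\<in>dom_chart c. \<forall>i j k.
        alt2 (\<lambda>i j. cov2 \<Gamma> g c p i j k) i j = alt2 (\<lambda>i j. \<eta> c p i * g c p j k) i j)"

definition aligned ::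
    "('m::topological_space, real^'i::finite) chart set \<Rightarrow>
     ('m, 'i) tensor3 \<Rightarrow> ('m, 'i) tensor2 \<Rightarrow> bool" where
  "aligned A \<Gamma> g \<longleftrightarrow>
     (\<forall>c\<in>A. \<forall>p\<in>dom_chart c. \<forall>i.
        (\<Sum>a\<in>UNIV. \<Sum>b\<in>UNIV. ginv g c p a b * cov2 \<Gamma> g c p i a b) =
        real CARD('i) * (\<Sum>a\<in>UNIV. \<Sum>b\<in>UNIV. ginv g c p a b * cov2 \<Gamma> g c p a b i))"

definition AH_structure ::
    "('m::topological_space, real^'i::finite) chart set \<Rightarrow>
     ('m, 'i) tensor3 \<Rightarrow> ('m, 'i) tensor2 \<Rightarrow> bool" where
  "AH_structure A \<Gamma> g \<longleftrightarrow>
     torsion_free_connection A \<Gamma> \<and> pseudo_metric A g \<and>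
     (\<forall>h\<in>conformal_class A g. (\<exists>\<eta>. AH_form A \<Gamma> h \<eta>) \<and> aligned A \<Gamma> h)"

text \<open>
  The AH structure generated by \<open>(\<Gamma>, g)\<close> is \<open>(\<Gamma>', [g])\<close>, where \<open>\<Gamma>'\<close> is the aligned
  representative.
\<close>

definition generates_AH ::
    "('m::topological_space, real^'i::finite) chart set \<Rightarrow>
     ('m, 'i) tensor3 \<Rightarrow> ('m, 'i) tensor2 \<Rightarrow> ('m, 'i) tensor3 \<Rightarrow> bool" where
  "generates_AH A \<Gamma> g \<Gamma>' \<longleftrightarrow>
     torsion_free_connection A \<Gamma> \<and> pseudo_metric A g \<and> (\<exists>\<gamma>. AH_form A \<Gamma> g \<gamma>) \<and>
     (\<exists>\<sigma>. one_form A \<sigma> \<and>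
        (\<forall>c\<in>A. \<forall>p\<in>dom_chart c. \<forall>i j k.
           \<Gamma>' c p i j k = \<Gamma> c p i j k + 2 * sym2 (\<lambda>i j. \<sigma> c p i * kron j k) i j)) \<and>
     (\<forall>h\<in>conformal_class A g. aligned A \<Gamma>' h)"

definition cubic_form :: "('m, 'i::finite) tensor3 \<Rightarrow> ('m, 'i) tensor2 \<Rightarrow> ('m, 'i) tensor1 \<Rightarrow>
    ('m, 'i) tensor3" where
  "cubic_form \<Gamma> g \<eta> c p i j k = cov2 \<Gamma> g c p i j k - \<eta> c p i * g c p j k"

definition conjugate_connection ::
    "('m, 'i::finite) tensor3 \<Rightarrow> ('m, 'i) tensor2 \<Rightarrow> ('m, 'i) tensor1 \<Rightarrow> ('m, 'i) tensor3" where
  "conjugate_connection \<Gamma> g \<eta> c p i j k =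
     \<Gamma> c p i j k + (\<Sum>l\<in>UNIV. ginv g c p k l * cubic_form \<Gamma> g \<eta> c p i j l)"

text \<open>
  The condition \<open>R\<^sub>(\<^sub>i\<^sub>j\<^sub>) = (s/m) g\<^sub>i\<^sub>j\<close> and the conjugate connection do not depend on the
  representative \<open>g\<close> of the conformal class, and \<open>\<eta>\<close> is uniquely determined by \<open>g\<close>
  in dimension at least two.
\<close>

definition half_naive_einstein ::
    "('m::topological_space, real^'i::finite) chart set \<Rightarrow>
     ('m, 'i) tensor3 \<Rightarrow> ('m, 'i) tensor2 \<Rightarrow> bool" where
  "half_naive_einstein A \<Gamma> g \<longleftrightarrow>
     AH_structure A \<Gamma> g \<and>
     (\<forall>c\<in>A. \<forall>p\<in>dom_chart c. \<forall>i j.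
        sym2 (ricci \<Gamma> c p) i j = scal \<Gamma> g c p / real CARD('i) * g c p i j)"

definition naive_einstein ::
    "('m::topological_space, real^'i::finite) chart set \<Rightarrow>
     ('m, 'i) tensor3 \<Rightarrow> ('m, 'i) tensor2 \<Rightarrow> bool" where
  "naive_einstein A \<Gamma> g \<longleftrightarrow>
     half_naive_einstein A \<Gamma> g \<and>
     (\<forall>\<eta>. AH_form A \<Gamma> g \<eta> \<longrightarrow> half_naive_einstein A (conjugate_connection \<Gamma> g \<eta>) g)"

definition einstein_AH ::
    "('m::topological_space, real^'i::finite) chart set \<Rightarrow>
     ('m, 'i) tensor3 \<Rightarrow> ('m, 'i) tensor2 \<Rightarrow> bool" where
  "einstein_AH A \<Gamma> g \<longleftrightarrow>
     naive_einstein A \<Gamma> g \<and>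
     (\<forall>h\<in>conformal_class A g. \<forall>\<eta>. AH_form A \<Gamma> h \<eta> \<longrightarrow>
        (\<forall>c\<in>A. \<forall>p\<in>dom_chart c. \<forall>i.
           pd c (scal \<Gamma> h c) i p + scal \<Gamma> h c p * \<eta> c p i
           + real CARD('i) / 2 *
             (\<Sum>a\<in>UNIV. \<Sum>b\<in>UNIV. ginv h c p a b * cov2 \<Gamma> (ext_deriv \<eta>) c p a b i) = 0))"


section \<open>Principal connections and the cone connection\<close>

definition fundamental_field ::
    "structure_group \<Rightarrow> (complex \<Rightarrow> 'p \<Rightarrow> 'p) \<Rightarrow> ('p, 'k::finite) tensor1" where
  "fundamental_field K act c q I = deriv (\<lambda>t. coords c (act (group_exp K t) q) $ I) 0"

definition principal_connection ::
    "structure_group \<Rightarrow> ('p::topological_space, real^'k::finite) chart set \<Rightarrow>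
     (complex \<Rightarrow> 'p \<Rightarrow> 'p) \<Rightarrow> ('p, 'k) tensor1 \<Rightarrow> bool" where
  "principal_connection K AN act \<beta> \<longleftrightarrow>
     one_form AN \<beta> \<and>
     (\<forall>z\<in>group_carrier K. \<forall>c\<in>AN. \<forall>d\<in>AN. \<forall>q\<in>dom_chart c. act z q \<in> dom_chart d \<longrightarrow>
        (\<forall>I. (\<Sum>J\<in>UNIV. pd c (\<lambda>r. coords d (act z r) $ J) I q * \<beta> d (act z q) J) = \<beta> c q I)) \<and>
     (\<forall>c\<in>AN. \<forall>q\<in>dom_chart c. (\<Sum>I\<in>UNIV. \<beta> c q I * fundamental_field K act c q I) = 1)"

text \<open>
  The components of \<open>\<rho>\<^sup>* T\<close> in the chart \<open>c\<close> at \<open>q\<close>, computed using the chart \<open>b\<close>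
  around \<open>\<rho> q\<close> on the base.
\<close>

definition pullback2 ::
    "('m, real^'n::finite) chart \<Rightarrow> ('p \<Rightarrow> 'm) \<Rightarrow> ('m, 'n) tensor2 \<Rightarrow> ('p, 'k::finite) tensor2" where
  "pullback2 b \<rho> T c q I J =
     (\<Sum>i\<in>UNIV. \<Sum>j\<in>UNIV.
        pd c (\<lambda>r. coords b (\<rho> r) $ i) I q * pd c (\<lambda>r. coords b (\<rho> r) $ j) J q * T b (\<rho> q) i j)"

definition connection_curvature ::
    "('m::topological_space, real^'n::finite) chart set \<Rightarrow>
     ('p::topological_space, real^'k::finite) chart set \<Rightarrow> ('p \<Rightarrow> 'm) \<Rightarrow>
     ('p, 'k) tensor1 \<Rightarrow> ('m, 'n) tensor2 \<Rightarrow> bool" where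
  "connection_curvature AM AN \<rho> \<beta> \<omega> \<longleftrightarrow>
     two_form AM \<omega> \<and>
     (\<forall>c\<in>AN. \<forall>b\<in>AM. \<forall>q\<in>dom_chart c. \<rho> q \<in> dom_chart b \<longrightarrow>
        (\<forall>I J. pullback2 b \<rho> \<omega> c q I J = ext_deriv \<beta> c q I J))"

text \<open>\<open>X'\<close> is the horizontal lift to \<open>\<rho>\<^sup>-\<^sup>1(U)\<close> of the vector field \<open>X\<close> on the open set \<open>U\<close>.\<close>

definition horizontal_lift ::
    "('m::topological_space, real^'n::finite) chart set \<Rightarrow>
     ('p::topological_space, real^'k::finite) chart set \<Rightarrow> ('p \<Rightarrow> 'm) \<Rightarrow> ('p, 'k) tensor1 \<Rightarrow>
     'm set \<Rightarrow> ('m, 'n) tensor1 \<Rightarrow> ('p, 'k) tensor1 \<Rightarrow> bool" where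
  "horizontal_lift AM AN \<rho> \<beta> U X X' \<longleftrightarrow>
     (\<forall>c\<in>AN. \<forall>b\<in>AM. \<forall>q\<in>dom_chart c. \<rho> q \<in> U \<inter> dom_chart b \<longrightarrow>
        (\<Sum>I\<in>UNIV. \<beta> c q I * X' c q I) = 0 \<and>
        (\<forall>i. (\<Sum>I\<in>UNIV. X' c q I * pd c (\<lambda>r. coords b (\<rho> r) $ i) I q) = X b (\<rho> q) i))"

definition cone_connection ::
    "structure_group \<Rightarrow>
     ('m::topological_space, real^'n::finite) chart set \<Rightarrow>
     ('p::topological_space, real^'k::finite) chart set \<Rightarrow>
     ('p \<Rightarrow> 'm) \<Rightarrow> (complex \<Rightarrow> 'p \<Rightarrow> 'p) \<Rightarrow>
     ('m, 'n) tensor3 \<Rightarrow> ('p, 'k) tensor1 \<Rightarrow> ('m, 'n) tensor2 \<Rightarrow> ('p, 'k) tensor3 \<Rightarrow> bool" where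
  "cone_connection K AM AN \<rho> act \<Gamma> \<beta> \<omega> \<Gamma>h \<longleftrightarrow>
     (let E = fundamental_field K act;
          Q = (\<lambda>b x i j. sym2 (schouten \<Gamma> b x) i j - \<omega> b x i j / 2)
      in
      torsion_free_connection AN \<Gamma>h \<and>
      (\<forall>U X Y X' Y' Z'.
         vector_field_on AM U X \<and> vector_field_on AM U Y \<and>
         horizontal_lift AM AN \<rho> \<beta> U X X' \<and> horizontal_lift AM AN \<rho> \<beta> U Y Y' \<and>
         horizontal_lift AM AN \<rho> \<beta> U (cov_along \<Gamma> X Y) Z' \<longrightarrow>
         (\<forall>c\<in>AN. \<forall>b\<in>AM. \<forall>q\<in>dom_chart c. \<rho> q \<in> U \<inter> dom_chart b \<longrightarrow>
            (\<forall>I. cov_along \<Gamma>h X' Y' c q I =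
               Z' c q I + (\<Sum>i\<in>UNIV. \<Sum>j\<in>UNIV.
                 Q b (\<rho> q) i j * X b (\<rho> q) i * Y b (\<rho> q) j) * E c q I))) \<and>
      (\<forall>U X X'.
         vector_field_on AM U X \<and> horizontal_lift AM AN \<rho> \<beta> U X X' \<longrightarrow>
         (\<forall>c\<in>AN. \<forall>q\<in>dom_chart c. \<rho> q \<in> U \<longrightarrow>
            (\<forall>I. cov_along \<Gamma>h X' E c q I = X' c q I \<and> cov_along \<Gamma>h E X' c q I = X' c q I))) \<and>
      (\<forall>c\<in>AN. \<forall>q\<in>dom_chart c. \<forall>I. cov_along \<Gamma>h E E c q I = E c q I))"

end

theory Submission
  imports Defs
begin

text \<open>
  The one-forms \<open>\<theta>\<^sup>i = d (x\<^sup>i \<circ> \<rho>)\<close> and \<open>\<theta>\<^sup>\<infinity> = \<beta>\<close> form a local coframe of the total space. With respect to it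
  the cone connection, the metric \<open>G\<close> and the connections \<open>D s\<close> have components which are functions on the
  base: with \<open>u = 1 + t\<close> and \<open>\<omega>\<^sub>i\<^sup>k = \<omega>\<^sub>i\<^sub>q g\<^sup>q\<^sup>k\<close>, the nonzero coefficients of \<open>D s\<close> are
  \<open>\<Gamma>\<^sub>i\<^sub>j\<^sup>k\<close>, \<open>s g\<^sub>i\<^sub>j - \<omega>\<^sub>i\<^sub>j / 2\<close> (vertical output), \<open>s u \<delta>\<^sub>i\<^sup>k - u \<omega>\<^sub>i\<^sup>k / 2\<close> (one vertical input) and \<open>s u\<close>
  (all vertical). Hence \<open>\<nabla>G + 2 s u \<beta> \<otimes> G\<close> is minus the pullback of the base cubic form \<open>\<nabla>g\<close>, and the frame
  components of the Ricci tensor are algebraic expressions in \<open>g\<close>, \<open>\<omega>\<close> and the Ricci tensor of the base,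
  except for the mixed ones, which are multiples of \<open>\<nabla>\<^sub>a \<omega>\<^sub>i\<^sup>a\<close>. This divergence vanishes because \<open>\<omega>\<close> is
  closed, \<open>\<omega>\<^sub>i\<^sub>p \<omega>\<^sub>q\<^sub>j g\<^sup>p\<^sup>q = \<alpha> g\<^sub>i\<^sub>j\<close> and \<open>\<nabla>g\<close> is symmetric and trace-free. The connection conjugate to \<open>D s\<close> has
  the same coefficients with \<open>\<Gamma>\<close> replaced by its conjugate, so the same computation applies to it.
\<close>

section \<open>Smooth functions on open sets\<close>

text \<open>The value of s comes from comparing two blocks. With \<open>u = 1 + t\<close>, the
  vertical Ricci component of \<open>D s\<close> is -n\<alpha> u u / 4 while that of
  \<open>G\<close> is u, so the Einstein factor has to be r = -n\<alpha> u / 4. On horizontal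
  vectors \<open>G\<close> is -g and the symmetrized Ricci tensor is ((n-1)(u s s - 1) -
  u\<alpha>/2) g; equating it with -r g gives the stated square of s. The summand -(n-1) g is the
  Ricci tensor of the base. For \<nabla> it is the definition of g as a Schouten tensor; for the
  conjugate connection it has to be extracted from the Einstein hypothesis, the normalization
  -n(n-1) and the equality of the scalar curvatures of conjugate connections. The obstacle is that
  the cone connection is known only through its values on horizontal lifts and on \<open>E\<close>,
  and that every object is a family of components in charts. The dual frame must first be produced
  from local trivializations. Over a fixed base chart the frame coefficients are then the same in
  every chart of the total space, and this yields the transformation law of \<open>D s\<close>.
  Closedness of \<omega> also has to be derived, by descending d(d\<beta>) = 0 to the base.\<close>

lemma Ck_on_cong:
  assumes "open S" "\<And>x. x \<in> S \<Longrightarrow> f x = g x" "Ck_on k S f"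
  shows "Ck_on k S g"
  using assms(2,3)
proof (induction k arbitrary: f g)
  case 0
  then show ?case by (auto cong: continuous_on_cong)
next
  case (Suc k)
  have d: "g differentiable (at x)" if "x \<in> S" for x
    using Suc.prems that assms(1) unfolding differentiable_def Ck_on.simps
    by (metis has_derivative_transform_within_open)
  have e: "frechet_derivative f (at x) = frechet_derivative g (at x)" if "x \<in> S" for x
    using Suc.prems that assms(1) by (intro frechet_derivative_transform_within_open[of _ _ S]) auto
  have "Ck_on k S (\<lambda>x. frechet_derivative g (at x) v)" if "v \<in> Basis" for v
    using Suc.prems(2) that e by (auto intro: Suc.IH[of "\<lambda>x. frechet_derivative f (at x) v"])
  then show ?case using d by auto
qed

lemma Ck_on_subset: "Ck_on k S f \<Longrightarrow> T \<subseteq> S \<Longrightarrow> Ck_on k T f"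
  by (induction k arbitrary: f) (auto intro: continuous_on_subset)

lemma Ck_on_open_Union:
  "(\<And>U. U \<in> \<U> \<Longrightarrow> open U) \<Longrightarrow> (\<And>U. U \<in> \<U> \<Longrightarrow> Ck_on k U f) \<Longrightarrow> Ck_on k (\<Union>\<U>) f"
  by (induction k arbitrary: f) (auto intro: continuous_on_open_Union)

lemma Ck_on_imp_continuous_on: "Ck_on k S f \<Longrightarrow> continuous_on S f"
  by (cases k)
    (auto intro: continuous_at_imp_continuous_on dest: differentiable_imp_continuous_within)

lemma Ck_on_SucD: "Ck_on (Suc k) S f \<Longrightarrow> Ck_on k S f"
proof (induction k arbitrary: f)
  case 0
  then show ?case by (simp only: Ck_on_imp_continuous_on Ck_on.simps(1))
next
  case (Suc k)
  then show ?case by (metis Ck_on.simps(2))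
qed

text \<open>\<open>Ck_on\<close> speaks of the derivative selected by
  \<open>frechet_derivative\<close>. Derivatives on an open set are unique, so any explicit formula
  may be supplied instead; most closure rules below go through this one.\<close>

lemma Ck_on_SucI:
  assumes "open S" "\<And>x. x \<in> S \<Longrightarrow> (f has_derivative f' x) (at x)"
    and "\<And>v. v \<in> Basis \<Longrightarrow> Ck_on k S (\<lambda>x. f' x v)"
  shows "Ck_on (Suc k) S f"
proof -
  have e: "frechet_derivative f (at x) = f' x" if "x \<in> S" for x
    using frechet_derivative_at[OF assms(2)[OF that]] by simp
  have "Ck_on k S (\<lambda>x. frechet_derivative f (at x) v)" if "v \<in> Basis" for v
    using e by (intro Ck_on_cong[OF assms(1) _ assms(3)[OF that]]) auto
  then show ?thesis using assms(2) by (auto simp: differentiable_def)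
qed

lemma Ck_on_Suc_has_derivative:
  "Ck_on (Suc k) S f \<Longrightarrow> x \<in> S \<Longrightarrow> (f has_derivative frechet_derivative f (at x)) (at x)"
  by (simp add: frechet_derivative_works)

lemma Ck_on_bounded_linear:
  assumes "open S" "bounded_linear L" "Ck_on k S f"
  shows "Ck_on k S (\<lambda>x. L (f x))"
  using assms(3)
proof (induction k arbitrary: f)
  case 0
  then show ?case using assms(2) by (auto intro: bounded_linear.continuous_on)
next
  case (Suc k)
  show ?case
  proof (rule Ck_on_SucI[OF assms(1), where f' = "\<lambda>x v. L (frechet_derivative f (at x) v)"])
    show "((\<lambda>x. L (f x)) has_derivative (\<lambda>v. L (frechet_derivative f (at x) v))) (at x)"
      if "x \<in> S" for x
      using bounded_linear.has_derivative[OF assms(2) Ck_on_Suc_has_derivative[OF Suc.prems that]] .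
    show "Ck_on k S (\<lambda>x. L (frechet_derivative f (at x) v))" if "v \<in> Basis" for v
      using Suc.prems that by (intro Suc.IH) auto
  qed
qed

lemma Ck_on_const: "Ck_on k S (\<lambda>x. c)"
  by (induction k arbitrary: c) (auto simp: frechet_derivative_const)

lemma Ck_on_add:
  assumes "open S" "Ck_on k S f" "Ck_on k S g"
  shows "Ck_on k S (\<lambda>x. f x + g x)"
  using assms(2,3)
proof (induction k arbitrary: f g)
  case (Suc k)
  show ?case
  proof (rule Ck_on_SucI[OF assms(1)])
    show "((\<lambda>x. f x + g x) has_derivative
        (\<lambda>v. frechet_derivative f (at x) v + frechet_derivative g (at x) v)) (at x)" if "x \<in> S" for x
      using Suc.prems that by (intro has_derivative_add Ck_on_Suc_has_derivative)
    show "Ck_on k S (\<lambda>x. frechet_derivative f (at x) v + frechet_derivative g (at x) v)"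
      if "v \<in> Basis" for v
      using Suc.prems that by (intro Suc.IH) auto
  qed
qed (auto intro: continuous_intros)

lemma Ck_on_mult:
  fixes f g :: "'a::euclidean_space \<Rightarrow> real"
  assumes "open S" "Ck_on k S f" "Ck_on k S g"
  shows "Ck_on k S (\<lambda>x. f x * g x)"
  using assms(2,3)
proof (induction k arbitrary: f g)
  case (Suc k)
  show ?case
  proof (rule Ck_on_SucI[OF assms(1)])
    show "((\<lambda>x. f x * g x) has_derivative
        (\<lambda>v. f x * frechet_derivative g (at x) v + frechet_derivative f (at x) v * g x)) (at x)"
      if "x \<in> S" for x
      using Suc.prems that by (intro has_derivative_mult Ck_on_Suc_has_derivative)
    show "Ck_on k S (\<lambda>x. f x * frechet_derivative g (at x) v + frechet_derivative f (at x) v * g x)"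
      if "v \<in> Basis" for v
    proof (intro Ck_on_add[OF assms(1)] Suc.IH)
      show "Ck_on k S f" "Ck_on k S g" using Suc.prems by (auto dest: Ck_on_SucD simp del: Ck_on.simps)
      show "Ck_on k S (\<lambda>x. frechet_derivative f (at x) v)"
        "Ck_on k S (\<lambda>x. frechet_derivative g (at x) v)" using Suc.prems that by auto
    qed
  qed
qed (auto intro: continuous_intros)

text \<open>Here f stays fixed in the induction: the derivative of 1/f is built from 1/f, known one
  order lower, and from the derivative of f.\<close>

lemma Ck_on_inverse:
  fixes f :: "'a::euclidean_space \<Rightarrow> real"
  assumes "open S" "\<And>x. x \<in> S \<Longrightarrow> f x \<noteq> 0" "Ck_on k S f"
  shows "Ck_on k S (\<lambda>x. inverse (f x))"
  using assms(3)
proof (induction k)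
  case (Suc k)
  show ?case
  proof (rule Ck_on_SucI[OF assms(1)])
    show "((\<lambda>x. inverse (f x)) has_derivative
        (\<lambda>v. - (inverse (f x) * frechet_derivative f (at x) v * inverse (f x)))) (at x)"
      if "x \<in> S" for x
      using Suc.prems that assms(2)
      by (intro Deriv.has_derivative_inverse Ck_on_Suc_has_derivative) auto
    show "Ck_on k S (\<lambda>x. - (inverse (f x) * frechet_derivative f (at x) v * inverse (f x)))"
      if "v \<in> Basis" for v
    proof -
      have "Ck_on k S (\<lambda>x. (-1) * (inverse (f x) * frechet_derivative f (at x) v * inverse (f x)))"
        using Suc.prems that
        by (intro Ck_on_mult[OF assms(1)] Ck_on_const Suc.IH Ck_on_SucD[OF Suc.prems]) auto
      then show ?thesis by simp
    qed
  qed
next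
  case 0
  then show ?case using assms(2) by (auto intro!: continuous_on_inverse)
qed

lemma Ck_on_sum:
  assumes "open S" "\<And>i. i \<in> I \<Longrightarrow> Ck_on k S (f i)"
  shows "Ck_on k S (\<lambda>x. \<Sum>i\<in>I. f i x)"
  using assms(2)
  by (induction I rule: infinite_finite_induct) (auto intro: Ck_on_const Ck_on_add[OF assms(1)])

section \<open>The chain rule expanded along coordinate axes\<close>

lemma has_derivative_linear_axis_sum:
  fixes f :: "real^'i::finite \<Rightarrow> real"
  assumes "f differentiable (at x)"
  shows "frechet_derivative f (at x) v = (\<Sum>j\<in>UNIV. v $ j * frechet_derivative f (at x) (axis j 1))"
proof -
  interpret linear "frechet_derivative f (at x)"
    using assms by (rule linear_frechet_derivative)
  have "v = (\<Sum>j\<in>UNIV. v $ j *\<^sub>R axis j 1)"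
    using basis_expansion[of v] by (simp add: scalar_mult_eq_scaleR)
  then have "frechet_derivative f (at x) v = frechet_derivative f (at x) (\<Sum>j\<in>UNIV. v $ j *\<^sub>R axis j 1)"
    by simp
  then show ?thesis by (simp add: sum scale)
qed

lemma has_derivative_compose_axis_sum:
  fixes f :: "real^'i::finite \<Rightarrow> real" and h :: "'a::euclidean_space \<Rightarrow> real^'i"
  assumes "f differentiable (at (h x))" "\<And>j. (\<lambda>x. h x $ j) differentiable (at x)"
  shows "((\<lambda>x. f (h x)) has_derivative (\<lambda>v. \<Sum>j\<in>UNIV.
    frechet_derivative (\<lambda>x. h x $ j) (at x) v * frechet_derivative f (at (h x)) (axis j 1))) (at x)"
proof -
  have h: "((\<lambda>x. \<Sum>j\<in>UNIV. h x $ j *\<^sub>R axis j (1::real)) has_derivative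
      (\<lambda>v. \<Sum>j\<in>UNIV. frechet_derivative (\<lambda>x. h x $ j) (at x) v *\<^sub>R axis j 1)) (at x)"
    using assms(2)
    by (intro has_derivative_sum has_derivative_scaleR_left) (simp add: frechet_derivative_works)
  have ax: "(\<Sum>j\<in>UNIV. w j *\<^sub>R axis j (1::real)) = (\<chi> j. w j)" for w :: "'i \<Rightarrow> real"
    by (simp add: vec_eq_iff axis_def if_distrib cong: if_cong)
  from h have "((\<lambda>x. \<chi> j. h x $ j) has_derivative
      (\<lambda>v. \<chi> j. frechet_derivative (\<lambda>x. h x $ j) (at x) v)) (at x)"
    by (simp only: ax)
  then have "(h has_derivative (\<lambda>v. \<chi> j. frechet_derivative (\<lambda>x. h x $ j) (at x) v)) (at x)"
    by simp
  from diff_chain_at[OF this assms(1)[unfolded frechet_derivative_works]]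
  have "((\<lambda>x. f (h x)) has_derivative (\<lambda>v. frechet_derivative f (at (h x))
      (\<chi> j. frechet_derivative (\<lambda>x. h x $ j) (at x) v))) (at x)"
    by (simp add: o_def)
  then show ?thesis
    by (subst (asm) has_derivative_linear_axis_sum[OF assms(1)]) simp
qed

text \<open>Expanding the chain rule along the axes leaves only sums and products of real functions,
  to which \<open>Ck_on_sum\<close>, \<open>Ck_on_mult\<close> and the induction hypothesis
  apply.\<close>

lemma Ck_on_compose:
  fixes f :: "real^'i::finite \<Rightarrow> real" and h :: "'a::euclidean_space \<Rightarrow> real^'i"
  assumes "open S" "\<And>j. Ck_on k S (\<lambda>x. h x $ j)" "h ` S \<subseteq> T" "Ck_on k T f"
  shows "Ck_on k S (\<lambda>x. f (h x))"
  using assms(2,4)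
proof (induction k arbitrary: f)
  case 0
  have "continuous_on S (\<lambda>x. \<chi> j. h x $ j)"
    using 0 by (intro continuous_on_vec_lambda) simp
  then have "continuous_on S h" by simp
  then show ?case using 0 assms(3) by (auto intro: continuous_on_compose2)
next
  case (Suc k)
  show ?case
  proof (rule Ck_on_SucI[OF assms(1)])
    show "((\<lambda>x. f (h x)) has_derivative (\<lambda>v. \<Sum>j\<in>UNIV.
        frechet_derivative (\<lambda>x. h x $ j) (at x) v * frechet_derivative f (at (h x)) (axis j 1))) (at x)"
      if "x \<in> S" for x
      using Suc.prems that assms(3) by (intro has_derivative_compose_axis_sum) auto
    show "Ck_on k S (\<lambda>x. \<Sum>j\<in>UNIV.
        frechet_derivative (\<lambda>x. h x $ j) (at x) v * frechet_derivative f (at (h x)) (axis j 1))"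
      if "v \<in> Basis" for v
    proof (intro Ck_on_sum[OF assms(1)] Ck_on_mult[OF assms(1)])
      show "Ck_on k S (\<lambda>x. frechet_derivative (\<lambda>x. h x $ j) (at x) v)" for j
        using Suc.prems that by simp
      have "Ck_on k T (\<lambda>y. frechet_derivative f (at y) (axis j 1))" for j
        using Suc.prems(2) by (auto simp: Basis_vec_def)
      then show "Ck_on k S (\<lambda>x. frechet_derivative f (at (h x)) (axis j 1))" for j
        by (rule Suc.IH[OF Ck_on_SucD[OF Suc.prems(1)]])
    qed
  qed
qed

section \<open>Symmetry of second derivatives\<close>

lemma frechet_derivative_along_line:
  assumes "f differentiable (at (x + t *\<^sub>R u))"
  shows "((\<lambda>t. f (x + t *\<^sub>R u)) has_real_derivative frechet_derivative f (at (x + t *\<^sub>R u)) u) (at t)"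
proof -
  have "((\<lambda>t. x + t *\<^sub>R u) has_derivative (\<lambda>h. h *\<^sub>R u)) (at t)"
    by (auto intro!: derivative_eq_intros)
  from diff_chain_at[OF this assms[unfolded frechet_derivative_works]]
  have *: "((\<lambda>t. f (x + t *\<^sub>R u)) has_derivative
      (\<lambda>h. frechet_derivative f (at (x + t *\<^sub>R u)) (h *\<^sub>R u))) (at t)"
    by (simp add: o_def)
  interpret linear "frechet_derivative f (at (x + t *\<^sub>R u))"
    using assms by (rule linear_frechet_derivative)
  show ?thesis unfolding has_field_derivative_def
    by (rule has_derivative_eq_rhs[OF *]) (simp add: fun_eq_iff scale)
qed

text \<open>The mean value theorem is used twice, first along u for the difference taken in
  direction v, then along v. The second difference is symmetric in u and v while the right-hand side
  is not; this asymmetry is what gets exploited next.\<close>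

lemma second_difference_mean_value:
  fixes f :: "'a::euclidean_space \<Rightarrow> real"
  assumes "u \<in> Basis" "v \<in> Basis" "0 < h" and C: "Ck_on 2 (ball x r) f" and h: "2 * h < r"
  shows "\<exists>y\<in>ball x (3 * h). f (x + h *\<^sub>R u + h *\<^sub>R v) - f (x + h *\<^sub>R u) - f (x + h *\<^sub>R v) + f x =
    h * h * frechet_derivative (\<lambda>z. frechet_derivative f (at z) u) (at y) v"
proof -
  have n1: "norm u = 1" "norm v = 1" using assms by auto
  have inb: "x + a *\<^sub>R u + b *\<^sub>R v \<in> ball x (3 * h) \<inter> ball x r" if "0 \<le> a" "a \<le> h" "0 \<le> b" "b \<le> h" for a b
  proof -
    have "norm (a *\<^sub>R u + b *\<^sub>R v) \<le> a + b"
      using norm_triangle_ineq[of "a *\<^sub>R u" "b *\<^sub>R v"] n1 that by simp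
    then have "dist x (x + (a *\<^sub>R u + b *\<^sub>R v)) \<le> a + b"
      by (metis add_diff_cancel_left' dist_commute dist_norm)
    then show ?thesis using that h assms(3) by (auto simp: add.assoc)
  qed
  have d1: "f differentiable (at z)" if "z \<in> ball x r" for z
    using C that by (simp add: numeral_2_eq_2)
  have d2: "(\<lambda>z. frechet_derivative f (at z) u) differentiable (at z)" if "z \<in> ball x r" for z
    using C that assms(1) by (simp add: numeral_2_eq_2)
  define \<phi> where "\<phi> a = f (x + h *\<^sub>R v + a *\<^sub>R u) - f (x + a *\<^sub>R u)" for a
  define \<phi>' where "\<phi>' a = frechet_derivative f (at (x + h *\<^sub>R v + a *\<^sub>R u)) u
    - frechet_derivative f (at (x + a *\<^sub>R u)) u" for a
  have "(\<phi> has_real_derivative \<phi>' a) (at a)" if "0 \<le> a" "a \<le> h" for a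
    unfolding \<phi>_def[abs_def] \<phi>'_def
    using inb[of a h] inb[of a 0] that assms(3)
    by (intro DERIV_diff frechet_derivative_along_line d1) (auto simp: algebra_simps)
  from MVT2[OF assms(3) this] obtain a where a: "0 < a" "a < h" "\<phi> h - \<phi> 0 = h * \<phi>' a"
    by auto
  have "((\<lambda>b. frechet_derivative f (at (x + a *\<^sub>R u + b *\<^sub>R v)) u) has_real_derivative
      frechet_derivative (\<lambda>z. frechet_derivative f (at z) u) (at (x + a *\<^sub>R u + b *\<^sub>R v)) v) (at b)"
    if "0 \<le> b" "b \<le> h" for b
    using inb[of a b] that a by (intro frechet_derivative_along_line d2) auto
  from MVT2[OF assms(3) this] obtain b where b: "0 < b" "b < h"
    "frechet_derivative f (at (x + a *\<^sub>R u + h *\<^sub>R v)) u - frechet_derivative f (at (x + a *\<^sub>R u + 0 *\<^sub>R v)) u =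
     h * frechet_derivative (\<lambda>z. frechet_derivative f (at z) u) (at (x + a *\<^sub>R u + b *\<^sub>R v)) v"
    by auto
  show ?thesis
  proof (rule bexI[of _ "x + a *\<^sub>R u + b *\<^sub>R v"])
    have "x + a *\<^sub>R u + h *\<^sub>R v = x + h *\<^sub>R v + a *\<^sub>R u" "x + h *\<^sub>R u + h *\<^sub>R v = x + h *\<^sub>R v + h *\<^sub>R u"
      by (auto simp: algebra_simps)
    then show "f (x + h *\<^sub>R u + h *\<^sub>R v) - f (x + h *\<^sub>R u) - f (x + h *\<^sub>R v) + f x = h * h *
        frechet_derivative (\<lambda>z. frechet_derivative f (at z) u) (at (x + a *\<^sub>R u + b *\<^sub>R v)) v"
      using a(3) b(3) by (simp add: \<phi>_def \<phi>'_def algebra_simps)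
  qed (use inb[of a b] a b in auto)
qed

text \<open>The same second difference is written with both orders of differentiation; as the step
  shrinks, continuity of the second partial derivatives makes the two values at x agree.\<close>

lemma symmetric_second_derivative:
  fixes f :: "'a::euclidean_space \<Rightarrow> real"
  assumes "open S" "x \<in> S" "Ck_on 2 S f" "u \<in> Basis" "v \<in> Basis"
  shows "frechet_derivative (\<lambda>z. frechet_derivative f (at z) u) (at x) v =
    frechet_derivative (\<lambda>z. frechet_derivative f (at z) v) (at x) u"
proof -
  define F where "F u v y = frechet_derivative (\<lambda>z. frechet_derivative f (at z) u) (at y) v" for u v y
  obtain r where r: "0 < r" "ball x r \<subseteq> S" using assms(1,2) open_contains_ball by blast
  have C: "Ck_on 2 (ball x r) f" using assms(3) r(2) by (rule Ck_on_subset)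
  have tend: "(F u v \<longlongrightarrow> F u v x) (at x)" if "u \<in> Basis" "v \<in> Basis" for u v
  proof -
    have "continuous_on S (F u v)"
      using assms(3) that by (auto simp: numeral_2_eq_2 F_def)
    then show ?thesis
      using assms(1,2) by (simp add: continuous_on_eq_continuous_at isCont_def)
  qed
  have "\<bar>F u v x - F v u x\<bar> \<le> 0 + e" if e: "0 < e" for e
  proof -
    have near: "\<exists>d>0. \<forall>y\<in>ball x d. \<bar>F a b y - F a b x\<bar> < e / 2" if ab: "a \<in> Basis" "b \<in> Basis" for a b
    proof -
      obtain d where "d > 0" "\<And>y. y \<noteq> x \<Longrightarrow> dist y x < d \<Longrightarrow> dist (F a b y) (F a b x) < e / 2"
        using tend[OF ab] e unfolding LIM_def by (metis half_gt_zero)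
      then show ?thesis using e
        by (intro exI[of _ d]) (metis abs_0 cancel_comm_monoid_add_class.diff_cancel dist_commute dist_real_def half_gt_zero mem_ball)
    qed
    obtain d1 where d1: "d1 > 0" "\<And>y. y \<in> ball x d1 \<Longrightarrow> \<bar>F u v y - F u v x\<bar> < e / 2"
      using near[OF assms(4,5)] by blast
    obtain d2 where d2: "d2 > 0" "\<And>y. y \<in> ball x d2 \<Longrightarrow> \<bar>F v u y - F v u x\<bar> < e / 2"
      using near[OF assms(5,4)] by blast
    \<comment> \<open>The corners of the parallelogram lie within 2 * h of x and the mean value
      points within 3 * h, so a quarter of the radii is small enough.\<close>
    define h where "h = min r (min d1 d2) / 4"
    have h: "0 < h" "2 * h < r" "3 * h \<le> d1" "3 * h \<le> d2" using r d1 d2 by (auto simp: h_def)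
    obtain y where y: "y \<in> ball x (3 * h)"
      "f (x + h *\<^sub>R u + h *\<^sub>R v) - f (x + h *\<^sub>R u) - f (x + h *\<^sub>R v) + f x = h * h * F u v y"
      using second_difference_mean_value[OF assms(4,5) h(1) C h(2)] unfolding F_def by blast
    obtain z where z: "z \<in> ball x (3 * h)"
      "f (x + h *\<^sub>R v + h *\<^sub>R u) - f (x + h *\<^sub>R v) - f (x + h *\<^sub>R u) + f x = h * h * F v u z"
      using second_difference_mean_value[OF assms(5,4) h(1) C h(2)] unfolding F_def by blast
    have "x + h *\<^sub>R v + h *\<^sub>R u = x + h *\<^sub>R u + h *\<^sub>R v" by simp
    then have "h * h * F u v y = h * h * F v u z"
      using y(2) z(2) by (simp only: y(2)[symmetric] z(2)[symmetric])
    then have "F u v y = F v u z" using h(1) by simp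
    moreover have "\<bar>F u v y - F u v x\<bar> < e / 2" "\<bar>F v u z - F v u x\<bar> < e / 2"
      using d1(2) d2(2) y(1) z(1) h by auto
    ultimately show ?thesis by linarith
  qed
  then have "\<bar>F u v x - F v u x\<bar> \<le> 0" by (rule field_le_epsilon)
  then show ?thesis unfolding F_def by simp
qed

section \<open>Calculus in a chart\<close>

text \<open>Exactly what coordinate calculus requires, with no topology on the manifold itself.
  Overlaps of charts and preimages under \<rho> can therefore serve as domains just as well as full
  chart domains.\<close>

definition chart_region :: "('m, real^'i::finite) chart \<Rightarrow> 'm set \<Rightarrow> bool" where
  "chart_region c U \<longleftrightarrow> inj_on (coords c) (dom_chart c) \<and> U \<subseteq> dom_chart c \<and> open (coords c ` U)"

definition smooth_in :: "('m, real^'i::finite) chart \<Rightarrow> 'm set \<Rightarrow> ('m \<Rightarrow> real) \<Rightarrow> bool" where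
  "smooth_in c U f \<longleftrightarrow> smooth_on (coords c ` U) (f \<circ> inv_chart c)"

lemma inv_chart_coords: "chart_region c U \<Longrightarrow> p \<in> U \<Longrightarrow> inv_chart c (coords c p) = p"
  by (auto simp: chart_region_def inv_chart_def)

lemma smooth_in_Ck: "smooth_in c U f \<Longrightarrow> Ck_on k (coords c ` U) (\<lambda>x. f (inv_chart c x))"
  by (simp add: smooth_in_def smooth_on_def o_def)

lemma smooth_inI: "(\<And>k. Ck_on k (coords c ` U) (\<lambda>x. f (inv_chart c x))) \<Longrightarrow> smooth_in c U f"
  by (simp add: smooth_in_def smooth_on_def o_def)

lemma chart_region_open: "chart_region c U \<Longrightarrow> open (coords c ` U)"
  by (simp add: chart_region_def)

lemma smooth_in_has_derivative:
  assumes "smooth_in c U f" "p \<in> U"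
  shows "((\<lambda>x. f (inv_chart c x)) has_derivative
    frechet_derivative (\<lambda>x. f (inv_chart c x)) (at (coords c p))) (at (coords c p))"
  using smooth_in_Ck[OF assms(1), of "Suc 0"] assms(2) by (auto simp: frechet_derivative_works)

lemma pd_eqI:
  "((\<lambda>x. f (inv_chart c x)) has_derivative D) (at (coords c p)) \<Longrightarrow> pd c f i p = D (axis i 1)"
  unfolding pd_def using frechet_derivative_at by (simp add: o_def) fastforce

lemma pd_const [simp]: "pd c (\<lambda>p. a) i p = 0"
  by (rule pd_eqI) (rule has_derivative_const)

lemma smooth_in_cong:
  assumes "chart_region c U" "\<And>p. p \<in> U \<Longrightarrow> f p = g p" "smooth_in c U f"
  shows "smooth_in c U g"
proof (rule smooth_inI)
  fix k
  show "Ck_on k (coords c ` U) (\<lambda>x. g (inv_chart c x))"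
    by (rule Ck_on_cong[OF _ _ smooth_in_Ck[OF assms(3)]])
      (use assms in \<open>auto simp: chart_region_open inv_chart_coords\<close>)
qed

lemma pd_cong:
  assumes "chart_region c U" "p \<in> U" "\<And>p. p \<in> U \<Longrightarrow> f p = g p"
  shows "pd c f i p = pd c g i p"
proof -
  have "((f \<circ> inv_chart c) has_derivative D) (at (coords c p)) \<longleftrightarrow>
      ((g \<circ> inv_chart c) has_derivative D) (at (coords c p))" for D
    using assms chart_region_open[OF assms(1)]
    by (intro iffI; elim has_derivative_transform_within_open) (auto simp: inv_chart_coords)
  then show ?thesis unfolding pd_def frechet_derivative_def by simp
qed

lemma smooth_in_subset: "smooth_in c U f \<Longrightarrow> V \<subseteq> U \<Longrightarrow> smooth_in c V f"
  by (rule smooth_inI) (blast intro: Ck_on_subset smooth_in_Ck)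

lemma smooth_in_Union:
  assumes "\<And>V. V \<in> \<V> \<Longrightarrow> chart_region c V" "\<And>V. V \<in> \<V> \<Longrightarrow> smooth_in c V f"
  shows "smooth_in c (\<Union>\<V>) f"
proof (rule smooth_inI)
  fix k
  have "Ck_on k (\<Union>((`) (coords c) ` \<V>)) (\<lambda>x. f (inv_chart c x))"
    using assms by (intro Ck_on_open_Union) (auto simp: chart_region_open smooth_in_Ck)
  then show "Ck_on k (coords c ` \<Union>\<V>) (\<lambda>x. f (inv_chart c x))"
    by (simp add: image_Union)
qed

lemma smooth_in_const: "smooth_in c U (\<lambda>p. a)"
  by (rule smooth_inI) (rule Ck_on_const)

context
  fixes c :: "('m, real^'i::finite) chart" and U :: "'m set"
  assumes R: "chart_region c U"
begin

lemma smooth_in_add: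
  "smooth_in c U f \<Longrightarrow> smooth_in c U g \<Longrightarrow> smooth_in c U (\<lambda>p. f p + g p)"
  by (rule smooth_inI) (intro Ck_on_add chart_region_open[OF R] smooth_in_Ck)

lemma smooth_in_mult:
  "smooth_in c U f \<Longrightarrow> smooth_in c U g \<Longrightarrow> smooth_in c U (\<lambda>p. f p * g p)"
  by (rule smooth_inI) (intro Ck_on_mult chart_region_open[OF R] smooth_in_Ck)

lemma smooth_in_uminus: "smooth_in c U f \<Longrightarrow> smooth_in c U (\<lambda>p. - f p)"
  using smooth_in_mult[OF smooth_in_const[of c U "-1"], of f] by simp

lemma smooth_in_diff:
  "smooth_in c U f \<Longrightarrow> smooth_in c U g \<Longrightarrow> smooth_in c U (\<lambda>p. f p - g p)"
  using smooth_in_add[OF _ smooth_in_uminus, of f g] by simp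

lemma smooth_in_sum:
  "(\<And>i. i \<in> I \<Longrightarrow> smooth_in c U (f i)) \<Longrightarrow> smooth_in c U (\<lambda>p. \<Sum>i\<in>I. f i p)"
  by (rule smooth_inI) (intro Ck_on_sum chart_region_open[OF R] smooth_in_Ck)

lemma smooth_in_prod:
  "(\<And>i. i \<in> I \<Longrightarrow> smooth_in c U (f i)) \<Longrightarrow> smooth_in c U (\<lambda>p. \<Prod>i\<in>I. f i p)"
  by (induction I rule: infinite_finite_induct) (auto intro: smooth_in_const smooth_in_mult)

lemma smooth_in_inverse:
  "smooth_in c U f \<Longrightarrow> (\<And>p. p \<in> U \<Longrightarrow> f p \<noteq> 0) \<Longrightarrow> smooth_in c U (\<lambda>p. inverse (f p))"
  by (rule smooth_inI, intro Ck_on_inverse chart_region_open[OF R] smooth_in_Ck)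
    (auto simp: inv_chart_coords[OF R])

lemma smooth_in_divide:
  "smooth_in c U f \<Longrightarrow> smooth_in c U g \<Longrightarrow> (\<And>p. p \<in> U \<Longrightarrow> g p \<noteq> 0) \<Longrightarrow> smooth_in c U (\<lambda>p. f p / g p)"
  unfolding divide_inverse by (intro smooth_in_mult smooth_in_inverse)

lemma smooth_in_pd:
  assumes "smooth_in c U f"
  shows "smooth_in c U (pd c f i)"
proof (rule smooth_inI)
  fix k
  show "Ck_on k (coords c ` U) (\<lambda>x. pd c f i (inv_chart c x))"
  proof (rule Ck_on_cong)
    show "Ck_on k (coords c ` U) (\<lambda>x. frechet_derivative (\<lambda>x. f (inv_chart c x)) (at x) (axis i 1))"
      using smooth_in_Ck[OF assms, of "Suc k"] by (auto simp: Basis_vec_def)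
  qed (auto simp: chart_region_open[OF R] inv_chart_coords[OF R] pd_def o_def)
qed

context
  fixes p :: 'm and i :: 'i
  assumes p: "p \<in> U"
begin

lemma pd_add:
  assumes "smooth_in c U f" "smooth_in c U g"
  shows "pd c (\<lambda>q. f q + g q) i p = pd c f i p + pd c g i p"
  using pd_eqI[OF has_derivative_add[OF assms[THEN smooth_in_has_derivative[OF _ p]]]]
  by (simp add: pd_def o_def)

lemma pd_mult:
  assumes "smooth_in c U f" "smooth_in c U g"
  shows "pd c (\<lambda>q. f q * g q) i p = pd c f i p * g p + f p * pd c g i p"
  using pd_eqI[OF has_derivative_mult[OF assms[THEN smooth_in_has_derivative[OF _ p]]]] p
  by (simp add: pd_def o_def inv_chart_coords[OF R])

lemma pd_cmult: "smooth_in c U f \<Longrightarrow> pd c (\<lambda>q. a * f q) i p = a * pd c f i p"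
  by (simp add: pd_mult smooth_in_const)

lemma pd_uminus: "smooth_in c U f \<Longrightarrow> pd c (\<lambda>q. - f q) i p = - pd c f i p"
  using pd_cmult[of f "-1"] by simp

lemma pd_diff:
  "smooth_in c U f \<Longrightarrow> smooth_in c U g \<Longrightarrow> pd c (\<lambda>q. f q - g q) i p = pd c f i p - pd c g i p"
  using pd_add[of f "\<lambda>q. - g q"] by (simp add: pd_uminus smooth_in_uminus)

lemma pd_sum:
  "(\<And>k. k \<in> I \<Longrightarrow> smooth_in c U (f k)) \<Longrightarrow> pd c (\<lambda>q. \<Sum>k\<in>I. f k q) i p = (\<Sum>k\<in>I. pd c (f k) i p)"
  by (induction I rule: infinite_finite_induct) (auto simp: pd_add smooth_in_sum)

lemma pd_inverse:
  assumes "smooth_in c U f" "\<And>p. p \<in> U \<Longrightarrow> f p \<noteq> 0"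
  shows "pd c (\<lambda>q. inverse (f q)) i p = - (pd c f i p / (f p)\<^sup>2)"
proof -
  have "f (inv_chart c (coords c p)) \<noteq> 0" using p assms(2) by (simp add: inv_chart_coords[OF R])
  from pd_eqI[OF Deriv.has_derivative_inverse[OF this smooth_in_has_derivative[OF assms(1) p]]]
  show ?thesis using p
    by (simp add: pd_def o_def inv_chart_coords[OF R] power2_eq_square field_simps)
qed

lemma pd_compose_real:
  assumes "smooth_in c U f" "(h has_real_derivative h') (at (f p))"
  shows "pd c (\<lambda>q. h (f q)) i p = h' * pd c f i p"
proof -
  have "(h has_derivative times h') (at (f (inv_chart c (coords c p))))"
    using assms(2) p by (simp add: inv_chart_coords[OF R] has_field_derivative_def)
  from pd_eqI[of "\<lambda>q. h (f q)", OF diff_chain_at[OF smooth_in_has_derivative[OF assms(1) p] this, unfolded o_def]]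
  show ?thesis by (simp add: pd_def o_def)
qed

text \<open>Near \<open>coords c p\<close> the inner \<open>pd\<close> is again a Frechet derivative
  of a function on the coordinate space, so \<open>symmetric_second_derivative\<close> can be
  transported to the chart.\<close>

lemma pd_commute:
  assumes "smooth_in c U f"
  shows "pd c (pd c f i) j p = pd c (pd c f j) i p"
proof -
  have *: "pd c (pd c f i) j p = frechet_derivative
      (\<lambda>x. frechet_derivative (\<lambda>x. f (inv_chart c x)) (at x) (axis i 1)) (at (coords c p)) (axis j 1)" for i j
  proof (rule pd_eqI)
    have "(\<lambda>x. frechet_derivative (\<lambda>x. f (inv_chart c x)) (at x) (axis i 1)) differentiable (at (coords c p))"
      using smooth_in_Ck[OF assms, of 2] p by (auto simp: numeral_2_eq_2 Basis_vec_def)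
    then show "((\<lambda>x. pd c f i (inv_chart c x)) has_derivative frechet_derivative
      (\<lambda>x. frechet_derivative (\<lambda>x. f (inv_chart c x)) (at x) (axis i 1)) (at (coords c p))) (at (coords c p))"
      unfolding frechet_derivative_works
      by (rule has_derivative_transform_within_open[OF _ chart_region_open[OF R]])
        (use p in \<open>auto simp: inv_chart_coords[OF R] pd_def o_def\<close>)
  qed
  show ?thesis unfolding *
    by (rule symmetric_second_derivative[OF chart_region_open[OF R] _ smooth_in_Ck[OF assms]])
      (use p in \<open>auto simp: Basis_vec_def\<close>)
qed

end

lemma pd_coords:
  assumes p: "p \<in> U"
  shows "pd c (\<lambda>q. coords c q $ j) i p = (if i = j then 1 else 0)"
proof -
  have "((\<lambda>x. x $ j) has_derivative (\<lambda>v. v $ j)) (at (coords c p))"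
    by (rule bounded_linear_imp_has_derivative) (rule bounded_linear_vec_nth)
  then have "((\<lambda>x. coords c (inv_chart c x) $ j) has_derivative (\<lambda>v. v $ j)) (at (coords c p))"
    by (rule has_derivative_transform_within_open[OF _ chart_region_open[OF R]])
      (use p in \<open>auto simp: inv_chart_coords[OF R]\<close>)
  from pd_eqI[OF this] show ?thesis by (simp add: axis_def)
qed

section \<open>Pulling functions back along a smooth map\<close>

context
  fixes b :: "('n, real^'j::finite) chart" and V :: "'n set" and \<rho> :: "'m \<Rightarrow> 'n"
  assumes RV: "chart_region b V" and \<rho>: "\<rho> ` U \<subseteq> V"
    and smooth_\<rho>: "\<And>j. smooth_in c U (\<lambda>q. coords b (\<rho> q) $ j)"
begin

lemma smooth_in_compose:
  assumes "smooth_in b V f"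
  shows "smooth_in c U (\<lambda>q. f (\<rho> q))"
proof (rule smooth_inI)
  fix k
  have "Ck_on k (coords c ` U) (\<lambda>x. f (inv_chart b (coords b (\<rho> (inv_chart c x)))))"
    by (rule Ck_on_compose[where f = "\<lambda>y. f (inv_chart b y)" and T = "coords b ` V"])
      (use \<rho> in \<open>auto simp: chart_region_open[OF R] inv_chart_coords[OF R]
        intro: smooth_in_Ck[OF smooth_\<rho>] smooth_in_Ck[OF assms]\<close>)
  then show "Ck_on k (coords c ` U) (\<lambda>x. f (\<rho> (inv_chart c x)))"
    by (rule Ck_on_cong[rotated 2])
      (use \<rho> in \<open>auto simp: chart_region_open[OF R] inv_chart_coords[OF R] inv_chart_coords[OF RV]\<close>)
qed

text \<open>With the identity as \<open>\<rho>\<close> this is the change of charts; with the bundle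
  projection it differentiates pulled-back functions.\<close>

lemma pd_compose:
  assumes "smooth_in b V f" "q \<in> U"
  shows "pd c (\<lambda>q. f (\<rho> q)) i q = (\<Sum>j\<in>UNIV. pd c (\<lambda>r. coords b (\<rho> r) $ j) i q * pd b f j (\<rho> q))"
proof -
  have "((\<lambda>x. f (inv_chart b (coords b (\<rho> (inv_chart c x))))) has_derivative (\<lambda>v. \<Sum>j\<in>UNIV.
      frechet_derivative (\<lambda>x. coords b (\<rho> (inv_chart c x)) $ j) (at (coords c q)) v *
      frechet_derivative (\<lambda>y. f (inv_chart b y)) (at (coords b (\<rho> (inv_chart c (coords c q))))) (axis j 1)))
      (at (coords c q))"
    using smooth_in_has_derivative[OF smooth_\<rho> assms(2)]
      smooth_in_has_derivative[OF assms(1), of "\<rho> q"] assms(2) \<rho>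
    by (intro has_derivative_compose_axis_sum[where f = "\<lambda>y. f (inv_chart b y)"])
      (auto simp: differentiable_def inv_chart_coords[OF R])
  then have "((\<lambda>x. f (\<rho> (inv_chart c x))) has_derivative (\<lambda>v. \<Sum>j\<in>UNIV.
      frechet_derivative (\<lambda>x. coords b (\<rho> (inv_chart c x)) $ j) (at (coords c q)) v *
      frechet_derivative (\<lambda>y. f (inv_chart b y)) (at (coords b (\<rho> (inv_chart c (coords c q))))) (axis j 1)))
      (at (coords c q))"
    by (rule has_derivative_transform_within_open[OF _ chart_region_open[OF R]])
      (use \<rho> assms in \<open>auto simp: inv_chart_coords[OF R] inv_chart_coords[OF RV]\<close>)
  from pd_eqI[OF this] show ?thesis
    using assms(2) by (simp add: pd_def o_def inv_chart_coords[OF R])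
qed

end

end

section \<open>Charts of an atlas\<close>

lemma open_in_chart_image:
  assumes "smooth_atlas A" "c \<in> A" "openin (top_of_set (dom_chart c)) U"
  shows "chart_region c U"
proof -
  have h: "homeomorphism (dom_chart c) (coords c ` dom_chart c) (coords c) (inv_chart c)"
    and o: "open (coords c ` dom_chart c)"
    using assms by (auto simp: smooth_atlas_def)
  have "openin (top_of_set (coords c ` dom_chart c)) (coords c ` U)"
    using homeomorphism_imp_open_map[OF h assms(3)] .
  then have "open (coords c ` U)" using o by (simp add: openin_open_eq)
  moreover have "inj_on (coords c) (dom_chart c)"
    using h by (metis homeomorphism_apply1 inj_on_inverseI)
  ultimately show ?thesis using openin_imp_subset[OF assms(3)] by (simp add: chart_region_def)
qed

lemma atlas_chart_region_Int:
  assumes "smooth_atlas A" "c \<in> A" "open_in A W"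
  shows "chart_region c (dom_chart c \<inter> W)"
proof (rule open_in_chart_image[OF assms(1,2)])
  show "openin (top_of_set (dom_chart c)) (dom_chart c \<inter> W)"
    using assms(2,3) by (auto simp: open_in_def carrier_def openin_open)
qed

lemma atlas_chart_region: "smooth_atlas A \<Longrightarrow> c \<in> A \<Longrightarrow> chart_region c (dom_chart c)"
  by (rule open_in_chart_image) auto

lemma atlas_chart_region2:
  "smooth_atlas A \<Longrightarrow> c \<in> A \<Longrightarrow> d \<in> A \<Longrightarrow> chart_region c (dom_chart c \<inter> dom_chart d)"
  by (rule atlas_chart_region_Int) (auto simp: smooth_atlas_def)

lemma smooth_on_component: "open S \<Longrightarrow> smooth_on S f \<Longrightarrow> smooth_on S (\<lambda>x. f x $ j)"
  unfolding smooth_on_def by (auto intro: Ck_on_bounded_linear bounded_linear_vec_nth)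

lemma atlas_coords_smooth:
  assumes "smooth_atlas A" "c \<in> A" "d \<in> A"
  shows "smooth_in c (dom_chart c \<inter> dom_chart d) (\<lambda>q. coords d q $ j)"
proof -
  have "smooth_on (coords c ` (dom_chart c \<inter> dom_chart d)) (coords d \<circ> inv_chart c)"
    using assms by (simp add: smooth_atlas_def)
  from smooth_on_component[OF chart_region_open[OF atlas_chart_region2[OF assms]] this]
  show ?thesis by (simp add: smooth_in_def o_def)
qed

lemma pd_change_chart:
  assumes "smooth_atlas A" "c \<in> A" "d \<in> A" "chart_region c U" "chart_region d U"
    and "smooth_in d U f" "p \<in> U"
  shows "pd c f i p = (\<Sum>j\<in>UNIV. pd c (\<lambda>q. coords d q $ j) i p * pd d f j p)"
  by (rule pd_compose[OF assms(4,5), where \<rho> = "\<lambda>q. q" and f = f])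
    (use assms(4-7) in \<open>auto simp: chart_region_def
      intro: smooth_in_subset[OF atlas_coords_smooth[OF assms(1-3)]]\<close>)

lemma smooth_in_change_chart:
  assumes "smooth_atlas A" "c \<in> A" "d \<in> A" "chart_region c U" "chart_region d U" "smooth_in d U f"
  shows "smooth_in c U f"
  by (rule smooth_in_compose[OF assms(4,5), where \<rho> = "\<lambda>q. q" and f = f])
    (use assms(4-6) in \<open>auto simp: chart_region_def
      intro: smooth_in_subset[OF atlas_coords_smooth[OF assms(1-3)]]\<close>)

section \<open>Matrix-valued functions in a chart\<close>

lemma matrix_inv_right: "invertible (A :: real^'k::finite^'k) \<Longrightarrow> A ** matrix_inv A = mat 1"
  and matrix_inv_left: "invertible (A :: real^'k::finite^'k) \<Longrightarrow> matrix_inv A ** A = mat 1"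
  unfolding invertible_def matrix_inv_def by (rule someI2_ex; blast)+

lemma matrix_inv_unique:
  fixes A B :: "real^'k::finite^'k"
  assumes "A ** B = mat 1"
  shows "invertible A" "matrix_inv A = B"
proof -
  have BA: "B ** A = mat 1" using assms matrix_left_right_inverse by blast
  show inv: "invertible A" using assms BA invertible_def by blast
  have "matrix_inv A = matrix_inv A ** (A ** B)" by (simp add: assms)
  also have "\<dots> = B" by (simp add: matrix_mul_assoc matrix_inv_left[OF inv])
  finally show "matrix_inv A = B" .
qed

lemma matrix_add_rdistrib: "(B + C) ** (A :: real^'a^'b::finite) = B ** A + C ** A"
  by (simp add: matrix_matrix_mult_def vec_eq_iff distrib_right sum.distrib)

lemma matrix_diff_ldistrib: "(A :: real^'a::finite^'b) ** (B - C) = A ** B - A ** C"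
  by (simp add: matrix_matrix_mult_def vec_eq_iff right_diff_distrib sum_subtractf)

lemma matrix_diff_rdistrib: "(B - C) ** (A :: real^'a^'b::finite) = B ** A - C ** A"
  by (simp add: matrix_matrix_mult_def vec_eq_iff left_diff_distrib sum_subtractf)

lemma matrix_uminus_left: "(- B) ** (A :: real^'a^'b::finite) = - (B ** A)"
  by (simp add: matrix_matrix_mult_def vec_eq_iff sum_negf)

lemma matrix_uminus_right: "(A :: real^'a::finite^'b) ** (- B) = - (A ** B)"
  by (simp add: matrix_matrix_mult_def vec_eq_iff sum_negf)

lemma matrix_sum_right: "(A :: real^'a::finite^'b) ** (\<Sum>i\<in>I. B i) = (\<Sum>i\<in>I. A ** B i)"
  by (induction I rule: infinite_finite_induct) (auto simp: matrix_add_ldistrib)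

lemma matrix_sum_left: "(\<Sum>i\<in>I. B i) ** (A :: real^'a^'b::finite) = (\<Sum>i\<in>I. B i ** A)"
  by (induction I rule: infinite_finite_induct) (auto simp: matrix_add_rdistrib)

lemma matrix_scaleR_left: "(r *\<^sub>R B) ** (A :: real^'a^'b::finite) = r *\<^sub>R (B ** A)"
  by (simp add: matrix_matrix_mult_def vec_eq_iff sum_distrib_left mult.assoc)

lemma matrix_scaleR_right: "(A :: real^'a::finite^'b) ** (r *\<^sub>R B) = r *\<^sub>R (A ** B)"
  by (simp add: matrix_matrix_mult_def vec_eq_iff sum_distrib_left mult.left_commute)

lemma transpose_add: "transpose (A + B :: real^'a^'b) = transpose A + transpose B"
  and transpose_diff: "transpose (A - B :: real^'a^'b) = transpose A - transpose B"
  and transpose_uminus: "transpose (- A :: real^'a^'b) = - transpose A"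
  and transpose_scaleR: "transpose (r *\<^sub>R A :: real^'a^'b) = r *\<^sub>R transpose A"
  by (simp_all add: transpose_def vec_eq_iff)

lemma transpose_sum: "transpose (\<Sum>i\<in>I. B i :: real^'a^'b) = (\<Sum>i\<in>I. transpose (B i))"
  by (simp add: transpose_def vec_eq_iff)

lemmas matrix_distribs = matrix_add_ldistrib matrix_add_rdistrib matrix_diff_ldistrib
  matrix_diff_rdistrib matrix_uminus_left matrix_uminus_right matrix_scaleR_left matrix_scaleR_right
  matrix_sum_left matrix_sum_right matrix_transpose_mul transpose_add transpose_diff
  transpose_uminus transpose_scaleR transpose_sum

lemma matrix_mult_component: "(A ** B) $ i $ j = (\<Sum>k\<in>UNIV. A $ i $ k * B $ k $ j)"
  by (simp add: matrix_matrix_mult_def)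

lemma matrix_right_cancel:
  fixes A B M N :: "real^'k::finite^'k"
  assumes "M ** N = mat 1" "A ** M = B ** M"
  shows "A = B"
  using arg_cong[OF assms(2), of "\<lambda>X. X ** N"] by (simp flip: matrix_mul_assoc add: assms(1))

text \<open>Matrices are differentiated entrywise so that index contractions can be written as
  matrix products and normalized by associativity and \<open>matrix_distribs\<close>.\<close>

definition smoothM :: "('m, real^'i::finite) chart \<Rightarrow> 'm set \<Rightarrow> ('m \<Rightarrow> real^'a^'b) \<Rightarrow> bool" where
  "smoothM c U F \<longleftrightarrow> (\<forall>a b. smooth_in c U (\<lambda>q. F q $ a $ b))"

definition pdM :: "('m, real^'i::finite) chart \<Rightarrow> ('m \<Rightarrow> real^'a^'b) \<Rightarrow> 'i \<Rightarrow> 'm \<Rightarrow> real^'a^'b" where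
  "pdM c F i p = (\<chi> a b. pd c (\<lambda>q. F q $ a $ b) i p)"

lemma pd_component: "pd c (\<lambda>q. F q $ a $ b) i p = pdM c F i p $ a $ b"
  by (simp add: pdM_def)

lemma smoothMD: "smoothM c U F \<Longrightarrow> smooth_in c U (\<lambda>q. F q $ a $ b)"
  by (simp add: smoothM_def)

context
  fixes c :: "('m, real^'i::finite) chart" and U :: "'m set"
  assumes R: "chart_region c U"
begin

lemma smoothM_mult:
  fixes F :: "'m \<Rightarrow> real^'a::finite^'b"
  assumes "smoothM c U F" "smoothM c U G"
  shows "smoothM c U (\<lambda>q. F q ** G q)"
  using assms unfolding smoothM_def matrix_mult_component
  by (auto intro!: smooth_in_sum[OF R] smooth_in_mult[OF R])

lemma smoothM_transpose: "smoothM c U F \<Longrightarrow> smoothM c U (\<lambda>q. transpose (F q))"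
  by (simp add: smoothM_def transpose_def)

lemma smoothM_pdM: "smoothM c U F \<Longrightarrow> smoothM c U (pdM c F i)"
  unfolding smoothM_def pdM_def by (auto intro: smooth_in_pd[OF R])

lemma smoothM_scaleR: "smooth_in c U f \<Longrightarrow> smoothM c U F \<Longrightarrow> smoothM c U (\<lambda>q. f q *\<^sub>R F q)"
  unfolding smoothM_def by (auto intro: smooth_in_mult[OF R])

lemma smoothM_sum: "(\<And>k. k \<in> I \<Longrightarrow> smoothM c U (F k)) \<Longrightarrow> smoothM c U (\<lambda>q. \<Sum>k\<in>I. F k q)"
  unfolding smoothM_def by (auto intro: smooth_in_sum[OF R])

lemma smooth_in_det:
  fixes F :: "'m \<Rightarrow> real^'a::finite^'a"
  shows "smoothM c U F \<Longrightarrow> smooth_in c U (\<lambda>q. det (F q))"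
  unfolding det_def smoothM_def
  by (auto intro!: smooth_in_sum[OF R] smooth_in_mult[OF R] smooth_in_prod[OF R] smooth_in_const)

text \<open>Cramer's rule writes the entries of the inverse as quotients of determinants, and these
  are polynomial in the entries.\<close>

lemma smoothM_matrix_inv:
  fixes F :: "'m \<Rightarrow> real^'a::finite^'a"
  assumes "smoothM c U F" "\<And>q. q \<in> U \<Longrightarrow> invertible (F q)"
  shows "smoothM c U (\<lambda>q. matrix_inv (F q))"
proof -
  have cr: "det (\<chi> i j. if j = a then axis b 1 $ i else F q $ i $ j) / det (F q) = matrix_inv (F q) $ a $ b"
    if "q \<in> U" for q a b
  proof -
    have "F q *v column b (matrix_inv (F q)) = axis b 1"
      using matrix_inv_right[OF assms(2)[OF that]]
      by (auto simp: vec_eq_iff matrix_mult_component column_def matrix_vector_mult_def axis_def mat_def)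
    then have "column b (matrix_inv (F q)) =
        (\<chi> k. det (\<chi> i j. if j = k then axis b 1 $ i else F q $ i $ j) / det (F q))"
      by (rule cramer[THEN iffD1, rotated]) (use assms(2)[OF that] in \<open>simp add: invertible_det_nz\<close>)
    from arg_cong[OF this, of "\<lambda>v. v $ a"] show ?thesis by (simp add: column_def)
  qed
  show ?thesis
    unfolding smoothM_def
  proof (intro allI smooth_in_cong[OF R cr])
    fix a b
    have "smoothM c U (\<lambda>q. \<chi> i j. if j = a then axis b 1 $ i else F q $ i $ j)"
      unfolding smoothM_def
    proof (intro allI)
      show "smooth_in c U (\<lambda>q. (\<chi> i j. if j = a then axis b 1 $ i else F q $ i $ j) $ x $ y)" for x y
        using smoothMD[OF assms(1)] by (cases "y = a") (auto intro: smooth_in_const)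
    qed
    then show "smooth_in c U (\<lambda>q. det (\<chi> i j. if j = a then axis b 1 $ i else F q $ i $ j) / det (F q))"
      using assms by (intro smooth_in_divide[OF R] smooth_in_det) (auto simp: invertible_det_nz)
  qed
qed

context
  fixes p :: 'm and i :: 'i
  assumes p: "p \<in> U"
begin

lemma pdM_cong: "(\<And>q. q \<in> U \<Longrightarrow> F q = G q) \<Longrightarrow> pdM c F i p = pdM c G i p"
  by (simp add: pdM_def vec_eq_iff cong: pd_cong[OF R p])

lemma pdM_mult:
  fixes F :: "'m \<Rightarrow> real^'a::finite^'b"
  assumes "smoothM c U F" "smoothM c U G"
  shows "pdM c (\<lambda>q. F q ** G q) i p = pdM c F i p ** G p + F p ** pdM c G i p"
  using assms unfolding smoothM_def pdM_def vec_eq_iff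
  by (simp add: matrix_mult_component pd_sum[OF R p] pd_mult[OF R p] smooth_in_mult[OF R] sum.distrib)

lemma pdM_transpose: "pdM c (\<lambda>q. transpose (F q)) i p = transpose (pdM c F i p)"
  by (simp add: pdM_def transpose_def)

lemma pdM_const [simp]: "pdM c (\<lambda>q. A) i p = 0"
  by (simp add: pdM_def vec_eq_iff)

lemma pdM_scaleR:
  assumes "smooth_in c U f" "smoothM c U F"
  shows "pdM c (\<lambda>q. f q *\<^sub>R F q) i p = pd c f i p *\<^sub>R F p + f p *\<^sub>R pdM c F i p"
  using assms unfolding smoothM_def pdM_def vec_eq_iff by (simp add: pd_mult[OF R p])

lemma pdM_sum:
  assumes "\<And>k. k \<in> I \<Longrightarrow> smoothM c U (F k)"
  shows "pdM c (\<lambda>q. \<Sum>k\<in>I. F k q) i p = (\<Sum>k\<in>I. pdM c (F k) i p)"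
  using assms unfolding smoothM_def pdM_def vec_eq_iff by (simp add: pd_sum[OF R p])

text \<open>Differentiate \<open>H F = 1\<close> and multiply by H on the right.\<close>

lemma pdM_matrix_inv:
  fixes F :: "'m \<Rightarrow> real^'a::finite^'a"
  assumes F: "smoothM c U F" "\<And>q. q \<in> U \<Longrightarrow> invertible (F q)"
  shows "pdM c (\<lambda>q. matrix_inv (F q)) i p = - (matrix_inv (F p) ** pdM c F i p ** matrix_inv (F p))"
proof -
  let ?H = "\<lambda>q. matrix_inv (F q)"
  note H = smoothM_matrix_inv[OF F]
  have "pdM c (\<lambda>q. ?H q ** F q) i p = pdM c (\<lambda>q. mat 1) i p"
    by (rule pdM_cong) (simp add: matrix_inv_left F(2))
  then have "pdM c ?H i p ** F p + ?H p ** pdM c F i p = 0"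
    by (simp add: pdM_mult[OF H F(1)])
  then have "(pdM c ?H i p ** F p + ?H p ** pdM c F i p) ** ?H p = 0" by simp
  moreover have "pdM c ?H i p ** F p ** ?H p = pdM c ?H i p"
    using matrix_inv_right[OF F(2)[OF p]] by (simp flip: matrix_mul_assoc)
  ultimately show ?thesis by (simp add: matrix_add_rdistrib eq_neg_iff_add_eq_0)
qed

lemma pd_prod:
  assumes "finite I" "\<And>k. k \<in> I \<Longrightarrow> smooth_in c U (f k)"
  shows "pd c (\<lambda>q. \<Prod>k\<in>I. f k q) i p = (\<Sum>k\<in>I. pd c (f k) i p * (\<Prod>l\<in>I - {k}. f l p))"
  using assms
proof (induction I)
  case (insert k I)
  have "pd c (\<lambda>q. f k q * (\<Prod>l\<in>I. f l q)) i p =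
      pd c (f k) i p * (\<Prod>l\<in>I. f l p) + f k p * (\<Sum>l\<in>I. pd c (f l) i p * (\<Prod>m\<in>I - {l}. f m p))"
    using insert by (subst pd_mult[OF R p]) (auto intro: smooth_in_prod[OF R])
  also have "f k p * (\<Sum>l\<in>I. pd c (f l) i p * (\<Prod>m\<in>I - {l}. f m p)) =
      (\<Sum>l\<in>I. pd c (f l) i p * (\<Prod>m\<in>insert k I - {l}. f m p))"
    unfolding sum_distrib_left
  proof (rule sum.cong[OF refl])
    fix l assume "l \<in> I"
    then have "insert k I - {l} = insert k (I - {l})" using insert.hyps by auto
    then show "f k p * (pd c (f l) i p * (\<Prod>m\<in>I - {l}. f m p)) =
        pd c (f l) i p * (\<Prod>m\<in>insert k I - {l}. f m p)"
      using insert.hyps by (simp add: mult_ac)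
  qed
  finally show ?case using insert.hyps by simp
qed simp

text \<open>Jacobi's formula. Differentiating the Leibniz expansion replaces one row of F at a time
  by its derivative. The k-th row of dF is the k-th row of \<open>B = dF F^-1\<close> times F, so
  Cramer's lemma evaluates that determinant as \<open>B $ k $ k * det F\<close>. Transposes appear
  because Cramer's lemma replaces columns.\<close>

lemma pd_det:
  fixes F :: "'m \<Rightarrow> real^'a::finite^'a"
  assumes F: "smoothM c U F" and inv: "invertible (F p)"
  shows "pd c (\<lambda>q. det (F q)) i p = det (F p) * trace (pdM c F i p ** matrix_inv (F p))"
proof -
  let ?B = "pdM c F i p ** matrix_inv (F p)"
  let ?row = "\<lambda>k. \<chi> a b. if a = k then pdM c F i p $ a $ b else F p $ a $ b"
  have row: "det (?row k) = ?B $ k $ k * det (F p)" for k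
  proof -
    have "?B ** F p = pdM c F i p"
      using matrix_inv_left[OF inv] by (simp flip: matrix_mul_assoc)
    then have "(transpose (F p) *v (?B $ k)) $ a = pdM c F i p $ k $ a" for a
      by (auto simp: matrix_vector_mult_def transpose_def vec_eq_iff matrix_mult_component mult.commute)
    then have "transpose (?row k) =
        (\<chi> a b. if b = k then (transpose (F p) *v (?B $ k)) $ a else transpose (F p) $ a $ b)"
      by (auto simp: transpose_def vec_eq_iff)
    then have "det (transpose (?row k)) = ?B $ k $ k * det (transpose (F p))"
      by (simp add: cramer_lemma)
    then show ?thesis by (simp add: det_transpose)
  qed
  have "pd c (\<lambda>q. det (F q)) i p = (\<Sum>\<pi> | \<pi> permutes UNIV. of_int (sign \<pi>) *
      (\<Sum>k\<in>UNIV. pd c (\<lambda>q. F q $ k $ \<pi> k) i p * (\<Prod>l\<in>UNIV - {k}. F p $ l $ \<pi> l)))"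
    unfolding det_def using F
    by (simp add: pd_sum[OF R p] pd_cmult[OF R p] pd_prod smoothM_def smooth_in_prod[OF R]
        smooth_in_mult[OF R] smooth_in_const)
  also have "\<dots> = (\<Sum>k\<in>UNIV. \<Sum>\<pi> | \<pi> permutes UNIV. of_int (sign \<pi>) * (\<Prod>l\<in>UNIV. ?row k $ l $ \<pi> l))"
    unfolding sum_distrib_left
  proof (subst sum.swap, intro sum.cong refl)
    fix k :: 'a and \<pi> :: "'a \<Rightarrow> 'a"
    have "(\<Prod>l\<in>UNIV - {k}. F p $ l $ \<pi> l) = (\<Prod>l\<in>UNIV - {k}. ?row k $ l $ \<pi> l)"
      by (rule prod.cong) auto
    moreover have "(\<Prod>l\<in>UNIV. ?row k $ l $ \<pi> l) = ?row k $ k $ \<pi> k * (\<Prod>l\<in>UNIV - {k}. ?row k $ l $ \<pi> l)"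
      by (rule prod.remove) auto
    ultimately show "of_int (sign \<pi>) * (pd c (\<lambda>q. F q $ k $ \<pi> k) i p * (\<Prod>l\<in>UNIV - {k}. F p $ l $ \<pi> l)) =
        of_int (sign \<pi>) * (\<Prod>l\<in>UNIV. ?row k $ l $ \<pi> l)"
      by (simp add: pdM_def)
  qed
  also have "\<dots> = (\<Sum>k\<in>UNIV. det (?row k))" by (simp add: det_def)
  finally show ?thesis by (simp add: row trace_def sum_distrib_left mult.commute)
qed

lemma pdM_commute: "smoothM c U F \<Longrightarrow> pdM c (pdM c F i) j p = pdM c (pdM c F j) i p"
  unfolding smoothM_def pdM_def vec_eq_iff by (simp add: pd_commute[OF R p])

end

end

section \<open>Connections and curvature in moving frames\<close>

text \<open>Rows carry the lower index and columns the upper one, so the matrix acts from the left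
  on a coframe stored in columns. This reverses the order of the quadratic terms of the curvature in
  \<open>curvM_eq\<close>.\<close>

definition connM :: "('m, 'i::finite) tensor3 \<Rightarrow> ('m, real^'i) chart \<Rightarrow> 'm \<Rightarrow> 'i \<Rightarrow> real^'i^'i" where
  "connM \<Gamma> c p i = (\<chi> j k. \<Gamma> c p i j k)"

definition covM :: "('m, 'i::finite) tensor3 \<Rightarrow> ('m, 'i) tensor2 \<Rightarrow> ('m, real^'i) chart \<Rightarrow> 'm \<Rightarrow> 'i \<Rightarrow> real^'i^'i" where
  "covM \<Gamma> T c p i = (\<chi> j k. cov2 \<Gamma> T c p i j k)"

definition curvM :: "('m, 'i::finite) tensor3 \<Rightarrow> ('m, real^'i) chart \<Rightarrow> 'm \<Rightarrow> 'i \<Rightarrow> 'i \<Rightarrow> real^'i^'i" where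
  "curvM \<Gamma> c p i j = (\<chi> k l. curvature \<Gamma> c p i j k l)"

definition ricM :: "('m, 'i::finite) tensor3 \<Rightarrow> ('m, real^'i) chart \<Rightarrow> 'm \<Rightarrow> real^'i^'i" where
  "ricM \<Gamma> c p = (\<chi> i j. ricci \<Gamma> c p i j)"

lemma covM_eq: "covM \<Gamma> T c p i =
    pdM c (gram T c) i p - connM \<Gamma> c p i ** gram T c p - gram T c p ** transpose (connM \<Gamma> c p i)"
  by (simp add: vec_eq_iff covM_def pdM_def gram_def connM_def cov2_def matrix_mult_component
      transpose_def mult.commute)

lemma curvM_eq: "curvM \<Gamma> c p i j =
    pdM c (\<lambda>q. connM \<Gamma> c q j) i p - pdM c (\<lambda>q. connM \<Gamma> c q i) j p
    + connM \<Gamma> c p j ** connM \<Gamma> c p i - connM \<Gamma> c p i ** connM \<Gamma> c p j"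
  by (simp add: vec_eq_iff curvM_def pdM_def connM_def curvature_def matrix_mult_component mult.commute)

lemma ricM_component: "ricM \<Gamma> c p $ i $ j = (\<Sum>k\<in>UNIV. curvM \<Gamma> c p k i $ j $ k)"
  by (simp add: ricM_def ricci_def curvM_def)


text \<open>
  The columns of \<open>M\<close> are the members \<open>\<theta>\<^sup>A\<close> of a coframe. The connection has the coefficients
  \<open>C\<^sub>B\<^sub>C\<^sup>A\<close>, stored as \<open>C B q $ C $ A\<close>, with respect to it, in the sense that
  \<open>\<nabla>\<^sub>I \<theta>\<^sup>A\<^sub>J = - C\<^sub>B\<^sub>C\<^sup>A \<theta>\<^sup>B\<^sub>I \<theta>\<^sup>C\<^sub>J\<close>; \<open>dC D B\<close> is the derivative of \<open>C B\<close> along the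
  \<open>D\<close>-th vector of the dual frame.
\<close>

locale moving_frame =
  fixes c :: "('p, real^'k::finite) chart" and U :: "'p set"
    and M :: "'p \<Rightarrow> real^'k^'k" and \<Gamma> :: "('p, 'k) tensor3"
    and C :: "'k \<Rightarrow> 'p \<Rightarrow> real^'k^'k" and dC :: "'k \<Rightarrow> 'k \<Rightarrow> 'p \<Rightarrow> real^'k^'k"
  assumes region: "chart_region c U"
    and smooth_M: "smoothM c U M"
    and invertible_M: "q \<in> U \<Longrightarrow> invertible (M q)"
    and smooth_C: "smoothM c U (C B)"
    and pdM_C: "q \<in> U \<Longrightarrow> pdM c (C B) i q = (\<Sum>D\<in>UNIV. M q $ i $ D *\<^sub>R dC D B q)"
    and framed: "q \<in> U \<Longrightarrow> connM \<Gamma> c q i ** M q =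
      pdM c M i q + M q ** (\<Sum>B\<in>UNIV. M q $ i $ B *\<^sub>R C B q)"
begin

abbreviation "Cdir q i \<equiv> \<Sum>B\<in>UNIV. M q $ i $ B *\<^sub>R C B q"

lemma smooth_Cdir: "smoothM c U (\<lambda>q. Cdir q i)"
  by (intro smoothM_sum[OF region] smoothM_scaleR[OF region] smooth_C smoothMD[OF smooth_M])

lemma smooth_N: "smoothM c U (\<lambda>q. matrix_inv (M q))"
  by (rule smoothM_matrix_inv[OF region smooth_M invertible_M])

lemma connM_eq: "q \<in> U \<Longrightarrow> connM \<Gamma> c q i =
    pdM c M i q ** matrix_inv (M q) + M q ** Cdir q i ** matrix_inv (M q)"
  using arg_cong[OF framed, of q "\<lambda>X. X ** matrix_inv (M q)" i]
  by (simp add: matrix_add_rdistrib matrix_inv_right invertible_M flip: matrix_mul_assoc)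

lemma smooth_connM: "smoothM c U (\<lambda>q. connM \<Gamma> c q i)"
proof -
  have *: "smoothM c U (\<lambda>q. pdM c M i q ** matrix_inv (M q))"
    "smoothM c U (\<lambda>q. M q ** Cdir q i ** matrix_inv (M q))"
    by (intro smoothM_mult[OF region] smoothM_pdM[OF region] smooth_M smooth_N smooth_Cdir)+
  have "smooth_in c U (\<lambda>q. connM \<Gamma> c q i $ a $ b)" for a b
    by (rule smooth_in_cong[OF region _ smooth_in_add[OF region *[THEN smoothMD]]])
      (simp add: connM_eq)
  then show ?thesis by (simp add: smoothM_def)
qed

text \<open>The curvature of a connection is, after conjugation by the coframe, the curvature of its
  gauge-transformed matrices. It is obtained by differentiating \<open>framed\<close> and
  antisymmetrizing.\<close>

lemma gauge_curvature:
  assumes q: "q \<in> U"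
  shows "curvM \<Gamma> c q i j ** M q = M q ** (pdM c (\<lambda>q. Cdir q j) i q - pdM c (\<lambda>q. Cdir q i) j q
    + Cdir q j ** Cdir q i - Cdir q i ** Cdir q j)"
proof -
  \<comment> \<open>One half of the curvature applied to M. The second derivatives of M and the two
    terms containing its first derivatives are together symmetric in i and j, so they cancel in the
    difference of the halves.\<close>
  have half: "pdM c (\<lambda>q. connM \<Gamma> c q j) i q ** M q + connM \<Gamma> c q j ** connM \<Gamma> c q i ** M q =
    pdM c (pdM c M j) i q + pdM c M i q ** Cdir q j + pdM c M j q ** Cdir q i
    + M q ** pdM c (\<lambda>q. Cdir q j) i q + M q ** Cdir q j ** Cdir q i" for i j
  proof -
    have "smoothM c U (\<lambda>q. M q ** Cdir q j)"
      by (rule smoothM_mult[OF region smooth_M smooth_Cdir])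
    then have "pdM c (\<lambda>q. connM \<Gamma> c q j ** M q) i q =
        pdM c (pdM c M j) i q + pdM c (\<lambda>q. M q ** Cdir q j) i q"
      using smoothM_pdM[OF region smooth_M, of j] q
      by (subst pdM_cong[OF region q framed]) (auto simp: pdM_def vec_eq_iff smoothM_def pd_add[OF region])
    then have "pdM c (\<lambda>q. connM \<Gamma> c q j) i q ** M q + connM \<Gamma> c q j ** pdM c M i q =
      pdM c (pdM c M j) i q + pdM c M i q ** Cdir q j + M q ** pdM c (\<lambda>q. Cdir q j) i q"
      by (simp add: pdM_mult[OF region q] smooth_connM smooth_M smooth_Cdir)
    moreover have "connM \<Gamma> c q j ** connM \<Gamma> c q i ** M q =
        connM \<Gamma> c q j ** pdM c M i q + (pdM c M j q + M q ** Cdir q j) ** Cdir q i"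
    proof -
      have "connM \<Gamma> c q j ** connM \<Gamma> c q i ** M q =
          connM \<Gamma> c q j ** pdM c M i q + (connM \<Gamma> c q j ** M q) ** Cdir q i"
        unfolding matrix_mul_assoc[symmetric] framed[OF q, of i] matrix_add_ldistrib by (simp add: matrix_mul_assoc)
      then show ?thesis by (simp only: framed[OF q])
    qed
    ultimately show ?thesis
      by (simp add: matrix_add_ldistrib matrix_add_rdistrib algebra_simps)
  qed
  have "curvM \<Gamma> c q i j ** M q =
      (pdM c (\<lambda>q. connM \<Gamma> c q j) i q ** M q + connM \<Gamma> c q j ** connM \<Gamma> c q i ** M q)
    - (pdM c (\<lambda>q. connM \<Gamma> c q i) j q ** M q + connM \<Gamma> c q i ** connM \<Gamma> c q j ** M q)"
    by (simp add: curvM_eq matrix_distribs)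
  then show ?thesis
    unfolding half by (simp add: pdM_commute[OF region q smooth_M, of j i] matrix_distribs matrix_mul_assoc)
qed

text \<open>The first structure equation: without torsion, the exterior derivative of the coframe is
  the antisymmetric part of the coefficients.\<close>

lemma torsion_coframe:
  assumes q: "q \<in> U" and sym: "\<And>a b k. \<Gamma> c q a b k = \<Gamma> c q b a k"
  shows "pdM c M i q $ j $ A - pdM c M j q $ i $ A =
    (\<Sum>D\<in>UNIV. \<Sum>B\<in>UNIV. M q $ i $ D * M q $ j $ B * (C B q $ D $ A - C D q $ B $ A))"
proof -
  have "(connM \<Gamma> c q i ** M q) $ j $ A = (connM \<Gamma> c q j ** M q) $ i $ A"
    unfolding matrix_mult_component connM_def vec_lambda_beta by (subst sym) (rule refl)
  then have "pdM c M i q $ j $ A - pdM c M j q $ i $ A =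
      (M q ** Cdir q j) $ i $ A - (M q ** Cdir q i) $ j $ A"
    by (simp add: framed[OF q] algebra_simps)
  also have "(M q ** Cdir q j) $ i $ A = (\<Sum>D\<in>UNIV. \<Sum>B\<in>UNIV. M q $ i $ D * M q $ j $ B * C B q $ D $ A)"
    by (simp add: matrix_mult_component sum_distrib_left mult.assoc)
  also have "(M q ** Cdir q i) $ j $ A = (\<Sum>D\<in>UNIV. \<Sum>B\<in>UNIV. M q $ i $ D * M q $ j $ B * C D q $ B $ A)"
    by (subst sum.swap) (simp add: matrix_mult_component sum_distrib_left mult_ac)
  finally show ?thesis by (simp add: right_diff_distrib sum_subtractf)
qed

text \<open>The last sum is the anholonomy term. It would normally involve brackets of the dual
  frame; for a torsion-free connection the structure equation expresses these through the
  coefficients themselves.\<close>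

definition frame_curv :: "'k \<Rightarrow> 'k \<Rightarrow> 'p \<Rightarrow> real^'k^'k" where
  "frame_curv D B q = dC D B q - dC B D q + C B q ** C D q - C D q ** C B q
    + (\<Sum>E\<in>UNIV. (C B q $ D $ E - C D q $ B $ E) *\<^sub>R C E q)"

lemma curvature_frame:
  assumes q: "q \<in> U" and sym: "\<And>a b k. \<Gamma> c q a b k = \<Gamma> c q b a k"
  shows "curvM \<Gamma> c q i j ** M q =
    M q ** (\<Sum>D\<in>UNIV. \<Sum>B\<in>UNIV. (M q $ i $ D * M q $ j $ B) *\<^sub>R frame_curv D B q)"
proof -
  have pC: "pdM c (\<lambda>q. Cdir q j) i q = (\<Sum>E\<in>UNIV. pdM c M i q $ j $ E *\<^sub>R C E q)
      + (\<Sum>D\<in>UNIV. \<Sum>B\<in>UNIV. (M q $ i $ D * M q $ j $ B) *\<^sub>R dC D B q)" for i j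
  proof -
    have "pdM c (\<lambda>q. Cdir q j) i q = (\<Sum>B\<in>UNIV. pdM c M i q $ j $ B *\<^sub>R C B q + M q $ j $ B *\<^sub>R pdM c (C B) i q)"
      by (subst pdM_sum[OF region q])
        (simp_all add: smoothM_scaleR[OF region] smooth_C smoothMD[OF smooth_M] pdM_scaleR[OF region q] pd_component)
    also have "\<dots> = (\<Sum>E\<in>UNIV. pdM c M i q $ j $ E *\<^sub>R C E q)
        + (\<Sum>B\<in>UNIV. \<Sum>D\<in>UNIV. (M q $ i $ D * M q $ j $ B) *\<^sub>R dC D B q)"
      by (simp add: pdM_C[OF q] scaleR_sum_right sum.distrib mult.commute)
    finally show ?thesis by (subst sum.swap) simp
  qed
  have CC: "Cdir q j ** Cdir q i = (\<Sum>D\<in>UNIV. \<Sum>B\<in>UNIV. (M q $ i $ D * M q $ j $ B) *\<^sub>R (C B q ** C D q))" for i j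
    by (simp add: matrix_sum_left matrix_sum_right matrix_scaleR_left matrix_scaleR_right scaleR_sum_right)
  have swap: "(\<Sum>D\<in>UNIV. \<Sum>B\<in>UNIV. (M q $ j $ D * M q $ i $ B) *\<^sub>R X D B) =
      (\<Sum>D\<in>UNIV. \<Sum>B\<in>UNIV. (M q $ i $ D * M q $ j $ B) *\<^sub>R X B D)" for X :: "'k \<Rightarrow> 'k \<Rightarrow> real^'k^'k"
    by (subst sum.swap) (simp add: mult.commute)
  \<comment> \<open>Differentiating the factor \<open>M q $ j $ B\<close> hidden in
    \<open>Cdir\<close> produces the exterior derivative of the coframe, which becomes the
    anholonomy term.\<close>
  have tors: "(\<Sum>E\<in>UNIV. pdM c M i q $ j $ E *\<^sub>R C E q) - (\<Sum>E\<in>UNIV. pdM c M j q $ i $ E *\<^sub>R C E q) =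
      (\<Sum>D\<in>UNIV. \<Sum>B\<in>UNIV. (M q $ i $ D * M q $ j $ B) *\<^sub>R
        (\<Sum>E\<in>UNIV. (C B q $ D $ E - C D q $ B $ E) *\<^sub>R C E q))"
  proof -
    have "(\<Sum>E\<in>UNIV. pdM c M i q $ j $ E *\<^sub>R C E q) - (\<Sum>E\<in>UNIV. pdM c M j q $ i $ E *\<^sub>R C E q) =
      (\<Sum>E\<in>UNIV. (\<Sum>D\<in>UNIV. \<Sum>B\<in>UNIV. M q $ i $ D * M q $ j $ B * (C B q $ D $ E - C D q $ B $ E)) *\<^sub>R C E q)"
      by (simp add: torsion_coframe[OF q sym] flip: sum_subtractf scaleR_diff_left)
    also have "\<dots> = (\<Sum>E\<in>UNIV. \<Sum>D\<in>UNIV. \<Sum>B\<in>UNIV.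
        (M q $ i $ D * M q $ j $ B) *\<^sub>R (C B q $ D $ E - C D q $ B $ E) *\<^sub>R C E q)"
      by (simp add: scaleR_sum_left)
    also have "\<dots> = (\<Sum>D\<in>UNIV. \<Sum>E\<in>UNIV. \<Sum>B\<in>UNIV.
        (M q $ i $ D * M q $ j $ B) *\<^sub>R (C B q $ D $ E - C D q $ B $ E) *\<^sub>R C E q)"
      by (rule sum.swap)
    also have "\<dots> = (\<Sum>D\<in>UNIV. \<Sum>B\<in>UNIV. \<Sum>E\<in>UNIV.
        (M q $ i $ D * M q $ j $ B) *\<^sub>R (C B q $ D $ E - C D q $ B $ E) *\<^sub>R C E q)"
      by (rule sum.cong[OF refl], rule sum.swap)
    finally show ?thesis by (simp add: scaleR_sum_right)
  qed
  have "pdM c (\<lambda>q. Cdir q j) i q - pdM c (\<lambda>q. Cdir q i) j q + Cdir q j ** Cdir q i - Cdir q i ** Cdir q j =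
      ((\<Sum>E\<in>UNIV. pdM c M i q $ j $ E *\<^sub>R C E q) - (\<Sum>E\<in>UNIV. pdM c M j q $ i $ E *\<^sub>R C E q))
      + (\<Sum>D\<in>UNIV. \<Sum>B\<in>UNIV. (M q $ i $ D * M q $ j $ B) *\<^sub>R dC D B q)
      - (\<Sum>D\<in>UNIV. \<Sum>B\<in>UNIV. (M q $ i $ D * M q $ j $ B) *\<^sub>R dC B D q)
      + (\<Sum>D\<in>UNIV. \<Sum>B\<in>UNIV. (M q $ i $ D * M q $ j $ B) *\<^sub>R (C B q ** C D q))
      - (\<Sum>D\<in>UNIV. \<Sum>B\<in>UNIV. (M q $ i $ D * M q $ j $ B) *\<^sub>R (C D q ** C B q))"
    unfolding pC CC swap[of "\<lambda>D B. dC D B q"] swap[of "\<lambda>D B. C B q ** C D q"] by simp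
  also have "\<dots> = (\<Sum>D\<in>UNIV. \<Sum>B\<in>UNIV. (M q $ i $ D * M q $ j $ B) *\<^sub>R frame_curv D B q)"
    unfolding tors frame_curv_def by (simp add: scaleR_add_right scaleR_diff_right sum.distrib sum_subtractf)
  finally show ?thesis using gauge_curvature[OF q, of i j] by simp
qed

definition frame_ric :: "'p \<Rightarrow> real^'k^'k" where
  "frame_ric q = (\<chi> B C. \<Sum>D\<in>UNIV. frame_curv D B q $ C $ D)"

text \<open>The Ricci contraction pairs a direction index with the upper index. One transforms by M
  and the other by its inverse, so the contraction can be done in the frame.\<close>

lemma ricci_frame:
  assumes q: "q \<in> U" and sym: "\<And>a b k. \<Gamma> c q a b k = \<Gamma> c q b a k"
  shows "ricM \<Gamma> c q = M q ** frame_ric q ** transpose (M q)"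
proof -
  let ?N = "matrix_inv (M q)"
  have NM: "?N ** M q = mat 1" "M q ** ?N = mat 1" using invertible_M[OF q] matrix_inv_left matrix_inv_right by auto
  have curv: "curvM \<Gamma> c q i j =
      (\<Sum>D\<in>UNIV. \<Sum>B\<in>UNIV. (M q $ i $ D * M q $ j $ B) *\<^sub>R (M q ** frame_curv D B q ** ?N))" for i j
    using arg_cong[OF curvature_frame[OF q sym, of i j], of "\<lambda>X. X ** ?N"]
    by (simp add: NM matrix_sum_left matrix_sum_right matrix_scaleR_left matrix_scaleR_right flip: matrix_mul_assoc)
  \<comment> \<open>This is where M cancels against its inverse.\<close>
  have tr: "(\<Sum>k\<in>UNIV. M q $ k $ D * (M q ** X ** ?N) $ j $ k) = (M q ** X) $ j $ D" for D j and X :: "real^'k^'k"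
  proof -
    have "(\<Sum>k\<in>UNIV. M q $ k $ D * (M q ** X ** ?N) $ j $ k) = (M q ** X ** ?N ** M q) $ j $ D"
      by (simp add: matrix_mult_component[of "M q ** X ** ?N"] mult.commute)
    then show ?thesis by (simp add: NM flip: matrix_mul_assoc)
  qed
  show ?thesis
  proof (simp only: vec_eq_iff, intro allI)
    fix i j
    have "ricM \<Gamma> c q $ i $ j = (\<Sum>k\<in>UNIV. \<Sum>D\<in>UNIV. \<Sum>B\<in>UNIV.
        M q $ i $ B * (M q $ k $ D * (M q ** frame_curv D B q ** ?N) $ j $ k))"
      by (simp add: ricM_component curv mult_ac)
    also have "\<dots> = (\<Sum>D\<in>UNIV. \<Sum>k\<in>UNIV. \<Sum>B\<in>UNIV.
        M q $ i $ B * (M q $ k $ D * (M q ** frame_curv D B q ** ?N) $ j $ k))"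
      by (rule sum.swap)
    also have "\<dots> = (\<Sum>D\<in>UNIV. \<Sum>B\<in>UNIV. M q $ i $ B * (M q ** frame_curv D B q) $ j $ D)"
      by (rule sum.cong[OF refl], subst sum.swap) (simp add: tr flip: sum_distrib_left)
    also have "\<dots> = (\<Sum>B\<in>UNIV. \<Sum>D\<in>UNIV. M q $ i $ B * (M q ** frame_curv D B q) $ j $ D)"
      by (rule sum.swap)
    also have "\<dots> = (\<Sum>B\<in>UNIV. M q $ i $ B * (\<Sum>C\<in>UNIV. M q $ j $ C * frame_ric q $ B $ C))"
    proof (rule sum.cong[OF refl])
      fix B
      have "(\<Sum>D\<in>UNIV. (M q ** frame_curv D B q) $ j $ D) = (\<Sum>C\<in>UNIV. M q $ j $ C * frame_ric q $ B $ C)"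
        by (simp add: frame_ric_def matrix_mult_component sum_distrib_left) (rule sum.swap)
      then show "(\<Sum>D\<in>UNIV. M q $ i $ B * (M q ** frame_curv D B q) $ j $ D) =
          M q $ i $ B * (\<Sum>C\<in>UNIV. M q $ j $ C * frame_ric q $ B $ C)"
        by (simp flip: sum_distrib_left)
    qed
    also have "\<dots> = (M q ** frame_ric q ** transpose (M q)) $ i $ j"
      by (simp add: matrix_mult_component transpose_def sum_distrib_left sum_distrib_right mult_ac flip: matrix_mul_assoc)
    finally show "ricM \<Gamma> c q $ i $ j = (M q ** frame_ric q ** transpose (M q)) $ i $ j" .
  qed
qed

text \<open>The derivatives of M from the product rule cancel against the inhomogeneous terms of
  \<open>framed\<close>; what is left is the derivative of the frame components corrected by the
  coefficients.\<close>

lemma covM_frame: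
  assumes q: "q \<in> U" and T: "\<And>q. q \<in> U \<Longrightarrow> gram T c q = M q ** S q ** transpose (M q)"
    and S: "smoothM c U S" "pdM c S i q = (\<Sum>D\<in>UNIV. M q $ i $ D *\<^sub>R dS D)"
  shows "covM \<Gamma> T c q i = M q ** (\<Sum>D\<in>UNIV. M q $ i $ D *\<^sub>R
    (dS D - C D q ** S q - S q ** transpose (C D q))) ** transpose (M q)"
proof -
  have "pdM c (gram T c) i q = pdM c (\<lambda>q. M q ** S q ** transpose (M q)) i q"
    by (rule pdM_cong[OF region q T])
  also have "\<dots> = (pdM c M i q ** S q + M q ** pdM c S i q) ** transpose (M q)
      + M q ** S q ** transpose (pdM c M i q)"
    by (simp add: pdM_mult[OF region q] smoothM_mult[OF region] smooth_M S(1) smoothM_transpose[OF region]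
        pdM_transpose[OF region q])
  finally have p: "pdM c (gram T c) i q = \<dots>" .
  have 1: "connM \<Gamma> c q i ** gram T c q = (pdM c M i q + M q ** Cdir q i) ** S q ** transpose (M q)"
    by (simp add: T[OF q] framed[OF q, symmetric] matrix_mul_assoc)
  have 2: "gram T c q ** transpose (connM \<Gamma> c q i) =
      M q ** S q ** transpose (pdM c M i q + M q ** Cdir q i)"
    by (simp add: T[OF q] framed[OF q, symmetric] matrix_transpose_mul flip: matrix_mul_assoc)
  show ?thesis
    unfolding covM_eq p 1 2 S(2)
    by (simp add: matrix_distribs matrix_mul_assoc scaleR_diff_right sum_subtractf)
qed

lemma ginv_frame:
  assumes q: "q \<in> U" and T: "gram T c q = M q ** S ** transpose (M q)" and S: "invertible S"
  shows "invertible (gram T c q)"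
    "matrix_inv (gram T c q) = transpose (matrix_inv (M q)) ** matrix_inv S ** matrix_inv (M q)"
proof -
  let ?N = "matrix_inv (M q)"
  have tr: "transpose (M q) ** transpose ?N = mat 1"
    by (simp add: matrix_inv_left[OF invertible_M[OF q]] transpose_mat flip: matrix_transpose_mul)
  have "gram T c q ** (transpose ?N ** matrix_inv S ** ?N) =
      M q ** (S ** ((transpose (M q) ** transpose ?N) ** matrix_inv S)) ** ?N"
    by (simp add: T matrix_mul_assoc)
  also have "\<dots> = mat 1"
    by (simp add: tr matrix_inv_right[OF S] matrix_inv_right[OF invertible_M[OF q]])
  finally have "gram T c q ** (transpose ?N ** matrix_inv S ** ?N) = mat 1" .
  then show "invertible (gram T c q)" "matrix_inv (gram T c q) = transpose ?N ** matrix_inv S ** ?N"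
    by (rule matrix_inv_unique)+
qed

end

section \<open>Statistical structures\<close>

lemma trace_uminus: "trace (- A :: real^'k::finite^'k) = - trace A"
  by (simp add: trace_def sum_negf)

lemma trace_scaleR: "trace (r *\<^sub>R A :: real^'k::finite^'k) = r * trace A"
  by (simp add: trace_def sum_distrib_left)

lemma trace_transpose: "trace (transpose A) = trace (A :: real^'k::finite^'k)"
  by (simp add: trace_def transpose_def)

lemma sum_symmetric_antisymmetric:
  fixes V S :: "'k::finite \<Rightarrow> 'k \<Rightarrow> real"
  assumes "\<And>a b. V a b = - V b a" "\<And>a b. S a b = S b a"
  shows "(\<Sum>a\<in>UNIV. \<Sum>b\<in>UNIV. V a b * S a b) = 0"
proof -
  have "(\<Sum>a\<in>UNIV. \<Sum>b\<in>UNIV. V a b * S a b) = (\<Sum>a\<in>UNIV. \<Sum>b\<in>UNIV. V b a * S b a)"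
    by (rule sum.swap)
  also have "\<dots> = - (\<Sum>a\<in>UNIV. \<Sum>b\<in>UNIV. V a b * S a b)"
    unfolding sum_negf[symmetric]
  proof (intro sum.cong refl)
    fix a b show "V b a * S b a = - (V a b * S a b)" using assms(1)[of b a] assms(2)[of b a] by simp
  qed
  finally show ?thesis by simp
qed

lemma transpose_eqD:
  assumes "transpose A = A"
  shows "A $ i $ j = A $ j $ i"
proof -
  have "transpose A $ j $ i = A $ j $ i" by (simp only: assms)
  then show ?thesis by (simp add: transpose_def)
qed

lemma transpose_eq_uminusD:
  assumes "transpose A = - (A :: real^'k^'k)"
  shows "A $ i $ j = - (A $ j $ i)"
proof -
  have "transpose A $ j $ i = (- A) $ j $ i" by (simp only: assms)
  then show ?thesis by (simp add: transpose_def)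
qed

section \<open>Vanishing divergence of \<omega> at a point; \<open>g' k\<close> and
  \<open>W' k\<close> stand for covariant derivatives\<close>

context
  fixes g H W :: "real^'n::finite^'n" and g' W' :: "'n \<Rightarrow> real^'n^'n" and \<alpha> :: real
  assumes gH: "g ** H = mat 1" and g_sym: "transpose g = g"
    and W_skew: "transpose W = - W" and W'_skew: "\<And>k. transpose (W' k) = - W' k"
    and g'_sym: "\<And>k. transpose (g' k) = g' k" and g'_sym2: "\<And>i j k. g' i $ j $ k = g' j $ i $ k"
    and g'_trace: "\<And>k. trace (H ** g' k) = 0"
    and square: "W ** H ** W = \<alpha> *\<^sub>R g" and \<alpha>: "\<alpha> \<noteq> 0"
    and closed: "\<And>i j k. W' i $ j $ k + W' j $ k $ i + W' k $ i $ j = 0"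
    and square': "\<And>k. W' k ** H ** W + W ** H ** W' k - W ** H ** g' k ** H ** W = \<alpha> *\<^sub>R g' k"
begin

lemma Hg: "H ** g = mat 1"
  using gH matrix_left_right_inverse by blast

lemma H_sym: "transpose H = H"
proof -
  have "g ** transpose H = mat 1"
    by (metis Hg g_sym matrix_transpose_mul transpose_mat)
  then show ?thesis using gH Hg by (metis matrix_mul_assoc matrix_mul_lid)
qed

text \<open>The full contraction of \<omega> with itself is constant. Tracing \<open>square'\<close>
  gives this: the first two terms have equal trace, while the third and the right-hand side reduce
  to multiples of the trace of \<open>g' k\<close>.\<close>

lemma trace_inverse_square: "trace (H ** W ** H ** W' k) = 0"
proof -
  have e: "trace (H ** (W' k ** H ** W + W ** H ** W' k - W ** H ** g' k ** H ** W)) = 0"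
    by (simp add: square' matrix_scaleR_right trace_scaleR g'_trace)
  have "trace (H ** (W' k ** H ** W)) = trace (H ** W ** H ** W' k)"
    using trace_mul_sym[of "H ** W' k" "H ** W"] by (simp add: matrix_mul_assoc)
  moreover have "trace (H ** (W ** H ** g' k ** H ** W)) = trace (H ** (W ** H ** W) ** H ** g' k)"
    using trace_mul_sym[of "H ** W ** H ** g' k" "H ** W"] by (simp add: matrix_mul_assoc)
  then have "trace (H ** (W ** H ** g' k ** H ** W)) = 0"
    unfolding square
    by (simp add: matrix_scaleR_left matrix_scaleR_right trace_scaleR Hg g'_trace)
  ultimately show ?thesis
    using e by (simp add: matrix_add_ldistrib matrix_diff_ldistrib trace_add trace_sub matrix_mul_assoc)
qed

text \<open>Contract the closedness identity with the skew matrix \<open>H ** W ** H\<close>. Two of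
  the three terms coincide and the third is the trace already known to vanish.\<close>

lemma divergence_inverse: "(\<Sum>a\<in>UNIV. \<Sum>i\<in>UNIV. (H ** W ** H) $ a $ i * W' a $ i $ q) = 0"
proof -
  define V where "V = H ** W ** H"
  have "transpose V = - V"
    by (simp add: V_def matrix_transpose_mul H_sym W_skew matrix_uminus_left matrix_uminus_right matrix_mul_assoc)
  then have V_skew: "V $ a $ i = - (V $ i $ a)" for a i by (rule transpose_eq_uminusD)
  have W': "W' k $ a $ i = - (W' k $ i $ a)" for k a i
    by (rule transpose_eq_uminusD[OF W'_skew])
  have "0 = (\<Sum>a\<in>UNIV. \<Sum>i\<in>UNIV. V $ a $ i * (W' a $ i $ q + W' i $ q $ a + W' q $ a $ i))"
    by (simp add: closed)
  also have "\<dots> = (\<Sum>a\<in>UNIV. \<Sum>i\<in>UNIV. V $ a $ i * W' a $ i $ q)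
     + (\<Sum>a\<in>UNIV. \<Sum>i\<in>UNIV. V $ a $ i * W' i $ q $ a) + (\<Sum>a\<in>UNIV. \<Sum>i\<in>UNIV. V $ a $ i * W' q $ a $ i)"
    by (simp add: distrib_left sum.distrib)
  also have "(\<Sum>a\<in>UNIV. \<Sum>i\<in>UNIV. V $ a $ i * W' i $ q $ a) = (\<Sum>a\<in>UNIV. \<Sum>i\<in>UNIV. V $ a $ i * W' a $ i $ q)"
  proof (subst sum.swap, intro sum.cong refl)
    fix a i show "V $ i $ a * W' a $ q $ i = V $ a $ i * W' a $ i $ q"
      using V_skew[of i a] W'[of a q i] by simp
  qed
  also have "(\<Sum>a\<in>UNIV. \<Sum>i\<in>UNIV. V $ a $ i * W' q $ a $ i) = - trace (V ** W' q)"
    unfolding trace_def matrix_mult_component sum_negf[symmetric]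
  proof (intro sum.cong refl)
    fix a i show "V $ a $ i * W' q $ a $ i = - (V $ a $ i * W' q $ i $ a)"
      using W'[of q a i] by simp
  qed
  finally show ?thesis using trace_inverse_square[of q] by (simp add: V_def)
qed

text \<open>Contract \<open>square'\<close> with H so that the direction index meets the left matrix
  index. The second term is \<open>divergence_inverse\<close>; the third pairs a skew matrix with a
  symmetric pair of indices; the right-hand side is a trace of \<open>g' j\<close>. The first term
  thus says that the divergence d satisfies \<open>d Y = 0\<close> for \<open>Y = H ** W\<close>,
  and d vanishes because Y squares to the nonzero constant \<alpha>.\<close>

lemma divergence_free: "(\<Sum>k\<in>UNIV. (H ** W' k) $ k $ p) = 0"
proof -
  define d where "d p = (\<Sum>k\<in>UNIV. (H ** W' k) $ k $ p)" for p
  let ?Y = "H ** W" and ?V = "H ** W ** H"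
  have "transpose ?V = - ?V"
    by (simp add: matrix_transpose_mul H_sym W_skew matrix_uminus_left matrix_uminus_right matrix_mul_assoc)
  then have V: "?V $ a $ i = - (?V $ i $ a)" for a i by (rule transpose_eq_uminusD)
  have "(\<Sum>p\<in>UNIV. d p * ?Y $ p $ j) = 0" for j
  proof -
    have "H ** (W' k ** H ** W) + H ** (W ** H ** W' k) - H ** (W ** H ** g' k ** H ** W) = \<alpha> *\<^sub>R (H ** g' k)" for k
      using arg_cong[OF square'[of k], of "\<lambda>X. H ** X"]
      by (simp add: matrix_add_ldistrib matrix_diff_ldistrib matrix_scaleR_right)
    then have "(\<Sum>k\<in>UNIV. (H ** (W' k ** H ** W) + H ** (W ** H ** W' k) - H ** (W ** H ** g' k ** H ** W)) $ k $ j) =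
        (\<Sum>k\<in>UNIV. (\<alpha> *\<^sub>R (H ** g' k)) $ k $ j)"
      by (simp only:)
    then have sum: "(\<Sum>k\<in>UNIV. (H ** W' k ** ?Y) $ k $ j) + (\<Sum>k\<in>UNIV. (?V ** W' k) $ k $ j)
        - (\<Sum>k\<in>UNIV. (?V ** g' k ** ?Y) $ k $ j) = \<alpha> * (\<Sum>k\<in>UNIV. (H ** g' k) $ k $ j)"
      by (simp add: sum.distrib sum_subtractf sum_distrib_left matrix_mul_assoc)
    have "(\<Sum>k\<in>UNIV. (?V ** W' k) $ k $ j) = 0"
      using divergence_inverse[of j] by (simp add: matrix_mult_component[of ?V])
    moreover have "(\<Sum>k\<in>UNIV. (?V ** g' k ** ?Y) $ k $ j) = 0"
    proof -
      have "(\<Sum>k\<in>UNIV. (?V ** g' k ** ?Y) $ k $ j) =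
          (\<Sum>c\<in>UNIV. (\<Sum>k\<in>UNIV. \<Sum>b\<in>UNIV. ?V $ k $ b * g' k $ b $ c) * ?Y $ c $ j)"
        unfolding sum_distrib_right
        by (subst sum.swap) (simp add: matrix_mult_component[of "?V ** g' _"] matrix_mult_component[of ?V]
            sum_distrib_right)
      moreover have "(\<Sum>k\<in>UNIV. \<Sum>b\<in>UNIV. ?V $ k $ b * g' k $ b $ c) = 0" for c
        by (rule sum_symmetric_antisymmetric) (rule V, rule g'_sym2)
      ultimately show ?thesis by simp
    qed
    moreover have "(\<Sum>k\<in>UNIV. (H ** g' k) $ k $ j) = trace (H ** g' j)"
      unfolding trace_def matrix_mult_component
    proof (intro sum.cong refl)
      fix k i
      have "g' k $ i $ j = g' k $ j $ i" by (rule transpose_eqD[OF g'_sym])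
      also have "\<dots> = g' j $ k $ i" by (rule g'_sym2)
      also have "\<dots> = g' j $ i $ k" by (rule transpose_eqD[OF g'_sym])
      finally show "H $ k $ i * g' k $ i $ j = H $ k $ i * g' j $ i $ k" by simp
    qed
    moreover have "(\<Sum>k\<in>UNIV. (H ** W' k ** ?Y) $ k $ j) = (\<Sum>p\<in>UNIV. d p * ?Y $ p $ j)"
      unfolding d_def sum_distrib_right
      by (subst sum.swap) (simp add: matrix_mult_component[of "H ** W' _"])
    ultimately show ?thesis using sum g'_trace by simp
  qed
  then have "(\<Sum>j\<in>UNIV. (\<Sum>p\<in>UNIV. d p * ?Y $ p $ j) * ?Y $ j $ r) = 0" for r by simp
  moreover have "(\<Sum>j\<in>UNIV. (\<Sum>p\<in>UNIV. d p * ?Y $ p $ j) * ?Y $ j $ r) = (\<Sum>p\<in>UNIV. d p * (?Y ** ?Y) $ p $ r)" for r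
    unfolding sum_distrib_right by (subst sum.swap) (simp add: matrix_mult_component[of ?Y ?Y] sum_distrib_left mult.assoc)
  moreover have "?Y ** ?Y = \<alpha> *\<^sub>R mat 1"
  proof -
    have "?Y ** ?Y = H ** (W ** H ** W)" by (simp add: matrix_mul_assoc)
    then show ?thesis by (simp add: square matrix_scaleR_right Hg)
  qed
  ultimately have "(\<Sum>p\<in>UNIV. d p * (\<alpha> *\<^sub>R mat 1 :: real^'n^'n) $ p $ r) = 0" for r by simp
  then have "d r * \<alpha> = 0" for r by (simp add: mat_def if_distrib cong: if_cong)
  then show ?thesis using \<alpha> unfolding d_def by simp
qed

text \<open>The same statement for the endomorphism \<open>W ** H\<close>: its derivative has an
  extra term from differentiating the inverse metric, and the total symmetry of \<open>g'\<close>
  turns the divergence of that term into a trace.\<close>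

lemma divergence_endomorphism: "(\<Sum>a\<in>UNIV. (W' a ** H - W ** H ** g' a ** H) $ i $ a) = 0"
proof -
  have "(\<Sum>a\<in>UNIV. (W' a ** H) $ i $ a) = - (\<Sum>k\<in>UNIV. (H ** W' k) $ k $ i)"
    unfolding matrix_mult_component sum_negf[symmetric]
  proof (intro sum.cong refl)
    fix a q
    have "W' a $ i $ q = - (W' a $ q $ i)" by (rule transpose_eq_uminusD[OF W'_skew])
    moreover have "H $ q $ a = H $ a $ q" by (rule transpose_eqD[OF H_sym])
    ultimately show "W' a $ i $ q * H $ q $ a = - (H $ a $ q * W' a $ q $ i)" by simp
  qed
  moreover have "(\<Sum>a\<in>UNIV. (W ** H ** g' a ** H) $ i $ a) = 0"
  proof -
    have "(\<Sum>a\<in>UNIV. (W ** H ** g' a ** H) $ i $ a) = (\<Sum>b\<in>UNIV. (W ** H) $ i $ b * (\<Sum>a\<in>UNIV. (g' a ** H) $ b $ a))"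
      unfolding sum_distrib_left
      by (subst sum.swap) (simp add: matrix_mult_component[of "W ** H"] flip: matrix_mul_assoc[of "W ** H"])
    moreover have "(\<Sum>a\<in>UNIV. (g' a ** H) $ b $ a) = trace (g' b ** H)" for b
      by (simp add: trace_def matrix_mult_component g'_sym2[of _ b])
    ultimately show ?thesis by (simp add: trace_mul_sym[of _ H] g'_trace)
  qed
  ultimately show ?thesis using divergence_free[of i] by (simp add: sum_subtractf)
qed

end

section \<open>Statistical structures in a single chart\<close>

lemma DERIV_abs_sgn: "x \<noteq> 0 \<Longrightarrow> (abs has_real_derivative sgn x) (at (x :: real))"
proof (cases "x > 0")
  case True
  have "((\<lambda>x. x) has_real_derivative 1) (at x)" by (rule DERIV_ident)
  then have "(abs has_real_derivative 1) (at x)"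
    by (rule has_field_derivative_transform_within_open[where S = "{0<..}"]) (use True in auto)
  then show ?thesis using True by simp
next
  case False
  assume "x \<noteq> 0"
  with False have x: "x < 0" by simp
  have "((\<lambda>x. - x) has_real_derivative - 1) (at x)" by (auto intro!: derivative_eq_intros)
  then have "(abs has_real_derivative - 1) (at x)"
    by (rule has_field_derivative_transform_within_open[where S = "{..<0}"]) (use x in auto)
  then show ?thesis using x by simp
qed

text \<open>The condition on the determinant is recast as \<open>cov_trace\<close>. In this form it
  passes at once to the conjugate connection, for which \<nabla>g merely changes sign.\<close>

locale statistical_chart =
  fixes b :: "('m, real^'n::finite) chart" and V :: "'m set" and \<Gamma> :: "('m, 'n) tensor3" and g :: "('m, 'n) tensor2"
  assumes region: "chart_region b V"
    and smooth_g: "smoothM b V (gram g b)" and smooth_\<Gamma>: "smoothM b V (\<lambda>x. connM \<Gamma> b x i)"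
    and torsion_free: "x \<in> V \<Longrightarrow> \<Gamma> b x i j k = \<Gamma> b x j i k"
    and g_sym: "x \<in> V \<Longrightarrow> g b x i j = g b x j i" and g_inv: "x \<in> V \<Longrightarrow> invertible (gram g b x)"
    and cov_sym: "x \<in> V \<Longrightarrow> cov2 \<Gamma> g b x i j k = cov2 \<Gamma> g b x j i k"
    and cov_trace: "x \<in> V \<Longrightarrow> trace (matrix_inv (gram g b x) ** covM \<Gamma> g b x i) = 0"
begin

abbreviation "H x \<equiv> matrix_inv (gram g b x)"

lemma gram_sym: "x \<in> V \<Longrightarrow> transpose (gram g b x) = gram g b x"
  by (simp add: gram_def transpose_def g_sym vec_eq_iff)

lemma H_sym: "x \<in> V \<Longrightarrow> transpose (H x) = H x"
  by (metis gram_sym g_inv matrix_inv_left matrix_inv_unique(2) matrix_transpose_mul transpose_mat)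

lemma gram_H: "x \<in> V \<Longrightarrow> gram g b x ** H x = mat 1" "x \<in> V \<Longrightarrow> H x ** gram g b x = mat 1"
  by (simp_all add: matrix_inv_right matrix_inv_left g_inv)

lemma covM_sym: "x \<in> V \<Longrightarrow> transpose (covM \<Gamma> g b x i) = covM \<Gamma> g b x i"
proof -
  assume x: "x \<in> V"
  have "transpose (pdM b (gram g b) i x) = pdM b (\<lambda>x. transpose (gram g b x)) i x"
    by (simp add: pdM_transpose[OF region x])
  also have "\<dots> = pdM b (gram g b) i x"
    by (rule pdM_cong[OF region x]) (rule gram_sym)
  finally show ?thesis
    by (simp add: covM_eq matrix_distribs gram_sym[OF x])
qed

end

lemma special_statistical_chart:
  assumes A: "smooth_atlas A" and b: "b \<in> A" and S: "special_statistical A \<Gamma> g"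
  shows "statistical_chart b (dom_chart b) \<Gamma> g"
proof
  note R = atlas_chart_region[OF A b]
  show "chart_region b (dom_chart b)" by (rule R)
  have st: "statistical A \<Gamma> g" and det0: "x \<in> dom_chart b \<Longrightarrow> cov_det \<Gamma> g b x i = 0" for x i
    using S b by (auto simp: special_statistical_def)
  have g: "pseudo_metric A g" and t: "torsion_free_connection A \<Gamma>" using st by (auto simp: statistical_def)
  show sg: "smoothM b (dom_chart b) (gram g b)"
    using g b by (auto simp: pseudo_metric_def covariant2_def smoothM_def smooth_in_def gram_def)
  show "smoothM b (dom_chart b) (\<lambda>x. connM \<Gamma> b x i)" for i
    using t b by (auto simp: torsion_free_connection_def affine_connection_def smoothM_def smooth_in_def connM_def)
  show "\<Gamma> b x i j k = \<Gamma> b x j i k" if "x \<in> dom_chart b" for x i j k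
    using t b that by (auto simp: torsion_free_connection_def)
  show "g b x i j = g b x j i" if "x \<in> dom_chart b" for x i j
    using g b that by (auto simp: pseudo_metric_def)
  then have sym: "transpose (gram g b x) = gram g b x" if "x \<in> dom_chart b" for x
    using that by (simp add: gram_def transpose_def vec_eq_iff)
  show inv: "invertible (gram g b x)" if "x \<in> dom_chart b" for x
    using g b that by (auto simp: pseudo_metric_def nondegenerate_def)
  show "cov2 \<Gamma> g b x i j k = cov2 \<Gamma> g b x j i k" if "x \<in> dom_chart b" for x i j k
    using st b that by (auto simp: statistical_def alt2_def)
  show "trace (matrix_inv (gram g b x) ** covM \<Gamma> g b x i) = 0" if x: "x \<in> dom_chart b" for x i
  proof -
    let ?H = "matrix_inv (gram g b x)" and ?d = "det (gram g b x)"
    have d: "?d \<noteq> 0" using inv[OF x] by (simp add: invertible_det_nz)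
    \<comment> \<open>Jacobi's formula turns the parallel determinant into
      \<open>trace (H dg) = 2 trace \<Gamma>\<close>, which is the vanishing of the trace of
      \<nabla>g because each slot of g contributes one trace of \<Gamma>.\<close>
    have "pd b (\<lambda>q. \<bar>det (gram g b q)\<bar>) i x = sgn ?d * (?d * trace (pdM b (gram g b) i x ** ?H))"
      using pd_compose_real[OF R x smooth_in_det[OF R sg] DERIV_abs_sgn[OF d]] pd_det[OF R x sg inv[OF x]] by simp
    also have "\<dots> = \<bar>?d\<bar> * trace (pdM b (gram g b) i x ** ?H)" by (simp add: sgn_if)
    finally have "\<bar>?d\<bar> * (trace (pdM b (gram g b) i x ** ?H) - 2 * trace (connM \<Gamma> b x i)) = 0"
      using det0[OF x, of i] by (simp add: cov_det_def trace_def connM_def algebra_simps)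
    then have 1: "trace (?H ** pdM b (gram g b) i x) = 2 * trace (connM \<Gamma> b x i)"
      using d by (simp add: trace_mul_sym[of ?H])
    have 2: "trace (?H ** (connM \<Gamma> b x i ** gram g b x)) = trace (connM \<Gamma> b x i)"
      by (subst trace_mul_sym) (simp add: matrix_inv_right[OF inv[OF x]] flip: matrix_mul_assoc)
    have 3: "trace (?H ** (gram g b x ** transpose (connM \<Gamma> b x i))) = trace (connM \<Gamma> b x i)"
      by (simp add: matrix_mul_assoc matrix_inv_left[OF inv[OF x]] trace_transpose)
    show ?thesis
      by (simp add: covM_eq matrix_diff_ldistrib trace_sub 1 2 3)
  qed
qed

lemma curvature_antisym: "curvM \<Gamma> c p i j = - curvM \<Gamma> c p j i"
  by (simp add: curvM_eq)

text \<open>A double trace of curvature matrices: the form in which conjugation becomes a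
  transposition.\<close>

lemma scal_eq_sum: "scal \<Gamma> g c p =
    (\<Sum>i\<in>UNIV. \<Sum>k\<in>UNIV. (matrix_inv (gram g c p) ** curvM \<Gamma> c p k i) $ i $ k)"
proof -
  have "(\<Sum>j\<in>UNIV. ginv g c p i j * ricci \<Gamma> c p i j) =
      (\<Sum>k\<in>UNIV. (matrix_inv (gram g c p) ** curvM \<Gamma> c p k i) $ i $ k)" for i
    unfolding matrix_mult_component ginv_def ricci_def sum_distrib_left
    by (subst sum.swap) (simp add: curvM_def)
  then show ?thesis by (simp add: scal_def)
qed

section \<open>The conjugate connection and its curvature\<close>

context statistical_chart
begin

lemma smooth_covM: "smoothM b V (\<lambda>x. covM \<Gamma> g b x i)"
  unfolding covM_eq
proof -
  have *: "smoothM b V (pdM b (gram g b) i)" "smoothM b V (\<lambda>x. connM \<Gamma> b x i ** gram g b x)"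
    "smoothM b V (\<lambda>x. gram g b x ** transpose (connM \<Gamma> b x i))"
    by (intro smoothM_pdM[OF region] smoothM_mult[OF region] smoothM_transpose[OF region] smooth_g smooth_\<Gamma>)+
  show "smoothM b V (\<lambda>x. pdM b (gram g b) i x - connM \<Gamma> b x i ** gram g b x - gram g b x ** transpose (connM \<Gamma> b x i))"
    using *[THEN smoothMD] unfolding smoothM_def
    by (auto intro!: smooth_in_diff[OF region])
qed

lemma smooth_H: "smoothM b V H"
  by (rule smoothM_matrix_inv[OF region smooth_g g_inv])

definition conj :: "('m, 'n) tensor3" where
  "conj = conjugate_connection \<Gamma> g (\<lambda>c p i. 0)"

lemma connM_conj: "x \<in> V \<Longrightarrow> connM conj b x i = connM \<Gamma> b x i + covM \<Gamma> g b x i ** H x"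
  by (simp add: vec_eq_iff connM_def conj_def conjugate_connection_def cubic_form_def covM_def
      matrix_mult_component ginv_def transpose_eqD[OF H_sym, of x _ "_ :: 'n"] mult.commute)

lemma smooth_conj: "smoothM b V (\<lambda>x. connM conj b x i)"
proof -
  have *: "smoothM b V (\<lambda>x. covM \<Gamma> g b x i ** H x)"
    by (intro smoothM_mult[OF region] smooth_covM smooth_H)
  have "smooth_in b V (\<lambda>x. connM conj b x i $ j $ k)" for j k
    by (rule smooth_in_cong[OF region _ smooth_in_add[OF region smoothMD[OF smooth_\<Gamma>] smoothMD[OF *]]])
      (simp add: connM_conj)
  then show ?thesis by (simp add: smoothM_def)
qed

text \<open>Each of the two slots of g absorbs one copy of the cubic form, so \<nabla>g changes by
  minus twice itself.\<close>

lemma covM_conj: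
  assumes x: "x \<in> V"
  shows "covM conj g b x i = - covM \<Gamma> g b x i"
proof -
  have "covM \<Gamma> g b x i ** H x ** gram g b x = covM \<Gamma> g b x i"
    "gram g b x ** (H x ** covM \<Gamma> g b x i) = covM \<Gamma> g b x i"
    using gram_H[OF x] by (simp_all flip: matrix_mul_assoc) (simp add: matrix_mul_assoc)
  then have "covM conj g b x i = covM \<Gamma> g b x i - covM \<Gamma> g b x i - covM \<Gamma> g b x i"
    unfolding covM_eq[of conj] connM_conj[OF x]
    by (simp add: matrix_distribs covM_sym[OF x] H_sym[OF x]) (simp add: covM_eq)
  then show ?thesis by simp
qed

lemma statistical_chart_conj: "statistical_chart b V conj g"
proof
  show "conj b x i j k = conj b x j i k" if "x \<in> V" for x i j k
    using torsion_free[OF that] cov_sym[OF that]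
    by (simp add: conj_def conjugate_connection_def cubic_form_def)
  have cov: "cov2 conj g b x i j k = - cov2 \<Gamma> g b x i j k" if "x \<in> V" for x i j k
    using covM_conj[OF that, of i] by (simp add: covM_def vec_eq_iff)
  show "cov2 conj g b x i j k = cov2 conj g b x j i k" if "x \<in> V" for x i j k
    by (simp add: cov[OF that] cov_sym[OF that, of i])
  show "trace (H x ** covM conj g b x i) = 0" if "x \<in> V" for x i
    by (simp add: covM_conj[OF that] matrix_uminus_right trace_uminus cov_trace[OF that])
qed (use region smooth_g smooth_conj g_sym g_inv in auto)

text \<open>The metric pairs a connection with its conjugate: dg is \<Gamma> g plus g times the
  transposed conjugate matrix. Since second derivatives of g commute, antisymmetrizing the
  derivative of this relation pairs the two curvatures in the same way.\<close>

lemma curvature_conj: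
  assumes x: "x \<in> V"
  shows "curvM \<Gamma> b x i j ** gram g b x = - (gram g b x ** transpose (curvM conj b x i j))"
proof -
  let ?G = "\<lambda>i x. connM \<Gamma> b x i" and ?K = "\<lambda>i x. connM conj b x i"
  have d: "pdM b (gram g b) i x = ?G i x ** gram g b x + gram g b x ** transpose (?K i x)" if x: "x \<in> V" for x i
  proof -
    have "gram g b x ** (H x ** covM \<Gamma> g b x i) = covM \<Gamma> g b x i"
      using gram_H[OF x] by (simp add: matrix_mul_assoc)
    then show ?thesis
      by (simp add: connM_conj[OF x] matrix_distribs covM_sym[OF x] H_sym[OF x]) (simp add: covM_eq)
  qed
  have ext_deriv_frame: "pdM b (pdM b (gram g b) j) i x =
      pdM b (?G j) i x ** gram g b x + ?G j x ** (?G i x ** gram g b x + gram g b x ** transpose (?K i x))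
      + (?G i x ** gram g b x + gram g b x ** transpose (?K i x)) ** transpose (?K j x)
      + gram g b x ** transpose (pdM b (?K j) i x)" for i j
  proof -
    have s: "smoothM b V (\<lambda>x. ?G j x ** gram g b x)" "smoothM b V (\<lambda>x. gram g b x ** transpose (?K j x))"
      by (intro smoothM_mult[OF region] smoothM_transpose[OF region] smooth_g smooth_\<Gamma> smooth_conj)+
    have "pdM b (pdM b (gram g b) j) i x = pdM b (\<lambda>x. ?G j x ** gram g b x) i x
        + pdM b (\<lambda>x. gram g b x ** transpose (?K j x)) i x"
    proof -
      have "pdM b (pdM b (gram g b) j) i x =
          pdM b (\<lambda>x. ?G j x ** gram g b x + gram g b x ** transpose (?K j x)) i x"
        by (rule pdM_cong[OF region x]) (rule d)
      then show ?thesis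
        using s by (simp add: pdM_def[of b "\<lambda>x. _ x + _ x"] pdM_def[of b "\<lambda>x. _ x ** _ x"]
            vec_eq_iff smoothM_def pd_add[OF region x])
    qed
    then show ?thesis
      by (simp add: pdM_mult[OF region x] smooth_g smooth_\<Gamma> smooth_conj smoothM_transpose[OF region]
          pdM_transpose[OF region x] d[OF x])
  qed
  show ?thesis
    using pdM_commute[OF region x smooth_g, of i j]
    unfolding ext_deriv_frame curvM_eq by (simp add: matrix_distribs matrix_mul_assoc algebra_simps)
qed

text \<open>With an index lowered, conjugation exchanges the last two indices of the curvature up to
  sign. The skewness of the first pair supplies the other sign, so the matrices entering the double
  trace are transposed and merely relabelled.\<close>

lemma scal_conj:
  assumes x: "x \<in> V"
  shows "scal conj g b x = scal \<Gamma> g b x"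
proof -
  have "(H x ** curvM conj b x k i) $ i $ k = (H x ** curvM \<Gamma> b x i k) $ k $ i" for i k
  proof -
    have "transpose (curvM \<Gamma> b x k i ** gram g b x) = - (curvM conj b x k i ** gram g b x)"
      by (simp add: curvature_conj[OF x] matrix_distribs gram_sym[OF x])
    then have "gram g b x ** transpose (curvM \<Gamma> b x k i) = - (curvM conj b x k i ** gram g b x)"
      by (simp add: matrix_transpose_mul gram_sym[OF x])
    then have "H x ** (gram g b x ** transpose (curvM \<Gamma> b x k i)) ** H x =
        H x ** (- (curvM conj b x k i ** gram g b x)) ** H x"
      by simp
    then have "transpose (curvM \<Gamma> b x k i) ** H x = - (H x ** curvM conj b x k i ** (gram g b x ** H x))"
      by (simp add: matrix_mul_assoc gram_H(2)[OF x] matrix_uminus_left matrix_uminus_right)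
    then have "H x ** curvM conj b x k i = transpose (H x ** curvM \<Gamma> b x i k)"
      by (simp add: gram_H[OF x] matrix_transpose_mul H_sym[OF x] curvature_antisym[of \<Gamma> b x i k]
          transpose_uminus matrix_uminus_left)
    then show ?thesis by (simp add: transpose_def)
  qed
  then show ?thesis unfolding scal_eq_sum by (subst sum.swap) simp
qed

end

section \<open>The two-form \<omega> on a statistical chart\<close>

locale statistical_chart_form = statistical_chart b V \<Gamma> g
  for b :: "('m, real^'n::finite) chart" and V \<Gamma> g +
  fixes \<omega> :: "('m, 'n) tensor2" and \<alpha> :: real
  assumes smooth_\<omega>: "smoothM b V (gram \<omega> b)"
    and \<omega>_skew: "x \<in> V \<Longrightarrow> \<omega> b x i j = - \<omega> b x j i"
    and \<omega>_closed: "x \<in> V \<Longrightarrow> cov2 \<Gamma> \<omega> b x i j k + cov2 \<Gamma> \<omega> b x j k i + cov2 \<Gamma> \<omega> b x k i j = 0"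
    and \<alpha>: "\<alpha> \<noteq> 0"
    and \<omega>_square: "x \<in> V \<Longrightarrow> gram \<omega> b x ** H x ** gram \<omega> b x = \<alpha> *\<^sub>R gram g b x"
begin

lemma gram_\<omega>_skew: "x \<in> V \<Longrightarrow> transpose (gram \<omega> b x) = - gram \<omega> b x"
  unfolding gram_def transpose_def vec_eq_iff by (simp, subst \<omega>_skew) auto

lemma covM_\<omega>_skew:
  assumes x: "x \<in> V"
  shows "transpose (covM \<Gamma> \<omega> b x i) = - covM \<Gamma> \<omega> b x i"
proof -
  have "transpose (pdM b (gram \<omega> b) i x) = pdM b (\<lambda>x. (-1) *\<^sub>R gram \<omega> b x) i x"
    unfolding pdM_transpose[OF region x, symmetric]
    by (rule pdM_cong[OF region x]) (simp add: gram_\<omega>_skew)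
  also have "\<dots> = - pdM b (gram \<omega> b) i x"
    by (subst pdM_scaleR[OF region x smooth_in_const smooth_\<omega>]) simp
  finally show ?thesis
    by (simp add: covM_eq matrix_distribs gram_\<omega>_skew[OF x])
qed

text \<open>This is \<open>\<omega>_square\<close> differentiated covariantly. The inverse metric
  accounts for the term with the minus sign, and the connection terms on the two sides agree by
  \<open>\<omega>_square\<close> itself.\<close>

lemma covM_square:
  assumes x: "x \<in> V"
  shows "covM \<Gamma> \<omega> b x i ** H x ** gram \<omega> b x + gram \<omega> b x ** H x ** covM \<Gamma> \<omega> b x i
    - gram \<omega> b x ** H x ** covM \<Gamma> g b x i ** H x ** gram \<omega> b x = \<alpha> *\<^sub>R covM \<Gamma> g b x i"
proof -
  let ?W = "gram \<omega> b x" and ?g = "gram g b x" and ?G = "connM \<Gamma> b x i"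
  have "pdM b (\<lambda>x. gram \<omega> b x ** H x ** gram \<omega> b x) i x = pdM b (\<lambda>x. \<alpha> *\<^sub>R gram g b x) i x"
    by (rule pdM_cong[OF region x]) (rule \<omega>_square)
  then have d: "pdM b (gram \<omega> b) i x ** H x ** ?W - ?W ** H x ** pdM b (gram g b) i x ** H x ** ?W
      + ?W ** H x ** pdM b (gram \<omega> b) i x = \<alpha> *\<^sub>R pdM b (gram g b) i x"
    by (simp add: pdM_mult[OF region x] smoothM_mult[OF region] smooth_\<omega> smooth_H
        pdM_scaleR[OF region x smooth_in_const smooth_g] pdM_matrix_inv[OF region x smooth_g g_inv]
        matrix_distribs matrix_mul_assoc pd_const)
  have [simp]: "X ** ?g ** H x = X" "X ** H x ** ?g = X" for X
    using gram_H[OF x] by (simp_all flip: matrix_mul_assoc)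
  have [simp]: "X ** ?W ** H x ** ?W = \<alpha> *\<^sub>R (X ** ?g)" for X
    using arg_cong[OF \<omega>_square[OF x], of "\<lambda>Y. X ** Y"] by (simp add: matrix_mul_assoc matrix_scaleR_right)
  show ?thesis
    unfolding covM_eq using d
    by (simp add: matrix_distribs matrix_mul_assoc \<omega>_square[OF x] algebra_simps)
qed

lemma divergence:
  assumes x: "x \<in> V"
  shows "(\<Sum>k\<in>UNIV. (H x ** covM \<Gamma> \<omega> b x k) $ k $ p) = 0"
    and "(\<Sum>a\<in>UNIV. (covM \<Gamma> \<omega> b x a ** H x - gram \<omega> b x ** H x ** covM \<Gamma> g b x a ** H x) $ i $ a) = 0"
proof -
  note * = gram_H(1)[OF x] gram_sym[OF x] gram_\<omega>_skew[OF x] covM_\<omega>_skew[OF x] covM_sym[OF x] _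
    cov_trace[OF x] \<omega>_square[OF x] \<alpha> _ covM_square[OF x]
  have s: "covM \<Gamma> g b x i $ j $ k = covM \<Gamma> g b x j $ i $ k" for i j k
    by (simp add: covM_def cov_sym[OF x, of i])
  have c: "covM \<Gamma> \<omega> b x i $ j $ k + covM \<Gamma> \<omega> b x j $ k $ i + covM \<Gamma> \<omega> b x k $ i $ j = 0" for i j k
    by (simp add: covM_def \<omega>_closed[OF x])
  show "(\<Sum>k\<in>UNIV. (H x ** covM \<Gamma> \<omega> b x k) $ k $ p) = 0"
    by (rule divergence_free[OF *]) (rule s, rule c)
  show "(\<Sum>a\<in>UNIV. (covM \<Gamma> \<omega> b x a ** H x - gram \<omega> b x ** H x ** covM \<Gamma> g b x a ** H x) $ i $ a) = 0"
    by (rule divergence_endomorphism[OF *]) (rule s, rule c)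
qed

abbreviation "e x \<equiv> gram \<omega> b x ** H x"

lemma trace_e: "x \<in> V \<Longrightarrow> trace (e x) = 0"
proof -
  assume x: "x \<in> V"
  have "trace (e x) = trace (transpose (e x))" by (simp add: trace_transpose)
  also have "\<dots> = - trace (e x)"
    by (simp add: matrix_transpose_mul gram_\<omega>_skew[OF x] H_sym[OF x] matrix_uminus_right trace_uminus
        trace_mul_sym[of "H x"])
  finally show ?thesis by simp
qed

lemma e_square: "x \<in> V \<Longrightarrow> e x ** e x = \<alpha> *\<^sub>R mat 1"
  using \<omega>_square[of x] gram_H[of x] by (simp add: matrix_mul_assoc matrix_scaleR_left)

text \<open>The bracketed matrix is the covariant derivative of the endomorphism \<open>e\<close>,
  written in the form in which the Ricci components of the total space will need it.\<close>

lemma divergence_e: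
  assumes x: "x \<in> V"
  shows "(\<Sum>a\<in>UNIV. (pdM b e a x + e x ** connM \<Gamma> b x a - connM \<Gamma> b x a ** e x) $ i $ a) = 0"
proof -
  have [simp]: "X ** gram g b x ** H x = X" "X ** H x ** gram g b x = X" for X
    using gram_H[OF x] by (simp_all flip: matrix_mul_assoc)
  have "pdM b e a x + e x ** connM \<Gamma> b x a - connM \<Gamma> b x a ** e x =
      covM \<Gamma> \<omega> b x a ** H x - gram \<omega> b x ** H x ** covM \<Gamma> g b x a ** H x" for a
    unfolding covM_eq pdM_mult[OF region x smooth_\<omega> smooth_H]
    by (simp add: pdM_matrix_inv[OF region x smooth_g g_inv] matrix_distribs matrix_mul_assoc)
  then show ?thesis using divergence(2)[OF x] by simp
qed

end

section \<open>Adapted coframes on the total space\<close>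

lemma sum_option: "(\<Sum>x\<in>UNIV. f x) = f None + (\<Sum>i\<in>UNIV. f (Some i))"
  for f :: "'a::finite option \<Rightarrow> 'b::comm_monoid_add"
  by (simp add: UNIV_option_conv sum.reindex)

text \<open>The index \<open>None\<close> is the fibre direction. \<open>G\<close> and pulled-back
  tensors have this shape in an adapted coframe.\<close>

definition block :: "real \<Rightarrow> real^'n::finite^'n \<Rightarrow> real^('n option)^('n option)" where
  "block u X = (\<chi> A B. case A of
     None \<Rightarrow> (case B of None \<Rightarrow> u | Some j \<Rightarrow> 0)
   | Some i \<Rightarrow> (case B of None \<Rightarrow> 0 | Some j \<Rightarrow> X $ i $ j))"

lemma block_simps [simp]:
  "block u X $ None $ None = u" "block u X $ None $ Some j = 0"
  "block u X $ Some i $ None = 0" "block u X $ Some i $ Some j = X $ i $ j"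
  by (simp_all add: block_def)

lemma matrix_option_eqI:
  fixes A B :: "real^('n::finite option)^('n option)"
  assumes "A $ None $ None = B $ None $ None" "\<And>j. A $ None $ Some j = B $ None $ Some j"
    and "\<And>i. A $ Some i $ None = B $ Some i $ None" "\<And>i j. A $ Some i $ Some j = B $ Some i $ Some j"
  shows "A = B"
proof (simp only: vec_eq_iff, intro allI)
  fix x y show "A $ x $ y = B $ x $ y" using assms by (cases x; cases y) auto
qed

lemma block_mult: "block u X ** block v Y = block (u * v) (X ** Y)"
  by (rule matrix_option_eqI) (simp_all add: matrix_mult_component sum_option)

lemma block_inverse:
  assumes "u \<noteq> 0" "invertible X"
  shows "invertible (block u X)" "matrix_inv (block u X) = block (1 / u) (matrix_inv X)"
proof -
  have "block u X ** block (1 / u) (matrix_inv X) = mat 1"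
    by (rule matrix_option_eqI) (simp_all add: assms block_mult matrix_inv_right, simp_all add: mat_def)
  then show "invertible (block u X)" "matrix_inv (block u X) = block (1 / u) (matrix_inv X)"
    by (rule matrix_inv_unique)+
qed

definition coframe :: "('m, real^'n::finite) chart \<Rightarrow> ('p \<Rightarrow> 'm) \<Rightarrow> ('p, 'n option) tensor1 \<Rightarrow>
    ('p, real^('n option)) chart \<Rightarrow> 'p \<Rightarrow> real^('n option)^('n option)" where
  "coframe b \<rho> \<beta> c q = (\<chi> I A. case A of
     None \<Rightarrow> \<beta> c q I | Some i \<Rightarrow> pd c (\<lambda>r. coords b (\<rho> r) $ i) I q)"

lemma coframe_simps [simp]:
  "coframe b \<rho> \<beta> c q $ I $ None = \<beta> c q I"
  "coframe b \<rho> \<beta> c q $ I $ Some i = pd c (\<lambda>r. coords b (\<rho> r) $ i) I q"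
  by (simp_all add: coframe_def)

text \<open>
  The coefficients, with respect to an adapted coframe, of the cone connection
  (\<open>\<kappa> = s = 1\<close>, \<open>\<mu> = 0\<close>) and of the connections derived from it
  (\<open>\<kappa> = s (1 + t)\<close>, \<open>\<mu> = (1 + t) / 2\<close>).
\<close>

definition fibre_coef :: "real \<Rightarrow> real \<Rightarrow> ('m, 'n::finite) tensor2 \<Rightarrow> ('m, 'n) tensor2 \<Rightarrow>
    ('m, real^'n) chart \<Rightarrow> 'm \<Rightarrow> real^'n^'n" where
  "fibre_coef \<kappa> \<mu> g \<omega> b x = \<kappa> *\<^sub>R mat 1 - \<mu> *\<^sub>R (gram \<omega> b x ** matrix_inv (gram g b x))"

definition frame_coef :: "real \<Rightarrow> real \<Rightarrow> real \<Rightarrow> ('m, 'n::finite) tensor3 \<Rightarrow> ('m, 'n) tensor2 \<Rightarrow>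
    ('m, 'n) tensor2 \<Rightarrow> ('m, real^'n) chart \<Rightarrow> 'n option \<Rightarrow> 'm \<Rightarrow> real^('n option)^('n option)" where
  "frame_coef \<kappa> \<mu> s \<Gamma> g \<omega> b B x = (case B of
     None \<Rightarrow> block \<kappa> (fibre_coef \<kappa> \<mu> g \<omega> b x)
   | Some i \<Rightarrow> (\<chi> C A. case C of
       None \<Rightarrow> (case A of None \<Rightarrow> 0 | Some k \<Rightarrow> fibre_coef \<kappa> \<mu> g \<omega> b x $ i $ k)
     | Some j \<Rightarrow> (case A of None \<Rightarrow> s * g b x i j - \<omega> b x i j / 2 | Some k \<Rightarrow> \<Gamma> b x i j k)))"

lemma frame_coef_simps [simp]:
  "frame_coef \<kappa> \<mu> s \<Gamma> g \<omega> b None x = block \<kappa> (fibre_coef \<kappa> \<mu> g \<omega> b x)"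
  "frame_coef \<kappa> \<mu> s \<Gamma> g \<omega> b (Some i) x $ None $ None = 0"
  "frame_coef \<kappa> \<mu> s \<Gamma> g \<omega> b (Some i) x $ None $ Some k = fibre_coef \<kappa> \<mu> g \<omega> b x $ i $ k"
  "frame_coef \<kappa> \<mu> s \<Gamma> g \<omega> b (Some i) x $ Some j $ None = s * g b x i j - \<omega> b x i j / 2"
  "frame_coef \<kappa> \<mu> s \<Gamma> g \<omega> b (Some i) x $ Some j $ Some k = \<Gamma> b x i j k"
  by (simp_all add: frame_coef_def)

locale bundle_chart =
  fixes b :: "('m, real^'n::finite) chart" and V :: "'m set"
    and c :: "('p, real^('n option)) chart" and U :: "'p set"
    and \<rho> :: "'p \<Rightarrow> 'm" and \<beta> :: "('p, 'n option) tensor1"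
  assumes region_b: "chart_region b V" and region_c: "chart_region c U"
    and \<rho>_in: "q \<in> U \<Longrightarrow> \<rho> q \<in> V"
    and smooth_\<rho>: "smooth_in c U (\<lambda>q. coords b (\<rho> q) $ i)"
    and smooth_\<beta>: "smooth_in c U (\<lambda>q. \<beta> c q I)"
    and invertible_coframe: "q \<in> U \<Longrightarrow> invertible (coframe b \<rho> \<beta> c q)"
begin

abbreviation "M \<equiv> coframe b \<rho> \<beta> c"

lemma smooth_M: "smoothM c U M"
  unfolding smoothM_def
proof (intro allI)
  fix I A show "smooth_in c U (\<lambda>q. M q $ I $ A)"
    using smooth_\<beta>[of I] smooth_in_pd[OF region_c smooth_\<rho>] by (cases A) auto
qed

lemma smoothM_pullback: "smoothM b V F \<Longrightarrow> smoothM c U (\<lambda>q. F (\<rho> q))"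
  unfolding smoothM_def using \<rho>_in
  by (auto intro!: smooth_in_compose[OF region_c region_b _ smooth_\<rho>, where f = "\<lambda>x. F x $ _ $ _"])

text \<open>Pulled-back functions are constant along the fibres, so the vertical derivative is 0 and
  the horizontal ones are partial derivatives on the base.\<close>

lemma pdM_pullback: "smoothM b V F \<Longrightarrow> q \<in> U \<Longrightarrow> pdM c (\<lambda>q. F (\<rho> q)) I q =
    (\<Sum>D\<in>UNIV. M q $ I $ D *\<^sub>R (case D of None \<Rightarrow> 0 | Some i \<Rightarrow> pdM b F i (\<rho> q)))"
proof -
  assume F: "smoothM b V F" and q: "q \<in> U"
  have "\<rho> ` U \<subseteq> V" using \<rho>_in by auto
  from pd_compose[OF region_c region_b this smooth_\<rho> smoothMD[OF F] q]
  show ?thesis by (simp add: sum_option pdM_def vec_eq_iff)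
qed

end

section \<open>Tensors of rank three in a frame\<close>

text \<open>The frame components are \<open>Y A $ B $ C\<close>. The first slot stays outside the
  matrix to match the direction index of \<open>covM\<close>; the lemmas below move between the two
  viewpoints when indices are exchanged or contracted.\<close>

definition frame_tensor :: "real^'k::finite^'k \<Rightarrow> ('k \<Rightarrow> real^'k^'k) \<Rightarrow> 'k \<Rightarrow> 'k \<Rightarrow> 'k \<Rightarrow> real" where
  "frame_tensor M Y I J K = (\<Sum>A\<in>UNIV. \<Sum>B\<in>UNIV. \<Sum>C\<in>UNIV. M $ I $ A * M $ J $ B * M $ K $ C * Y A $ B $ C)"

lemma frame_tensor_matrix:
  "(M ** (\<Sum>A\<in>UNIV. M $ I $ A *\<^sub>R Y A) ** transpose M) $ J $ K = frame_tensor M Y I J K"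
proof -
  have "(M ** Y A ** transpose M) $ J $ K = (\<Sum>B\<in>UNIV. \<Sum>C\<in>UNIV. M $ J $ B * M $ K $ C * Y A $ B $ C)" for A
    by (simp add: matrix_mult_component transpose_def sum_distrib_left sum_distrib_right)
      (subst sum.swap, simp add: mult_ac)
  then show ?thesis
    by (simp add: frame_tensor_def matrix_distribs sum_distrib_left mult.assoc)
qed

lemma frame_tensor_swap: "frame_tensor M Y J I K = frame_tensor M (\<lambda>A. \<chi> B C. Y B $ A $ C) I J K"
  unfolding frame_tensor_def by (subst sum.swap) (simp add: mult_ac)

lemma frame_tensor_rotate: "frame_tensor M Y I J K = frame_tensor M (\<lambda>C. \<chi> A B. Y A $ B $ C) K I J"
proof -
  have "frame_tensor M Y I J K = (\<Sum>A\<in>UNIV. \<Sum>C\<in>UNIV. \<Sum>B\<in>UNIV. M $ I $ A * M $ J $ B * M $ K $ C * Y A $ B $ C)"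
    unfolding frame_tensor_def by (rule sum.cong[OF refl]) (rule sum.swap)
  also have "\<dots> = (\<Sum>C\<in>UNIV. \<Sum>A\<in>UNIV. \<Sum>B\<in>UNIV. M $ I $ A * M $ J $ B * M $ K $ C * Y A $ B $ C)"
    by (rule sum.swap)
  finally show ?thesis by (simp add: frame_tensor_def mult_ac)
qed

lemma frame_tensor_add: "frame_tensor M Y I J K + frame_tensor M Z I J K = frame_tensor M (\<lambda>A. Y A + Z A) I J K"
  by (simp add: frame_tensor_def distrib_left sum.distrib)

text \<open>The two matrix slots are freed by multiplying with the inverse coframe on both sides,
  the direction slot by summing against a row of it.\<close>

lemma frame_tensor_eq_0:
  assumes "N ** M = mat 1" "\<And>I J K. frame_tensor M Y I J K = 0"
  shows "Y A = 0"
proof -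
  have MN: "M ** N = mat 1" using assms(1) matrix_left_right_inverse by blast
  have tr: "transpose M ** transpose N = mat 1" using assms(1) by (simp add: transpose_mat flip: matrix_transpose_mul)
  have "M ** (\<Sum>A\<in>UNIV. M $ I $ A *\<^sub>R Y A) ** transpose M = 0" for I
    by (simp add: vec_eq_iff frame_tensor_matrix assms(2))
  then have "N ** (M ** (\<Sum>A\<in>UNIV. M $ I $ A *\<^sub>R Y A) ** transpose M) ** transpose N = 0" for I
    by simp
  moreover have "N ** (M ** X ** transpose M) ** transpose N = (N ** M) ** X ** (transpose M ** transpose N)" for X
    by (simp add: matrix_mul_assoc)
  ultimately have "(\<Sum>A\<in>UNIV. M $ I $ A *\<^sub>R Y A) = 0" for I
    by (simp add: assms(1) tr)
  then have "(\<Sum>I\<in>UNIV. N $ A $ I *\<^sub>R (\<Sum>B\<in>UNIV. M $ I $ B *\<^sub>R Y B)) = 0" by simp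
  also have "(\<Sum>I\<in>UNIV. N $ A $ I *\<^sub>R (\<Sum>B\<in>UNIV. M $ I $ B *\<^sub>R Y B)) = (\<Sum>B\<in>UNIV. (N ** M) $ A $ B *\<^sub>R Y B)"
    by (simp add: scaleR_sum_right matrix_mult_component scaleR_sum_left) (rule sum.swap)
  also have "\<dots> = Y A" by (simp add: assms(1) mat_def if_distrib if_distribR cong: if_cong)
  finally show ?thesis .
qed

lemma sum_matrix_trace: "(\<Sum>J\<in>UNIV. \<Sum>K\<in>UNIV. H $ J $ K * X $ J $ K) = trace (H ** transpose X)"
  for H X :: "real^'k::finite^'k"
  by (simp add: trace_def matrix_mult_component transpose_def)

lemma frame_trace:
  fixes M N S X :: "real^'k::finite^'k"
  assumes "N ** M = mat 1"
  shows "(\<Sum>J\<in>UNIV. \<Sum>K\<in>UNIV. (transpose N ** S ** N) $ J $ K * (M ** X ** transpose M) $ J $ K) =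
    (\<Sum>A\<in>UNIV. \<Sum>B\<in>UNIV. S $ A $ B * X $ A $ B)"
proof -
  have tr: "transpose M ** transpose N = mat 1" using assms(1) by (simp add: transpose_mat flip: matrix_transpose_mul)
  have "trace (transpose N ** S ** N ** (M ** transpose X ** transpose M)) =
      trace (S ** (N ** M) ** transpose X ** (transpose M ** transpose N))"
    using trace_mul_sym[of "transpose N" "S ** N ** (M ** transpose X ** transpose M)"]
    by (simp add: matrix_mul_assoc)
  then show ?thesis
    by (simp add: sum_matrix_trace assms tr matrix_transpose_mul matrix_mul_assoc)
qed

lemma frame_tensor_contract23:
  assumes "N ** M = mat 1"
  shows "(\<Sum>J\<in>UNIV. \<Sum>K\<in>UNIV. (transpose N ** S ** N) $ J $ K * frame_tensor M Y I J K) =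
    (\<Sum>A\<in>UNIV. M $ I $ A * (\<Sum>B\<in>UNIV. \<Sum>C\<in>UNIV. S $ B $ C * Y A $ B $ C))"
proof -
  have "(\<Sum>J\<in>UNIV. \<Sum>K\<in>UNIV. (transpose N ** S ** N) $ J $ K * frame_tensor M Y I J K) =
      (\<Sum>B\<in>UNIV. \<Sum>C\<in>UNIV. S $ B $ C * (\<Sum>A\<in>UNIV. M $ I $ A *\<^sub>R Y A) $ B $ C)"
    unfolding frame_tensor_matrix[symmetric] by (rule frame_trace[OF assms])
  also have "\<dots> = trace (S ** transpose (\<Sum>A\<in>UNIV. M $ I $ A *\<^sub>R Y A))"
    by (rule sum_matrix_trace)
  also have "\<dots> = (\<Sum>A\<in>UNIV. M $ I $ A * trace (S ** transpose (Y A)))"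
  proof -
    have "trace (\<Sum>A\<in>UNIV. X A) = (\<Sum>A\<in>UNIV. trace (X A :: real^'a^'a))" for X :: "'a \<Rightarrow> real^'a^'a"
      by (simp add: trace_def) (rule sum.swap)
    then show ?thesis by (simp add: matrix_distribs trace_scaleR)
  qed
  finally show ?thesis by (simp add: sum_matrix_trace)
qed

lemma frame_tensor_contract12:
  assumes "N ** M = mat 1"
  shows "(\<Sum>I\<in>UNIV. \<Sum>J\<in>UNIV. (transpose N ** S ** N) $ I $ J * frame_tensor M Y I J K) =
    (\<Sum>C\<in>UNIV. M $ K $ C * (\<Sum>A\<in>UNIV. \<Sum>B\<in>UNIV. S $ A $ B * Y A $ B $ C))"
  by (simp add: frame_tensor_rotate[of M Y _ _ K] frame_tensor_contract23[OF assms])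

section \<open>Connections whose frame coefficients come from the base\<close>

text \<open>The base connection and the three real parameters are left free so that the cone
  connection, every \<open>D s\<close> and the conjugate of \<open>D s\<close> are
  instances.\<close>

locale framed_connection = bundle_chart b V c U \<rho> \<beta>
  for b :: "('m, real^'n::finite) chart" and V and c :: "('p, real^('n option)) chart" and U \<rho> \<beta> +
  fixes \<Gamma> :: "('m, 'n) tensor3" and g \<omega> :: "('m, 'n) tensor2"
    and D :: "('p, 'n option) tensor3" and \<kappa> \<mu> s :: real
  assumes smooth_\<Gamma>: "smoothM b V (\<lambda>x. connM \<Gamma> b x i)" and smooth_g: "smoothM b V (gram g b)"
    and smooth_\<omega>: "smoothM b V (gram \<omega> b)"
    and torsion_free: "x \<in> V \<Longrightarrow> \<Gamma> b x i j k = \<Gamma> b x j i k"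
    and g_sym: "x \<in> V \<Longrightarrow> g b x i j = g b x j i" and g_inv: "x \<in> V \<Longrightarrow> invertible (gram g b x)"
    and \<omega>_skew: "x \<in> V \<Longrightarrow> \<omega> b x i j = - \<omega> b x j i"
    and d\<beta>: "q \<in> U \<Longrightarrow> ext_deriv \<beta> c q I J = pullback2 b \<rho> \<omega> c q I J"
    and framed_D: "q \<in> U \<Longrightarrow> connM D c q I ** M q =
      pdM c M I q + M q ** (\<Sum>B\<in>UNIV. M q $ I $ B *\<^sub>R frame_coef \<kappa> \<mu> s \<Gamma> g \<omega> b B (\<rho> q))"
begin

abbreviation "F \<equiv> frame_coef \<kappa> \<mu> s \<Gamma> g \<omega> b"
abbreviation "T \<equiv> fibre_coef \<kappa> \<mu> g \<omega> b"
abbreviation "endo x \<equiv> gram \<omega> b x ** matrix_inv (gram g b x)"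

lemma smooth_endo: "smoothM b V endo"
  by (intro smoothM_mult[OF region_b] smooth_\<omega> smoothM_matrix_inv[OF region_b smooth_g] g_inv)

lemma T_entry: "T x $ i $ j = \<kappa> * (if i = j then 1 else 0) - \<mu> * endo x $ i $ j"
  by (simp add: fibre_coef_def mat_def)

lemma smooth_T: "smoothM b V T"
  unfolding smoothM_def T_entry
  by (intro allI smooth_in_diff[OF region_b] smooth_in_mult[OF region_b] smooth_in_const smoothMD[OF smooth_endo])

lemma pd_T: "x \<in> V \<Longrightarrow> pd b (\<lambda>x. T x $ i $ j) k x = - \<mu> * pdM b endo k x $ i $ j"
  unfolding T_entry
  by (simp add: pd_diff[OF region_b] smooth_in_const smooth_in_mult[OF region_b] smoothMD[OF smooth_endo]
      pd_cmult[OF region_b] pd_component pd_const)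

lemma smooth_F: "smoothM b V (F B)"
  unfolding smoothM_def
proof (intro allI)
  fix C A
  have "smooth_in b V (\<lambda>x. s * g b x i j - \<omega> b x i j / 2)" "smooth_in b V (\<lambda>x. \<Gamma> b x i j k)" for i j k
    using smooth_g smooth_\<omega> smoothMD[OF smooth_\<Gamma>, of i j k]
    by (auto simp: smoothM_def gram_def connM_def
        intro!: smooth_in_diff[OF region_b] smooth_in_mult[OF region_b] smooth_in_divide[OF region_b] smooth_in_const)
  then show "smooth_in b V (\<lambda>x. F B x $ C $ A)"
    using smoothMD[OF smooth_T] by (cases B; cases C; cases A) (auto simp: smooth_in_const)
qed

sublocale moving_frame c U M D "\<lambda>B q. F B (\<rho> q)"
    "\<lambda>D B q. case D of None \<Rightarrow> 0 | Some i \<Rightarrow> pdM b (F B) i (\<rho> q)"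
  by unfold_locales (use region_c smooth_M invertible_coframe smoothM_pullback[OF smooth_F]
      pdM_pullback[OF smooth_F] framed_D in auto)

lemma pullback_gram: "gram (pullback2 b \<rho> S) c q = M q ** block 0 (gram S b (\<rho> q)) ** transpose (M q)"
proof (simp only: vec_eq_iff, intro allI)
  fix I J
  have "(M q ** block 0 (gram S b (\<rho> q)) ** transpose (M q)) $ I $ J =
      (\<Sum>j\<in>UNIV. \<Sum>i\<in>UNIV. M q $ I $ Some i * S b (\<rho> q) i j * M q $ J $ Some j)"
    by (simp add: matrix_mult_component sum_option transpose_def sum_distrib_right gram_def)
  also have "\<dots> = gram (pullback2 b \<rho> S) c q $ I $ J"
    by (subst sum.swap) (simp add: gram_def pullback2_def mult_ac)
  finally show "gram (pullback2 b \<rho> S) c q $ I $ J = (M q ** block 0 (gram S b (\<rho> q)) ** transpose (M q)) $ I $ J"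
    by simp
qed

lemma gram_ext_deriv: "q \<in> U \<Longrightarrow> gram (ext_deriv \<beta>) c q = M q ** block 0 (gram \<omega> b (\<rho> q)) ** transpose (M q)"
  using d\<beta> by (simp add: pullback_gram[symmetric]) (simp add: gram_def)

text \<open>The coefficients are symmetric except for the vertical output, whose skew part comes
  from \<omega>. This is exactly compensated by d\<beta>, whereas the remaining members of the
  coframe are closed.\<close>

lemma D_torsion_free:
  assumes q: "q \<in> U"
  shows "D c q I J K = D c q J I K"
proof -
  have eq: "(connM D c q I ** M q) $ J $ A = (connM D c q J ** M q) $ I $ A" for A
  proof -
    have x: "\<rho> q \<in> V" using q by (rule \<rho>_in)
    have C: "(M q ** (\<Sum>B\<in>UNIV. M q $ I $ B *\<^sub>R F B (\<rho> q))) $ J $ A =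
        (\<Sum>B\<in>UNIV. \<Sum>C\<in>UNIV. M q $ I $ B * M q $ J $ C * F B (\<rho> q) $ C $ A)" for I J
      by (simp add: matrix_mult_component sum_distrib_left mult_ac) (rule sum.swap)
    have diff: "(\<Sum>B\<in>UNIV. \<Sum>C\<in>UNIV. M q $ I $ B * M q $ J $ C * F B (\<rho> q) $ C $ A)
        - (\<Sum>B\<in>UNIV. \<Sum>C\<in>UNIV. M q $ J $ B * M q $ I $ C * F B (\<rho> q) $ C $ A)
        = (\<Sum>B\<in>UNIV. \<Sum>C\<in>UNIV. M q $ I $ B * M q $ J $ C * (F B (\<rho> q) $ C $ A - F C (\<rho> q) $ B $ A))"
      by (subst (2) sum.swap) (simp add: right_diff_distrib sum_subtractf mult.commute mult.left_commute)
    show ?thesis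
    proof (cases A)
      case None
      \<comment> \<open>\<open>the\<close> only strips \<open>Some\<close>; in the cases where an
        index is \<open>None\<close> the two instantiated facts are irrelevant.\<close>
      have sk: "F B (\<rho> q) $ C $ None - F C (\<rho> q) $ B $ None = - block 0 (gram \<omega> b (\<rho> q)) $ B $ C" for B C
        using g_sym[OF x, of "the C" "the B"] \<omega>_skew[OF x, of "the C" "the B"]
        by (cases B; cases C) (simp_all add: gram_def)
      have "(\<Sum>B\<in>UNIV. \<Sum>C\<in>UNIV. M q $ I $ B * M q $ J $ C * block 0 (gram \<omega> b (\<rho> q)) $ B $ C)
          = (M q ** block 0 (gram \<omega> b (\<rho> q)) ** transpose (M q)) $ I $ J"
        by (simp add: matrix_mult_component transpose_def sum_distrib_right)
          (subst sum.swap, simp add: mult_ac)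
      also have "\<dots> = ext_deriv \<beta> c q I J"
        by (simp flip: gram_ext_deriv[OF q]) (simp add: gram_def)
      finally show ?thesis
        unfolding framed_D[OF q] using diff None C[of I J] C[of J I]
        by (simp add: sk sum_negf ext_deriv_def pdM_def del: frame_coef_simps)
    next
      case (Some k)
      have sk: "F B (\<rho> q) $ C $ Some k - F C (\<rho> q) $ B $ Some k = 0" for B C
        using torsion_free[OF x, of "the C" "the B" k]
        by (cases B; cases C) auto
      have "pdM c M I q $ J $ Some k = pdM c M J q $ I $ Some k"
        using pd_commute[OF region_c q smooth_\<rho>[of k], of J I] by (simp add: pdM_def)
      then show ?thesis
        unfolding framed_D[OF q] using diff Some C[of I J] C[of J I]
        by (simp add: sk del: frame_coef_simps)
    qed
  qed
  have "connM D c q I $ J = connM D c q J $ I"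
  proof -
    have "(\<chi> A. (connM D c q I ** M q) $ J $ A) = (\<chi> A. (connM D c q J ** M q) $ I $ A)"
      by (simp add: eq)
    then have "(connM D c q I $ J) v* M q = (connM D c q J $ I) v* M q"
      by (simp add: vector_matrix_mult_def matrix_mult_component vec_eq_iff mult.commute)
    then have "((connM D c q I $ J) v* M q) v* matrix_inv (M q) = ((connM D c q J $ I) v* M q) v* matrix_inv (M q)"
      by simp
    then show ?thesis
      by (simp add: vector_matrix_mul_assoc matrix_inv_right[OF invertible_coframe[OF q]])
  qed
  then show ?thesis by (simp add: connM_def vec_eq_iff)
qed

lemma covM_block:
  assumes q: "q \<in> U" and S: "\<And>q. q \<in> U \<Longrightarrow> gram S' c q = M q ** block u (S (\<rho> q)) ** transpose (M q)"
    and smooth_S: "smoothM b V S"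
  shows "cov2 D S' c q I J K = frame_tensor (M q) (\<lambda>A. (case A of None \<Rightarrow> 0 | Some i \<Rightarrow> block 0 (pdM b S i (\<rho> q)))
    - F A (\<rho> q) ** block u (S (\<rho> q)) - block u (S (\<rho> q)) ** transpose (F A (\<rho> q))) I J K"
proof -
  have s: "smoothM b V (\<lambda>x. block u (S x))"
    unfolding smoothM_def
  proof (intro allI)
    fix A B show "smooth_in b V (\<lambda>x. block u (S x) $ A $ B)"
      using smoothMD[OF smooth_S] by (cases A; cases B) (auto intro: smooth_in_const)
  qed
  have p: "pdM b (\<lambda>x. block u (S x)) i x = block 0 (pdM b S i x)" for i x
    by (rule matrix_option_eqI) (simp_all add: pdM_def pd_const)
  have "covM D S' c q I = M q ** (\<Sum>A\<in>UNIV. M q $ I $ A *\<^sub>R ((case A of None \<Rightarrow> 0 | Some i \<Rightarrow> block 0 (pdM b S i (\<rho> q)))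
    - F A (\<rho> q) ** block u (S (\<rho> q)) - block u (S (\<rho> q)) ** transpose (F A (\<rho> q)))) ** transpose (M q)"
    by (rule covM_frame[OF q S smoothM_pullback[OF s]])
      (simp_all add: pdM_pullback[OF s q] p cong: option.case_cong)
  from arg_cong[OF this, of "\<lambda>X. X $ J $ K"] show ?thesis
    by (simp add: frame_tensor_matrix) (simp add: covM_def)
qed

end

lemma gram_component: "gram g b x $ i $ j = g b x i j"
  by (simp add: gram_def)

lemma connM_component: "connM \<Gamma> b x i $ j $ k = \<Gamma> b x i j k"
  by (simp add: connM_def)

lemma sym2_double: "2 * sym2 T i j = T i j + T j i"
  by (simp add: sym2_def)

text \<open>In the cyclic sum the connection terms cancel in pairs, by symmetry of the connection
  and skewness of T, so the cyclic sum computes an exterior derivative.\<close>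

lemma cov2_skew_cyclic:
  fixes D :: "('p, 'k::finite) tensor3"
  assumes "\<And>I J K. D c q I J K = D c q J I K" "\<And>I J. T c q I J = - T c q J I"
  shows "cov2 D T c q I J K + cov2 D T c q J K I + cov2 D T c q K I J =
    pd c (\<lambda>q. T c q J K) I q + pd c (\<lambda>q. T c q K I) J q + pd c (\<lambda>q. T c q I J) K q"
proof -
  have *: "(\<Sum>l\<in>UNIV. D c q A B l * T c q l C) + (\<Sum>l\<in>UNIV. D c q B A l * T c q C l) = 0" for A B C
    unfolding sum.distrib[symmetric]
  proof (rule sum.neutral, intro ballI)
    fix l show "D c q A B l * T c q l C + D c q B A l * T c q C l = 0"
      using assms(1)[of B A l] assms(2)[of l C] by simp
  qed
  show ?thesis
    using *[of I J K] *[of J K I] *[of K I J] by (simp add: cov2_def)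
qed

context framed_connection
begin

lemma ext_deriv_closed:
  assumes q: "q \<in> U"
  shows "pd c (\<lambda>q. ext_deriv \<beta> c q J K) I q + pd c (\<lambda>q. ext_deriv \<beta> c q K I) J q
    + pd c (\<lambda>q. ext_deriv \<beta> c q I J) K q = 0"
  using pd_commute[OF region_c q smooth_\<beta>[of K], of J I] pd_commute[OF region_c q smooth_\<beta>[of J], of K I]
    pd_commute[OF region_c q smooth_\<beta>[of I], of J K]
  by (simp add: ext_deriv_def pd_diff[OF region_c q] smooth_in_pd[OF region_c] smooth_\<beta>)

definition ext_deriv_frame :: "'p \<Rightarrow> 'n option \<Rightarrow> real^('n option)^('n option)" where
  "ext_deriv_frame q A = (case A of None \<Rightarrow> 0 | Some i \<Rightarrow> block 0 (pdM b (gram \<omega> b) i (\<rho> q)))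
    - F A (\<rho> q) ** block 0 (gram \<omega> b (\<rho> q)) - block 0 (gram \<omega> b (\<rho> q)) ** transpose (F A (\<rho> q))"

lemma cov2_ext_deriv: "q \<in> U \<Longrightarrow> cov2 D (ext_deriv \<beta>) c q I J K = frame_tensor (M q) (ext_deriv_frame q) I J K"
  unfolding ext_deriv_frame_def by (rule covM_block[OF _ gram_ext_deriv smooth_\<omega>])

lemma ext_deriv_frame_Some: "ext_deriv_frame q (Some i) $ Some j $ Some k = cov2 \<Gamma> \<omega> b (\<rho> q) i j k"
  by (simp add: ext_deriv_frame_def cov2_def pdM_def gram_def matrix_mult_component sum_option transpose_def mult.commute)

text \<open>On the base \<omega> is known only through its pullback d\<beta>. Upstairs d(d\<beta>) =
  0 is a cyclic identity for the covariant derivative of d\<beta>, and the horizontal frame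
  components of that derivative are those of \<nabla>\<omega>.\<close>

lemma closed:
  assumes q: "q \<in> U"
  shows "cov2 \<Gamma> \<omega> b (\<rho> q) i j k + cov2 \<Gamma> \<omega> b (\<rho> q) j k i + cov2 \<Gamma> \<omega> b (\<rho> q) k i j = 0"
proof -
  let ?R = "\<lambda>Y C. \<chi> A B. Y A $ B $ C"
  have 1: "frame_tensor (M q) (ext_deriv_frame q) J K I = frame_tensor (M q) (?R (ext_deriv_frame q)) I J K" for I J K
    by (rule frame_tensor_rotate)
  have 2: "frame_tensor (M q) (ext_deriv_frame q) K I J = frame_tensor (M q) (?R (?R (ext_deriv_frame q))) I J K" for I J K
    by (subst frame_tensor_rotate) (rule frame_tensor_rotate)
  have skew: "ext_deriv \<beta> c q I J = - ext_deriv \<beta> c q J I" for I J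
    by (simp add: ext_deriv_def)
  have "frame_tensor (M q) (\<lambda>A. ext_deriv_frame q A + ?R (ext_deriv_frame q) A + ?R (?R (ext_deriv_frame q)) A) I J K = 0" for I J K
    unfolding frame_tensor_add[symmetric] 1[symmetric] 2[symmetric] cov2_ext_deriv[OF q, symmetric]
    by (subst cov2_skew_cyclic[where D = D and T = "ext_deriv \<beta>", OF D_torsion_free[OF q] skew]) (rule ext_deriv_closed[OF q])
  from frame_tensor_eq_0[OF matrix_inv_left[OF invertible_coframe[OF q]] this, of "Some i"]
  have "(ext_deriv_frame q (Some i) + ?R (ext_deriv_frame q) (Some i) + ?R (?R (ext_deriv_frame q)) (Some i)) $ Some j $ Some k = 0"
    by simp
  then show ?thesis by (simp add: ext_deriv_frame_Some)
qed

end

section \<open>The metric G and its cubic form in a frame\<close>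

text \<open>The relations for \<kappa> and \<mu> make the mixed components of the derivative of
  \<open>G\<close> cancel: the g parts through \<open>\<kappa> = s * u\<close>, the \<omega> parts
  through \<open>\<mu> = u / 2\<close>.\<close>

locale framed_statistical = framed_connection b V c U \<rho> \<beta> \<Gamma> g \<omega> D \<kappa> \<mu> s + stat: statistical_chart b V \<Gamma> g
  for b :: "('m, real^'n::finite) chart" and V and c :: "('p, real^('n option)) chart" and U \<rho> \<beta> \<Gamma> g \<omega> D \<kappa> \<mu> s +
  fixes G :: "('p, 'n option) tensor2" and u :: real
  assumes u: "u \<noteq> 0" and \<kappa>: "\<kappa> = s * u" and \<mu>: "\<mu> = u / 2"
    and gram_G: "q \<in> U \<Longrightarrow> gram G c q = M q ** block u (- gram g b (\<rho> q)) ** transpose (M q)"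
begin

lemma ginv_G:
  assumes q: "q \<in> U"
  shows "invertible (gram G c q)" "matrix_inv (gram G c q) =
    transpose (matrix_inv (M q)) ** block (1 / u) (- stat.H (\<rho> q)) ** matrix_inv (M q)"
proof -
  have "(- gram g b (\<rho> q)) ** (- stat.H (\<rho> q)) = mat 1"
    by (simp add: matrix_distribs stat.gram_H \<rho>_in[OF q])
  note i = matrix_inv_unique[OF this]
  from ginv_frame[OF q gram_G[OF q] block_inverse(1)[OF u i(1)]]
  show "invertible (gram G c q)" "matrix_inv (gram G c q) =
      transpose (matrix_inv (M q)) ** block (1 / u) (- stat.H (\<rho> q)) ** matrix_inv (M q)"
    by (simp_all add: block_inverse(2)[OF u i(1)] i(2))
qed

lemma T_gram: "x \<in> V \<Longrightarrow> T x ** gram g b x = \<kappa> *\<^sub>R gram g b x - \<mu> *\<^sub>R gram \<omega> b x"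
  by (simp add: fibre_coef_def matrix_distribs matrix_inv_left[OF g_inv] flip: matrix_mul_assoc)

lemma \<omega>_transpose: "x \<in> V \<Longrightarrow> transpose (gram \<omega> b x) = - gram \<omega> b x"
  unfolding gram_def transpose_def vec_eq_iff by (auto intro: \<omega>_skew)

lemma gram_T: "x \<in> V \<Longrightarrow> gram g b x ** transpose (T x) = \<kappa> *\<^sub>R gram g b x + \<mu> *\<^sub>R gram \<omega> b x"
  using arg_cong[OF T_gram[of x], of transpose]
  by (simp add: matrix_distribs stat.gram_sym \<omega>_transpose)

lemma smooth_minus_g: "smoothM b V (\<lambda>x. - gram g b x)"
  using smooth_g unfolding smoothM_def by (auto intro: smooth_in_uminus[OF region_b])

text \<open>The sign is that of \<open>G\<close>, which restricts to -g on horizontal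
  vectors.\<close>

definition cubic :: "'p \<Rightarrow> 'n option \<Rightarrow> real^('n option)^('n option)" where
  "cubic q A = (case A of None \<Rightarrow> 0 | Some i \<Rightarrow> block 0 (- covM \<Gamma> g b (\<rho> q) i))"

lemma cov2_G:
  assumes q: "q \<in> U"
  shows "cov2 D G c q I J K = - 2 * \<kappa> * \<beta> c q I * G c q J K + frame_tensor (M q) (cubic q) I J K"
proof -
  let ?S = "block u (- gram g b (\<rho> q))"
  have x: "\<rho> q \<in> V" by (rule \<rho>_in[OF q])
  \<comment> \<open>In the vertical direction the \<omega> parts of \<open>T g\<close> and
    \<open>g T^t\<close> cancel and 2\<kappa> g is left, giving a multiple of the metric. In a
    horizontal direction the mixed entries cancel and the base cubic form remains.\<close>
  have frame: "(case A of None \<Rightarrow> 0 | Some i \<Rightarrow> block 0 (pdM b (\<lambda>x. - gram g b x) i (\<rho> q)))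
      - F A (\<rho> q) ** ?S - ?S ** transpose (F A (\<rho> q))
    = (if A = None then (- 2 * \<kappa>) *\<^sub>R ?S else 0) + cubic q A" for A
  proof (cases A)
    case None
    have t: "transpose (block \<kappa> X) = block \<kappa> (transpose X)" for X :: "real^'n^'n"
      by (rule matrix_option_eqI) (simp_all add: transpose_def)
    have "- (block \<kappa> (T (\<rho> q)) ** ?S) - ?S ** block \<kappa> (transpose (T (\<rho> q))) = (- 2 * \<kappa>) *\<^sub>R ?S"
      using T_gram[OF x] gram_T[OF x]
      by (intro matrix_option_eqI) (simp_all add: block_mult matrix_uminus_left matrix_uminus_right)
    then show ?thesis using None by (simp add: cubic_def t)
  next
    case (Some i)
    have Tg: "(\<Sum>k\<in>UNIV. T (\<rho> q) $ i $ k * g b (\<rho> q) k j) = \<kappa> * g b (\<rho> q) i j - \<mu> * \<omega> b (\<rho> q) i j" for j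
      using arg_cong[OF T_gram[OF x], of "\<lambda>X. X $ i $ j"] by (simp add: matrix_mult_component gram_component)
    then have Tg2: "(\<Sum>k\<in>UNIV. g b (\<rho> q) k j * T (\<rho> q) $ i $ k) = \<kappa> * g b (\<rho> q) i j - \<mu> * \<omega> b (\<rho> q) i j" for j
      by (simp add: mult.commute)
    have gs: "g b (\<rho> q) j k = g b (\<rho> q) k j" for j k by (rule g_sym[OF x])
    have Tg': "(\<Sum>k\<in>UNIV. g b (\<rho> q) j k * T (\<rho> q) $ i $ k) = \<kappa> * g b (\<rho> q) i j - \<mu> * \<omega> b (\<rho> q) i j" for j
      using Tg[of j] by (simp add: gs[of j] mult.commute)
    have d: "pdM b (\<lambda>x. - gram g b x) i (\<rho> q) = - pdM b (gram g b) i (\<rho> q)"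
      using smooth_g by (simp add: pdM_def vec_eq_iff smoothM_def pd_uminus[OF region_b x])
    have c: "covM \<Gamma> g b (\<rho> q) i $ j $ k = pdM b (gram g b) i (\<rho> q) $ j $ k
      - (\<Sum>l\<in>UNIV. \<Gamma> b (\<rho> q) i j l * g b (\<rho> q) l k) - (\<Sum>l\<in>UNIV. g b (\<rho> q) j l * \<Gamma> b (\<rho> q) i k l)" for j k
      by (simp add: covM_eq matrix_mult_component gram_component connM_component transpose_def)
    show ?thesis
      unfolding Some
      by (rule matrix_option_eqI)
        (simp_all add: cubic_def matrix_mult_component sum_option transpose_def d c gram_component sum_negf
          Tg2[unfolded \<kappa> \<mu>] Tg'[unfolded \<kappa> \<mu>] \<kappa> \<mu> algebra_simps)
  qed
  have "cov2 D G c q I J K = frame_tensor (M q) (\<lambda>A. (if A = None then (- 2 * \<kappa>) *\<^sub>R ?S else 0) + cubic q A) I J K"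
    unfolding frame[symmetric] by (rule covM_block[OF q gram_G smooth_minus_g])
  also have "\<dots> = (M q ** (\<Sum>A\<in>UNIV. M q $ I $ A *\<^sub>R (if A = None then (- 2 * \<kappa>) *\<^sub>R ?S else 0)) ** transpose (M q)) $ J $ K
      + frame_tensor (M q) (cubic q) I J K"
    by (simp add: frame_tensor_matrix frame_tensor_add)
  also have "M q ** (\<Sum>A\<in>UNIV. M q $ I $ A *\<^sub>R (if A = None then (- 2 * \<kappa>) *\<^sub>R ?S else 0)) ** transpose (M q)
      = (- 2 * \<kappa> * \<beta> c q I) *\<^sub>R gram G c q"
    by (simp add: sum_option gram_G[OF q] matrix_scaleR_left matrix_scaleR_right matrix_uminus_left matrix_uminus_right)
  finally show ?thesis by (simp add: gram_def)
qed

lemma cubic_sym: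
  assumes q: "q \<in> U"
  shows "frame_tensor (M q) (cubic q) I J K = frame_tensor (M q) (cubic q) J I K"
proof -
  have "cov2 \<Gamma> g b (\<rho> q) i j k = cov2 \<Gamma> g b (\<rho> q) j i k" for i j k by (rule stat.cov_sym[OF \<rho>_in[OF q]])
  then have "cubic q A $ B $ C = cubic q B $ A $ C" for A B C
    by (cases A; cases B; cases C) (auto simp: cubic_def covM_def)
  then have "cubic q = (\<lambda>A. \<chi> B C. cubic q B $ A $ C)" by (simp add: fun_eq_iff vec_eq_iff)
  then show ?thesis by (subst frame_tensor_swap) simp
qed

lemma cubic_trace:
  assumes q: "q \<in> U"
  shows "(\<Sum>J\<in>UNIV. \<Sum>K\<in>UNIV. ginv G c q J K * frame_tensor (M q) (cubic q) I J K) = 0"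
proof -
  have "(\<Sum>B\<in>UNIV. \<Sum>C\<in>UNIV. block (1 / u) (- stat.H (\<rho> q)) $ B $ C * cubic q A $ B $ C) = 0" for A
  proof (cases A)
    case (Some i)
    have "(\<Sum>j\<in>UNIV. \<Sum>k\<in>UNIV. stat.H (\<rho> q) $ j $ k * covM \<Gamma> g b (\<rho> q) i $ j $ k) = 0"
      using stat.cov_trace[OF \<rho>_in[OF q], of i] stat.covM_sym[OF \<rho>_in[OF q], of i]
      by (simp add: sum_matrix_trace)
    then show ?thesis using Some by (simp add: sum_option cubic_def)
  qed (simp add: cubic_def)
  then show ?thesis
    unfolding ginv_def ginv_G(2)[OF q] frame_tensor_contract23[OF matrix_inv_left[OF invertible_coframe[OF q]]]
    by simp
qed

end

section \<open>Ricci tensor and the divergence of d\<beta> in a frame\<close>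

text \<open>For \<nabla> itself \<open>ric_base\<close> expresses that g is the symmetrized Schouten
  tensor; for the conjugate connection it will come from the Einstein hypothesis.\<close>

locale framed_einstein = framed_statistical b V c U \<rho> \<beta> \<Gamma> g \<omega> D \<kappa> \<mu> s G u
    + form: statistical_chart_form b V \<Gamma> g \<omega> \<alpha>
  for b :: "('m, real^'n::finite) chart" and V and c :: "('p, real^('n option)) chart"
    and U \<rho> \<beta> \<Gamma> g \<omega> D \<kappa> \<mu> s G u \<alpha> +
  assumes ric_base: "x \<in> V \<Longrightarrow> sym2 (ricci \<Gamma> b x) i j = (1 - real CARD('n)) * g b x i j"
begin

lemma trace_T: "x \<in> V \<Longrightarrow> (\<Sum>d\<in>UNIV. T x $ d $ d) = real CARD('n) * \<kappa>"
  using form.trace_e[of x]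
  by (simp add: T_entry sum_subtractf trace_def flip: sum_distrib_left)

lemma T_square: "x \<in> V \<Longrightarrow> (\<Sum>d\<in>UNIV. \<Sum>k\<in>UNIV. T x $ d $ k * T x $ k $ d) =
    real CARD('n) * (\<kappa>\<^sup>2 + \<mu>\<^sup>2 * \<alpha>)"
proof -
  assume x: "x \<in> V"
  have "(\<Sum>d\<in>UNIV. \<Sum>k\<in>UNIV. T x $ d $ k * T x $ k $ d) = trace (T x ** T x)"
    by (simp add: trace_def matrix_mult_component)
  also have "T x ** T x = (\<kappa>\<^sup>2 + \<mu>\<^sup>2 * \<alpha>) *\<^sub>R mat 1 - (2 * \<kappa> * \<mu>) *\<^sub>R endo x"
    using form.e_square[OF x]
    by (simp add: fibre_coef_def matrix_distribs power2_eq_square) (simp add: vec_eq_iff algebra_simps)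
  also have "trace \<dots> = real CARD('n) * (\<kappa>\<^sup>2 + \<mu>\<^sup>2 * \<alpha>)"
    by (simp add: trace_sub trace_scaleR form.trace_e[OF x] trace_I)
  finally show ?thesis .
qed

text \<open>T is a constant multiple of the identity minus \<mu> times \<open>endo\<close>, so its
  covariant divergence reduces to \<open>divergence_e\<close>.\<close>

lemma T_divergence:
  assumes x: "x \<in> V"
  shows "(\<Sum>d\<in>UNIV. - \<mu> * pdM b endo d x $ i $ d + (\<Sum>k\<in>UNIV. T x $ i $ k * \<Gamma> b x d k d)
    - (\<Sum>k\<in>UNIV. \<Gamma> b x d i k * T x $ k $ d)) = 0"
proof -
  have "(\<Sum>k\<in>UNIV. T x $ i $ k * \<Gamma> b x d k d) = (T x ** connM \<Gamma> b x d) $ i $ d" for d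
    by (simp add: matrix_mult_component[of "T x"] connM_component)
  moreover have "T x ** connM \<Gamma> b x d = \<kappa> *\<^sub>R connM \<Gamma> b x d - \<mu> *\<^sub>R (endo x ** connM \<Gamma> b x d)" for d
    by (simp add: fibre_coef_def matrix_distribs)
  moreover have "(\<Sum>k\<in>UNIV. \<Gamma> b x d i k * T x $ k $ d) = (connM \<Gamma> b x d ** T x) $ i $ d" for d
    by (simp add: matrix_mult_component[of _ "T x"] connM_component)
  moreover have "connM \<Gamma> b x d ** T x = \<kappa> *\<^sub>R connM \<Gamma> b x d - \<mu> *\<^sub>R (connM \<Gamma> b x d ** endo x)" for d
    by (simp add: fibre_coef_def matrix_distribs)
  ultimately have "(\<Sum>d\<in>UNIV. - \<mu> * pdM b endo d x $ i $ d + (\<Sum>k\<in>UNIV. T x $ i $ k * \<Gamma> b x d k d)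
      - (\<Sum>k\<in>UNIV. \<Gamma> b x d i k * T x $ k $ d)) =
    (\<Sum>d\<in>UNIV. - \<mu> * (pdM b endo d x + endo x ** connM \<Gamma> b x d - connM \<Gamma> b x d ** endo x) $ i $ d)"
    by (intro sum.cong refl) (simp add: algebra_simps)
  also have "\<dots> = 0"
    using form.divergence_e[OF x, of i] by (simp only: sum_distrib_left[symmetric])
  finally show ?thesis .
qed

lemma pdM_F_component: "pdM b (F B) i x $ C $ A = pd b (\<lambda>x. F B x $ C $ A) i x"
  by (simp add: pdM_def)

text \<open>The vertical component is \<kappa> times the trace of T minus the trace of T squared;
  the terms quadratic in \<kappa> cancel.\<close>

lemma frame_ric_None_None:
  assumes q: "q \<in> U"
  shows "frame_ric q $ None $ None = - (\<mu>\<^sup>2 * real CARD('n) * \<alpha>)"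
proof -
  have x: "\<rho> q \<in> V" by (rule \<rho>_in[OF q])
  have "frame_ric q $ None $ None = (\<Sum>d\<in>UNIV. \<kappa> * T (\<rho> q) $ d $ d)
      - (\<Sum>d\<in>UNIV. \<Sum>k\<in>UNIV. T (\<rho> q) $ d $ k * T (\<rho> q) $ k $ d)"
    by (simp add: frame_ric_def sum_option frame_curv_def matrix_mult_component
        pdM_F_component pd_const sum_subtractf)
  then show ?thesis
    by (simp add: T_square[OF x] trace_T[OF x] power2_eq_square algebra_simps flip: sum_distrib_left)
qed

lemma frame_ric_None_Some:
  assumes q: "q \<in> U"
  shows "frame_ric q $ None $ Some j = 0"
proof -
  have x: "\<rho> q \<in> V" by (rule \<rho>_in[OF q])
  have "frame_ric q $ None $ Some j = (\<Sum>d\<in>UNIV. - \<mu> * pdM b endo d (\<rho> q) $ j $ d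
      + (\<Sum>k\<in>UNIV. T (\<rho> q) $ j $ k * \<Gamma> b (\<rho> q) d k d) - (\<Sum>k\<in>UNIV. \<Gamma> b (\<rho> q) d j k * T (\<rho> q) $ k $ d))"
    by (simp add: frame_ric_def sum_option frame_curv_def matrix_mult_component
        pdM_F_component pd_const pd_T[OF x] sum_negf)
  then show ?thesis by (simp only: T_divergence[OF x])
qed

text \<open>The divergence of T appears again, now accompanied by the derivative of its trace, which
  is constant because \<open>endo\<close> has trace zero.\<close>

lemma frame_ric_Some_None:
  assumes q: "q \<in> U"
  shows "frame_ric q $ Some i $ None = 0"
proof -
  have x: "\<rho> q \<in> V" by (rule \<rho>_in[OF q])
  have "pd b (\<lambda>x. \<Sum>d\<in>UNIV. T x $ d $ d) i (\<rho> q) = pd b (\<lambda>x. real CARD('n) * \<kappa>) i (\<rho> q)"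
    by (rule pd_cong[OF region_b x]) (rule trace_T)
  then have tr: "(\<Sum>d\<in>UNIV. pd b (\<lambda>x. T x $ d $ d) i (\<rho> q)) = 0"
    by (simp add: pd_sum[OF region_b x] smoothMD[OF smooth_T] pd_const)
  have tf: "\<Gamma> b (\<rho> q) a k l = \<Gamma> b (\<rho> q) k a l" for a k l by (rule torsion_free[OF x])
  have "frame_ric q $ Some i $ None = (\<Sum>d\<in>UNIV. - \<mu> * pdM b endo d (\<rho> q) $ i $ d
      + (\<Sum>k\<in>UNIV. T (\<rho> q) $ i $ k * \<Gamma> b (\<rho> q) d k d)) - (\<Sum>d\<in>UNIV. pd b (\<lambda>x. T x $ d $ d) i (\<rho> q))
      - (\<Sum>d\<in>UNIV. \<Sum>k\<in>UNIV. T (\<rho> q) $ d $ k * \<Gamma> b (\<rho> q) i k d)"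
    by (simp add: frame_ric_def sum_option frame_curv_def matrix_mult_component
        pdM_F_component pd_const pd_T[OF x] sum_subtractf sum.distrib sum_negf tf[of i])
  also have "(\<Sum>d\<in>UNIV. \<Sum>k\<in>UNIV. T (\<rho> q) $ d $ k * \<Gamma> b (\<rho> q) i k d) =
      (\<Sum>d\<in>UNIV. \<Sum>k\<in>UNIV. \<Gamma> b (\<rho> q) d i k * T (\<rho> q) $ k $ d)"
    by (subst sum.swap) (simp add: tf[of i] mult.commute)
  finally show ?thesis
    using T_divergence[OF x, of i] by (simp add: tr sum_subtractf)
qed

text \<open>Besides the Ricci tensor of the base there are only products of T with the matrix p of
  vertical outputs, together with an anholonomy term pairing \<omega> with T. All of them are
  evaluated by \<open>\<omega>_square\<close>.\<close>

lemma frame_ric_Some_Some: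
  assumes q: "q \<in> U"
  shows "frame_ric q $ Some i $ Some j = ricci \<Gamma> b (\<rho> q) i j
    + (real CARD('n) - 1) * \<kappa> * s * g b (\<rho> q) i j - \<mu> * \<alpha> * g b (\<rho> q) i j
    - (real CARD('n) + 1) * \<kappa> / 2 * \<omega> b (\<rho> q) i j"
proof -
  have x: "\<rho> q \<in> V" by (rule \<rho>_in[OF q])
  \<comment> \<open>The antisymmetric part of p is carried by \<omega> alone; it supplies the
    anholonomy term.\<close>
  define p where "p = s *\<^sub>R gram g b (\<rho> q) - (1 / 2) *\<^sub>R gram \<omega> b (\<rho> q)"
  let ?W = "gram \<omega> b (\<rho> q)" and ?T = "T (\<rho> q)"
  have p: "s * g b (\<rho> q) i j - \<omega> b (\<rho> q) i j / 2 = p $ i $ j" for i j by (simp add: p_def gram_def)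
  have w: "p $ i $ d - p $ d $ i = - ?W $ i $ d" for i d
    using g_sym[OF x, of d i] \<omega>_skew[OF x, of d i] by (simp add: p_def gram_def)
  have tf: "\<Gamma> b (\<rho> q) i k l - \<Gamma> b (\<rho> q) k i l = 0" for k l using torsion_free[OF x] by simp
  have "frame_ric q $ Some i $ Some j = p $ i $ j * \<kappa> - (\<Sum>k\<in>UNIV. ?T $ j $ k * p $ i $ k)
      + (\<Sum>d\<in>UNIV. pd b (\<lambda>x. \<Gamma> b x i j d) d (\<rho> q) - pd b (\<lambda>x. \<Gamma> b x d j d) i (\<rho> q)
          + (p $ i $ j * ?T $ d $ d + (\<Sum>k\<in>UNIV. \<Gamma> b (\<rho> q) i j k * \<Gamma> b (\<rho> q) d k d))
          - (p $ d $ j * ?T $ i $ d + (\<Sum>k\<in>UNIV. \<Gamma> b (\<rho> q) d j k * \<Gamma> b (\<rho> q) i k d))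
          + (p $ i $ d - p $ d $ i) * ?T $ j $ d)"
    by (simp add: frame_ric_def sum_option frame_curv_def matrix_mult_component
        pdM_F_component pd_const tf p)
  also have "\<dots> = ricci \<Gamma> b (\<rho> q) i j + p $ i $ j * (\<kappa> + (\<Sum>d\<in>UNIV. ?T $ d $ d))
      - (p ** transpose ?T) $ i $ j - (?T ** p) $ i $ j - (?W ** transpose ?T) $ i $ j"
    unfolding w
    by (simp add: ricci_def curvature_def sum.distrib sum_subtractf matrix_mult_component transpose_def
        sum_distrib_left sum_negf mult.commute distrib_left)
  also have "p ** transpose ?T = (s * \<kappa>) *\<^sub>R gram g b (\<rho> q) + (s * \<mu>) *\<^sub>R ?W - (\<kappa> / 2) *\<^sub>R ?W - (\<mu> * \<alpha> / 2) *\<^sub>R gram g b (\<rho> q)"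
  proof -
    have "?W ** transpose ?T = \<kappa> *\<^sub>R ?W + (\<mu> * \<alpha>) *\<^sub>R gram g b (\<rho> q)"
      by (simp add: fibre_coef_def matrix_distribs stat.H_sym[OF x] form.gram_\<omega>_skew[OF x] transpose_mat
          form.\<omega>_square[OF x] matrix_mul_assoc)
    then show ?thesis using gram_T[OF x] by (simp add: p_def matrix_distribs algebra_simps)
  qed
  also have "?T ** p = (\<kappa> * s) *\<^sub>R gram g b (\<rho> q) - (\<kappa> / 2) *\<^sub>R ?W - (\<mu> * s) *\<^sub>R ?W + (\<mu> * \<alpha> / 2) *\<^sub>R gram g b (\<rho> q)"
  proof -
    have "?T ** ?W = \<kappa> *\<^sub>R ?W - (\<mu> * \<alpha>) *\<^sub>R gram g b (\<rho> q)"
      by (simp add: fibre_coef_def matrix_distribs form.\<omega>_square[OF x])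
    then show ?thesis
      by (simp add: p_def matrix_distribs T_gram[OF x]) (simp add: vec_eq_iff algebra_simps)
  qed
  also have "?W ** transpose ?T = \<kappa> *\<^sub>R ?W + (\<mu> * \<alpha>) *\<^sub>R gram g b (\<rho> q)"
    by (simp add: fibre_coef_def matrix_distribs stat.H_sym[OF x] form.gram_\<omega>_skew[OF x] transpose_mat
        form.\<omega>_square[OF x] matrix_mul_assoc)
  finally show ?thesis
    by (simp add: p_def trace_T[OF x] gram_def field_simps)
qed

lemma ricci_G:
  assumes q: "q \<in> U" and s: "s\<^sup>2 = 1 / u + (real CARD('n) + 2) * \<alpha> / (4 * (real CARD('n) - 1))"
    and n: "CARD('n) \<ge> 2"
  shows "sym2 (ricci D c q) I J = - (real CARD('n) * \<alpha> * u / 4) * G c q I J"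
    and "scal D G c q = - (real CARD('n) * (real CARD('n) + 1) * \<alpha> * u / 4)"
proof -
  let ?r = "- (real CARD('n) * \<alpha> * u / 4)"
  have x: "\<rho> q \<in> V" by (rule \<rho>_in[OF q])
  \<comment> \<open>The equation that determines s: the horizontal factor must match the vertical
    one. Its left-hand side is the coefficient of g in the symmetrized horizontal block.\<close>
  have k: "(real CARD('n) - 1) * (\<kappa> * s - 1) - \<mu> * \<alpha> = - ?r"
  proof -
    have "(real CARD('n) - 1) * (\<kappa> * s - 1) = (real CARD('n) - 1) * (u * s\<^sup>2 - 1)"
      by (simp add: \<kappa> power2_eq_square)
    also have "\<dots> = u * (real CARD('n) + 2) * \<alpha> / 4"
      unfolding s using u n by (simp add: field_simps)
    finally show ?thesis by (simp add: \<mu> field_simps)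
  qed
  have NN: "frame_ric q $ None $ None = - (u * u * real CARD('n) * \<alpha> / 4)"
    by (subst frame_ric_None_None[OF q]) (simp add: \<mu> power2_eq_square)
  have "frame_ric q + transpose (frame_ric q) = (2 * ?r) *\<^sub>R block u (- gram g b (\<rho> q))"
  proof (rule matrix_option_eqI)
    fix i j
    have "ricci \<Gamma> b (\<rho> q) i j + ricci \<Gamma> b (\<rho> q) j i = 2 * (1 - real CARD('n)) * g b (\<rho> q) i j"
      using ric_base[OF x, of i j] by (simp add: sym2_def)
    then have "(frame_ric q + transpose (frame_ric q)) $ Some i $ Some j =
        2 * ((real CARD('n) - 1) * (\<kappa> * s - 1) - \<mu> * \<alpha>) * g b (\<rho> q) i j"
      using g_sym[OF x, of j i] \<omega>_skew[OF x, of j i]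
      by (simp add: transpose_def frame_ric_Some_Some[OF q] algebra_simps add_divide_distrib diff_divide_distrib)
    then show "(frame_ric q + transpose (frame_ric q)) $ Some i $ Some j =
        ((2 * ?r) *\<^sub>R block u (- gram g b (\<rho> q))) $ Some i $ Some j"
      unfolding k by (simp add: gram_def)
  qed (simp_all add: transpose_def NN frame_ric_None_Some[OF q] frame_ric_Some_None[OF q])
  then have "M q ** (frame_ric q + transpose (frame_ric q)) ** transpose (M q) = (2 * ?r) *\<^sub>R gram G c q"
    by (simp add: gram_G[OF q] matrix_scaleR_left matrix_scaleR_right matrix_uminus_left matrix_uminus_right)
  then have "ricM D c q + transpose (ricM D c q) = (2 * ?r) *\<^sub>R gram G c q"
    by (simp add: ricci_frame[OF q D_torsion_free[OF q]] matrix_distribs matrix_mul_assoc)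
  then have "(ricM D c q + transpose (ricM D c q)) $ I $ J = ((2 * ?r) *\<^sub>R gram G c q) $ I $ J" for I J
    by simp
  then show sym: "sym2 (ricci D c q) I J = ?r * G c q I J" for I J
    by (simp add: sym2_def ricM_def transpose_def gram_def field_simps)
  note inv = ginv_G[OF q]
  have Gs: "transpose (gram G c q) = gram G c q"
    by (simp add: gram_G[OF q] matrix_distribs matrix_mul_assoc)
      (rule arg_cong[where f = "\<lambda>X. M q ** X ** transpose (M q)"],
        rule matrix_option_eqI, simp_all add: transpose_def gram_def g_sym[OF x])
  have gs: "ginv G c q I J = ginv G c q J I" for I J
  proof -
    have "gram G c q ** transpose (matrix_inv (gram G c q)) = mat 1"
      by (metis Gs inv(1) matrix_inv_left matrix_transpose_mul transpose_mat)
    then have "transpose (matrix_inv (gram G c q)) = matrix_inv (gram G c q)"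
      using matrix_inv_unique(2) by metis
    then show ?thesis unfolding ginv_def by (rule transpose_eqD)
  qed
  \<comment> \<open>The inverse metric is symmetric, so only the symmetrized Ricci tensor
    contributes, and the trace of the identity supplies the factor n + 1.\<close>
  have "scal D G c q = (\<Sum>I\<in>UNIV. \<Sum>J\<in>UNIV. ginv G c q I J * ricci D c q J I)"
    unfolding scal_def by (subst sum.swap) (simp add: gs)
  then have "2 * scal D G c q = (\<Sum>I\<in>UNIV. \<Sum>J\<in>UNIV. ginv G c q I J * (2 * sym2 (ricci D c q) I J))"
    unfolding sym2_double distrib_left sum.distrib by (simp add: scal_def)
  also have "\<dots> = 2 * ?r * (\<Sum>I\<in>UNIV. \<Sum>J\<in>UNIV. ginv G c q I J * G c q I J)"
    by (simp add: sym sum_distrib_left mult_ac)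
  also have "(\<Sum>I\<in>UNIV. \<Sum>J\<in>UNIV. ginv G c q I J * G c q I J) = real CARD('n option)"
    using sum_matrix_trace[of "matrix_inv (gram G c q)" "gram G c q"]
    by (simp add: Gs matrix_inv_left[OF inv(1)] trace_I) (simp add: gram_def ginv_def)
  finally show "scal D G c q = - (real CARD('n) * (real CARD('n) + 1) * \<alpha> * u / 4)"
    by (simp add: field_simps)
qed

text \<open>Its horizontal part is the divergence of \<omega>, which vanishes. The vertical part
  pairs \<omega> with T; the \<kappa> part is traceless and the \<mu> part contributes n \<mu>
  \<alpha>. This is the term balancing the scalar curvature in the Einstein condition.\<close>

lemma divergence_ext_deriv:
  assumes q: "q \<in> U"
  shows "(\<Sum>I\<in>UNIV. \<Sum>J\<in>UNIV. ginv G c q I J * cov2 D (ext_deriv \<beta>) c q I J K) =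
    real CARD('n) * \<alpha> * u / 2 * \<beta> c q K"
proof -
  have x: "\<rho> q \<in> V" by (rule \<rho>_in[OF q])
  let ?H = "stat.H (\<rho> q)" and ?W = "gram \<omega> b (\<rho> q)"
  have "(\<Sum>A\<in>UNIV. \<Sum>B\<in>UNIV. block (1 / u) (- ?H) $ A $ B * ext_deriv_frame q A $ B $ C) =
      (case C of None \<Rightarrow> real CARD('n) * \<alpha> * u / 2 | Some i \<Rightarrow> 0)" for C
  proof (cases C)
    case None
    have "(\<Sum>A\<in>UNIV. \<Sum>B\<in>UNIV. block (1 / u) (- ?H) $ A $ B * ext_deriv_frame q A $ B $ None) =
        (\<Sum>i\<in>UNIV. \<Sum>j\<in>UNIV. ?H $ i $ j * (T (\<rho> q) ** transpose ?W) $ i $ j)"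
      by (simp add: sum_option ext_deriv_frame_def matrix_mult_component transpose_def mult.commute)
    also have "\<dots> = trace (?H ** ?W ** transpose (T (\<rho> q)))"
      by (simp add: sum_matrix_trace matrix_transpose_mul matrix_mul_assoc)
    also have "?H ** ?W ** transpose (T (\<rho> q)) = \<kappa> *\<^sub>R (?H ** ?W) + (\<mu> * \<alpha>) *\<^sub>R mat 1"
      using arg_cong[OF form.\<omega>_square[OF x], of "\<lambda>X. ?H ** X"]
      by (simp add: fibre_coef_def matrix_distribs stat.H_sym[OF x] form.gram_\<omega>_skew[OF x] transpose_mat
          matrix_mul_assoc stat.gram_H[OF x])
    also have "trace \<dots> = real CARD('n) * \<alpha> * u / 2"
      using form.trace_e[OF x] by (simp add: trace_add trace_scaleR trace_I trace_mul_sym[of ?H] \<mu>)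
    finally show ?thesis using None by simp
  next
    case (Some k)
    have "(\<Sum>A\<in>UNIV. \<Sum>B\<in>UNIV. block (1 / u) (- ?H) $ A $ B * ext_deriv_frame q A $ B $ Some k) =
        - (\<Sum>i\<in>UNIV. \<Sum>j\<in>UNIV. ?H $ i $ j * covM \<Gamma> \<omega> b (\<rho> q) i $ j $ k)"
      by (simp add: sum_option ext_deriv_frame_Some covM_def sum_negf) (simp add: ext_deriv_frame_def matrix_mult_component sum_option transpose_def)
    also have "\<dots> = - (\<Sum>j\<in>UNIV. (?H ** covM \<Gamma> \<omega> b (\<rho> q) j) $ j $ k)"
      by (simp add: matrix_mult_component)
    finally show ?thesis using form.divergence(1)[OF x, of k] Some by simp
  qed
  then show ?thesis
    unfolding cov2_ext_deriv[OF q] ginv_def ginv_G(2)[OF q]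
      frame_tensor_contract12[OF matrix_inv_left[OF invertible_coframe[OF q]]]
    by (simp add: sum_option)
qed

end

section \<open>AH structures\<close>

text \<open>For the representative \<open>g\<close>, this combines the two conditions in the definition of an AH structure.\<close>

definition trace_free_cubic ::
    "('m::topological_space, real^'i::finite) chart set \<Rightarrow> ('m, 'i) tensor3 \<Rightarrow> ('m, 'i) tensor2 \<Rightarrow>
     ('m, 'i) tensor1 \<Rightarrow> bool" where
  "trace_free_cubic A \<Gamma> g \<eta> \<longleftrightarrow> smooth_atlas A \<and> torsion_free_connection A \<Gamma> \<and> pseudo_metric A g \<and>
     one_form A \<eta> \<and> (\<forall>c\<in>A. \<forall>p\<in>dom_chart c. \<forall>i.
       (\<forall>j k. cubic_form \<Gamma> g \<eta> c p i j k = cubic_form \<Gamma> g \<eta> c p j i k) \<and>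
       (\<Sum>j\<in>UNIV. \<Sum>k\<in>UNIV. ginv g c p j k * cubic_form \<Gamma> g \<eta> c p i j k) = 0)"

lemma trace_free_cubicD:
  assumes "trace_free_cubic A \<Gamma> g \<eta>" "c \<in> A" "p \<in> dom_chart c"
  shows "cubic_form \<Gamma> g \<eta> c p i j k = cubic_form \<Gamma> g \<eta> c p j i k"
    "(\<Sum>j\<in>UNIV. \<Sum>k\<in>UNIV. ginv g c p j k * cubic_form \<Gamma> g \<eta> c p i j k) = 0"
  using assms unfolding trace_free_cubic_def by blast+

lemma one_form_change:
  "one_form A \<beta> \<Longrightarrow> c \<in> A \<Longrightarrow> d \<in> A \<Longrightarrow> p \<in> dom_chart c \<Longrightarrow> p \<in> dom_chart d \<Longrightarrow>
    \<beta> c p i = (\<Sum>j\<in>UNIV. pd c (\<lambda>q. coords d q $ j) i p * \<beta> d p j)"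
  unfolding one_form_def by blast

lemma covariant2_change:
  "covariant2 A g \<Longrightarrow> c \<in> A \<Longrightarrow> d \<in> A \<Longrightarrow> p \<in> dom_chart c \<Longrightarrow> p \<in> dom_chart d \<Longrightarrow>
    g c p i j = (\<Sum>k\<in>UNIV. \<Sum>l\<in>UNIV. pd c (\<lambda>q. coords d q $ k) i p * pd c (\<lambda>q. coords d q $ l) j p * g d p k l)"
  unfolding covariant2_def by blast

lemma pseudo_metric_gram:
  assumes "pseudo_metric A g" "c \<in> A" "p \<in> dom_chart c"
  shows "invertible (gram g c p)" "transpose (gram g c p) = gram g c p"
    "transpose (matrix_inv (gram g c p)) = matrix_inv (gram g c p)"
proof -
  show inv: "invertible (gram g c p)" and sym: "transpose (gram g c p) = gram g c p"
    using assms by (auto simp: pseudo_metric_def nondegenerate_def gram_def transpose_def)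
  have "gram g c p ** transpose (matrix_inv (gram g c p)) = mat 1"
    by (metis sym inv matrix_inv_left matrix_transpose_mul transpose_mat)
  then show "transpose (matrix_inv (gram g c p)) = matrix_inv (gram g c p)"
    using matrix_inv_unique(2) by metis
qed

lemma pseudo_metric_contract:
  fixes g :: "('m::topological_space, 'i::finite) tensor2"
  assumes "pseudo_metric A g" "c \<in> A" "p \<in> dom_chart c"
  shows "(\<Sum>j\<in>UNIV. \<Sum>k\<in>UNIV. ginv g c p j k * g c p j k) = real CARD('i)"
    "(\<Sum>j\<in>UNIV. \<Sum>k\<in>UNIV. ginv g c p j k * (v j * g c p k l)) = v l"
proof -
  note G = pseudo_metric_gram[OF assms]
  show "(\<Sum>j\<in>UNIV. \<Sum>k\<in>UNIV. ginv g c p j k * g c p j k) = real CARD('i)"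
    using sum_matrix_trace[of "matrix_inv (gram g c p)" "gram g c p"]
    by (simp add: G(2) matrix_inv_left[OF G(1)] trace_I) (simp add: gram_def ginv_def)
  have "(\<Sum>j\<in>UNIV. \<Sum>k\<in>UNIV. ginv g c p j k * (v j * g c p k l)) =
      (\<Sum>j\<in>UNIV. v j * (matrix_inv (gram g c p) ** gram g c p) $ j $ l)"
    by (simp add: matrix_mult_component sum_distrib_left ginv_def gram_component mult.left_commute)
  then show "(\<Sum>j\<in>UNIV. \<Sum>k\<in>UNIV. ginv g c p j k * (v j * g c p k l)) = v l"
    by (simp add: matrix_inv_left[OF G(1)] mat_def if_distrib[of "\<lambda>x. _ * x"] cong: if_cong)
qed

lemma cov2_sym23:
  assumes "smooth_atlas A" "pseudo_metric A g" "c \<in> A" "p \<in> dom_chart c"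
  shows "cov2 \<Gamma> g c p i j k = cov2 \<Gamma> g c p i k j"
proof -
  have g: "g c q a b = g c q b a" if "q \<in> dom_chart c" for q a b
    using assms that by (auto simp: pseudo_metric_def)
  have "pd c (\<lambda>q. g c q j k) i p = pd c (\<lambda>q. g c q k j) i p"
    by (rule pd_cong[OF atlas_chart_region[OF assms(1,3)] assms(4)]) (rule g)
  then show ?thesis using g[OF assms(4), of j] g[OF assms(4), of k]
    by (simp add: cov2_def)
qed

lemma trace_free_cubic_AH_form: "trace_free_cubic A \<Gamma> g \<eta> \<Longrightarrow> AH_form A \<Gamma> g \<eta>"
  unfolding AH_form_def
proof (intro conjI ballI allI)
  assume tf: "trace_free_cubic A \<Gamma> g \<eta>"
  then show "one_form A \<eta>" by (simp add: trace_free_cubic_def)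
  fix c p i j k assume "c \<in> A" "p \<in> dom_chart c"
  from trace_free_cubicD(1)[OF tf this, of i j k]
  show "alt2 (\<lambda>i j. cov2 \<Gamma> g c p i j k) i j = alt2 (\<lambda>i j. \<eta> c p i * g c p j k) i j"
    by (simp add: alt2_def cubic_form_def)
qed

text \<open>The cubic form is totally symmetric and trace-free, so it drops out of both contractions
  of \<nabla>g. The remaining \<eta> g contributes m \<eta> to one and \<eta> to the other.\<close>

lemma trace_free_cubic_aligned:
  assumes "trace_free_cubic A \<Gamma> g \<eta>"
  shows "aligned A \<Gamma> g"
  unfolding aligned_def
proof (intro ballI allI)
  fix c p and i :: 'b assume c: "c \<in> A" and p: "p \<in> dom_chart c"
  let ?X = "cubic_form \<Gamma> g \<eta> c p" and ?H = "ginv g c p"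
  have at: "smooth_atlas A" and g: "pseudo_metric A g" using assms by (auto simp: trace_free_cubic_def)
  have X12: "?X i j k = ?X j i k" for i j k by (rule trace_free_cubicD(1)[OF assms c p])
  have X23: "?X i j k = ?X i k j" for i j k
    using cov2_sym23[OF at g c p, of \<Gamma> i j k] g c p by (auto simp: cubic_form_def pseudo_metric_def)
  have X0: "(\<Sum>a\<in>UNIV. \<Sum>b\<in>UNIV. ?H a b * ?X i a b) = 0" by (rule trace_free_cubicD(2)[OF assms c p])
  have cov: "cov2 \<Gamma> g c p i j k = \<eta> c p i * g c p j k + ?X i j k" for i j k by (simp add: cubic_form_def)
  have "(\<Sum>a\<in>UNIV. \<Sum>b\<in>UNIV. ?H a b * cov2 \<Gamma> g c p i a b) = \<eta> c p i * (\<Sum>a\<in>UNIV. \<Sum>b\<in>UNIV. ?H a b * g c p a b)"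
    using X0 by (simp add: cov distrib_left sum.distrib sum_distrib_left mult_ac)
  moreover have "(\<Sum>a\<in>UNIV. \<Sum>b\<in>UNIV. ?H a b * cov2 \<Gamma> g c p a b i) = \<eta> c p i"
  proof -
    have "?X a b i = ?X i a b" for a b using X12[of i a b] X23[of a i b] by simp
    then show ?thesis
      using X0 pseudo_metric_contract(2)[OF g c p, of "\<eta> c p" i] by (simp add: cov distrib_left sum.distrib)
  qed
  ultimately show "(\<Sum>a\<in>UNIV. \<Sum>b\<in>UNIV. ?H a b * cov2 \<Gamma> g c p i a b) =
      real CARD('b) * (\<Sum>a\<in>UNIV. \<Sum>b\<in>UNIV. ?H a b * cov2 \<Gamma> g c p a b i)"
    by (simp add: pseudo_metric_contract(1)[OF g c p])
qed

lemma smooth_function_smooth_in: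
  "smooth_function A (carrier A) f \<Longrightarrow> c \<in> A \<Longrightarrow> smooth_in c (dom_chart c) f"
proof -
  assume f: "smooth_function A (carrier A) f" and c: "c \<in> A"
  have "dom_chart c \<inter> carrier A = dom_chart c" using c by (auto simp: carrier_def)
  then show ?thesis using f c by (auto simp: smooth_function_def smooth_in_def)
qed

lemma one_form_smooth: "one_form A \<zeta> \<Longrightarrow> c \<in> A \<Longrightarrow> smooth_in c (dom_chart c) (\<lambda>p. \<zeta> c p i)"
  by (auto simp: one_form_def smooth_in_def)

lemma gram_scale: "(\<And>i j. h c p i j = r * g c p i j) \<Longrightarrow> gram h c p = r *\<^sub>R gram g c p"
  by (simp add: gram_def vec_eq_iff)

lemma ginv_scale:
  assumes "invertible (gram g c p)" "r \<noteq> 0" "\<And>i j. h c p i j = r * g c p i j"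
  shows "invertible (gram h c p)" "ginv h c p i j = ginv g c p i j / r"
proof -
  have "gram h c p ** ((1 / r) *\<^sub>R matrix_inv (gram g c p)) = mat 1"
    using assms(2) by (simp add: gram_scale[where h = h and c = c and p = p and r = r and g = g, OF assms(3)] matrix_scaleR_left matrix_scaleR_right matrix_inv_right[OF assms(1)])
  from matrix_inv_unique[OF this] show "invertible (gram h c p)" "ginv h c p i j = ginv g c p i j / r"
    by (auto simp: ginv_def)
qed

section \<open>Change of conformal representative\<close>

context
  fixes A :: "('m::topological_space, real^'i::finite) chart set"
    and \<Gamma> :: "('m, 'i) tensor3" and g :: "('m, 'i) tensor2" and \<eta> :: "('m, 'i) tensor1"
    and h :: "('m, 'i) tensor2" and f :: "'m \<Rightarrow> real"
  assumes cubic: "trace_free_cubic A \<Gamma> g \<eta>"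
    and f: "smooth_function A (carrier A) f" and f_pos: "\<And>p. p \<in> carrier A \<Longrightarrow> f p > 0"
    and h: "\<And>c p i j. c \<in> A \<Longrightarrow> p \<in> dom_chart c \<Longrightarrow> h c p i j = f p * g c p i j"
begin

lemma atlas: "smooth_atlas A" and metric: "pseudo_metric A g"
  using cubic by (auto simp: trace_free_cubic_def)

lemma f_pos': "c \<in> A \<Longrightarrow> p \<in> dom_chart c \<Longrightarrow> f p > 0"
  using f_pos by (auto simp: carrier_def)

lemma f_nonzero: "c \<in> A \<Longrightarrow> p \<in> dom_chart c \<Longrightarrow> f p \<noteq> 0"
  using f_pos' by fastforce

lemma metric_smooth: "c \<in> A \<Longrightarrow> smooth_in c (dom_chart c) (\<lambda>p. g c p i j)"
  using metric by (auto simp: pseudo_metric_def covariant2_def smooth_in_def)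

lemma conformal_metric: "pseudo_metric A h"
  unfolding pseudo_metric_def covariant2_def nondegenerate_def
proof (intro conjI ballI allI)
  fix c assume c: "c \<in> A"
  note R = atlas_chart_region[OF atlas c]
  have "smooth_in c (dom_chart c) (\<lambda>p. h c p i j)" for i j
    by (rule smooth_in_cong[OF R _ smooth_in_mult[OF R smooth_function_smooth_in[OF f c] metric_smooth[OF c, of i j]]])
      (simp add: h[OF c])
  then show "smooth_on (coords c ` dom_chart c) ((\<lambda>p. h c p i j) \<circ> inv_chart c)" for i j
    by (simp add: smooth_in_def)
  show "h c p i j = h c p j i" if "p \<in> dom_chart c" for p i j
    using h[OF c that] metric c that by (auto simp: pseudo_metric_def)
  show "invertible (gram h c p)" if p: "p \<in> dom_chart c" for p
    by (rule ginv_scale(1)[OF pseudo_metric_gram(1)[OF metric c p], where r = "f p"])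
      (use h[OF c p] f_pos'[OF c p] in auto)
  show "h c p i j = (\<Sum>k\<in>UNIV. \<Sum>l\<in>UNIV. pd c (\<lambda>q. coords d q $ k) i p * pd c (\<lambda>q. coords d q $ l) j p * h d p k l)"
    if d: "d \<in> A" and p: "p \<in> dom_chart c \<inter> dom_chart d" for d p i j
  proof -
    have "g c p i j = (\<Sum>k\<in>UNIV. \<Sum>l\<in>UNIV. pd c (\<lambda>q. coords d q $ k) i p * pd c (\<lambda>q. coords d q $ l) j p * g d p k l)"
      using metric p unfolding pseudo_metric_def by (intro covariant2_change[OF _ c d]) auto
    then show ?thesis using p by (simp add: h[OF c] h[OF d] sum_distrib_left mult_ac)
  qed
qed

text \<open>The added term is d log f, the correction that makes the cubic form scale by f.\<close>

definition conformal_form :: "('m, 'i) tensor1" where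
  "conformal_form c p i = \<eta> c p i + pd c f i p / f p"

lemma smooth_conformal_form: "c \<in> A \<Longrightarrow> smooth_in c (dom_chart c) (\<lambda>p. pd c f i p / f p)"
  by (intro smooth_in_divide smooth_in_pd atlas_chart_region[OF atlas] smooth_function_smooth_in[OF f] f_nonzero)

lemma one_form_conformal: "one_form A conformal_form"
  unfolding one_form_def
proof (intro conjI ballI allI)
  have \<eta>: "one_form A \<eta>" using cubic by (simp add: trace_free_cubic_def)
  fix c assume c: "c \<in> A"
  show "smooth_on (coords c ` dom_chart c) ((\<lambda>p. conformal_form c p i) \<circ> inv_chart c)" for i
    using smooth_in_add[OF atlas_chart_region[OF atlas c] one_form_smooth[OF \<eta> c] smooth_conformal_form[OF c]]
    by (simp add: conformal_form_def smooth_in_def)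
  show "conformal_form c p i = (\<Sum>j\<in>UNIV. pd c (\<lambda>q. coords d q $ j) i p * conformal_form d p j)"
    if d: "d \<in> A" and p: "p \<in> dom_chart c \<inter> dom_chart d" for d p i
  proof -
    have "\<eta> c p i = (\<Sum>j\<in>UNIV. pd c (\<lambda>q. coords d q $ j) i p * \<eta> d p j)"
      using p by (intro one_form_change[OF \<eta> c d]) auto
    moreover have "pd c f i p = (\<Sum>j\<in>UNIV. pd c (\<lambda>q. coords d q $ j) i p * pd d f j p)"
      by (rule pd_change_chart[OF atlas c d atlas_chart_region2[OF atlas c d]
          atlas_chart_region2[OF atlas d c, unfolded Int_commute[of "dom_chart d"]]
          smooth_in_subset[OF smooth_function_smooth_in[OF f d]] p]) auto
    ultimately show ?thesis
      by (simp add: conformal_form_def distrib_left sum.distrib sum_divide_distrib)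
  qed
qed

lemma cov2_conformal:
  assumes c: "c \<in> A" and p: "p \<in> dom_chart c"
  shows "cov2 \<Gamma> h c p i j k = pd c f i p * g c p j k + f p * cov2 \<Gamma> g c p i j k"
proof -
  note R = atlas_chart_region[OF atlas c]
  have "pd c (\<lambda>q. h c q j k) i p = pd c (\<lambda>q. f q * g c q j k) i p"
    by (rule pd_cong[OF R p]) (rule h[OF c])
  also have "\<dots> = pd c f i p * g c p j k + f p * pd c (\<lambda>q. g c q j k) i p"
    by (rule pd_mult[OF R p smooth_function_smooth_in[OF f c] metric_smooth[OF c]])
  finally show ?thesis
    by (simp add: cov2_def h[OF c p] sum_distrib_left right_diff_distrib mult_ac)
qed

text \<open>The cubic form is multiplied by f and the inverse metric divided by it, so symmetry and
  vanishing trace survive. Hence checking one representative establishes an AH structure.\<close>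

lemma trace_free_cubic_conformal: "trace_free_cubic A \<Gamma> h conformal_form"
proof -
  have X: "cubic_form \<Gamma> h conformal_form c p i j k = f p * cubic_form \<Gamma> g \<eta> c p i j k"
    if "c \<in> A" "p \<in> dom_chart c" for c p i j k
    using f_pos'[OF that]
    by (simp add: cubic_form_def cov2_conformal[OF that] conformal_form_def h[OF that] field_simps)
  have H: "ginv h c p j k = ginv g c p j k / f p" if "c \<in> A" "p \<in> dom_chart c" for c p j k
    using ginv_scale(2)[OF pseudo_metric_gram(1)[OF metric that]] f_pos'[OF that] h[OF that] by force
  have "(\<Sum>j\<in>UNIV. \<Sum>k\<in>UNIV. ginv h c p j k * cubic_form \<Gamma> h conformal_form c p i j k) =
      (\<Sum>j\<in>UNIV. \<Sum>k\<in>UNIV. ginv g c p j k * cubic_form \<Gamma> g \<eta> c p i j k)"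
    if "c \<in> A" "p \<in> dom_chart c" for c p i
    using f_pos'[OF that] by (intro sum.cong refl) (simp add: X[OF that] H[OF that])
  with X show ?thesis
    using cubic conformal_metric one_form_conformal unfolding trace_free_cubic_def by simp
qed

end

lemma trace_free_cubic_AH_structure:
  assumes "trace_free_cubic A \<Gamma> g \<eta>"
  shows "AH_structure A \<Gamma> g"
proof -
  have "(\<exists>\<eta>. AH_form A \<Gamma> h \<eta>) \<and> aligned A \<Gamma> h" if h: "h \<in> conformal_class A g" for h
  proof -
    obtain f where "smooth_function A (carrier A) f" "\<And>p. p \<in> carrier A \<Longrightarrow> f p > 0"
      "\<And>c p i j. c \<in> A \<Longrightarrow> p \<in> dom_chart c \<Longrightarrow> h c p i j = f p * g c p i j"
      using h by (auto simp: conformal_class_def)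
    from trace_free_cubic_conformal[OF assms this] show ?thesis
      using trace_free_cubic_AH_form trace_free_cubic_aligned by blast
  qed
  then show ?thesis using assms by (auto simp: AH_structure_def trace_free_cubic_def)
qed

section \<open>Uniqueness of the one-form and the Einstein condition\<close>

text \<open>The difference v of two such forms satisfies \<open>v i * g j k = v j * g i k\<close>;
  contraction with the inverse metric gives m v = v, hence v = 0 for m at least 2. This identifies
  the arbitrary one-forms over which the Einstein conditions quantify.\<close>

lemma AH_form_unique:
  fixes \<Gamma> :: "('m::topological_space, 'i::finite) tensor3"
  assumes "AH_form A \<Gamma> g \<eta>" "AH_form A \<Gamma> g \<zeta>" and g: "pseudo_metric A g" and n: "CARD('i) \<ge> 2"
    and c: "c \<in> A" and p: "p \<in> dom_chart c"
  shows "\<eta> c p i = \<zeta> c p i"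
proof -
  define v where "v i = \<eta> c p i - \<zeta> c p i" for i
  have h: "alt2 (\<lambda>i j. \<eta> c p i * g c p j k) i j = alt2 (\<lambda>i j. \<zeta> c p i * g c p j k) i j" for i j k
    using assms(1,2) c p by (auto simp: AH_form_def)
  have e: "v i * g c p j k = v j * g c p i k" for i j k
  proof -
    have "\<eta> c p i * g c p j k - \<eta> c p j * g c p i k = \<zeta> c p i * g c p j k - \<zeta> c p j * g c p i k"
      using h[of k i j] unfolding alt2_def divide_cancel_right by simp
    then show ?thesis unfolding v_def by algebra
  qed
  have "v i * real CARD('i) = (\<Sum>j\<in>UNIV. \<Sum>k\<in>UNIV. ginv g c p j k * (v i * g c p j k))"
    using pseudo_metric_contract(1)[OF g c p] by (simp add: sum_distrib_left mult_ac flip: sum_distrib_left)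
  also have "\<dots> = (\<Sum>j\<in>UNIV. \<Sum>k\<in>UNIV. ginv g c p j k * (v j * g c p k i))"
  proof (intro sum.cong refl)
    fix j k
    have "g c p i k = g c p k i" using g c p by (auto simp: pseudo_metric_def)
    then show "ginv g c p j k * (v i * g c p j k) = ginv g c p j k * (v j * g c p k i)"
      using e[of i j k] by simp
  qed
  also have "\<dots> = v i" by (rule pseudo_metric_contract(2)[OF g c p])
  finally have "v i * (real CARD('i) - 1) = 0" by (simp add: algebra_simps)
  then show ?thesis using n by (auto simp: v_def)
qed

text \<open>This is closedness of d log f, so the exterior derivative of the AH one-form does not
  change with the representative.\<close>

lemma pd_div_antisym:
  assumes R: "chart_region c U" and p: "p \<in> U" and f: "smooth_in c U f" "\<And>p. p \<in> U \<Longrightarrow> f p \<noteq> 0"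
  shows "pd c (\<lambda>q. pd c f j q / f q) i p = pd c (\<lambda>q. pd c f i q / f q) j p"
  unfolding divide_inverse
  by (simp add: pd_mult[OF R p] smooth_in_pd[OF R] smooth_in_inverse[OF R] f pd_inverse[OF R p] pd_commute[OF R p f(1), of i j])

text \<open>Passing to f g divides the scalar curvature and the divergence term by f and adds d log
  f to the one-form. The derivative of S/f cancels the new d log f term, so the whole expression is
  merely divided by f and one representative with constant scalar curvature suffices.\<close>

lemma einstein_AH_I:
  fixes \<Gamma> :: "('m::topological_space, 'i::finite) tensor3"
  assumes cubic: "trace_free_cubic A \<Gamma> g \<eta>" and n: "CARD('i) \<ge> 2" and naive: "naive_einstein A \<Gamma> g"
    and scal: "\<And>c p. c \<in> A \<Longrightarrow> p \<in> dom_chart c \<Longrightarrow> scal \<Gamma> g c p = S"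
    and div: "\<And>c p i. c \<in> A \<Longrightarrow> p \<in> dom_chart c \<Longrightarrow> S * \<eta> c p i
      + real CARD('i) / 2 * (\<Sum>a\<in>UNIV. \<Sum>b\<in>UNIV. ginv g c p a b * cov2 \<Gamma> (ext_deriv \<eta>) c p a b i) = 0"
  shows "einstein_AH A \<Gamma> g"
  unfolding einstein_AH_def
proof (intro conjI naive ballI allI impI)
  fix h \<zeta> c p i
  assume h: "h \<in> conformal_class A g" and \<zeta>: "AH_form A \<Gamma> h \<zeta>" and c: "c \<in> A" and p: "p \<in> dom_chart c"
  have at: "smooth_atlas A" and g: "pseudo_metric A g" and \<eta>1: "one_form A \<eta>"
    using cubic by (auto simp: trace_free_cubic_def)
  note R = atlas_chart_region[OF at c]
  obtain f where f: "smooth_function A (carrier A) f" "\<And>p. p \<in> carrier A \<Longrightarrow> f p > 0"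
    "\<And>c p i j. c \<in> A \<Longrightarrow> p \<in> dom_chart c \<Longrightarrow> h c p i j = f p * g c p i j"
    using h by (auto simp: conformal_class_def)
  have fp: "f p > 0" if "p \<in> dom_chart c" for p using f(2) c that by (auto simp: carrier_def)
  note fs = smooth_function_smooth_in[OF f(1) c]
  note ch = trace_free_cubic_conformal[OF cubic f]
  have \<zeta>_eq: "\<zeta> c p i = \<eta> c p i + pd c f i p / f p" if "p \<in> dom_chart c" for p i
    using AH_form_unique[OF \<zeta> trace_free_cubic_AH_form[OF ch] _ n c that] ch
    by (simp add: trace_free_cubic_def conformal_form_def[OF cubic f])
  have "pd c (\<lambda>q. \<zeta> c q j) i p = pd c (\<lambda>q. \<eta> c q j) i p + pd c (\<lambda>q. pd c f j q / f q) i p"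
    if p: "p \<in> dom_chart c" for p i j
  proof -
    have "pd c (\<lambda>q. \<zeta> c q j) i p = pd c (\<lambda>q. \<eta> c q j + pd c f j q / f q) i p"
      by (rule pd_cong[OF R p]) (rule \<zeta>_eq)
    also have "\<dots> = pd c (\<lambda>q. \<eta> c q j) i p + pd c (\<lambda>q. pd c f j q / f q) i p"
      using \<eta>1 c f_nonzero[OF cubic f c]
      by (intro pd_add[OF R p] smooth_in_divide[OF R] smooth_in_pd[OF R] fs)
        (auto simp: one_form_def smooth_in_def)
    finally show ?thesis .
  qed
  then have ext: "ext_deriv \<zeta> c p i j = ext_deriv \<eta> c p i j" if "p \<in> dom_chart c" for p i j
    using pd_div_antisym[OF R that fs, of i j] fp that by (force simp: ext_deriv_def)
  have cov: "cov2 \<Gamma> (ext_deriv \<zeta>) c p a b i = cov2 \<Gamma> (ext_deriv \<eta>) c p a b i" for a b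
    unfolding cov2_def using ext[OF p] pd_cong[OF R p ext] by simp
  have H: "ginv h c p a b = ginv g c p a b / f p" if "p \<in> dom_chart c" for p a b
    using ginv_scale(2)[OF pseudo_metric_gram(1)[OF g c that]] fp[OF that] f(3)[OF c that] by force
  have sc: "scal \<Gamma> h c q = S * inverse (f q)" if "q \<in> dom_chart c" for q
    unfolding scal[OF c that, symmetric] scal_def sum_distrib_right
    by (simp add: H[OF that] divide_inverse mult_ac)
  have "pd c (scal \<Gamma> h c) i p = pd c (\<lambda>q. S * inverse (f q)) i p"
    by (rule pd_cong[OF R p]) (rule sc)
  also have "\<dots> = - (S * (pd c f i p / (f p)\<^sup>2))"
    using fp by (subst pd_cmult[OF R p smooth_in_inverse[OF R fs]])
      (force, subst pd_inverse[OF R p fs], force, simp)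
  finally have ds: "pd c (scal \<Gamma> h c) i p = - (S * (pd c f i p / (f p)\<^sup>2))" .
  have "(\<Sum>a\<in>UNIV. \<Sum>b\<in>UNIV. ginv h c p a b * cov2 \<Gamma> (ext_deriv \<zeta>) c p a b i) =
      (\<Sum>a\<in>UNIV. \<Sum>b\<in>UNIV. ginv g c p a b * cov2 \<Gamma> (ext_deriv \<eta>) c p a b i) / f p"
    by (simp add: cov H[OF p] sum_divide_distrib)
  then have "pd c (scal \<Gamma> h c) i p + scal \<Gamma> h c p * \<zeta> c p i + real CARD('i) / 2 *
      (\<Sum>a\<in>UNIV. \<Sum>b\<in>UNIV. ginv h c p a b * cov2 \<Gamma> (ext_deriv \<zeta>) c p a b i) =
      (S * \<eta> c p i + real CARD('i) / 2 * (\<Sum>a\<in>UNIV. \<Sum>b\<in>UNIV. ginv g c p a b * cov2 \<Gamma> (ext_deriv \<eta>) c p a b i)) / f p"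
    using fp[OF p] by (simp add: ds sc[OF p] \<zeta>_eq[OF p] field_simps power2_eq_square)
  then show "pd c (scal \<Gamma> h c) i p + scal \<Gamma> h c p * \<zeta> c p i + real CARD('i) / 2 *
      (\<Sum>a\<in>UNIV. \<Sum>b\<in>UNIV. ginv h c p a b * cov2 \<Gamma> (ext_deriv \<zeta>) c p a b i) = 0"
    by (simp only: div[OF c p] div_0)
qed

section \<open>Transformation law of a framed connection\<close>

lemma coframe_change:
  assumes A: "smooth_atlas A" "c \<in> A" "d \<in> A" and \<beta>: "one_form A \<beta>"
    and W: "chart_region c W" "chart_region d W" and \<rho>: "\<And>i. smooth_in d W (\<lambda>q. coords b (\<rho> q) $ i)"
    and q: "q \<in> W"
  shows "coframe b \<rho> \<beta> c q = (\<chi> I J. pd c (\<lambda>r. coords d r $ J) I q) ** coframe b \<rho> \<beta> d q"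
proof (simp only: vec_eq_iff, intro allI)
  fix I Z
  have "q \<in> dom_chart c" "q \<in> dom_chart d" using W q by (auto simp: chart_region_def)
  then have "\<beta> c q I = (\<Sum>J\<in>UNIV. pd c (\<lambda>r. coords d r $ J) I q * \<beta> d q J)"
    by (rule one_form_change[OF \<beta> A(2,3)])
  then show "coframe b \<rho> \<beta> c q $ I $ Z =
      ((\<chi> I J. pd c (\<lambda>r. coords d r $ J) I q) ** coframe b \<rho> \<beta> d q) $ I $ Z"
    using pd_change_chart[OF A W \<rho> q] by (cases Z) (simp_all add: matrix_mult_component)
qed

text \<open>If both charts see the same frame coefficients F, the inhomogeneous part of the change
  of connection matrices is forced by the change of coframes, which is the Jacobian. Cancelling the
  invertible coframe leaves the affine transformation law.\<close>

lemma framed_transformation: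
  fixes D :: "('p::topological_space, 'n::finite option) tensor3"
  assumes A: "smooth_atlas A" and c: "c \<in> A" and d: "d \<in> A" and \<beta>: "one_form A \<beta>"
    and W: "chart_region c W" "chart_region d W" and \<rho>: "\<And>i. smooth_in d W (\<lambda>q. coords b (\<rho> q) $ i)"
    and q: "q \<in> W" and inv: "invertible (coframe b \<rho> \<beta> d q)"
    and fc: "connM D c q I ** coframe b \<rho> \<beta> c q = pdM c (coframe b \<rho> \<beta> c) I q
      + coframe b \<rho> \<beta> c q ** (\<Sum>B\<in>UNIV. coframe b \<rho> \<beta> c q $ I $ B *\<^sub>R F B)"
    and fd: "\<And>I. connM D d q I ** coframe b \<rho> \<beta> d q = pdM d (coframe b \<rho> \<beta> d) I q
      + coframe b \<rho> \<beta> d q ** (\<Sum>B\<in>UNIV. coframe b \<rho> \<beta> d q $ I $ B *\<^sub>R F B)"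
  shows "(\<Sum>K\<in>UNIV. D c q I J K * pd c (\<lambda>q. coords d q $ L) K q) =
    pd c (pd c (\<lambda>q. coords d q $ L) J) I q + (\<Sum>a\<in>UNIV. \<Sum>b\<in>UNIV.
      D d q a b L * pd c (\<lambda>q. coords d q $ a) I q * pd c (\<lambda>q. coords d q $ b) J q)"
proof -
  let ?Mc = "coframe b \<rho> \<beta> c" and ?Md = "coframe b \<rho> \<beta> d"
  let ?P = "\<lambda>q. \<chi> I J. pd c (\<lambda>r. coords d r $ J) I q"
  have WW: "W \<subseteq> dom_chart c \<inter> dom_chart d" using W by (auto simp: chart_region_def)
  have sP: "smoothM c W ?P"
    unfolding smoothM_def using WW
    by (auto intro!: smooth_in_pd[OF W(1)] intro: smooth_in_subset[OF atlas_coords_smooth[OF A c d]])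
  have sMd: "smoothM d W ?Md"
    unfolding smoothM_def
  proof (intro allI)
    fix I Z
    have "smooth_in d W (\<lambda>q. \<beta> d q I)"
      by (rule smooth_in_subset[where U = "dom_chart d"]) (use \<beta> d WW in \<open>auto simp: one_form_def smooth_in_def\<close>)
    then show "smooth_in d W (\<lambda>q. ?Md q $ I $ Z)"
      using smooth_in_pd[OF W(2) \<rho>] by (cases Z) auto
  qed
  have sMd': "smoothM c W ?Md"
    using sMd smooth_in_change_chart[OF A c d W] by (auto simp: smoothM_def)
  have "pdM c ?Mc I q = pdM c (\<lambda>q. ?P q ** ?Md q) I q"
    by (rule pdM_cong[OF W(1) q]) (rule coframe_change[OF A c d \<beta> W \<rho>])
  also have "\<dots> = pdM c ?P I q ** ?Md q + ?P q ** pdM c ?Md I q"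
    by (rule pdM_mult[OF W(1) q sP sMd'])
  also have "pdM c ?Md I q = (\<Sum>J\<in>UNIV. ?P q $ I $ J *\<^sub>R pdM d ?Md J q)"
    using pd_change_chart[OF A c d W smoothMD[OF sMd] q] by (simp add: pdM_def vec_eq_iff)
  finally have dM: "pdM c ?Mc I q = pdM c ?P I q ** ?Md q + ?P q ** (\<Sum>J\<in>UNIV. ?P q $ I $ J *\<^sub>R pdM d ?Md J q)" .
  have Mc: "?Mc q = ?P q ** ?Md q" by (rule coframe_change[OF A c d \<beta> W \<rho> q])
  define Y where "Y J = (\<Sum>B\<in>UNIV. ?Md q $ J $ B *\<^sub>R F B)" for J
  have "(\<Sum>B\<in>UNIV. ?Mc q $ I $ B *\<^sub>R F B) = (\<Sum>J\<in>UNIV. ?P q $ I $ J *\<^sub>R Y J)"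
    unfolding Mc Y_def matrix_mult_component scaleR_sum_left scaleR_sum_right by (subst sum.swap) simp
  then have 1: "connM D c q I ** (?P q ** ?Md q) =
      pdM c ?P I q ** ?Md q + ?P q ** (\<Sum>J\<in>UNIV. ?P q $ I $ J *\<^sub>R pdM d ?Md J q)
      + (?P q ** ?Md q) ** (\<Sum>J\<in>UNIV. ?P q $ I $ J *\<^sub>R Y J)"
    using fc unfolding dM by (simp only: Mc)
  have fd': "connM D d q J ** ?Md q = pdM d ?Md J q + ?Md q ** Y J" for J
    unfolding Y_def by (rule fd)
  have 2: "(\<Sum>J\<in>UNIV. ?P q $ I $ J *\<^sub>R connM D d q J) ** ?Md q =
      (\<Sum>J\<in>UNIV. ?P q $ I $ J *\<^sub>R pdM d ?Md J q) + ?Md q ** (\<Sum>J\<in>UNIV. ?P q $ I $ J *\<^sub>R Y J)"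
    unfolding matrix_sum_left matrix_sum_right matrix_scaleR_left matrix_scaleR_right fd'
    by (simp only: scaleR_add_right sum.distrib)
  have "(connM D c q I ** ?P q) ** ?Md q =
      (pdM c ?P I q + ?P q ** (\<Sum>J\<in>UNIV. ?P q $ I $ J *\<^sub>R connM D d q J)) ** ?Md q"
    unfolding matrix_add_rdistrib matrix_mul_assoc[symmetric] 1 2 matrix_add_ldistrib by simp
  then have "connM D c q I ** ?P q = pdM c ?P I q + ?P q ** (\<Sum>J\<in>UNIV. ?P q $ I $ J *\<^sub>R connM D d q J)"
    by (rule matrix_right_cancel[OF matrix_inv_right[OF inv]])
  then have "(connM D c q I ** ?P q) $ J $ L = (pdM c ?P I q + ?P q ** (\<Sum>J\<in>UNIV. ?P q $ I $ J *\<^sub>R connM D d q J)) $ J $ L"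
    by simp
  moreover have "(?P q ** (\<Sum>J\<in>UNIV. ?P q $ I $ J *\<^sub>R connM D d q J)) $ J $ L =
      (\<Sum>b\<in>UNIV. \<Sum>a\<in>UNIV. D d q a b L * pd c (\<lambda>q. coords d q $ a) I q * pd c (\<lambda>q. coords d q $ b) J q)"
    by (simp add: matrix_mult_component connM_component sum_distrib_left mult_ac)
  moreover have "\<dots> = (\<Sum>a\<in>UNIV. \<Sum>b\<in>UNIV. D d q a b L * pd c (\<lambda>q. coords d q $ a) I q * pd c (\<lambda>q. coords d q $ b) J q)"
    by (rule sum.swap)
  ultimately show ?thesis
    by (simp add: matrix_mult_component connM_component pdM_def)
qed

section \<open>Local geometry of a principal bundle\<close>

text \<open>The chain rule along a map \<sigma> into coordinates when the composite with f is known
  explicitly near the point. With a coordinate of \<rho> as f it computes how the velocities of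
  sections and orbits project to the base.\<close>

lemma pd_along:
  fixes \<sigma> :: "'a::euclidean_space \<Rightarrow> real^'k::finite"
  assumes f: "smooth_in c U f" and q: "q \<in> U" and \<sigma>: "\<sigma> x = coords c q" "\<sigma> differentiable (at x)"
    and ev: "\<forall>\<^sub>F y in nhds x. f (inv_chart c (\<sigma> y)) = \<phi> y" and \<phi>: "(\<phi> has_derivative \<phi>') (at x)"
  shows "\<phi>' v = (\<Sum>I\<in>UNIV. frechet_derivative (\<lambda>y. \<sigma> y $ I) (at x) v * pd c f I q)"
proof -
  have "(\<lambda>z. f (inv_chart c z)) differentiable (at (\<sigma> x))"
    using smooth_in_has_derivative[OF f q] \<sigma>(1) by (auto simp: differentiable_def)
  moreover have "(\<lambda>y. \<sigma> y $ I) differentiable (at x)" for I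
    using \<sigma>(2) bounded_linear.has_derivative[OF bounded_linear_vec_nth] unfolding differentiable_def by blast
  ultimately have h: "((\<lambda>y. f (inv_chart c (\<sigma> y))) has_derivative (\<lambda>v. \<Sum>I\<in>UNIV.
      frechet_derivative (\<lambda>y. \<sigma> y $ I) (at x) v *
      frechet_derivative (\<lambda>z. f (inv_chart c z)) (at (\<sigma> x)) (axis I 1))) (at x)"
    by (rule has_derivative_compose_axis_sum[where f = "\<lambda>z. f (inv_chart c z)"])
  obtain S where S: "open S" "x \<in> S" "\<And>y. y \<in> S \<Longrightarrow> f (inv_chart c (\<sigma> y)) = \<phi> y"
    using ev by (auto simp: eventually_nhds)
  have "(\<phi> has_derivative (\<lambda>v. \<Sum>I\<in>UNIV. frechet_derivative (\<lambda>y. \<sigma> y $ I) (at x) v *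
      frechet_derivative (\<lambda>z. f (inv_chart c z)) (at (\<sigma> x)) (axis I 1))) (at x)"
    by (rule has_derivative_transform_within_open[OF h S])
  from has_derivative_unique[OF \<phi> this] show ?thesis
    by (simp add: \<sigma>(1) pd_def o_def)
qed

section \<open>The structure groups and their exponential charts\<close>

lemma group_exp_0: "group_exp K 0 = 1"
  by (cases K) auto

lemma group_carrier_exp:
  assumes "z \<in> group_carrier K"
  shows "group_exp K t * z \<in> group_carrier K"
proof (cases K)
  case Circle
  then show ?thesis using assms by (simp add: norm_mult)
next
  case Nonzero_Reals
  then obtain r where "r \<noteq> 0" "z = complex_of_real r" using assms by auto
  then have "group_exp K t * z = complex_of_real (exp t * r)" "exp t * r \<noteq> 0"
    using Nonzero_Reals by auto
  then show ?thesis using Nonzero_Reals by (metis (mono_tags) group_carrier.simps(2) imageI mem_Collect_eq)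
qed

lemma group_carrier_nonzero: "z \<in> group_carrier K \<Longrightarrow> z \<noteq> 0"
  by (cases K) auto

text \<open>On the circle two parameters with the same image differ by a multiple of 2 pi, which
  exceeds the length 2 of the interval.\<close>

lemma inj_on_group_exp:
  assumes "z \<noteq> 0"
  shows "inj_on (\<lambda>t. group_exp K t * z) {-1<..<1}"
proof (rule inj_onI)
  fix s t :: real assume st: "s \<in> {-1<..<1}" "t \<in> {-1<..<1}" and "group_exp K s * z = group_exp K t * z"
  then have e: "group_exp K s = group_exp K t" using assms by simp
  show "s = t"
  proof (cases K)
    case Circle
    then obtain n :: int where "\<i> * complex_of_real s = \<i> * complex_of_real t + (of_int (2 * n) * pi) * \<i>"
      using e by (auto simp: exp_eq)
    then have "\<i> * complex_of_real s = \<i> * complex_of_real (t + 2 * of_int n * pi)"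
      by (simp add: algebra_simps)
    then have "complex_of_real s = complex_of_real (t + 2 * of_int n * pi)"
      by (simp only: mult_cancel_left) simp
    then have s: "s = t + 2 * of_int n * pi" by (simp only: of_real_eq_iff)
    have "n = 0"
    proof (rule ccontr)
      assume "n \<noteq> 0"
      then have "1 \<le> \<bar>of_int n :: real\<bar>" by linarith
      then have "2 * 1 * pi \<le> 2 * \<bar>of_int n\<bar> * pi" using pi_gt_zero by (intro mult_right_mono) auto
      then have "2 * pi \<le> \<bar>2 * of_int n * pi\<bar>" using pi_gt_zero by (simp add: abs_mult)
      moreover have "\<bar>2 * of_int n * pi\<bar> < 2" using s st by auto
      ultimately show False using pi_gt3 by linarith
    qed
    then show ?thesis using s by simp
  next
    case Nonzero_Reals
    then show ?thesis using e by simp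
  qed
qed

lemma carrier_group_atlas: "carrier (group_atlas K) = group_carrier K"
proof
  show "carrier (group_atlas K) \<subseteq> group_carrier K"
    by (auto simp: carrier_def group_atlas_def group_carrier_exp)
  show "group_carrier K \<subseteq> carrier (group_atlas K)"
  proof
    fix z assume "z \<in> group_carrier K"
    moreover have "z \<in> (\<lambda>t. group_exp K t * z) ` {-1<..<1}"
      by (rule image_eqI[of _ _ 0]) (auto simp: group_exp_0)
    ultimately show "z \<in> carrier (group_atlas K)" unfolding carrier_def group_atlas_def by auto
  qed
qed

lemma carrier_restrict_atlas: "carrier (restrict_atlas A S) = carrier A \<inter> S"
  by (auto simp: carrier_def restrict_atlas_def)

lemma carrier_prod_atlas: "carrier (prod_atlas A B) = carrier A \<times> carrier B"
  by (force simp: carrier_def prod_atlas_def)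

lemma continuous_on_group_exp: "continuous_on S (group_exp K)"
proof (cases K)
  case Circle
  then have "group_exp K = (\<lambda>t. exp (\<i> * complex_of_real t))" by auto
  then show ?thesis by (auto intro!: continuous_intros)
next
  case Nonzero_Reals
  then have "group_exp K = (\<lambda>t. complex_of_real (exp t))" by auto
  then show ?thesis by (auto intro!: continuous_intros)
qed

lemma smooth_map_components:
  assumes "smooth_atlas A" "smooth_atlas B" "smooth_map A B \<rho>" "c \<in> A" "b \<in> B"
  shows "chart_region c (dom_chart c \<inter> \<rho> -` dom_chart b)"
    "smooth_in c (dom_chart c \<inter> \<rho> -` dom_chart b) (\<lambda>q. coords b (\<rho> q) $ i)"
proof -
  have "continuous_on (dom_chart c) \<rho>" "\<rho> ` dom_chart c \<subseteq> carrier B"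
    using assms(3,4) by (auto simp: smooth_map_def carrier_def intro: continuous_on_subset)
  moreover have "openin (top_of_set (carrier B)) (dom_chart b)"
    using assms(2,5) by (auto simp: smooth_atlas_def open_in_def)
  ultimately have "openin (top_of_set (dom_chart c)) (dom_chart c \<inter> \<rho> -` dom_chart b)"
    by (metis continuous_on_open_gen image_subset_iff_funcset)
  then show R: "chart_region c (dom_chart c \<inter> \<rho> -` dom_chart b)"
    by (rule open_in_chart_image[OF assms(1,4)])
  have "smooth_on (coords c ` (dom_chart c \<inter> \<rho> -` dom_chart b)) (coords b \<circ> \<rho> \<circ> inv_chart c)"
    using assms(3-5) by (auto simp: smooth_map_def)
  from smooth_on_component[OF chart_region_open[OF R] this]
  show "smooth_in c (dom_chart c \<inter> \<rho> -` dom_chart b) (\<lambda>q. coords b (\<rho> q) $ i)"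
    by (simp add: smooth_in_def o_def)
qed

section \<open>Frames from local trivializations\<close>

text \<open>Fixing the group coordinate in an inverse trivialization gives a local section through
  q, and its velocities project to the coordinate vectors of the base. Fixing the base point gives
  the orbit of q; its velocity is the fundamental field, and \<rho> is constant along it.\<close>

lemma principal_bundle_frame:
  fixes AM :: "('m::{t2_space,second_countable_topology}, real^'n::finite) chart set"
    and AN :: "('p::{t2_space,second_countable_topology}, real^'k::finite) chart set"
  assumes AM: "smooth_atlas AM" and AN: "smooth_atlas AN" and P: "principal_bundle K AM AN \<rho> act"
    and c: "c \<in> AN" and b: "b \<in> AM" and q: "q \<in> dom_chart c" "\<rho> q \<in> dom_chart b"
  shows "\<exists>L. \<forall>k i. (\<Sum>I\<in>UNIV. L k I * pd c (\<lambda>r. coords b (\<rho> r) $ i) I q) = (if i = k then 1 else 0)"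
    and "(\<Sum>I\<in>UNIV. fundamental_field K act c q I * pd c (\<lambda>r. coords b (\<rho> r) $ i) I q) = 0"
proof -
  have \<rho>: "smooth_map AN AM \<rho>" and act: "smooth_map (prod_atlas (group_atlas K) AN) AN (\<lambda>(z, q). act z q)"
    and \<rho>_act: "z \<in> group_carrier K \<Longrightarrow> y \<in> carrier AN \<Longrightarrow> \<rho> (act z y) = \<rho> y" for z y
    using P by (auto simp: principal_bundle_def)
  have qN: "q \<in> carrier AN" and qM: "\<rho> q \<in> carrier AM" using c b q by (auto simp: carrier_def)
  obtain W \<tau> where W: "open_in AM W" "\<rho> q \<in> W"
    and dif: "diffeomorphism (restrict_atlas AN (carrier AN \<inter> \<rho> -` W))
      (prod_atlas (restrict_atlas AM W) (group_atlas K)) (\<lambda>q. (\<rho> q, \<tau> q))"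
    and \<tau>_act: "\<And>z y. z \<in> group_carrier K \<Longrightarrow> y \<in> carrier AN \<inter> \<rho> -` W \<Longrightarrow> \<tau> (act z y) = z * \<tau> y"
    using P qM unfolding principal_bundle_def by (auto 0 3)
  define A' where "A' = restrict_atlas AN (carrier AN \<inter> \<rho> -` W)"
  define B' where "B' = prod_atlas (restrict_atlas AM W) (group_atlas K)"
  define \<Psi> where "\<Psi> = (\<lambda>q. (\<rho> q, \<tau> q))"
  define f where "f = inv_into (carrier A') \<Psi>"
  have cA': "carrier A' = carrier AN \<inter> \<rho> -` W" by (auto simp: A'_def carrier_restrict_atlas)
  have cB': "carrier B' = (carrier AM \<inter> W) \<times> group_carrier K"
    by (simp add: B'_def carrier_prod_atlas carrier_restrict_atlas carrier_group_atlas)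
  have bij: "bij_betw \<Psi> (carrier A') (carrier B')" and f: "smooth_map B' A' f"
    using dif by (auto simp: diffeomorphism_def A'_def B'_def \<Psi>_def f_def)
  have f\<Psi>: "f (\<Psi> y) = y" if "y \<in> carrier A'" for y
    using bij that by (simp add: f_def bij_betw_def)
  have \<Psi>f: "\<Psi> (f w) = w" and fA: "f w \<in> carrier A'" if "w \<in> carrier B'" for w
    using bij that by (auto simp: f_def bij_betw_def intro: f_inv_into_f inv_into_into)
  have bM: "dom_chart b \<subseteq> carrier AM" using b by (auto simp: carrier_def)
  have qA: "q \<in> carrier A'" using qN W by (simp add: cA')
  define z where "z = \<tau> q"
  have z: "z \<in> group_carrier K"
    using bij qA unfolding bij_betw_def \<Psi>_def cB' z_def by auto
  define e where "e t = group_exp K t * z" for t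
  have e0: "e 0 = z" by (simp add: e_def group_exp_0)
  have inj_e: "inj_on e {-1<..<1}"
    unfolding e_def[abs_def] by (rule inj_on_group_exp[OF group_carrier_nonzero[OF z]])
  \<comment> \<open>The charts of the restricted and the product atlas in which the smoothness of
    the inverse trivialization f is read. The group chart is centred at z, so q corresponds to
    (\<xi>, 0).\<close>
  define c' where "c' = (dom_chart c \<inter> (carrier AN \<inter> \<rho> -` W), coords c)"
  define pc where "pc = ((dom_chart b \<inter> W) \<times> e ` {-1<..<1}, map_prod (coords b) (inv_into {-1<..<1} e))"
  have c'A: "c' \<in> A'" using c by (auto simp: A'_def c'_def restrict_atlas_def)
  have pcB: "pc \<in> B'"
  proof -
    have "(dom_chart b \<inter> W, coords b) \<in> restrict_atlas AM W"
      using b by (auto simp: restrict_atlas_def)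
    moreover have "(e ` {-1<..<1}, inv_into {-1<..<1} e) \<in> group_atlas K"
      unfolding group_atlas_def e_def[abs_def] using z by (rule image_eqI[rotated]) simp
    ultimately show ?thesis unfolding B'_def prod_atlas_def pc_def
      by (intro image_eqI[where x = "((dom_chart b \<inter> W, coords b), (e ` {-1<..<1}, inv_into {-1<..<1} e))"]) auto
  qed
  note Rb = atlas_chart_region_Int[OF AM b W(1)]
  define B where "B = coords b ` (dom_chart b \<inter> W)"
  have openB: "open B" unfolding B_def by (rule chart_region_open[OF Rb])
  define \<xi> where "\<xi> = coords b (\<rho> q)"
  have \<xi>B: "\<xi> \<in> B" using q W by (auto simp: B_def \<xi>_def)
  have inv_b: "inv_chart b x \<in> dom_chart b \<inter> W" "coords b (inv_chart b x) = x" if "x \<in> B" for x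
    using that by (auto simp: B_def inv_chart_coords[OF Rb])
  have inv_pc: "inv_chart pc (x, t) = (inv_chart b x, e t)" if "x \<in> B" "t \<in> {-1<..<1}" for x t
    unfolding inv_chart_def[of pc]
  proof (rule inv_into_f_eq)
    have "inj_on (coords b) (dom_chart b \<inter> W)"
      using Rb by (auto simp: chart_region_def intro: inj_on_subset)
    then show "inj_on (coords pc) (dom_chart pc)"
      using inj_on_inv_into[of "e ` {-1<..<1}" e "{-1<..<1}"] by (auto simp: pc_def intro: map_prod_inj_on)
    show "(inv_chart b x, e t) \<in> dom_chart pc" "coords pc (inv_chart b x, e t) = (x, t)"
      using inv_b[OF that(1)] that(2) inv_into_f_f[OF inj_e that(2)] by (auto simp: pc_def)
  qed
  define \<Phi> where "\<Phi> = coords c \<circ> f \<circ> inv_chart pc"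
  have \<Psi>q: "\<Psi> q = (\<rho> q, z)" by (simp add: \<Psi>_def z_def)
  have fq: "f (\<rho> q, z) = q" using f\<Psi>[OF qA] by (simp add: \<Psi>q)
  have diff: "\<Phi> differentiable (at (\<xi>, 0))"
  proof -
    have "smooth_on (coords pc ` (dom_chart pc \<inter> f -` dom_chart c')) (coords c' \<circ> f \<circ> inv_chart pc)"
      using f c'A pcB by (auto simp: smooth_map_def)
    then have "Ck_on (Suc 0) (coords pc ` (dom_chart pc \<inter> f -` dom_chart c')) \<Phi>"
      unfolding smooth_on_def \<Phi>_def by (simp only: c'_def snd_conv)
    moreover have "(\<xi>, 0) \<in> coords pc ` (dom_chart pc \<inter> f -` dom_chart c')"
    proof (rule image_eqI[of _ _ "(\<rho> q, z)"])
      show "(\<xi>, 0) = coords pc (\<rho> q, z)"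
        using inv_into_f_f[OF inj_e, of 0] by (simp add: pc_def \<xi>_def e0)
      have "z \<in> e ` {-1<..<1}" by (rule image_eqI[of _ _ 0]) (auto simp: e0)
      then show "(\<rho> q, z) \<in> dom_chart pc \<inter> f -` dom_chart c'"
        using q W qN by (simp add: pc_def fq c'_def)
    qed
    ultimately show ?thesis using Ck_on_Suc_has_derivative unfolding differentiable_def by blast
  qed
  obtain O' where O': "open O'" "dom_chart c = carrier AN \<inter> O'"
    using AN c by (auto simp: smooth_atlas_def open_in_def openin_open)
  have cont_f: "continuous_on (carrier B') f" using f by (simp add: smooth_map_def)
  \<comment> \<open>Evaluating through \<open>inv_chart c\<close> is meaningful only inside the
    domain of c. That domain is relatively open, so by continuity of f the points stay in it near
    q.\<close>
  have dom: "\<forall>\<^sub>F y in nhds x0. f (w y) \<in> dom_chart c"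
    if w: "continuous_on S w" "open S" "x0 \<in> S" "w ` S \<subseteq> carrier B'" "w x0 = (\<rho> q, z)"
    for w :: "'x::topological_space \<Rightarrow> 'm \<times> complex" and S x0
  proof -
    have "continuous_on S (\<lambda>y. f (w y))"
      by (rule continuous_on_compose2[OF cont_f w(1,4)])
    then have "open ((\<lambda>y. f (w y)) -` O' \<inter> S)"
      using w(2) O'(1) by (simp add: continuous_on_open_vimage)
    moreover have "x0 \<in> (\<lambda>y. f (w y)) -` O' \<inter> S"
      using w(3,5) q O'(2) by (auto simp: fq)
    moreover have "f (w y) \<in> dom_chart c" if "y \<in> (\<lambda>y. f (w y)) -` O' \<inter> S" for y
      using that fA[of "w y"] w(4) O'(2) by (auto simp: cA')
    ultimately show ?thesis unfolding eventually_nhds by blast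
  qed
  note sc = smooth_map_components[OF AN AM \<rho> c b]
  have qU: "q \<in> dom_chart c \<inter> \<rho> -` dom_chart b" using q by simp
  have \<Phi>0: "\<Phi> (\<xi>, 0) = coords c q"
    using \<xi>B inv_chart_coords[OF Rb, of "\<rho> q"] q W by (simp add: \<Phi>_def inv_pc e0 \<xi>_def fq)
  have inv_c: "inv_chart c (coords c y) = y" if "y \<in> dom_chart c" for y
    using inv_chart_coords[OF atlas_chart_region[OF AN c] that] .
  show "\<exists>L. \<forall>k i. (\<Sum>I\<in>UNIV. L k I * pd c (\<lambda>r. coords b (\<rho> r) $ i) I q) = (if i = k then 1 else 0)"
  proof (intro exI allI)
    fix k i
    have ev: "\<forall>\<^sub>F y in nhds \<xi>. f (inv_chart b y, z) \<in> dom_chart c"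
    proof (rule dom[of B])
      have "continuous_on (coords b ` dom_chart b) (inv_chart b)"
        using AM b by (auto simp: smooth_atlas_def homeomorphism_def)
      then have "continuous_on B (inv_chart b)"
        by (rule continuous_on_subset) (auto simp: B_def)
      then show "continuous_on B (\<lambda>y. (inv_chart b y, z))" by (intro continuous_intros)
      show "(\<lambda>y. (inv_chart b y, z)) ` B \<subseteq> carrier B'"
        using inv_b z bM by (auto simp: cB')
      show "(inv_chart b \<xi>, z) = (\<rho> q, z)" using inv_chart_coords[OF Rb, of "\<rho> q"] q W by (simp add: \<xi>_def)
    qed (use openB \<xi>B in auto)
    have "(\<lambda>y. y $ i) (axis k 1) = (\<Sum>I\<in>UNIV. frechet_derivative (\<lambda>y. \<Phi> (y, 0) $ I) (at \<xi>) (axis k 1) *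
        pd c (\<lambda>r. coords b (\<rho> r) $ i) I q)"
    proof (rule pd_along[OF sc(2) qU])
      show "\<Phi> (\<xi>, 0) = coords c q" by (rule \<Phi>0)
      have "((\<lambda>y. (y, 0)) has_derivative (\<lambda>v. (v, 0))) (at \<xi>)"
        by (auto intro!: derivative_eq_intros)
      from diff_chain_at[OF this diff[unfolded frechet_derivative_works]]
      show "(\<lambda>y. \<Phi> (y, 0)) differentiable (at \<xi>)" by (auto simp: differentiable_def o_def)
      show "((\<lambda>y. y $ i) has_derivative (\<lambda>y. y $ i)) (at \<xi>)"
        by (rule bounded_linear_imp_has_derivative) (rule bounded_linear_vec_nth)
      have "\<forall>\<^sub>F y in nhds \<xi>. y \<in> B" using openB \<xi>B by (rule eventually_nhds_in_open)
      with ev show "\<forall>\<^sub>F y in nhds \<xi>. coords b (\<rho> (inv_chart c (\<Phi> (y, 0)))) $ i = y $ i"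
      proof eventually_elim
        case (elim y)
        have "(inv_chart b y, z) \<in> carrier B'" using inv_b[OF elim(2)] z bM by (auto simp: cB')
        then have "\<rho> (f (inv_chart b y, z)) = inv_chart b y" using \<Psi>f by (metis \<Psi>_def fst_conv)
        then show ?case using elim inv_b[OF elim(2)] by (simp add: \<Phi>_def inv_pc e0 inv_c)
      qed
    qed
    then show "(\<Sum>I\<in>UNIV. frechet_derivative (\<lambda>y. \<Phi> (y, 0) $ I) (at \<xi>) (axis k 1) *
        pd c (\<lambda>r. coords b (\<rho> r) $ i) I q) = (if i = k then 1 else 0)"
      by (simp add: axis_def)
  qed
  \<comment> \<open>Equivariance of \<tau> identifies the curve that varies the group coordinate
    with the orbit through q.\<close>
  have act_curve: "f (\<rho> q, e t) = act (group_exp K t) q" for t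
  proof -
    have g: "group_exp K t \<in> group_carrier K"
      using group_carrier_exp[of 1 K t] by (cases K) auto
    have "act (group_exp K t) q \<in> carrier AN"
      using act g qN by (auto simp: smooth_map_def carrier_prod_atlas carrier_group_atlas)
    then have "act (group_exp K t) q \<in> carrier A'" "\<Psi> (act (group_exp K t) q) = (\<rho> q, e t)"
      using \<rho>_act[OF g qN] \<tau>_act[OF g, of q] W qN by (auto simp: cA' \<Psi>_def e_def z_def)
    then show ?thesis using f\<Psi> by metis
  qed
  show "(\<Sum>I\<in>UNIV. fundamental_field K act c q I * pd c (\<lambda>r. coords b (\<rho> r) $ i) I q) = 0"
  proof -
    have B'e: "(\<rho> q, e t) \<in> carrier B'" for t
      using qM W group_carrier_exp[OF z] by (simp add: cB' e_def)
    have ev: "\<forall>\<^sub>F t in nhds 0. f (\<rho> q, e t) \<in> dom_chart c"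
    proof (rule dom[of UNIV])
      show "continuous_on UNIV (\<lambda>t. (\<rho> q, e t))"
        unfolding e_def by (intro continuous_intros continuous_on_group_exp)
    qed (use B'e e0 in auto)
    have ev1: "\<forall>\<^sub>F t in nhds 0. t \<in> {-1<..<1::real}" by (rule eventually_nhds_in_open) auto
    have \<Phi>t: "\<Phi> (\<xi>, t) = coords c (act (group_exp K t) q)" if "t \<in> {-1<..<1}" for t
      using \<xi>B inv_chart_coords[OF Rb, of "\<rho> q"] q W that
      by (simp add: \<Phi>_def inv_pc \<xi>_def act_curve del: greaterThanLessThan_iff)
    have "((\<lambda>t. (\<xi>, t)) has_derivative (\<lambda>v. (0, v))) (at 0)"
      by (auto intro!: derivative_eq_intros)
    from diff_chain_at[OF this diff[unfolded frechet_derivative_works]]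
    have d\<Phi>: "(\<lambda>t. \<Phi> (\<xi>, t)) differentiable (at 0)" by (auto simp: differentiable_def o_def)
    have "(\<lambda>v. 0) 1 = (\<Sum>I\<in>UNIV. frechet_derivative (\<lambda>t. \<Phi> (\<xi>, t) $ I) (at 0) 1 *
        pd c (\<lambda>r. coords b (\<rho> r) $ i) I q)"
    proof (rule pd_along[OF sc(2) qU \<Phi>0 d\<Phi> _ has_derivative_const])
      show "\<forall>\<^sub>F t in nhds 0. coords b (\<rho> (inv_chart c (\<Phi> (\<xi>, t)))) $ i = \<xi> $ i"
        using ev ev1
      proof eventually_elim
        case (elim t)
        have "\<rho> (f (\<rho> q, e t)) = \<rho> q" using \<Psi>f[OF B'e] by (metis \<Psi>_def fst_conv)
        then show ?case using elim by (simp add: \<Phi>t inv_c act_curve[symmetric] del: greaterThanLessThan_iff) (simp add: \<xi>_def)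
      qed
    qed
    moreover have "frechet_derivative (\<lambda>t. \<Phi> (\<xi>, t) $ I) (at 0) 1 = fundamental_field K act c q I" for I
    proof -
      have "(\<lambda>t. \<Phi> (\<xi>, t) $ I) differentiable (at 0)"
        using d\<Phi> bounded_linear.has_derivative[OF bounded_linear_vec_nth] unfolding differentiable_def by blast
      then have D: "((\<lambda>t. \<Phi> (\<xi>, t) $ I) has_derivative frechet_derivative (\<lambda>t. \<Phi> (\<xi>, t) $ I) (at 0)) (at 0)"
        by (simp add: frechet_derivative_works)
      have "((\<lambda>t. coords c (act (group_exp K t) q) $ I) has_derivative
          frechet_derivative (\<lambda>t. \<Phi> (\<xi>, t) $ I) (at 0)) (at 0)"
        by (rule has_derivative_transform_within_open[OF D open_greaterThanLessThan[of "-1" 1]]) (auto simp: \<Phi>t)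
      moreover obtain a where "frechet_derivative (\<lambda>t. \<Phi> (\<xi>, t) $ I) (at 0) = (\<lambda>v. v * a)"
        using has_derivative_bounded_linear[OF D] real_bounded_linear by blast
      then have "frechet_derivative (\<lambda>t. \<Phi> (\<xi>, t) $ I) (at 0) =
          times (frechet_derivative (\<lambda>t. \<Phi> (\<xi>, t) $ I) (at 0) 1)"
        by (simp add: fun_eq_iff)
      ultimately have "((\<lambda>t. coords c (act (group_exp K t) q) $ I) has_field_derivative
          frechet_derivative (\<lambda>t. \<Phi> (\<xi>, t) $ I) (at 0) 1) (at 0)"
        by (simp add: has_field_derivative_def)
      then show ?thesis by (simp add: fundamental_field_def DERIV_imp_deriv)
    qed
    ultimately show ?thesis by simp
  qed
qed

lemma coframe_invertible:
  fixes AM :: "('m::{t2_space,second_countable_topology}, real^'n::finite) chart set"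
    and AN :: "('p::{t2_space,second_countable_topology}, real^('n option)) chart set"
  assumes AM: "smooth_atlas AM" and AN: "smooth_atlas AN" and P: "principal_bundle K AM AN \<rho> act"
    and \<beta>: "principal_connection K AN act \<beta>"
    and c: "c \<in> AN" and b: "b \<in> AM" and q: "q \<in> dom_chart c" "\<rho> q \<in> dom_chart b"
  shows "invertible (coframe b \<rho> \<beta> c q)"
    and "matrix_inv (coframe b \<rho> \<beta> c q) $ None $ I = fundamental_field K act c q I"
proof -
  let ?E = "fundamental_field K act c q" and ?\<theta> = "\<lambda>i I. pd c (\<lambda>r. coords b (\<rho> r) $ i) I q"
  note fr = principal_bundle_frame[OF AM AN P c b q]
  obtain L where L: "\<And>k i. (\<Sum>I\<in>UNIV. L k I * ?\<theta> i I) = (if i = k then 1 else 0)" using fr(1) by blast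
  have \<beta>E: "(\<Sum>I\<in>UNIV. ?E I * \<beta> c q I) = 1"
    using \<beta> c q by (auto simp: principal_connection_def mult.commute)
  \<comment> \<open>The dual frame: \<open>E\<close> for \<beta>, and each lift made horizontal by
    subtracting its \<beta>-component along \<open>E\<close>. The subtraction does not affect
    pairings with the base coordinates, since these annihilate \<open>E\<close>.\<close>
  define R :: "real^('n option)^('n option)" where "R = (\<chi> A I. case A of
    None \<Rightarrow> ?E I | Some k \<Rightarrow> L k I - (\<Sum>J\<in>UNIV. L k J * \<beta> c q J) * ?E I)"
  have "R ** coframe b \<rho> \<beta> c q = mat 1"
  proof (rule matrix_option_eqI)
    fix i j
    have "(\<Sum>I\<in>UNIV. (\<Sum>J\<in>UNIV. L i J * \<beta> c q J) * ?E I * ?\<theta> j I) = 0"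
      using fr(2)[of j] by (simp add: mult.assoc flip: sum_distrib_left)
    then show "(R ** coframe b \<rho> \<beta> c q) $ Some i $ Some j = mat 1 $ Some i $ Some j"
      by (simp add: matrix_mult_component R_def left_diff_distrib sum_subtractf L mat_def)
    have "(\<Sum>I\<in>UNIV. (\<Sum>J\<in>UNIV. L i J * \<beta> c q J) * ?E I * \<beta> c q I) = (\<Sum>J\<in>UNIV. L i J * \<beta> c q J)"
      using \<beta>E by (simp add: mult.assoc flip: sum_distrib_left)
    then show "(R ** coframe b \<rho> \<beta> c q) $ Some i $ None = mat 1 $ Some i $ None"
      by (simp add: matrix_mult_component R_def left_diff_distrib sum_subtractf mat_def)
  qed (simp_all add: matrix_mult_component R_def \<beta>E fr(2) mat_def)
  then have "coframe b \<rho> \<beta> c q ** R = mat 1" using matrix_left_right_inverse by blast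
  from matrix_inv_unique[OF this] show "invertible (coframe b \<rho> \<beta> c q)"
    "matrix_inv (coframe b \<rho> \<beta> c q) $ None $ I = ?E I"
    by (simp_all add: R_def)
qed

section \<open>The cone connection in an adapted coframe\<close>

lemma sym2_schouten: "sym2 (schouten \<Gamma> c p) i j = sym2 (ricci \<Gamma> c p) i j / (1 - real CARD('i))"
  for \<Gamma> :: "('m, 'i::finite) tensor3"
proof -
  have *: "sym2 (\<lambda>i j. a * sym2 R i j - b * alt2 R i j) i j = a * sym2 R i j" for a b and R :: "'i \<Rightarrow> 'i \<Rightarrow> real"
    by (simp add: sym2_def alt2_def field_simps)
  show ?thesis unfolding schouten_def[abs_def] * by simp
qed

lemma smooth_in_ricci:
  fixes \<Gamma> :: "('m, 'i::finite) tensor3"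
  assumes R: "chart_region c U" and s: "\<And>i j k. smooth_in c U (\<lambda>p. \<Gamma> c p i j k)"
  shows "smooth_in c U (\<lambda>p. ricci \<Gamma> c p i j)"
  unfolding ricci_def curvature_def
  by (intro smooth_in_sum[OF R] smooth_in_add[OF R] smooth_in_diff[OF R] smooth_in_mult[OF R] smooth_in_pd[OF R] s)

lemma chart_region_Int:
  assumes "chart_region c U" "chart_region c V"
  shows "chart_region c (U \<inter> V)"
proof -
  have "coords c ` (U \<inter> V) = coords c ` U \<inter> coords c ` V"
    using assms by (intro inj_on_image_Int[of _ "dom_chart c"]) (auto simp: chart_region_def)
  then show ?thesis using assms by (auto simp: chart_region_def)
qed

lemma affine_connection_smooth:
  "affine_connection A \<Gamma> \<Longrightarrow> c \<in> A \<Longrightarrow> smooth_in c (dom_chart c) (\<lambda>p. \<Gamma> c p i j k)"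
  by (auto simp: affine_connection_def smooth_in_def)

lemma affine_connection_change:
  "affine_connection A \<Gamma> \<Longrightarrow> c \<in> A \<Longrightarrow> d \<in> A \<Longrightarrow> p \<in> dom_chart c \<Longrightarrow> p \<in> dom_chart d \<Longrightarrow>
     (\<Sum>k\<in>UNIV. \<Gamma> c p i j k * pd c (\<lambda>q. coords d q $ m) k p) =
        pd c (pd c (\<lambda>q. coords d q $ m) j) i p +
        (\<Sum>a\<in>UNIV. \<Sum>b\<in>UNIV.
           \<Gamma> d p a b m * pd c (\<lambda>q. coords d q $ a) i p * pd c (\<lambda>q. coords d q $ b) j p)"
  unfolding affine_connection_def by blast

lemma cone_connectionD:
  assumes "cone_connection K AM AN \<rho> act \<Gamma> \<beta> \<omega> \<Gamma>h"
  shows "vector_field_on AM U X \<Longrightarrow> vector_field_on AM U Y \<Longrightarrow> horizontal_lift AM AN \<rho> \<beta> U X X' \<Longrightarrow>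
      horizontal_lift AM AN \<rho> \<beta> U Y Y' \<Longrightarrow> horizontal_lift AM AN \<rho> \<beta> U (cov_along \<Gamma> X Y) Z' \<Longrightarrow>
      c \<in> AN \<Longrightarrow> b \<in> AM \<Longrightarrow> q \<in> dom_chart c \<Longrightarrow> \<rho> q \<in> U \<inter> dom_chart b \<Longrightarrow>
      cov_along \<Gamma>h X' Y' c q I = Z' c q I + (\<Sum>i\<in>UNIV. \<Sum>j\<in>UNIV.
        (sym2 (schouten \<Gamma> b (\<rho> q)) i j - \<omega> b (\<rho> q) i j / 2) * X b (\<rho> q) i * Y b (\<rho> q) j)
        * fundamental_field K act c q I"
    and "vector_field_on AM U X \<Longrightarrow> horizontal_lift AM AN \<rho> \<beta> U X X' \<Longrightarrow> c \<in> AN \<Longrightarrow> q \<in> dom_chart c \<Longrightarrow>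
      \<rho> q \<in> U \<Longrightarrow> cov_along \<Gamma>h X' (fundamental_field K act) c q I = X' c q I"
    and "vector_field_on AM U X \<Longrightarrow> horizontal_lift AM AN \<rho> \<beta> U X X' \<Longrightarrow> c \<in> AN \<Longrightarrow> q \<in> dom_chart c \<Longrightarrow>
      \<rho> q \<in> U \<Longrightarrow> cov_along \<Gamma>h (fundamental_field K act) X' c q I = X' c q I"
    and "c \<in> AN \<Longrightarrow> q \<in> dom_chart c \<Longrightarrow>
      cov_along \<Gamma>h (fundamental_field K act) (fundamental_field K act) c q I = fundamental_field K act c q I"
proof -
  note * = assms[unfolded cone_connection_def Let_def, THEN conjunct2]
  note 1 = *[THEN conjunct1, rule_format, of U X Y X' Y' Z' c b q I]
    and 2 = *[THEN conjunct2, THEN conjunct1, rule_format, of U X X' c q I]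
    and 3 = *[THEN conjunct2, THEN conjunct2, rule_format, of c q I]
  show "vector_field_on AM U X \<Longrightarrow> vector_field_on AM U Y \<Longrightarrow> horizontal_lift AM AN \<rho> \<beta> U X X' \<Longrightarrow>
      horizontal_lift AM AN \<rho> \<beta> U Y Y' \<Longrightarrow> horizontal_lift AM AN \<rho> \<beta> U (cov_along \<Gamma> X Y) Z' \<Longrightarrow>
      c \<in> AN \<Longrightarrow> b \<in> AM \<Longrightarrow> q \<in> dom_chart c \<Longrightarrow> \<rho> q \<in> U \<inter> dom_chart b \<Longrightarrow>
      cov_along \<Gamma>h X' Y' c q I = Z' c q I + (\<Sum>i\<in>UNIV. \<Sum>j\<in>UNIV.
        (sym2 (schouten \<Gamma> b (\<rho> q)) i j - \<omega> b (\<rho> q) i j / 2) * X b (\<rho> q) i * Y b (\<rho> q) j)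
        * fundamental_field K act c q I"
    by (rule 1) (intro conjI; assumption)
  show "vector_field_on AM U X \<Longrightarrow> horizontal_lift AM AN \<rho> \<beta> U X X' \<Longrightarrow> c \<in> AN \<Longrightarrow> q \<in> dom_chart c \<Longrightarrow>
      \<rho> q \<in> U \<Longrightarrow> cov_along \<Gamma>h X' (fundamental_field K act) c q I = X' c q I"
    "vector_field_on AM U X \<Longrightarrow> horizontal_lift AM AN \<rho> \<beta> U X X' \<Longrightarrow> c \<in> AN \<Longrightarrow> q \<in> dom_chart c \<Longrightarrow>
      \<rho> q \<in> U \<Longrightarrow> cov_along \<Gamma>h (fundamental_field K act) X' c q I = X' c q I"
    using 2 by blast+
  show "c \<in> AN \<Longrightarrow> q \<in> dom_chart c \<Longrightarrow>
      cov_along \<Gamma>h (fundamental_field K act) (fundamental_field K act) c q I = fundamental_field K act c q I"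
    using 3 by blast
qed

locale cone_bundle =
  fixes AM :: "('m::{t2_space,second_countable_topology}, real^'n::finite) chart set"
    and AN :: "('p::{t2_space,second_countable_topology}, real^('n option)) chart set"
    and K :: structure_group
    and \<rho> :: "'p \<Rightarrow> 'm" and act :: "complex \<Rightarrow> 'p \<Rightarrow> 'p"
    and \<Gamma> :: "('m, 'n) tensor3" and \<beta> E :: "('p, 'n option) tensor1"
    and \<omega> g :: "('m, 'n) tensor2" and \<Gamma>h :: "('p, 'n option) tensor3"
  assumes AM: "smooth_atlas AM" and AN: "smooth_atlas AN"
    and principal: "principal_bundle K AM AN \<rho> act"
    and E_def: "E = fundamental_field K act"
    and nabla: "torsion_free_connection AM \<Gamma>"
    and beta: "principal_connection K AN act \<beta>"
    and omega: "connection_curvature AM AN \<rho> \<beta> \<omega>"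
    and cone: "cone_connection K AM AN \<rho> act \<Gamma> \<beta> \<omega> \<Gamma>h"
    and g_def: "g = (\<lambda>c p i j. sym2 (schouten \<Gamma> c p) i j)"
    and g_nondegenerate: "nondegenerate AM g"
begin

abbreviation "over c b \<equiv> dom_chart c \<inter> \<rho> -` dom_chart b"

lemma \<rho>: "smooth_map AN AM \<rho>"
  using principal by (simp add: principal_bundle_def)

lemma one_form_\<beta>: "one_form AN \<beta>"
  using beta by (simp add: principal_connection_def)

lemma base_chart_exists:
  assumes "c \<in> AN" "q \<in> dom_chart c"
  obtains b where "b \<in> AM" "q \<in> over c b"
proof -
  have "q \<in> carrier AN" using assms by (auto simp: carrier_def)
  then have "\<rho> q \<in> carrier AM" using \<rho> by (auto simp: smooth_map_def)
  then show ?thesis using that assms by (auto simp: carrier_def)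
qed

lemma bundle_chart_over:
  assumes "c \<in> AN" "b \<in> AM"
  shows "bundle_chart b (dom_chart b) c (over c b) \<rho> \<beta>"
proof
  note sc = smooth_map_components[OF AN AM \<rho> assms]
  show "chart_region b (dom_chart b)" by (rule atlas_chart_region[OF AM assms(2)])
  show "chart_region c (over c b)" by (rule sc(1))
  show "smooth_in c (over c b) (\<lambda>q. coords b (\<rho> q) $ i)" for i by (rule sc(2))
  show "smooth_in c (over c b) (\<lambda>q. \<beta> c q I)" for I
    using smooth_in_subset[OF one_form_smooth[OF one_form_\<beta> assms(1)]] by simp
  show "invertible (coframe b \<rho> \<beta> c q)" if "q \<in> over c b" for q
    using coframe_invertible(1)[OF AM AN principal beta assms] that by simp
qed simp

lemma E_inverse: "c \<in> AN \<Longrightarrow> b \<in> AM \<Longrightarrow> q \<in> over c b \<Longrightarrow> E c q I = matrix_inv (coframe b \<rho> \<beta> c q) $ None $ I"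
  unfolding E_def using coframe_invertible(2)[OF AM AN principal beta] by simp

lemma smooth_g:
  assumes b: "b \<in> AM"
  shows "smoothM b (dom_chart b) (gram g b)"
proof -
  note R = atlas_chart_region[OF AM b]
  have "affine_connection AM \<Gamma>" using nabla by (simp add: torsion_free_connection_def)
  then have ric: "smooth_in b (dom_chart b) (\<lambda>p. ricci \<Gamma> b p i j)" for i j
    using b by (intro smooth_in_ricci[OF R] affine_connection_smooth)
  have "smooth_in b (dom_chart b) (\<lambda>p. (ricci \<Gamma> b p i j + ricci \<Gamma> b p j i) * (1 / 2) * (1 / (1 - real CARD('n))))" for i j
    by (intro smooth_in_mult[OF R] smooth_in_add[OF R] smooth_in_const ric)
  then show ?thesis by (simp add: smoothM_def gram_def g_def sym2_schouten) (simp add: sym2_def)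
qed

lemma g_sym: "g b x i j = g b x j i"
  by (simp add: g_def sym2_def add.commute)

lemma g_inv: "b \<in> AM \<Longrightarrow> x \<in> dom_chart b \<Longrightarrow> invertible (gram g b x)"
  using g_nondegenerate by (simp add: nondegenerate_def)

lemma omega_facts:
  shows "b \<in> AM \<Longrightarrow> smoothM b (dom_chart b) (gram \<omega> b)"
    and "b \<in> AM \<Longrightarrow> x \<in> dom_chart b \<Longrightarrow> \<omega> b x i j = - \<omega> b x j i"
proof -
  have cov: "covariant2 AM \<omega>" and skew: "\<forall>c\<in>AM. \<forall>p\<in>dom_chart c. \<forall>i j. \<omega> c p i j = - \<omega> c p j i"
    using omega unfolding connection_curvature_def two_form_def by blast+
  show "b \<in> AM \<Longrightarrow> smoothM b (dom_chart b) (gram \<omega> b)"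
    using cov by (simp add: covariant2_def smoothM_def smooth_in_def gram_def)
  show "b \<in> AM \<Longrightarrow> x \<in> dom_chart b \<Longrightarrow> \<omega> b x i j = - \<omega> b x j i"
    using skew by blast
qed

lemma d\<beta>: "c \<in> AN \<Longrightarrow> b \<in> AM \<Longrightarrow> q \<in> over c b \<Longrightarrow> ext_deriv \<beta> c q I J = pullback2 b \<rho> \<omega> c q I J"
  using omega by (auto simp: connection_curvature_def)

lemma connM_smooth:
  assumes "torsion_free_connection AM \<Gamma>'" "b \<in> AM"
  shows "smoothM b (dom_chart b) (\<lambda>x. connM \<Gamma>' b x i)"
  using affine_connection_smooth[of AM \<Gamma>' b] assms
  by (simp add: smoothM_def connM_def torsion_free_connection_def)

lemma framed_connection_over:
  assumes c: "c \<in> AN" and b: "b \<in> AM" and \<Gamma>': "torsion_free_connection AM \<Gamma>'"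
    and framed: "\<And>q I. q \<in> over c b \<Longrightarrow> connM D c q I ** coframe b \<rho> \<beta> c q = pdM c (coframe b \<rho> \<beta> c) I q
      + coframe b \<rho> \<beta> c q ** (\<Sum>B\<in>UNIV. coframe b \<rho> \<beta> c q $ I $ B *\<^sub>R frame_coef \<kappa> \<mu> s \<Gamma>' g \<omega> b B (\<rho> q))"
  shows "framed_connection b (dom_chart b) c (over c b) \<rho> \<beta> \<Gamma>' g \<omega> D \<kappa> \<mu> s"
proof (intro framed_connection.intro framed_connection_axioms.intro)
  show "bundle_chart b (dom_chart b) c (over c b) \<rho> \<beta>" by (rule bundle_chart_over[OF c b])
  show "\<Gamma>' b x i j k = \<Gamma>' b x j i k" if "x \<in> dom_chart b" for x i j k
    using \<Gamma>' b that by (auto simp: torsion_free_connection_def)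
qed (rule connM_smooth[OF \<Gamma>' b] smooth_g[OF b] omega_facts[OF b] g_sym g_inv[OF b] d\<beta>[OF c b] framed;
    assumption)+

text \<open>A coordinate field of b, with its components in every overlapping chart d, since vector
  fields and lifts are tested in all charts.\<close>

definition coord_field :: "('m, real^'n) chart \<Rightarrow> 'n \<Rightarrow> ('m, 'n) tensor1" where
  "coord_field b i d p j = pd b (\<lambda>q. coords d q $ j) i p"

lemma vector_field_coord_field:
  assumes b: "b \<in> AM"
  shows "vector_field_on AM (dom_chart b) (coord_field b i)"
  unfolding vector_field_on_def coord_field_def[abs_def]
proof (intro conjI ballI allI)
  show "open_in AM (dom_chart b)" using AM b by (simp add: smooth_atlas_def)
  fix c assume c: "c \<in> AM"
  have R: "chart_region c (dom_chart c \<inter> dom_chart b)" by (rule atlas_chart_region2[OF AM c b])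
  have Rb: "chart_region b (dom_chart c \<inter> dom_chart b)"
    using atlas_chart_region2[OF AM b c] by (simp add: Int_commute)
  have "smooth_in b (dom_chart c \<inter> dom_chart b) (\<lambda>q. coords c q $ j)" for j
    using atlas_coords_smooth[OF AM b c] by (simp add: Int_commute)
  then have "smooth_in c (dom_chart c \<inter> dom_chart b) (\<lambda>p. pd b (\<lambda>q. coords c q $ j) i p)" for j
    using smooth_in_change_chart[OF AM c b R Rb smooth_in_pd[OF Rb]] by simp
  then show "smooth_on (coords c ` (dom_chart c \<inter> dom_chart b)) ((\<lambda>p. pd b (\<lambda>q. coords c q $ j) i p) \<circ> inv_chart c)" for j
    by (simp add: smooth_in_def)
  fix d p j assume d: "d \<in> AM" and p: "p \<in> dom_chart c \<inter> dom_chart d \<inter> dom_chart b"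
  let ?W = "dom_chart b \<inter> dom_chart c \<inter> (dom_chart c \<inter> dom_chart d)"
  have "chart_region b ?W"
    using chart_region_Int[OF atlas_chart_region2[OF AM b c] atlas_chart_region2[OF AM b d]]
    by (simp add: Int_ac)
  moreover have "chart_region c ?W"
    using chart_region_Int[OF atlas_chart_region2[OF AM c b] atlas_chart_region2[OF AM c d]]
    by (simp add: Int_ac)
  ultimately show "pd b (\<lambda>q. coords d q $ j) i p =
      (\<Sum>k\<in>UNIV. pd b (\<lambda>q. coords c q $ k) i p * pd c (\<lambda>q. coords d q $ j) k p)"
    using p by (intro pd_change_chart[OF AM b c] smooth_in_subset[OF atlas_coords_smooth[OF AM c d]]) auto
qed

lemma cov_along_coord_field:
  assumes b: "b \<in> AM" and d: "d \<in> AM" and p: "p \<in> dom_chart b \<inter> dom_chart d"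
  shows "cov_along \<Gamma> (coord_field b i) (coord_field b j) d p m =
    (\<Sum>k\<in>UNIV. \<Gamma> b p i j k * pd b (\<lambda>q. coords d q $ m) k p)"
proof -
  have R: "chart_region b (dom_chart b \<inter> dom_chart d)" by (rule atlas_chart_region2[OF AM b d])
  have Rd: "chart_region d (dom_chart b \<inter> dom_chart d)"
    using atlas_chart_region2[OF AM d b] by (simp add: Int_commute)
  have sb: "smooth_in b (dom_chart b \<inter> dom_chart d) (pd b (\<lambda>q. coords d q $ m) j)"
    by (intro smooth_in_pd[OF R] atlas_coords_smooth[OF AM b d])
  then have sd: "smooth_in d (dom_chart b \<inter> dom_chart d) (pd b (\<lambda>q. coords d q $ m) j)"
    by (rule smooth_in_change_chart[OF AM d b Rd R])
  have "pd b (pd b (\<lambda>q. coords d q $ m) j) i p =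
      (\<Sum>a\<in>UNIV. pd b (\<lambda>q. coords d q $ a) i p * pd d (pd b (\<lambda>q. coords d q $ m) j) a p)"
    by (rule pd_change_chart[OF AM b d R Rd sd p])
  moreover have "(\<Sum>k\<in>UNIV. \<Gamma> b p i j k * pd b (\<lambda>q. coords d q $ m) k p) =
        pd b (pd b (\<lambda>q. coords d q $ m) j) i p + (\<Sum>a\<in>UNIV. \<Sum>l\<in>UNIV.
           \<Gamma> d p a l m * pd b (\<lambda>q. coords d q $ a) i p * pd b (\<lambda>q. coords d q $ l) j p)"
    using nabla b d p by (intro affine_connection_change) (auto simp: torsion_free_connection_def)
  ultimately show ?thesis
    by (simp add: cov_along_def coord_field_def distrib_left sum.distrib sum_distrib_left mult_ac)
qed

text \<open>The rows \<open>Some k\<close> of the inverse coframe are the lifts of the coordinate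
  fields. Arbitrary coefficients w are allowed so that covariant derivatives of coordinate fields
  are covered by the same statement.\<close>

lemma horizontal_lift_components:
  assumes b: "b \<in> AM" and X: "\<And>d p j. d \<in> AM \<Longrightarrow> p \<in> dom_chart b \<inter> dom_chart d \<Longrightarrow>
      X d p j = (\<Sum>k\<in>UNIV. w p k * pd b (\<lambda>q. coords d q $ j) k p)"
  shows "horizontal_lift AM AN \<rho> \<beta> (dom_chart b) X
    (\<lambda>c q I. \<Sum>k\<in>UNIV. w (\<rho> q) k * matrix_inv (coframe b \<rho> \<beta> c q) $ Some k $ I)"
  unfolding horizontal_lift_def
proof (intro ballI impI conjI allI)
  fix c d q assume c: "c \<in> AN" and d: "d \<in> AM" and q: "q \<in> dom_chart c" and \<rho>q: "\<rho> q \<in> dom_chart b \<inter> dom_chart d"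
  interpret bundle_chart b "dom_chart b" c "over c b" \<rho> \<beta> by (rule bundle_chart_over[OF c b])
  let ?N = "matrix_inv (M q)"
  have NM: "?N ** M q = mat 1" using invertible_coframe[of q] q \<rho>q by (simp add: matrix_inv_left)
  have sw: "(\<Sum>I\<in>UNIV. (\<Sum>k\<in>UNIV. w (\<rho> q) k * ?N $ Some k $ I) * M q $ I $ A) =
      (\<Sum>k\<in>UNIV. w (\<rho> q) k * (?N ** M q) $ Some k $ A)" for A
    unfolding sum_distrib_right matrix_mult_component sum_distrib_left
    by (subst sum.swap) (simp add: mult.assoc)
  show "(\<Sum>I\<in>UNIV. \<beta> c q I * (\<Sum>k\<in>UNIV. w (\<rho> q) k * ?N $ Some k $ I)) = 0"
    using sw[of None] by (simp add: NM mat_def mult.commute)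
  fix i
  have W: "chart_region c (over c b \<inter> over c d)"
    by (rule chart_region_Int[OF region_c smooth_map_components(1)[OF AN AM \<rho> c d]])
  have "\<rho> ` (over c b \<inter> over c d) \<subseteq> dom_chart b \<inter> dom_chart d" by auto
  moreover have "smooth_in c (over c b \<inter> over c d) (\<lambda>q. coords b (\<rho> q) $ j)" for j
    by (rule smooth_in_subset[OF smooth_\<rho>]) blast
  ultimately have "pd c (\<lambda>r. coords d (\<rho> r) $ i) I q = (\<Sum>j\<in>UNIV. pd c (\<lambda>r. coords b (\<rho> r) $ j) I q
      * pd b (\<lambda>q. coords d q $ i) j (\<rho> q))" for I
    using q \<rho>q by (intro pd_compose[OF W atlas_chart_region2[OF AM b d]] atlas_coords_smooth[OF AM b d]) auto
  then have "pd c (\<lambda>r. coords d (\<rho> r) $ i) I q =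
      (\<Sum>j\<in>UNIV. M q $ I $ Some j * pd b (\<lambda>q. coords d q $ i) j (\<rho> q))" for I
    by simp
  then have "(\<Sum>I\<in>UNIV. (\<Sum>k\<in>UNIV. w (\<rho> q) k * ?N $ Some k $ I) * pd c (\<lambda>r. coords d (\<rho> r) $ i) I q) =
      (\<Sum>j\<in>UNIV. (\<Sum>I\<in>UNIV. (\<Sum>k\<in>UNIV. w (\<rho> q) k * ?N $ Some k $ I) * M q $ I $ Some j)
        * pd b (\<lambda>q. coords d q $ i) j (\<rho> q))"
    by (simp only: sum_distrib_left sum_distrib_right mult.assoc) (rule sum.swap)
  also have "\<dots> = X d (\<rho> q) i"
    unfolding sw NM using X[OF d \<rho>q] by (simp add: mat_def if_distrib[of "\<lambda>x. _ * x"] cong: if_cong)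
  finally show "(\<Sum>I\<in>UNIV. (\<Sum>k\<in>UNIV. w (\<rho> q) k * ?N $ Some k $ I) * pd c (\<lambda>r. coords d (\<rho> r) $ i) I q) = X d (\<rho> q) i" .
qed

text \<open>The rows of the inverse coframe are \<open>E\<close> and the horizontal lifts of
  coordinate fields. Evaluated on these, the defining identities of the cone connection list all of
  its frame coefficients.\<close>

lemma cone_framed:
  assumes c: "c \<in> AN" and b: "b \<in> AM" and q: "q \<in> over c b"
  shows "connM \<Gamma>h c q I ** coframe b \<rho> \<beta> c q = pdM c (coframe b \<rho> \<beta> c) I q
    + coframe b \<rho> \<beta> c q ** (\<Sum>B\<in>UNIV. coframe b \<rho> \<beta> c q $ I $ B *\<^sub>R frame_coef 1 0 1 \<Gamma> g \<omega> b B (\<rho> q))"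
proof -
  interpret bundle_chart b "dom_chart b" c "over c b" \<rho> \<beta> by (rule bundle_chart_over[OF c b])
  let ?N = "\<lambda>q. matrix_inv (M q)" and ?F = "\<lambda>B. frame_coef 1 0 1 \<Gamma> g \<omega> b B (\<rho> q)"
  let ?X = "\<lambda>i c q I. matrix_inv (coframe b \<rho> \<beta> c q) $ Some i $ I"
  let ?Q = "\<lambda>b x i j. sym2 (schouten \<Gamma> b x) i j - \<omega> b x i j / 2"
  have x: "\<rho> q \<in> dom_chart b" and qc: "q \<in> dom_chart c" using q by auto
  have NM: "?N q ** M q = mat 1" and MN: "M q ** ?N q = mat 1"
    using invertible_coframe[OF q] by (simp_all add: matrix_inv_left matrix_inv_right)
  have dual: "(\<Sum>J\<in>UNIV. ?N q $ A $ J * M q $ J $ B) = (if A = B then 1 else 0)" for A B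
    using NM by (simp add: mat_def flip: matrix_mult_component)
  have kr: "coord_field b i b (\<rho> q) k = (if i = k then 1 else 0)" for i k
    by (simp add: coord_field_def pd_coords[OF region_b x])
  have lift: "horizontal_lift AM AN \<rho> \<beta> (dom_chart b) (coord_field b i) (?X i)" for i
    using horizontal_lift_components[OF b, of "coord_field b i" "\<lambda>p k. if k = i then 1 else 0"]
    by (simp add: coord_field_def if_distrib[of "\<lambda>x. x * _"] cong: if_cong)
  have lift2: "horizontal_lift AM AN \<rho> \<beta> (dom_chart b) (cov_along \<Gamma> (coord_field b i) (coord_field b j))
      (\<lambda>c q I. \<Sum>k\<in>UNIV. \<Gamma> b (\<rho> q) i j k * matrix_inv (coframe b \<rho> \<beta> c q) $ Some k $ I)" for i j
    by (rule horizontal_lift_components[OF b]) (rule cov_along_coord_field[OF b])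
  note vf = vector_field_coord_field[OF b]
  have cone1: "cov_along \<Gamma>h (?X i) (?X j) c q I = (\<Sum>k\<in>UNIV. \<Gamma> b (\<rho> q) i j k * ?N q $ Some k $ I)
      + ?Q b (\<rho> q) i j * E c q I" for i j I
  proof -
    have "cov_along \<Gamma>h (?X i) (?X j) c q I = (\<Sum>k\<in>UNIV. \<Gamma> b (\<rho> q) i j k * ?N q $ Some k $ I)
      + (\<Sum>k\<in>UNIV. \<Sum>l\<in>UNIV. ?Q b (\<rho> q) k l * coord_field b i b (\<rho> q) k * coord_field b j b (\<rho> q) l) * E c q I"
      unfolding E_def
      by (rule cone_connectionD(1)[OF cone vf vf lift lift lift2 c b qc]) (use x in simp)
    then show ?thesis
      by (simp add: kr if_distrib[of "\<lambda>x. _ * x"] cong: if_cong)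
  qed
  have cone2: "cov_along \<Gamma>h (?X i) E c q I = ?X i c q I" "cov_along \<Gamma>h E (?X i) c q I = ?X i c q I" for i I
    unfolding E_def by (rule cone_connectionD(2,3)[OF cone vf lift c qc x])+
  have cone3: "cov_along \<Gamma>h E E c q I = E c q I" for I
    unfolding E_def by (rule cone_connectionD(4)[OF cone c qc])
  \<comment> \<open>The connection matrix without the derivative of the coframe, written with lower
    index in the frame. It is to be identified with the combination of the
    \<open>?F B\<close>.\<close>
  let ?Y = "\<lambda>I. ?N q ** (connM \<Gamma>h c q I ** M q - pdM c M I q)"
  \<comment> \<open>A frame coefficient is the derivative of one dual vector along another, paired
    with a member of the coframe. The derivative of the dual vector comes from differentiating the
    inverse matrix.\<close>
  have cov: "(\<Sum>J\<in>UNIV. cov_along \<Gamma>h X Y c q J * M q $ J $ A) = (\<Sum>I\<in>UNIV. ?N q $ B $ I * ?Y I $ C $ A)"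
    if X: "\<And>I. X c q I = ?N q $ B $ I" and Y: "\<And>q I. q \<in> over c b \<Longrightarrow> Y c q I = ?N q $ C $ I" for X Y A B C
  proof -
    let ?Z = "\<lambda>I. ?N q ** connM \<Gamma>h c q I - ?N q ** pdM c M I q ** ?N q"
    have dY: "pd c (\<lambda>q. Y c q J) I q = pdM c ?N I q $ C $ J" for I J
      unfolding pdM_def by (simp, rule pd_cong[OF region_c q]) (rule Y)
    have ZY: "?Z I ** M q = ?Y I" for I
      by (simp add: matrix_distribs matrix_mul_assoc NM flip: matrix_mul_assoc[of _ "?N q" "M q"])
    have "pdM c ?N I q = - (?N q ** pdM c M I q ** ?N q)" for I
      by (rule pdM_matrix_inv[OF region_c q smooth_M]) (rule invertible_coframe)
    with dY have "cov_along \<Gamma>h X Y c q J = (\<Sum>I\<in>UNIV. ?N q $ B $ I * ?Z I $ C $ J)" for J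
      by (simp add: cov_along_def X Y[OF q]
          matrix_mult_component[of _ "connM _ _ _ _"] connM_component mult.commute)
    then have "(\<Sum>J\<in>UNIV. cov_along \<Gamma>h X Y c q J * M q $ J $ A) =
        (\<Sum>I\<in>UNIV. ?N q $ B $ I * (\<Sum>J\<in>UNIV. ?Z I $ C $ J * M q $ J $ A))"
      by (simp only: sum_distrib_left sum_distrib_right mult.assoc) (rule sum.swap)
    also have "\<dots> = (\<Sum>I\<in>UNIV. ?N q $ B $ I * (?Z I ** M q) $ C $ A)"
      by (simp only: matrix_mult_component[of _ "M q"])
    finally show ?thesis unfolding ZY .
  qed
  have E: "E c q I = ?N q $ None $ I" if "q \<in> over c b" for q I by (rule E_inverse[OF c b that])
  have F: "(\<Sum>I\<in>UNIV. ?N q $ B $ I * ?Y I $ C $ A) = ?F B $ C $ A" for A B C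
  proof (cases B)
    case B: None
    show ?thesis
    proof (cases C)
      case None
      show ?thesis
        using cov[of E None E None A, OF E[OF q] E] unfolding B None cone3 unfolding E[OF q] dual
        by (cases A) (simp_all only: frame_coef_simps block_simps, simp_all)
    next
      case (Some j)
      show ?thesis
        unfolding B Some cov[of E None "?X j" "Some j", OF E[OF q] refl, symmetric] cone2 dual
        by (cases A) (auto simp: fibre_coef_def mat_def)
    qed
  next
    case B: (Some i)
    show ?thesis
    proof (cases C)
      case None
      show ?thesis
        using cov[of "?X i" "Some i" E None A, OF refl E] unfolding B None cone2 unfolding dual
        by (cases A) (simp_all add: fibre_coef_def mat_def)
    next
      case (Some j)
      have "(\<Sum>J\<in>UNIV. ((\<Sum>k\<in>UNIV. \<Gamma> b (\<rho> q) i j k * ?N q $ Some k $ J) + ?Q b (\<rho> q) i j * ?N q $ None $ J) * M q $ J $ A) =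
          (\<Sum>J\<in>UNIV. \<Sum>k\<in>UNIV. \<Gamma> b (\<rho> q) i j k * (?N q $ Some k $ J * M q $ J $ A))
          + ?Q b (\<rho> q) i j * (\<Sum>J\<in>UNIV. ?N q $ None $ J * M q $ J $ A)"
        by (simp only: distrib_right sum.distrib sum_distrib_left sum_distrib_right mult.assoc)
      also have "(\<Sum>J\<in>UNIV. \<Sum>k\<in>UNIV. \<Gamma> b (\<rho> q) i j k * (?N q $ Some k $ J * M q $ J $ A)) =
          (\<Sum>k\<in>UNIV. \<Gamma> b (\<rho> q) i j k * (\<Sum>J\<in>UNIV. ?N q $ Some k $ J * M q $ J $ A))"
        by (subst sum.swap) (simp only: sum_distrib_left)
      finally show ?thesis
        unfolding B Some cov[of "?X i" "Some i" "?X j" "Some j", OF refl refl, symmetric] cone1 E[OF q] dual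
        by (cases A) (simp_all add: g_def if_distrib[of "\<lambda>x. _ * x"] cong: if_cong)
    qed
  qed
  have "?Y I = (\<Sum>B\<in>UNIV. M q $ I $ B *\<^sub>R ?F B)"
  proof (simp only: vec_eq_iff, intro allI)
    fix C A
    have "(\<Sum>B\<in>UNIV. M q $ I $ B *\<^sub>R ?F B) $ C $ A = (\<Sum>B\<in>UNIV. M q $ I $ B * (\<Sum>J\<in>UNIV. ?N q $ B $ J * ?Y J $ C $ A))"
      by (simp only: F) simp
    also have "\<dots> = (\<Sum>J\<in>UNIV. (M q ** ?N q) $ I $ J * ?Y J $ C $ A)"
      unfolding matrix_mult_component[of "M q" "?N q"] sum_distrib_left sum_distrib_right
      by (subst sum.swap) (simp only: mult.assoc)
    also have "\<dots> = ?Y I $ C $ A"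
      by (simp add: MN mat_def if_distrib[of "\<lambda>x. x * _"] cong: if_cong)
    finally show "?Y I $ C $ A = (\<Sum>B\<in>UNIV. M q $ I $ B *\<^sub>R ?F B) $ C $ A" by simp
  qed
  then have "M q ** ?Y I = M q ** (\<Sum>B\<in>UNIV. M q $ I $ B *\<^sub>R ?F B)" by simp
  then show ?thesis by (simp add: matrix_mul_assoc MN algebra_simps)
qed

end

section \<open>Gluing framed connections over the charts of the base\<close>

lemma one_form_cmult:
  assumes A: "smooth_atlas A" and \<beta>: "one_form A \<beta>"
  shows "one_form A (\<lambda>c p i. k * \<beta> c p i)"
  unfolding one_form_def
proof (intro conjI ballI allI)
  fix c assume c: "c \<in> A"
  show "smooth_on (coords c ` dom_chart c) ((\<lambda>p. k * \<beta> c p i) \<circ> inv_chart c)" for i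
    using smooth_in_mult[OF atlas_chart_region[OF A c] smooth_in_const one_form_smooth[OF \<beta> c]]
    by (simp add: smooth_in_def)
  show "k * \<beta> c p i = (\<Sum>j\<in>UNIV. pd c (\<lambda>q. coords d q $ j) i p * (k * \<beta> d p j))"
    if "d \<in> A" "p \<in> dom_chart c \<inter> dom_chart d" for d p i
    using one_form_change[OF \<beta> c that(1), of p i] that(2)
    by (simp add: sum_distrib_left mult.left_commute)
qed

lemma frame_direction_component:
  "(M ** (\<Sum>B\<in>UNIV. M $ I $ B *\<^sub>R X B)) $ J $ A = (\<Sum>B\<in>UNIV. \<Sum>C\<in>UNIV. M $ I $ B * M $ J $ C * X B $ C $ A)"
  for M :: "real^'k::finite^'k"
  by (simp add: matrix_mult_component sum_distrib_left mult_ac) (rule sum.swap)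

lemma matrix_sandwich_component:
  "(M ** X ** transpose M) $ I $ J = (\<Sum>B\<in>UNIV. \<Sum>C\<in>UNIV. M $ I $ B * M $ J $ C * X $ B $ C)"
  for M :: "real^'k::finite^'k"
  by (simp add: matrix_mult_component transpose_def sum_distrib_left sum_distrib_right)
    (subst sum.swap, simp add: mult_ac)

lemma block_linear: "block u X + block v Y = block (u + v) (X + Y)" "r *\<^sub>R block u X = block (r * u) (r *\<^sub>R X)"
  by (rule matrix_option_eqI; simp)+

lemma transpose_block: "transpose (block u X) = block u (transpose X)"
  by (rule matrix_option_eqI) (simp_all add: transpose_def)

context cone_bundle
begin

definition framed_by :: "('m, 'n) tensor3 \<Rightarrow> ('p, 'n option) tensor3 \<Rightarrow> real \<Rightarrow> real \<Rightarrow> real \<Rightarrow> bool" where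
  "framed_by \<Gamma>' D' \<kappa> \<mu> s \<longleftrightarrow> torsion_free_connection AM \<Gamma>' \<and>
    (\<forall>c\<in>AN. \<forall>b\<in>AM. \<forall>q\<in>over c b. \<forall>I. connM D' c q I ** coframe b \<rho> \<beta> c q =
      pdM c (coframe b \<rho> \<beta> c) I q + coframe b \<rho> \<beta> c q **
        (\<Sum>B\<in>UNIV. coframe b \<rho> \<beta> c q $ I $ B *\<^sub>R frame_coef \<kappa> \<mu> s \<Gamma>' g \<omega> b B (\<rho> q)))"

lemma framed_by_locale:
  assumes "framed_by \<Gamma>' D' \<kappa> \<mu> s" "c \<in> AN" "b \<in> AM"
  shows "framed_connection b (dom_chart b) c (over c b) \<rho> \<beta> \<Gamma>' g \<omega> D' \<kappa> \<mu> s"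
  using assms unfolding framed_by_def by (intro framed_connection_over) blast+

lemma cone_framed_by: "framed_by \<Gamma> \<Gamma>h 1 0 1"
  unfolding framed_by_def using nabla cone_framed by blast

lemma dom_chart_over:
  assumes c: "c \<in> AN"
  shows "dom_chart c = \<Union>((\<lambda>b. over c b) ` AM)"
proof
  show "dom_chart c \<subseteq> \<Union>((\<lambda>b. over c b) ` AM)"
  proof
    fix q assume q: "q \<in> dom_chart c"
    obtain b where "b \<in> AM" "q \<in> over c b" by (rule base_chart_exists[OF c q])
    then show "q \<in> \<Union>((\<lambda>b. over c b) ` AM)" by (rule UN_I)
  qed
qed auto

text \<open>Smoothness and symmetry are local and hold over each base chart. On an overlap of two
  charts of the total space, one common base chart gives both the same coefficients, and
  \<open>framed_transformation\<close> applies.\<close>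

lemma framed_by_torsion_free:
  assumes F: "framed_by \<Gamma>' D' \<kappa> \<mu> s"
  shows "torsion_free_connection AN D'"
  unfolding torsion_free_connection_def affine_connection_def
proof (intro conjI ballI allI)
  fix c assume c: "c \<in> AN"
  note U = dom_chart_over[OF c]
  have "smooth_in c (over c b) (\<lambda>q. D' c q I J K)" if b: "b \<in> AM" for b I J K
  proof -
    interpret framed_connection b "dom_chart b" c "over c b" \<rho> \<beta> \<Gamma>' g \<omega> D' \<kappa> \<mu> s
      by (rule framed_by_locale[OF F c b])
    show ?thesis using smoothMD[OF smooth_connM] by (simp add: connM_component)
  qed
  then have "smooth_in c (dom_chart c) (\<lambda>q. D' c q I J K)" for I J K
    by (subst U, intro smooth_in_Union) (auto intro: smooth_map_components(1)[OF AN AM \<rho> c])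
  then show "smooth_on (coords c ` dom_chart c) ((\<lambda>q. D' c q I J K) \<circ> inv_chart c)" for I J K
    by (simp add: smooth_in_def)
  show "D' c q I J K = D' c q J I K" if q: "q \<in> dom_chart c" for q I J K
  proof -
    obtain b where b: "b \<in> AM" "q \<in> over c b" using base_chart_exists[OF c q] .
    interpret framed_connection b "dom_chart b" c "over c b" \<rho> \<beta> \<Gamma>' g \<omega> D' \<kappa> \<mu> s
      by (rule framed_by_locale[OF F c b(1)])
    show ?thesis by (rule D_torsion_free[OF b(2)])
  qed
  fix d q I J L assume d: "d \<in> AN" and q: "q \<in> dom_chart c \<inter> dom_chart d"
  obtain b where b: "b \<in> AM" "q \<in> over c b" using base_chart_exists[OF c, of q] q by auto
  interpret c: framed_connection b "dom_chart b" c "over c b" \<rho> \<beta> \<Gamma>' g \<omega> D' \<kappa> \<mu> s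
    by (rule framed_by_locale[OF F c b(1)])
  interpret d: framed_connection b "dom_chart b" d "over d b" \<rho> \<beta> \<Gamma>' g \<omega> D' \<kappa> \<mu> s
    by (rule framed_by_locale[OF F d b(1)])
  let ?W = "over c b \<inter> over d b"
  have W: "chart_region c ?W" "chart_region d ?W"
    using chart_region_Int[OF c.region_c atlas_chart_region2[OF AN c d]]
      chart_region_Int[OF d.region_c atlas_chart_region2[OF AN d c]]
    by (simp_all add: Int_ac)
  show "(\<Sum>K\<in>UNIV. D' c q I J K * pd c (\<lambda>q. coords d q $ L) K q) =
    pd c (pd c (\<lambda>q. coords d q $ L) J) I q + (\<Sum>a\<in>UNIV. \<Sum>b\<in>UNIV.
      D' d q a b L * pd c (\<lambda>q. coords d q $ a) I q * pd c (\<lambda>q. coords d q $ b) J q)"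
    by (rule framed_transformation[OF AN c d one_form_\<beta> W smooth_in_subset[OF d.smooth_\<rho>] _
          d.invertible_coframe c.framed_D d.framed_D])
      (use q b in auto)
qed

end

section \<open>The metric G and the connections D s\<close>

locale cone_metric = cone_bundle AM AN K \<rho> act \<Gamma> \<beta> E \<omega> g \<Gamma>h
  for AM :: "('m::{t2_space,second_countable_topology}, real^'n::finite) chart set"
    and AN :: "('p::{t2_space,second_countable_topology}, real^('n option)) chart set"
    and K \<rho> act \<Gamma> \<beta> E \<omega> g \<Gamma>h +
  fixes G :: "('p, 'n option) tensor2" and \<Omega> D :: "real \<Rightarrow> ('p, 'n option) tensor3" and t :: real
  assumes n_ge_2: "CARD('n) \<ge> 2" and t: "t \<noteq> -1"
    and G_def: "G = (\<lambda>c q I J. sym2 (cov1 \<Gamma>h \<beta> c q) I J + (2 + t) * \<beta> c q I * \<beta> c q J)"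
    and Omega_def: "\<Omega> = (\<lambda>s c q I J L.
        (1 + t) * (\<Sum>Q\<in>UNIV. sym2 (\<lambda>I J. \<beta> c q I * ext_deriv \<beta> c q J Q) I J * ginv G c q Q L)
        - t * \<beta> c q I * \<beta> c q J * E c q L
        + (s - 1) * (2 * sym2 (\<lambda>I J. \<beta> c q I * kron J L) I J - G c q I J * E c q L)
        + 2 * s * t * sym2 (\<lambda>I J. \<beta> c q I * kron J L) I J)"
    and D_def: "D = (\<lambda>s c q I J L. \<Gamma>h c q I J L + \<Omega> s c q I J L)"
begin

text \<open>As \<beta> is the member \<open>None\<close> of the coframe, its covariant derivative is
  minus the vertical outputs of the cone connection: 1 vertically and g - \<omega>/2 horizontally.
  Symmetrizing removes \<omega>, and adding (2 + t) \<beta> \<beta> turns -1 into 1 + t.\<close>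

lemma gram_G:
  assumes c: "c \<in> AN" and b: "b \<in> AM" and q: "q \<in> over c b"
  shows "gram G c q = coframe b \<rho> \<beta> c q ** block (1 + t) (- gram g b (\<rho> q)) ** transpose (coframe b \<rho> \<beta> c q)"
proof -
  interpret framed_connection b "dom_chart b" c "over c b" \<rho> \<beta> \<Gamma> g \<omega> \<Gamma>h 1 0 1
    by (rule framed_by_locale[OF cone_framed_by c b])
  have x: "\<rho> q \<in> dom_chart b" using q by simp
  let ?p = "gram g b (\<rho> q) - (1 / 2) *\<^sub>R gram \<omega> b (\<rho> q)" and ?S = "\<lambda>X. M q ** X ** transpose (M q)"
  have F: "F B (\<rho> q) $ C $ None = block 1 ?p $ B $ C" for B C
    by (cases B; cases C) (simp_all add: gram_component)
  have "cov1 \<Gamma>h \<beta> c q I J = pdM c M I q $ J $ None - (connM \<Gamma>h c q I ** M q) $ J $ None" for I J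
    by (simp add: cov1_def pdM_def matrix_mult_component connM_component)
  then have cov1: "cov1 \<Gamma>h \<beta> c q I J = - ?S (block 1 ?p) $ I $ J" for I J
    unfolding framed_D[OF q] matrix_sandwich_component
    by (simp add: frame_direction_component F)
  have \<omega>t: "transpose (gram \<omega> b (\<rho> q)) = - gram \<omega> b (\<rho> q)"
    unfolding gram_def transpose_def vec_eq_iff using x by (auto intro: \<omega>_skew)
  have gt: "transpose (gram g b (\<rho> q)) = gram g b (\<rho> q)"
    by (auto simp: gram_def transpose_def vec_eq_iff intro: g_sym[OF x])
  have tr: "?S (block 1 ?p) $ J $ I = ?S (block 1 (transpose ?p)) $ I $ J" for I J
  proof -
    have "?S (block 1 ?p) $ J $ I = transpose (?S (block 1 ?p)) $ I $ J" by (simp add: transpose_def)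
    then show ?thesis by (simp add: matrix_transpose_mul transpose_block matrix_mul_assoc)
  qed
  have sy: "sym2 (cov1 \<Gamma>h \<beta> c q) I J = - (1 / 2) * (?S (block 1 ?p + block 1 (transpose ?p))) $ I $ J" for I J
    unfolding sym2_def cov1 tr[of J I] matrix_add_ldistrib matrix_add_rdistrib
    by (simp only: vector_add_component) (simp add: field_simps)
  have "block 1 ?p + block 1 (transpose ?p) = 2 *\<^sub>R block 1 (gram g b (\<rho> q))"
    by (rule matrix_option_eqI) (simp_all add: transpose_diff transpose_scaleR \<omega>t gt)
  then have "sym2 (cov1 \<Gamma>h \<beta> c q) I J = - ?S (block 1 (gram g b (\<rho> q))) $ I $ J" for I J
    unfolding sy by (simp add: matrix_scaleR_left matrix_scaleR_right)
  moreover have "\<beta> c q I * \<beta> c q J = ?S (block 1 0) $ I $ J" for I J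
    by (simp add: matrix_sandwich_component sum_option)
  ultimately have "gram G c q = (2 + t) *\<^sub>R ?S (block 1 0) - ?S (block 1 (gram g b (\<rho> q)))"
    by (simp add: vec_eq_iff gram_component G_def mult.assoc)
  also have "\<dots> = ?S ((2 + t) *\<^sub>R block 1 0 + (- 1) *\<^sub>R block 1 (gram g b (\<rho> q)))"
    by (simp add: matrix_distribs)
  finally show ?thesis by (simp add: block_linear)
qed

lemma inverse_G:
  assumes c: "c \<in> AN" and b: "b \<in> AM" and q: "q \<in> over c b"
  shows "invertible (gram G c q)"
    "matrix_inv (gram G c q) = transpose (matrix_inv (coframe b \<rho> \<beta> c q))
      ** block (1 / (1 + t)) (- matrix_inv (gram g b (\<rho> q))) ** matrix_inv (coframe b \<rho> \<beta> c q)"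
proof -
  interpret framed_connection b "dom_chart b" c "over c b" \<rho> \<beta> \<Gamma> g \<omega> \<Gamma>h 1 0 1
    by (rule framed_by_locale[OF cone_framed_by c b])
  have u: "1 + t \<noteq> 0" using t by auto
  have "(- gram g b (\<rho> q)) ** (- matrix_inv (gram g b (\<rho> q))) = mat 1"
    using g_inv[of "\<rho> q"] q by (simp add: matrix_distribs matrix_inv_right)
  note i = matrix_inv_unique[OF this]
  from ginv_frame[OF q gram_G[OF c b q] block_inverse(1)[OF u i(1)]]
  show "invertible (gram G c q)" "matrix_inv (gram G c q) = transpose (matrix_inv (coframe b \<rho> \<beta> c q))
      ** block (1 / (1 + t)) (- matrix_inv (gram g b (\<rho> q))) ** matrix_inv (coframe b \<rho> \<beta> c q)"
    by (simp_all add: block_inverse(2)[OF u i(1)] i(2))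
qed

lemma metric_G: "pseudo_metric AN G"
  unfolding pseudo_metric_def covariant2_def nondegenerate_def
proof (intro conjI ballI allI)
  fix c assume c: "c \<in> AN"
  note U = dom_chart_over[OF c]
  have "smooth_in c (over c b) (\<lambda>q. G c q I J)" if b: "b \<in> AM" for b I J
  proof -
    interpret framed_connection b "dom_chart b" c "over c b" \<rho> \<beta> \<Gamma> g \<omega> \<Gamma>h 1 0 1
      by (rule framed_by_locale[OF cone_framed_by c b])
    have "smooth_in b (dom_chart b) (\<lambda>x. block (1 + t) (- gram g b x) $ A $ B)" for A B
      using smoothMD[OF smooth_g]
      by (cases A; cases B) (auto intro: smooth_in_const smooth_in_uminus[OF region_b])
    then have "smoothM c (over c b) (\<lambda>q. block (1 + t) (- gram g b (\<rho> q)))"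
      by (intro smoothM_pullback) (simp add: smoothM_def)
    then have "smoothM c (over c b) (\<lambda>q. M q ** block (1 + t) (- gram g b (\<rho> q)) ** transpose (M q))"
      by (intro smoothM_mult[OF region_c] smoothM_transpose[OF region_c] smooth_M)
    from smooth_in_cong[OF region_c _ smoothMD[OF this]] show ?thesis
      by (simp add: gram_G[OF c b, symmetric] gram_component)
  qed
  then have "smooth_in c (dom_chart c) (\<lambda>q. G c q I J)" for I J
    by (subst U, intro smooth_in_Union) (auto intro: smooth_map_components(1)[OF AN AM \<rho> c])
  then show "smooth_on (coords c ` dom_chart c) ((\<lambda>q. G c q I J) \<circ> inv_chart c)" for I J
    by (simp add: smooth_in_def)
  show "G c q I J = G c q J I" for q I J by (simp add: G_def sym2_def)
  show "invertible (gram G c q)" if q: "q \<in> dom_chart c" for q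
    by (rule base_chart_exists[OF c q]) (rule inverse_G(1)[OF c])
  fix d q I J assume d: "d \<in> AN" and q: "q \<in> dom_chart c \<inter> dom_chart d"
  obtain b where b: "b \<in> AM" "q \<in> over c b" using base_chart_exists[OF c, of q] q by auto
  have qd: "q \<in> over d b" using q b by auto
  let ?W = "over c b \<inter> over d b" and ?P = "\<chi> I J. pd c (\<lambda>r. coords d r $ J) I q"
  have W: "chart_region c ?W" "chart_region d ?W"
    using chart_region_Int[OF smooth_map_components(1)[OF AN AM \<rho> c b(1)] atlas_chart_region2[OF AN c d]]
      chart_region_Int[OF smooth_map_components(1)[OF AN AM \<rho> d b(1)] atlas_chart_region2[OF AN d c]]
    by (simp_all add: Int_ac)
  \<comment> \<open>Both coframes are adapted to the same base chart, so they differ by the Jacobian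
    while the block in the middle is shared.\<close>
  have "coframe b \<rho> \<beta> c q = ?P ** coframe b \<rho> \<beta> d q"
    by (rule coframe_change[OF AN c d one_form_\<beta> W smooth_in_subset[OF smooth_map_components(2)[OF AN AM \<rho> d b(1)]]])
      (use q b in auto)
  then have "gram G c q = ?P ** gram G d q ** transpose ?P"
    by (simp add: gram_G[OF c b] gram_G[OF d b(1) qd] matrix_transpose_mul matrix_mul_assoc)
  then show "G c q I J = (\<Sum>k\<in>UNIV. \<Sum>l\<in>UNIV. pd c (\<lambda>q. coords d q $ k) I q * pd c (\<lambda>q. coords d q $ l) J q * G d q k l)"
    by (simp add: gram_component[symmetric] matrix_sandwich_component)
qed

lemma metric_G_pullback:
  assumes c: "c \<in> AN" and b: "b \<in> AM" and q: "q \<in> over c b"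
  shows "G c q I J = (1 + t) * \<beta> c q I * \<beta> c q J - sym2 (pullback2 b \<rho> (schouten \<Gamma>) c q) I J"
proof -
  interpret framed_connection b "dom_chart b" c "over c b" \<rho> \<beta> \<Gamma> g \<omega> \<Gamma>h 1 0 1
    by (rule framed_by_locale[OF cone_framed_by c b])
  let ?S = "\<lambda>X. M q ** X ** transpose (M q)" and ?P = "gram (schouten \<Gamma>) b (\<rho> q)"
  have "sym2 (pullback2 b \<rho> (schouten \<Gamma>) c q) I J =
      (gram (pullback2 b \<rho> (schouten \<Gamma>)) c q + transpose (gram (pullback2 b \<rho> (schouten \<Gamma>)) c q)) $ I $ J / 2"
    by (simp add: sym2_def gram_component transpose_def)
  also have "\<dots> = ?S ((1 / 2) *\<^sub>R (block 0 ?P + block 0 (transpose ?P))) $ I $ J"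
    by (simp add: pullback_gram matrix_distribs transpose_block matrix_mul_assoc)
  also have "(1 / 2) *\<^sub>R (block 0 ?P + block 0 (transpose ?P)) = block 0 (gram g b (\<rho> q))"
    by (rule matrix_option_eqI) (simp_all add: gram_component g_def sym2_def transpose_def)
  finally have "sym2 (pullback2 b \<rho> (schouten \<Gamma>) c q) I J = ?S (block 0 (gram g b (\<rho> q))) $ I $ J" .
  moreover have "G c q I J = ?S (block (1 + t) (- gram g b (\<rho> q))) $ I $ J"
    by (simp add: gram_G[OF c b q, symmetric] gram_component)
  ultimately show ?thesis
    by (simp add: matrix_sandwich_component sum_option sum_negf)
qed

text \<open>Paired with the coframe, \<Omega> changes each cone coefficient separately. The term
  with \<open>G\<close> turns g into s g; mixed coefficients become 1 + (s - 1) + s t = s(1 + t);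
  the purely vertical one becomes 1 - t + (s - 1)(1 - t) + 2 s t = s(1 + t); the d\<beta> term
  supplies the \<mu> part.\<close>

lemma D_framed_by: "framed_by \<Gamma> (D s) (s * (1 + t)) ((1 + t) / 2) s"
  unfolding framed_by_def
proof (intro conjI nabla ballI allI)
  fix c b q I assume c: "c \<in> AN" and b: "b \<in> AM" and q: "q \<in> over c b"
  interpret framed_connection b "dom_chart b" c "over c b" \<rho> \<beta> \<Gamma> g \<omega> \<Gamma>h 1 0 1
    by (rule framed_by_locale[OF cone_framed_by c b])
  let ?F = "\<lambda>B. frame_coef (s * (1 + t)) ((1 + t) / 2) s \<Gamma> g \<omega> b B (\<rho> q)" and ?N = "matrix_inv (M q)"
  let ?H = "matrix_inv (gram g b (\<rho> q))" and ?W = "gram \<omega> b (\<rho> q)"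
  have u: "1 + t \<noteq> 0" using t by auto
  have NM: "?N ** M q = mat 1" "transpose (M q) ** transpose ?N = mat 1"
    using matrix_inv_left[OF invertible_coframe[OF q]]
    by (simp_all add: transpose_mat flip: matrix_transpose_mul)
  \<comment> \<open>d\<beta> with an index raised by \<open>G\<close> and read in the coframe. The
    minus sign is that of \<open>G\<close> on horizontal vectors and becomes the sign of \<mu> in
    \<open>fibre_coef\<close>.\<close>
  define X where "X = M q ** block 0 (- (?W ** ?H))"
  have dP: "(\<Sum>L\<in>UNIV. \<Sum>Q\<in>UNIV. ext_deriv \<beta> c q J Q * ginv G c q Q L * M q $ L $ A) = X $ J $ A" for J A
  proof -
    have "(\<Sum>L\<in>UNIV. \<Sum>Q\<in>UNIV. ext_deriv \<beta> c q J Q * ginv G c q Q L * M q $ L $ A) =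
        (gram (ext_deriv \<beta>) c q ** matrix_inv (gram G c q) ** M q) $ J $ A"
      by (simp add: matrix_mult_component gram_component ginv_def sum_distrib_right)
    also have "gram (ext_deriv \<beta>) c q ** matrix_inv (gram G c q) ** M q =
        M q ** block 0 ?W ** (transpose (M q) ** transpose ?N) ** block (1 / (1 + t)) (- ?H) ** (?N ** M q)"
      by (simp add: gram_ext_deriv[OF q] inverse_G(2)[OF c b q] matrix_mul_assoc)
    also have "\<dots> = X"
      by (simp add: NM X_def block_mult matrix_uminus_right flip: matrix_mul_assoc)
    finally show ?thesis .
  qed
  have E0: "(\<Sum>L\<in>UNIV. E c q L * M q $ L $ A) = (if A = None then 1 else 0)" for A
  proof -
    have "(\<Sum>L\<in>UNIV. E c q L * M q $ L $ A) = (?N ** M q) $ None $ A"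
      by (simp add: matrix_mult_component E_inverse[OF c b q])
    then show ?thesis by (auto simp: NM mat_def)
  qed
  have kr: "(\<Sum>L\<in>UNIV. kron J L * M q $ L $ A) = M q $ J $ A" for J A
    by (simp add: kron_def if_distrib[of "\<lambda>x. x * _"] cong: if_cong)
  have Gq: "G c q I J = (1 + t) * \<beta> c q I * \<beta> c q J
      - (\<Sum>i\<in>UNIV. \<Sum>j\<in>UNIV. M q $ I $ Some i * M q $ J $ Some j * g b (\<rho> q) i j)" for J
    using gram_component[of G c q I J]
    by (simp add: gram_G[OF c b q] matrix_sandwich_component sum_option sum_negf gram_component mult_ac)
  have XN: "X $ J $ None = 0" and XS: "X $ J $ Some k = - (\<Sum>j\<in>UNIV. M q $ J $ Some j * (?W ** ?H) $ j $ k)" for J k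
    by (simp_all add: X_def matrix_mult_component[of "M q"] sum_option sum_negf)
  have Om: "(connM (\<Omega> s) c q I ** M q) $ J $ A =
      (1 + t) / 2 * (\<beta> c q I * X $ J $ A + \<beta> c q J * X $ I $ A)
      - t * \<beta> c q I * \<beta> c q J * (if A = None then 1 else 0)
      + (s - 1) * (\<beta> c q I * M q $ J $ A + \<beta> c q J * M q $ I $ A - G c q I J * (if A = None then 1 else 0))
      + s * t * (\<beta> c q I * M q $ J $ A + \<beta> c q J * M q $ I $ A)" for J A
  proof -
    have "(\<Sum>L\<in>UNIV. (\<Sum>Q\<in>UNIV. sym2 (\<lambda>I J. \<beta> c q I * ext_deriv \<beta> c q J Q) I J * ginv G c q Q L) * M q $ L $ A)
        = (\<Sum>L\<in>UNIV. \<Sum>Q\<in>UNIV. \<beta> c q I / 2 * (ext_deriv \<beta> c q J Q * ginv G c q Q L * M q $ L $ A)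
          + \<beta> c q J / 2 * (ext_deriv \<beta> c q I Q * ginv G c q Q L * M q $ L $ A))"
      unfolding sum_distrib_right by (intro sum.cong refl) (simp add: sym2_def field_simps)
    also have "\<dots> = \<beta> c q I / 2 * X $ J $ A + \<beta> c q J / 2 * X $ I $ A"
      by (simp only: sum.distrib sum_distrib_left[symmetric] dP)
    finally have 1: "(\<Sum>L\<in>UNIV. (\<Sum>Q\<in>UNIV. sym2 (\<lambda>I J. \<beta> c q I * ext_deriv \<beta> c q J Q) I J * ginv G c q Q L) * M q $ L $ A)
        = \<beta> c q I / 2 * X $ J $ A + \<beta> c q J / 2 * X $ I $ A" .
    have "(\<Sum>L\<in>UNIV. sym2 (\<lambda>I J. \<beta> c q I * kron J L) I J * M q $ L $ A)
        = (\<Sum>L\<in>UNIV. \<beta> c q I / 2 * (kron J L * M q $ L $ A) + \<beta> c q J / 2 * (kron I L * M q $ L $ A))"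
      by (intro sum.cong refl) (simp add: sym2_def field_simps)
    also have "\<dots> = \<beta> c q I / 2 * M q $ J $ A + \<beta> c q J / 2 * M q $ I $ A"
      by (simp only: sum.distrib sum_distrib_left[symmetric] kr)
    finally have 2: "(\<Sum>L\<in>UNIV. sym2 (\<lambda>I J. \<beta> c q I * kron J L) I J * M q $ L $ A)
        = \<beta> c q I / 2 * M q $ J $ A + \<beta> c q J / 2 * M q $ I $ A" .
    have "(connM (\<Omega> s) c q I ** M q) $ J $ A =
        (1 + t) * (\<Sum>L\<in>UNIV. (\<Sum>Q\<in>UNIV. sym2 (\<lambda>I J. \<beta> c q I * ext_deriv \<beta> c q J Q) I J * ginv G c q Q L) * M q $ L $ A)
        - t * \<beta> c q I * \<beta> c q J * (\<Sum>L\<in>UNIV. E c q L * M q $ L $ A)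
        + (s - 1) * (2 * (\<Sum>L\<in>UNIV. sym2 (\<lambda>I J. \<beta> c q I * kron J L) I J * M q $ L $ A)
          - G c q I J * (\<Sum>L\<in>UNIV. E c q L * M q $ L $ A))
        + 2 * s * t * (\<Sum>L\<in>UNIV. sym2 (\<lambda>I J. \<beta> c q I * kron J L) I J * M q $ L $ A)"
    proof -
      have lin: "(\<Sum>L\<in>UNIV. (a * P L - h * Z L + r * (2 * S L - l * Z L) + k * S L) * m L) =
          a * (\<Sum>L\<in>UNIV. P L * m L) - h * (\<Sum>L\<in>UNIV. Z L * m L)
          + r * (2 * (\<Sum>L\<in>UNIV. S L * m L) - l * (\<Sum>L\<in>UNIV. Z L * m L)) + k * (\<Sum>L\<in>UNIV. S L * m L)"
        for P Z S m :: "'n option \<Rightarrow> real" and a h r l k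
        by (simp add: sum_distrib_left algebra_simps sum.distrib sum_subtractf)
      have "(connM (\<Omega> s) c q I ** M q) $ J $ A = (\<Sum>L\<in>UNIV. \<Omega> s c q I J L * M q $ L $ A)"
        by (simp only: matrix_mult_component connM_component)
      then show ?thesis unfolding Omega_def lin .
    qed
    then show ?thesis unfolding 1 2 E0 by (simp add: algebra_simps)
  qed
  \<comment> \<open>It remains to compare with the difference of the two lists of coefficients,
    separately for vertical and horizontal output.\<close>
  have "connM (\<Omega> s) c q I ** M q = M q ** (\<Sum>B\<in>UNIV. M q $ I $ B *\<^sub>R (?F B - F B (\<rho> q)))"
  proof (simp only: vec_eq_iff, intro allI)
    fix J A
    show "(connM (\<Omega> s) c q I ** M q) $ J $ A = (M q ** (\<Sum>B\<in>UNIV. M q $ I $ B *\<^sub>R (?F B - F B (\<rho> q)))) $ J $ A"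
    proof (cases A)
      case None
      have "(M q ** (\<Sum>B\<in>UNIV. M q $ I $ B *\<^sub>R (?F B - F B (\<rho> q)))) $ J $ None =
          (s * (1 + t) - 1) * \<beta> c q I * \<beta> c q J
          + (s - 1) * (\<Sum>i\<in>UNIV. \<Sum>j\<in>UNIV. M q $ I $ Some i * M q $ J $ Some j * g b (\<rho> q) i j)"
        unfolding frame_direction_component
        by (simp add: sum_option sum_distrib_left algebra_simps)
      then show ?thesis unfolding Om None XN Gq by (simp add: algebra_simps)
    next
      case (Some k)
      have T: "?F None $ Some j $ Some k - F None (\<rho> q) $ Some j $ Some k =
          (s * (1 + t) - 1) * kron j k - (1 + t) / 2 * (?W ** ?H) $ j $ k" for j
        by (simp add: fibre_coef_def mat_def kron_def algebra_simps)
      have T': "?F (Some j) $ None $ Some k - F (Some j) (\<rho> q) $ None $ Some k =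
          (s * (1 + t) - 1) * kron j k - (1 + t) / 2 * (?W ** ?H) $ j $ k" for j
        using T[of j] by simp
      have MX: "(\<Sum>j\<in>UNIV. M q $ J $ Some j * ((s * (1 + t) - 1) * kron j k - (1 + t) / 2 * (?W ** ?H) $ j $ k)) =
          (s * (1 + t) - 1) * M q $ J $ Some k + (1 + t) / 2 * X $ J $ Some k" for J
      proof -
        have "(\<Sum>j\<in>UNIV. M q $ J $ Some j * ((s * (1 + t) - 1) * kron j k)) = (s * (1 + t) - 1) * M q $ J $ Some k"
          by (simp add: kron_def if_distrib[of "\<lambda>x. _ * x"] cong: if_cong)
        moreover have "(\<Sum>j\<in>UNIV. M q $ J $ Some j * ((1 + t) / 2 * (?W ** ?H) $ j $ k)) = - ((1 + t) / 2 * X $ J $ Some k)"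
          unfolding XS by (simp add: sum_distrib_left mult.left_commute)
        ultimately show ?thesis by (simp only: right_diff_distrib sum_subtractf)
      qed
      have "(M q ** (\<Sum>B\<in>UNIV. M q $ I $ B *\<^sub>R (?F B - F B (\<rho> q)))) $ J $ Some k =
          \<beta> c q I * (\<Sum>j\<in>UNIV. M q $ J $ Some j * (?F None $ Some j $ Some k - F None (\<rho> q) $ Some j $ Some k))
          + \<beta> c q J * (\<Sum>j\<in>UNIV. M q $ I $ Some j * (?F (Some j) $ None $ Some k - F (Some j) (\<rho> q) $ None $ Some k))"
        unfolding frame_direction_component
        by (simp add: sum_option sum_distrib_left mult_ac)
      then show ?thesis unfolding Om Some T T' MX by (simp add: algebra_simps)
    qed
  qed
  moreover have "connM (D s) c q I = connM \<Gamma>h c q I + connM (\<Omega> s) c q I"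
    by (simp add: connM_def D_def vec_eq_iff)
  ultimately show "connM (D s) c q I ** M q = pdM c M I q + M q ** (\<Sum>B\<in>UNIV. M q $ I $ B *\<^sub>R ?F B)"
    by (simp add: matrix_add_rdistrib framed_D[OF q] scaleR_diff_right sum_subtractf matrix_diff_ldistrib)
qed

end

section \<open>The AH structure on the total space\<close>

context cone_metric
begin

abbreviation "ah_form s \<equiv> \<lambda>c q I. - 2 * (s * (1 + t)) * \<beta> c q I"

definition square :: "real \<Rightarrow> bool" where
  "square \<alpha> \<longleftrightarrow> (\<forall>b\<in>AM. \<forall>x\<in>dom_chart b.
    gram \<omega> b x ** matrix_inv (gram g b x) ** gram \<omega> b x = \<alpha> *\<^sub>R gram g b x)"

context
  fixes \<Gamma>' :: "('m, 'n) tensor3" and D' :: "('p, 'n option) tensor3" and s :: real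
  assumes F: "framed_by \<Gamma>' D' (s * (1 + t)) ((1 + t) / 2) s"
    and st: "\<And>b. b \<in> AM \<Longrightarrow> statistical_chart b (dom_chart b) \<Gamma>' g"
begin

lemma framed_statistical_over:
  assumes "c \<in> AN" "b \<in> AM"
  shows "framed_statistical b (dom_chart b) c (over c b) \<rho> \<beta> \<Gamma>' g \<omega> D' (s * (1 + t)) ((1 + t) / 2) s G (1 + t)"
proof -
  interpret framed_connection b "dom_chart b" c "over c b" \<rho> \<beta> \<Gamma>' g \<omega> D' "s * (1 + t)" "(1 + t) / 2" s
    by (rule framed_by_locale[OF F assms])
  interpret statistical_chart b "dom_chart b" \<Gamma>' g by (rule st[OF assms(2)])
  show ?thesis
    by unfold_locales (use t gram_G[OF assms] in auto)
qed

lemma cubic_form_over: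
  assumes "c \<in> AN" "b \<in> AM" "q \<in> over c b"
  shows "cubic_form D' G (ah_form s) c q I J L = frame_tensor (coframe b \<rho> \<beta> c q)
    (framed_statistical.cubic b \<rho> \<Gamma>' g q) I J L"
proof -
  interpret framed_statistical b "dom_chart b" c "over c b" \<rho> \<beta> \<Gamma>' g \<omega> D' "s * (1 + t)" "(1 + t) / 2" s G "1 + t"
    by (rule framed_statistical_over[OF assms(1,2)])
  show ?thesis by (simp add: cubic_form_def cov2_G[OF assms(3)])
qed

lemma trace_free_cubic_G: "trace_free_cubic AN D' G (ah_form s)"
  unfolding trace_free_cubic_def
proof (intro conjI ballI allI)
  show "smooth_atlas AN" by (rule AN)
  show "torsion_free_connection AN D'" by (rule framed_by_torsion_free[OF F])
  show "pseudo_metric AN G" by (rule metric_G)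
  show "one_form AN (ah_form s)" by (rule one_form_cmult[OF AN one_form_\<beta>])
  fix c q I assume c: "c \<in> AN" and "q \<in> dom_chart c"
  then obtain b where b: "b \<in> AM" "q \<in> over c b" using base_chart_exists by metis
  interpret framed_statistical b "dom_chart b" c "over c b" \<rho> \<beta> \<Gamma>' g \<omega> D' "s * (1 + t)" "(1 + t) / 2" s G "1 + t"
    by (rule framed_statistical_over[OF c b(1)])
  show "cubic_form D' G (ah_form s) c q I J L = cubic_form D' G (ah_form s) c q J I L" for J L
    unfolding cubic_form_over[OF c b] by (rule cubic_sym[OF b(2)])
  show "(\<Sum>J\<in>UNIV. \<Sum>L\<in>UNIV. ginv G c q J L * cubic_form D' G (ah_form s) c q I J L) = 0"
    unfolding cubic_form_over[OF c b] by (rule cubic_trace[OF b(2)])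
qed

lemma statistical_chart_form_base:
  assumes b: "b \<in> AM" and \<alpha>: "\<alpha> \<noteq> 0" "square \<alpha>"
  shows "statistical_chart_form b (dom_chart b) \<Gamma>' g \<omega> \<alpha>"
proof -
  interpret statistical_chart b "dom_chart b" \<Gamma>' g by (rule st[OF b])
  show ?thesis
  proof
    show "smoothM b (dom_chart b) (gram \<omega> b)" by (rule omega_facts(1)[OF b])
    show "\<omega> b x i j = - \<omega> b x j i" if "x \<in> dom_chart b" for x i j by (rule omega_facts(2)[OF b that])
    show "gram \<omega> b x ** H x ** gram \<omega> b x = \<alpha> *\<^sub>R gram g b x" if "x \<in> dom_chart b" for x
      using \<alpha>(2) b that by (simp add: square_def)
    show "cov2 \<Gamma>' \<omega> b x i j k + cov2 \<Gamma>' \<omega> b x j k i + cov2 \<Gamma>' \<omega> b x k i j = 0"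
      if x: "x \<in> dom_chart b" for x i j k
    proof -
      \<comment> \<open>Closedness is proved at points of the total space, so surjectivity of \<rho>
        is used to find one over x.\<close>
      have "x \<in> \<rho> ` carrier AN" using principal b x by (auto simp: principal_bundle_def carrier_def)
      then obtain c q where c: "c \<in> AN" and q: "q \<in> dom_chart c" "\<rho> q = x" by (auto simp: carrier_def)
      interpret framed_connection b "dom_chart b" c "over c b" \<rho> \<beta> \<Gamma>' g \<omega> D' "s * (1 + t)" "(1 + t) / 2" s
        by (rule framed_by_locale[OF F c b])
      show ?thesis using closed[of q i j k] q x by simp
    qed
  qed (rule \<alpha>(1))
qed

context
  fixes \<alpha> :: real
  assumes \<alpha>: "\<alpha> \<noteq> 0" "square \<alpha>"
    and ric: "\<And>b x i j. b \<in> AM \<Longrightarrow> x \<in> dom_chart b \<Longrightarrow>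
      sym2 (ricci \<Gamma>' b x) i j = (1 - real CARD('n)) * g b x i j"
    and s: "s\<^sup>2 = 1 / (1 + t) + (real CARD('n) + 2) * \<alpha> / (4 * (real CARD('n) - 1))"
begin

lemma framed_einstein_over:
  assumes "c \<in> AN" "b \<in> AM"
  shows "framed_einstein b (dom_chart b) c (over c b) \<rho> \<beta> \<Gamma>' g \<omega> D' (s * (1 + t)) ((1 + t) / 2) s G (1 + t) \<alpha>"
proof -
  interpret framed_statistical b "dom_chart b" c "over c b" \<rho> \<beta> \<Gamma>' g \<omega> D' "s * (1 + t)" "(1 + t) / 2" s G "1 + t"
    by (rule framed_statistical_over[OF assms])
  interpret statistical_chart_form b "dom_chart b" \<Gamma>' g \<omega> \<alpha>
    by (rule statistical_chart_form_base[OF assms(2) \<alpha>])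
  show ?thesis by unfold_locales (rule ric[OF assms(2)])
qed

lemma ricci_scal_G:
  assumes c: "c \<in> AN" and q: "q \<in> dom_chart c"
  shows "sym2 (ricci D' c q) I J = - (real CARD('n) * \<alpha> * (1 + t) / 4) * G c q I J"
    and "scal D' G c q = - (real CARD('n) * (real CARD('n) + 1) * \<alpha> * (1 + t) / 4)"
proof -
  obtain b where b: "b \<in> AM" "q \<in> over c b" by (rule base_chart_exists[OF c q])
  interpret framed_einstein b "dom_chart b" c "over c b" \<rho> \<beta> \<Gamma>' g \<omega> D' "s * (1 + t)" "(1 + t) / 2" s G "1 + t" \<alpha>
    by (rule framed_einstein_over[OF c b(1)])
  show "sym2 (ricci D' c q) I J = - (real CARD('n) * \<alpha> * (1 + t) / 4) * G c q I J"
    "scal D' G c q = - (real CARD('n) * (real CARD('n) + 1) * \<alpha> * (1 + t) / 4)"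
    by (rule ricci_G[OF b(2) s n_ge_2])+
qed

lemma half_naive_einstein_G: "half_naive_einstein AN D' G"
  unfolding half_naive_einstein_def
proof (intro conjI ballI allI)
  show "AH_structure AN D' G" by (rule trace_free_cubic_AH_structure[OF trace_free_cubic_G])
  fix c q I J assume cq: "c \<in> AN" "q \<in> dom_chart c"
  show "sym2 (ricci D' c q) I J = scal D' G c q / real CARD('n option) * G c q I J"
    unfolding ricci_scal_G[OF cq] by (simp add: card_option field_simps)
qed

text \<open>For the representative \<open>G\<close> the scalar curvature is constant, and both
  remaining terms of the Einstein condition are multiples of \<beta>: the one-form is one by
  definition, the divergence of its exterior derivative by
  \<open>divergence_ext_deriv\<close>.\<close>

lemma einstein_AH_G:
  assumes "naive_einstein AN D' G"
  shows "einstein_AH AN D' G"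
proof (rule einstein_AH_I[OF trace_free_cubic_G _ assms ricci_scal_G(2)])
  show "CARD('n option) \<ge> 2" using n_ge_2 by (simp add: card_option)
  fix c q L assume c: "c \<in> AN" and q: "q \<in> dom_chart c"
  obtain b where b: "b \<in> AM" "q \<in> over c b" by (rule base_chart_exists[OF c q])
  interpret framed_einstein b "dom_chart b" c "over c b" \<rho> \<beta> \<Gamma>' g \<omega> D' "s * (1 + t)" "(1 + t) / 2" s G "1 + t" \<alpha>
    by (rule framed_einstein_over[OF c b(1)])
  let ?k = "- 2 * (s * (1 + t))"
  have ext: "ext_deriv (ah_form s) c q I J = ?k * ext_deriv \<beta> c q I J" if "q \<in> over c b" for q I J
    unfolding ext_deriv_def pd_cmult[OF region_c that smooth_\<beta>] by (simp add: algebra_simps)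
  have "smooth_in c (over c b) (\<lambda>q. ext_deriv \<beta> c q I J)" for I J
    unfolding ext_deriv_def by (intro smooth_in_diff[OF region_c] smooth_in_pd[OF region_c] smooth_\<beta>)
  then have "pd c (\<lambda>q. ?k * ext_deriv \<beta> c q J L) I q = ?k * pd c (\<lambda>q. ext_deriv \<beta> c q J L) I q" for I J L
    by (rule pd_cmult[OF region_c b(2)])
  moreover have "pd c (\<lambda>q. ext_deriv (ah_form s) c q J L) I q = pd c (\<lambda>q. ?k * ext_deriv \<beta> c q J L) I q" for I J L
    by (rule pd_cong[OF region_c b(2)]) (rule ext)
  ultimately have "pd c (\<lambda>q. ext_deriv (ah_form s) c q J L) I q = ?k * pd c (\<lambda>q. ext_deriv \<beta> c q J L) I q" for I J L
    by simp
  then have "cov2 D' (ext_deriv (ah_form s)) c q I J L = ?k * cov2 D' (ext_deriv \<beta>) c q I J L" for I J L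
    by (simp only: cov2_def ext[OF b(2)]) (simp add: sum_distrib_left right_diff_distrib mult_ac)
  then have div: "(\<Sum>I\<in>UNIV. \<Sum>J\<in>UNIV. ginv G c q I J * cov2 D' (ext_deriv (ah_form s)) c q I J L) =
      ?k * (\<Sum>I\<in>UNIV. \<Sum>J\<in>UNIV. ginv G c q I J * cov2 D' (ext_deriv \<beta>) c q I J L)"
    by (simp only: sum_distrib_left mult.left_commute)
  \<comment> \<open>With u = 1 + t, the two coefficients of \<beta> are n(n + 1) \<alpha> s u u / 2
    with opposite signs.\<close>
  show "- (real CARD('n) * (real CARD('n) + 1) * \<alpha> * (1 + t) / 4) * ah_form s c q L
      + real CARD('n option) / 2 * (\<Sum>I\<in>UNIV. \<Sum>J\<in>UNIV. ginv G c q I J * cov2 D' (ext_deriv (ah_form s)) c q I J L) = 0"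
    unfolding div divergence_ext_deriv[OF b(2)] by (simp add: card_option field_simps)
qed

end

end

section \<open>The conjugate of D s\<close>

lemma ricci_base: "sym2 (ricci \<Gamma> b x) i j = (1 - real CARD('n)) * g b x i j"
  using n_ge_2 by (simp add: g_def sym2_schouten)

text \<open>The cubic form upstairs is minus the pulled-back \<nabla>g, and the inverse of
  \<open>G\<close> is minus that of g on horizontal vectors. The signs cancel, so conjugating
  \<open>D s\<close> conjugates the base connection and leaves all other coefficients alone.\<close>

lemma conjugate_framed_by:
  assumes S: "special_statistical AM \<Gamma> g" and \<Gamma>': "torsion_free_connection AM (conjugate_connection \<Gamma> g (\<lambda>c p i. 0))"
    and \<eta>: "AH_form AN (D s) G \<eta>"
  shows "framed_by (conjugate_connection \<Gamma> g (\<lambda>c p i. 0)) (conjugate_connection (D s) G \<eta>) (s * (1 + t)) ((1 + t) / 2) s"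
  unfolding framed_by_def
proof (intro conjI \<Gamma>' ballI allI)
  note st = special_statistical_chart[OF AM _ S]
  fix c b q I assume c: "c \<in> AN" and b: "b \<in> AM" and q: "q \<in> over c b"
  have x: "\<rho> q \<in> dom_chart b" using q by simp
  interpret framed_statistical b "dom_chart b" c "over c b" \<rho> \<beta> \<Gamma> g \<omega> "D s" "s * (1 + t)" "(1 + t) / 2" s G "1 + t"
    by (rule framed_statistical_over[OF D_framed_by st c b])
  let ?\<Gamma>' = "conjugate_connection \<Gamma> g (\<lambda>c p i. 0)" and ?D' = "conjugate_connection (D s) G \<eta>"
  let ?F' = "\<lambda>B. frame_coef (s * (1 + t)) ((1 + t) / 2) s ?\<Gamma>' g \<omega> b B (\<rho> q)" and ?N = "matrix_inv (M q)"
  \<comment> \<open>The given form need not be \<open>ah_form s\<close> syntactically; uniqueness in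
    dimension n + 1 identifies their values.\<close>
  have \<eta>_eq: "\<eta> c q I = ah_form s c q I" for I
    using q n_ge_2 by (intro AH_form_unique[OF \<eta> trace_free_cubic_AH_form[OF trace_free_cubic_G[OF D_framed_by st]] metric_G _ c])
      (auto simp: card_option)
  have cubic: "cubic_form (D s) G \<eta> c q I J L = frame_tensor (M q) (cubic q) I J L" for J L
    using cubic_form_over[OF D_framed_by st c b q, of s I J L] by (simp add: cubic_form_def \<eta>_eq)
  have NM: "?N ** M q = mat 1" "transpose (M q) ** transpose ?N = mat 1"
    using matrix_inv_left[OF invertible_coframe[OF q]]
    by (simp_all add: transpose_mat flip: matrix_transpose_mul)
  let ?S = "\<Sum>A\<in>UNIV. M q $ I $ A *\<^sub>R cubic q A"
  have ginv_sym: "matrix_inv (gram G c q) $ J $ L = matrix_inv (gram G c q) $ L $ J" for J L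
    using q by (intro transpose_eqD pseudo_metric_gram(3)[OF metric_G c]) simp
  have "connM ?D' c q I = connM (D s) c q I + M q ** ?S ** transpose (M q) ** matrix_inv (gram G c q)"
  proof (simp only: vec_eq_iff, intro allI)
    fix J L
    have "(M q ** ?S ** transpose (M q) ** matrix_inv (gram G c q)) $ J $ L =
        (\<Sum>l\<in>UNIV. ginv G c q L l * cubic_form (D s) G \<eta> c q I J l)"
      unfolding matrix_mult_component[of _ "matrix_inv (gram G c q)"] frame_tensor_matrix cubic
      by (intro sum.cong refl) (simp add: ginv_sym[of L] ginv_def mult.commute)
    then show "connM ?D' c q I $ J $ L =
        (connM (D s) c q I + M q ** ?S ** transpose (M q) ** matrix_inv (gram G c q)) $ J $ L"
      by (simp add: connM_component conjugate_connection_def)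
  qed
  then have "connM ?D' c q I ** M q = connM (D s) c q I ** M q
      + M q ** ?S ** (transpose (M q) ** transpose ?N) ** block (1 / (1 + t)) (- stat.H (\<rho> q)) ** (?N ** M q)"
    by (simp add: matrix_add_rdistrib ginv_G(2)[OF q] matrix_mul_assoc)
  then have 1: "connM ?D' c q I ** M q = connM (D s) c q I ** M q + M q ** (?S ** block (1 / (1 + t)) (- stat.H (\<rho> q)))"
    by (simp add: NM matrix_mul_assoc)
  \<comment> \<open>Only the entries with horizontal inputs and output change; there the difference
    is the conjugation term of the base.\<close>
  have "cubic q A ** block (1 / (1 + t)) (- stat.H (\<rho> q)) = ?F' A - F A (\<rho> q)" for A
  proof (cases A)
    case None
    then show ?thesis by (simp add: cubic_def)
  next
    case (Some i)
    have "connM ?\<Gamma>' b (\<rho> q) i = connM \<Gamma> b (\<rho> q) i + covM \<Gamma> g b (\<rho> q) i ** stat.H (\<rho> q)"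
      using stat.connM_conj[OF x] unfolding stat.conj_def .
    then have e: "?\<Gamma>' b (\<rho> q) i j k = \<Gamma> b (\<rho> q) i j k + (covM \<Gamma> g b (\<rho> q) i ** stat.H (\<rho> q)) $ j $ k" for j k
      by (simp add: vec_eq_iff connM_component)
    show ?thesis
      by (rule matrix_option_eqI)
        (simp_all add: Some cubic_def block_mult matrix_uminus_left matrix_uminus_right e)
  qed
  then have 2: "?S ** block (1 / (1 + t)) (- stat.H (\<rho> q)) = (\<Sum>A\<in>UNIV. M q $ I $ A *\<^sub>R (?F' A - F A (\<rho> q)))"
    by (simp add: matrix_sum_left matrix_scaleR_left)
  show "connM ?D' c q I ** M q = pdM c M I q + M q ** (\<Sum>B\<in>UNIV. M q $ I $ B *\<^sub>R ?F' B)"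
    unfolding 1 2 framed_D[OF q]
    by (simp add: scaleR_diff_right sum_subtractf matrix_diff_ldistrib)
qed

end

section \<open>Definite signature and the assembled statement\<close>

lemma statistical_AH_form_0:
  assumes "smooth_atlas A" "statistical A \<Gamma> g" "one_form A \<beta>"
  shows "AH_form A \<Gamma> g (\<lambda>c p i. 0)"
  using one_form_cmult[OF assms(1,3), of 0] assms(2)
  by (simp add: AH_form_def statistical_def) (simp add: alt2_def)

lemma det_scaled: "det (r *\<^sub>R A) = r ^ CARD('n) * det A" for A :: "real^'n::finite^'n"
proof -
  have "r *\<^sub>R A = (\<chi> i. r *s A $ i)" by (simp add: vec_eq_iff)
  then show ?thesis using det_rows_mul[of "\<lambda>_. r" "\<lambda>i. A $ i"] by simp
qed

text \<open>Evaluating the square relation on v gives \<open>\<alpha> g(v,v) = - g(z,z)\<close> with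
  z = H W v, so definiteness and \<alpha> \<noteq> 0 force \<alpha> < 0. Taking determinants
  exhibits a positive multiple of the n-th power of \<alpha> as a square, which for negative
  \<alpha> requires n even.\<close>

lemma definite_square:
  fixes g H W :: "real^'n::finite^'n"
  assumes gH: "g ** H = mat 1" and W: "transpose W = - W" and sq: "W ** H ** W = \<alpha> *\<^sub>R g" and \<alpha>: "\<alpha> \<noteq> 0"
    and def: "(\<forall>v. v \<noteq> 0 \<longrightarrow> v \<bullet> (g *v v) > 0) \<or> (\<forall>v. v \<noteq> 0 \<longrightarrow> v \<bullet> (g *v v) < 0)"
  shows "\<alpha> < 0" "even CARD('n)"
proof -
  \<comment> \<open>Any nonzero vector would do; this is the one with all entries 1.\<close>
  define v :: "real^'n" where "v = 1"
  have v: "v \<noteq> 0" by (simp add: v_def)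
  define z where "z = H *v (W *v v)"
  have gz: "g *v z = W *v v" by (simp add: z_def matrix_vector_mul_assoc gH matrix_mul_assoc)
  have "\<alpha> * (v \<bullet> (g *v v)) = v \<bullet> (W *v z)"
    using arg_cong[OF sq, of "\<lambda>X. v \<bullet> (X *v v)"]
    by (simp add: z_def matrix_vector_mul_assoc matrix_mul_assoc scaleR_matrix_vector_assoc[symmetric])
  also have "\<dots> = (transpose W *v v) \<bullet> z" by (simp add: dot_lmul_matrix vector_transpose_matrix flip: vector_transpose_matrix)
  also have "transpose W *v v = - (g *v z)"
    unfolding W gz by (simp add: matrix_vector_mult_def vec_eq_iff sum_negf)
  also have "- (g *v z) \<bullet> z = - (z \<bullet> (g *v z))"
    by (simp add: inner_commute)
  finally have eq: "\<alpha> * (v \<bullet> (g *v v)) = - (z \<bullet> (g *v z))" .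
  show neg: "\<alpha> < 0"
    using def
  proof
    assume d: "\<forall>v. v \<noteq> 0 \<longrightarrow> v \<bullet> (g *v v) > 0"
    then have "z \<bullet> (g *v z) \<ge> 0" by (cases "z = 0") (auto simp: less_imp_le)
    then have "\<alpha> * (v \<bullet> (g *v v)) \<le> 0" using eq by simp
    then show ?thesis using d v \<alpha> by (metis mult_le_0_iff linorder_not_less order_le_less)
  next
    assume d: "\<forall>v. v \<noteq> 0 \<longrightarrow> v \<bullet> (g *v v) < 0"
    then have "z \<bullet> (g *v z) \<le> 0" by (cases "z = 0") (auto simp: less_imp_le)
    then have "\<alpha> * (v \<bullet> (g *v v)) \<ge> 0" using eq by simp
    then show ?thesis using d v \<alpha> by (metis zero_le_mult_iff linorder_not_less order_le_less)
  qed
  have dg: "det g * det H = 1" using arg_cong[OF gH, of det] by (simp add: det_mul)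
  then have dg0: "det g \<noteq> 0" by auto
  have "det W * det H * det W = \<alpha> ^ CARD('n) * det g"
    using arg_cong[OF sq, of det] by (simp add: det_mul det_scaled)
  then have "det W * (det g * det H) * det W = \<alpha> ^ CARD('n) * det g * det g" by (simp add: mult_ac)
  then have "\<alpha> ^ CARD('n) * (det g)\<^sup>2 = (det W)\<^sup>2" by (simp add: dg power2_eq_square)
  then have "\<alpha> ^ CARD('n) * (det g)\<^sup>2 \<ge> 0" by simp
  moreover have "(det g)\<^sup>2 > 0" using dg0 by simp
  ultimately have "\<not> \<alpha> ^ CARD('n) < 0" by (meson mult_neg_pos not_le)
  then show "even CARD('n)" using neg power_less_zero_eq[of \<alpha> "CARD('n)"] by blast
qed

theorem theorem10p10:
  fixes AM :: "('m::{t2_space,second_countable_topology}, real^'n::finite) chart set"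
    and AN :: "('p::{t2_space,second_countable_topology}, real^('n option)) chart set"
    and K :: structure_group
    and \<rho> :: "'p \<Rightarrow> 'm" and act :: "complex \<Rightarrow> 'p \<Rightarrow> 'p"
    and \<Gamma> :: "('m, 'n) tensor3" and \<beta> E :: "('p, 'n option) tensor1"
    and \<omega> g :: "('m, 'n) tensor2" and \<Gamma>h :: "('p, 'n option) tensor3"
    and G :: "('p, 'n option) tensor2" and \<Omega> D :: "real \<Rightarrow> ('p, 'n option) tensor3"
    and t n :: real
    and omega_squared :: "real \<Rightarrow> bool"
  assumes n_def: "n = real CARD('n)" and n_ge_2: "CARD('n) \<ge> 2"
    and M: "smooth_manifold AM" and N: "smooth_manifold AN"
    and principal: "principal_bundle K AM AN \<rho> act"
    and E_def: "E = fundamental_field K act"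
    and nabla: "torsion_free_connection AM \<Gamma>"
    and beta: "principal_connection K AN act \<beta>"
    and omega: "connection_curvature AM AN \<rho> \<beta> \<omega>"
    and cone: "cone_connection K AM AN \<rho> act \<Gamma> \<beta> \<omega> \<Gamma>h"
    and g_def: "g = (\<lambda>c p i j. sym2 (schouten \<Gamma> c p) i j)"
    and g_nondegenerate: "nondegenerate AM g"
    and t: "t \<noteq> -1"
    and G_def: "G = (\<lambda>c q I J. sym2 (cov1 \<Gamma>h \<beta> c q) I J + (2 + t) * \<beta> c q I * \<beta> c q J)"
    and Omega_def: "\<Omega> = (\<lambda>s c q I J L.
        (1 + t) * (\<Sum>Q\<in>UNIV. sym2 (\<lambda>I J. \<beta> c q I * ext_deriv \<beta> c q J Q) I J * ginv G c q Q L)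
        - t * \<beta> c q I * \<beta> c q J * E c q L
        + (s - 1) * (2 * sym2 (\<lambda>I J. \<beta> c q I * kron J L) I J - G c q I J * E c q L)
        + 2 * s * t * sym2 (\<lambda>I J. \<beta> c q I * kron J L) I J)"
    and D_def: "D = (\<lambda>s c q I J L. \<Gamma>h c q I J L + \<Omega> s c q I J L)"
    and omega_squared_def: "\<And>\<alpha>. omega_squared \<alpha> \<longleftrightarrow>
        (\<forall>c\<in>AM. \<forall>x\<in>dom_chart c. \<forall>i j.
           (\<Sum>p\<in>UNIV. \<Sum>q\<in>UNIV. \<omega> c x i p * \<omega> c x q j * ginv g c x p q) = \<alpha> * g c x i j)"
  shows
    "pseudo_metric AN G \<and>
     (\<forall>c\<in>AN. \<forall>b\<in>AM. \<forall>q\<in>dom_chart c. \<rho> q \<in> dom_chart b \<longrightarrow>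
        (\<forall>I J. G c q I J =
           (1 + t) * \<beta> c q I * \<beta> c q J - sym2 (pullback2 b \<rho> (schouten \<Gamma>) c q) I J)) \<and>
     (\<forall>s. torsion_free_connection AN (D s)) \<and>

     (\<forall>\<alpha>. special_statistical AM \<Gamma> g \<and> \<alpha> \<noteq> 0 \<and> omega_squared \<alpha> \<longrightarrow>
        (\<forall>s. \<forall>c\<in>AN. \<forall>q\<in>dom_chart c. \<forall>I J L.
           alt2 (\<lambda>I J. cov2 (D s) G c q I J L) I J =
           - 2 * s * (t + 1) * alt2 (\<lambda>I J. \<beta> c q I * G c q J L) I J) \<and>
        (\<alpha> > - (4 * (n - 1) / ((n + 2) * (t + 1))) \<longrightarrow>
           (\<forall>s. s = sqrt (1 / (1 + t) + (n + 2) * \<alpha> / (4 * (n - 1))) \<or>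
                s = - sqrt (1 / (1 + t) + (n + 2) * \<alpha> / (4 * (n - 1))) \<longrightarrow>
              half_naive_einstein AN (D s) G))) \<and>

     (\<forall>\<alpha>. special_statistical AM \<Gamma> g \<and> einstein_AH AM \<Gamma> g \<and>
          (\<forall>c\<in>AM. \<forall>x\<in>dom_chart c. scal \<Gamma> g c x = - n * (n - 1)) \<and>
          \<alpha> \<noteq> 0 \<and> omega_squared \<alpha> \<longrightarrow>
        (\<forall>s. s\<^sup>2 = 1 / (1 + t) + (n + 2) * \<alpha> / (4 * (n - 1)) \<longrightarrow>
           generates_AH AN (D s) G (D s) \<and> naive_einstein AN (D s) G \<and>
           (t = 0 \<longrightarrow>
              einstein_AH AN (D s) G \<and>
              (\<forall>c\<in>AN. \<forall>q\<in>dom_chart c. scal (D s) G c q = - (n * (n + 1) * \<alpha> / 4))))) \<and>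

     (\<forall>\<alpha>. definite_signature AM g \<and> special_statistical AM \<Gamma> g \<and> \<alpha> \<noteq> 0 \<and> omega_squared \<alpha> \<longrightarrow>
        \<alpha> < 0 \<and> even CARD('n)) \<and>
     (\<forall>\<alpha>. definite_signature AM g \<and> special_statistical AM \<Gamma> g \<and> einstein_AH AM \<Gamma> g \<and>
          (\<forall>c\<in>AM. \<forall>x\<in>dom_chart c. scal \<Gamma> g c x = - n * (n - 1)) \<and>
          \<alpha> \<noteq> 0 \<and> omega_squared \<alpha> \<longrightarrow>
        \<alpha> < 0 \<and> even CARD('n))"
proof -
  have carr: "carrier AM \<noteq> {}" using M by (simp add: smooth_manifold_def)
  have AM: "smooth_atlas AM" and AN: "smooth_atlas AN"
    using M N by (simp_all add: smooth_manifold_def)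
  interpret cone_metric AM AN K \<rho> act \<Gamma> \<beta> E \<omega> g \<Gamma>h G \<Omega> D t
    by unfold_locales (fact AM AN principal E_def nabla beta omega cone g_def g_nondegenerate n_ge_2 t
        G_def Omega_def D_def)+
  \<comment> \<open>The contraction in the hypothesis pairs the second index of the first \<omega>
    with the first index of the second, which is the matrix product.\<close>
  have sq: "square \<alpha> \<longleftrightarrow> omega_squared \<alpha>" for \<alpha>
  proof -
    have "(gram \<omega> b x ** matrix_inv (gram g b x) ** gram \<omega> b x) $ i $ j =
        (\<Sum>p\<in>UNIV. \<Sum>q\<in>UNIV. \<omega> b x i p * \<omega> b x q j * ginv g b x p q)" for b x i j
      by (simp add: matrix_mult_component gram_component ginv_def sum_distrib_right)
        (subst sum.swap, simp add: mult_ac)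
    then show ?thesis by (simp add: square_def omega_squared_def vec_eq_iff gram_component)
  qed
  have conn: "torsion_free_connection AN (D s)" for s
    by (rule framed_by_torsion_free[OF D_framed_by])
  have tfc: "trace_free_cubic AN (D s) G (ah_form s)" if "special_statistical AM \<Gamma> g" for s
    by (rule trace_free_cubic_G[OF D_framed_by special_statistical_chart[OF AM _ that]])
  have half: "half_naive_einstein AN (D s) G"
    and scal: "c \<in> AN \<Longrightarrow> q \<in> dom_chart c \<Longrightarrow> scal (D s) G c q = - (n * (n + 1) * \<alpha> * (1 + t) / 4)"
    and einstein: "naive_einstein AN (D s) G \<Longrightarrow> einstein_AH AN (D s) G"
    if "special_statistical AM \<Gamma> g" "\<alpha> \<noteq> 0" "omega_squared \<alpha>"
      "s\<^sup>2 = 1 / (1 + t) + (n + 2) * \<alpha> / (4 * (n - 1))" for \<alpha> s c q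
  proof -
    note st = special_statistical_chart[OF AM _ that(1)] and a = that(3)[folded sq] and s = that(4)[unfolded n_def]
    show "half_naive_einstein AN (D s) G"
      by (rule half_naive_einstein_G[OF D_framed_by st that(2) a ricci_base s])
    show "c \<in> AN \<Longrightarrow> q \<in> dom_chart c \<Longrightarrow> scal (D s) G c q = - (n * (n + 1) * \<alpha> * (1 + t) / 4)"
      unfolding n_def by (rule ricci_scal_G(2)[OF D_framed_by st that(2) a ricci_base s])
    show "naive_einstein AN (D s) G \<Longrightarrow> einstein_AH AN (D s) G"
      by (rule einstein_AH_G[OF D_framed_by st that(2) a ricci_base s])
  qed
  have naive: "naive_einstein AN (D s) G"
    if S: "special_statistical AM \<Gamma> g" and Ei: "einstein_AH AM \<Gamma> g"
      and sc: "\<forall>c\<in>AM. \<forall>x\<in>dom_chart c. scal \<Gamma> g c x = - n * (n - 1)"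
      and \<alpha>: "\<alpha> \<noteq> 0" "omega_squared \<alpha>" and s: "s\<^sup>2 = 1 / (1 + t) + (n + 2) * \<alpha> / (4 * (n - 1))" for \<alpha> s
    unfolding naive_einstein_def
  proof (intro conjI allI impI)
    show "half_naive_einstein AN (D s) G" by (rule half[OF S \<alpha> s])
    fix \<eta> assume \<eta>: "AH_form AN (D s) G \<eta>"
    \<comment> \<open>On the base the conjugate is formed with the zero one-form, an AH form of g
      because \<nabla>g is symmetric in its first two indices.\<close>
    let ?\<Gamma>' = "conjugate_connection \<Gamma> g (\<lambda>c p i. 0)"
    have "one_form AM (\<lambda>c p i. 0)"
      by (simp add: one_form_def smooth_on_def o_def Ck_on_const)
    then have "AH_form AM \<Gamma> g (\<lambda>c p i. 0)"
      using S by (intro statistical_AH_form_0[OF AM]) (simp_all add: special_statistical_def)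
    then have hn: "half_naive_einstein AM ?\<Gamma>' g"
      using Ei by (simp add: einstein_AH_def naive_einstein_def)
    \<comment> \<open>That the conjugate is a connection at all, transformation law included, is
      read off from its being part of an AH structure.\<close>
    then have tf: "torsion_free_connection AM ?\<Gamma>'"
      by (simp add: half_naive_einstein_def AH_structure_def)
    have st: "statistical_chart b (dom_chart b) ?\<Gamma>' g" and scal': "x \<in> dom_chart b \<Longrightarrow> scal ?\<Gamma>' g b x = scal \<Gamma> g b x"
      if b: "b \<in> AM" for b x
    proof -
      interpret statistical_chart b "dom_chart b" \<Gamma> g by (rule special_statistical_chart[OF AM b S])
      show "statistical_chart b (dom_chart b) ?\<Gamma>' g"
        "x \<in> dom_chart b \<Longrightarrow> scal ?\<Gamma>' g b x = scal \<Gamma> g b x"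
        using statistical_chart_conj scal_conj unfolding conj_def .
    qed
    \<comment> \<open>Half naive Einstein gives the factor scal / n for the conjugate; its scalar
      curvature equals that of \<nabla>, namely -n(n - 1).\<close>
    have ric: "sym2 (ricci ?\<Gamma>' b x) i j = (1 - real CARD('n)) * g b x i j" if "b \<in> AM" "x \<in> dom_chart b" for b x i j
    proof -
      have "sym2 (ricci ?\<Gamma>' b x) i j = scal ?\<Gamma>' g b x / n * g b x i j"
        using hn that by (simp add: half_naive_einstein_def n_def)
      also have "scal ?\<Gamma>' g b x / n = 1 - n"
        using sc that n_ge_2 by (simp add: scal' n_def field_simps)
      finally show ?thesis by (simp add: n_def)
    qed
    show "half_naive_einstein AN (conjugate_connection (D s) G \<eta>) G"
      by (rule half_naive_einstein_G[OF conjugate_framed_by[OF S tf \<eta>] st \<alpha>(1) \<alpha>(2)[folded sq] ric s[unfolded n_def]])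
  qed
  have definite: "\<alpha> < 0 \<and> even CARD('n)"
    if def: "definite_signature AM g" and S: "special_statistical AM \<Gamma> g" and \<alpha>: "\<alpha> \<noteq> 0" "omega_squared \<alpha>" for \<alpha>
  proof -
    \<comment> \<open>A single point decides the sign of \<alpha> and the parity, and the base is
      nonempty.\<close>
    obtain b x where b: "b \<in> AM" and x: "x \<in> dom_chart b" using carr by (auto simp: carrier_def)
    have "gram g b x ** matrix_inv (gram g b x) = mat 1" by (rule matrix_inv_right[OF g_inv[OF b x]])
    moreover have "transpose (gram \<omega> b x) = - gram \<omega> b x"
      unfolding gram_def transpose_def vec_eq_iff by (auto intro: omega_facts(2)[OF b x])
    moreover have "gram \<omega> b x ** matrix_inv (gram g b x) ** gram \<omega> b x = \<alpha> *\<^sub>R gram g b x"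
      using \<alpha>(2) b x unfolding sq[symmetric] square_def by blast
    moreover have "(\<forall>v. v \<noteq> 0 \<longrightarrow> v \<bullet> (gram g b x *v v) > 0) \<or> (\<forall>v. v \<noteq> 0 \<longrightarrow> v \<bullet> (gram g b x *v v) < 0)"
      using def b x unfolding definite_signature_def by blast
    ultimately show ?thesis using definite_square[OF _ _ _ \<alpha>(1)] by blast
  qed
  \<comment> \<open>\<open>D s\<close> is itself aligned, so the zero one-form serves as the shift
    \<sigma>.\<close>
  have gen: "generates_AH AN (D s) G (D s)" if S: "special_statistical AM \<Gamma> g" for s
  proof -
    have "AH_structure AN (D s) G" by (rule trace_free_cubic_AH_structure[OF tfc[OF S]])
    moreover have "one_form AN (\<lambda>c p i. 0)" using one_form_cmult[OF AN one_form_\<beta>, of 0] by simp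
    moreover have "\<exists>\<gamma>. AH_form AN (D s) G \<gamma>"
      by (rule exI[of _ "ah_form s"]) (rule trace_free_cubic_AH_form[OF tfc[OF S]])
    moreover have "\<exists>\<sigma>. one_form AN \<sigma> \<and> (\<forall>c\<in>AN. \<forall>p\<in>dom_chart c. \<forall>i j k.
        D s c p i j k = D s c p i j k + 2 * sym2 (\<lambda>i j. \<sigma> c p i * kron j k) i j)"
      using calculation(2) by (intro exI[of _ "\<lambda>c p i. 0"]) (simp add: sym2_def)
    ultimately show ?thesis
      unfolding generates_AH_def AH_structure_def by blast
  qed
  have ah: "alt2 (\<lambda>I J. cov2 (D s) G c q I J L) I J = - 2 * s * (t + 1) * alt2 (\<lambda>I J. \<beta> c q I * G c q J L) I J"
    if S: "special_statistical AM \<Gamma> g" and c: "c \<in> AN" and q: "q \<in> dom_chart c" for s c q I J L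
  proof -
    have "alt2 (\<lambda>I J. cov2 (D s) G c q I J L) I J = alt2 (\<lambda>I J. ah_form s c q I * G c q J L) I J"
      using trace_free_cubic_AH_form[OF tfc[OF S, of s]] c q unfolding AH_form_def by blast
    then show ?thesis by (simp add: alt2_def algebra_simps diff_divide_distrib add_divide_distrib)
  qed
  have root: "s\<^sup>2 = 1 / (1 + t) + (n + 2) * \<alpha> / (4 * (n - 1))"
    if "\<alpha> > - (4 * (n - 1) / ((n + 2) * (t + 1)))"
      and s: "s = sqrt (1 / (1 + t) + (n + 2) * \<alpha> / (4 * (n - 1))) \<or>
        s = - sqrt (1 / (1 + t) + (n + 2) * \<alpha> / (4 * (n - 1)))" for \<alpha> s
  proof -
    have n: "n \<ge> 2" using n_ge_2 by (simp add: n_def)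
    \<comment> \<open>k is the coefficient of \<alpha> in the radicand. It is positive for n at
      least 2, so multiplying the bound by it gives positivity of the radicand whatever the sign of
      1 + t.\<close>
    define k where "k = (n + 2) / (4 * (n - 1))"
    have k: "k > 0" using n by (simp add: k_def)
    have "- (4 * (n - 1) / ((n + 2) * (t + 1))) = - (1 / (1 + t)) / k"
      using n by (simp add: k_def field_simps)
    then have "- (1 / (1 + t)) / k < \<alpha>" using that(1) by simp
    then have "- (1 / (1 + t)) < \<alpha> * k" by (simp only: pos_divide_less_eq[OF k])
    then have "0 \<le> 1 / (1 + t) + (n + 2) * \<alpha> / (4 * (n - 1))" by (simp add: k_def mult.commute)
    then show ?thesis using s by auto
  qed
  show ?thesis
  proof (intro conjI ballI allI impI)
    show "pseudo_metric AN G" by (rule metric_G)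
    show "torsion_free_connection AN (D s)" for s by (rule conn)
    show "G c q I J = (1 + t) * \<beta> c q I * \<beta> c q J - sym2 (pullback2 b \<rho> (schouten \<Gamma>) c q) I J"
      if "c \<in> AN" "b \<in> AM" "q \<in> dom_chart c" "\<rho> q \<in> dom_chart b" for c b q I J
      using that by (intro metric_G_pullback) auto
  next
    fix \<alpha> s c q I J L
    assume "special_statistical AM \<Gamma> g \<and> \<alpha> \<noteq> 0 \<and> omega_squared \<alpha>" "c \<in> AN" "q \<in> dom_chart c"
    then show "alt2 (\<lambda>I J. cov2 (D s) G c q I J L) I J = - 2 * s * (t + 1) * alt2 (\<lambda>I J. \<beta> c q I * G c q J L) I J"
      by (intro ah) auto
  next
    fix \<alpha> s
    assume "special_statistical AM \<Gamma> g \<and> \<alpha> \<noteq> 0 \<and> omega_squared \<alpha>" "\<alpha> > - (4 * (n - 1) / ((n + 2) * (t + 1)))"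
      "s = sqrt (1 / (1 + t) + (n + 2) * \<alpha> / (4 * (n - 1))) \<or> s = - sqrt (1 / (1 + t) + (n + 2) * \<alpha> / (4 * (n - 1)))"
    then show "half_naive_einstein AN (D s) G" using half root by blast
  next
    fix \<alpha> s
    assume h: "special_statistical AM \<Gamma> g \<and> einstein_AH AM \<Gamma> g \<and>
        (\<forall>c\<in>AM. \<forall>x\<in>dom_chart c. scal \<Gamma> g c x = - n * (n - 1)) \<and> \<alpha> \<noteq> 0 \<and> omega_squared \<alpha>"
      and s: "s\<^sup>2 = 1 / (1 + t) + (n + 2) * \<alpha> / (4 * (n - 1))"
    then show "generates_AH AN (D s) G (D s)" using gen by blast
    show ne: "naive_einstein AN (D s) G" using naive h s by blast
    show "einstein_AH AN (D s) G" using einstein[OF _ _ _ s ne] h by blast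
    show "scal (D s) G c q = - (n * (n + 1) * \<alpha> / 4)" if "t = 0" "c \<in> AN" "q \<in> dom_chart c" for c q
      using scal[OF _ _ _ s that(2,3)] h that(1) by auto
  qed (use definite in blast)+
qed

end
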